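(* Let $G\subset\mathbb{R}^n$ be a bounded closed region and consider the real analytic Hamiltonian system $$H(y,x,\varepsilon)=h(y)+\varepsilon P(y,x,\varepsilon),\qquad (y,x)\in G\times\mathbb{T}^n,$$ where $\varepsilon>0$ is a small parameter. Let $\omega(\xi)=\nabla h(\xi)$ for $\xi\in G$, and fix $\xi_0\in G^o$ such that: (A0) $\deg(\nabla h(\cdot),G^o,\nabla h(\xi_0))\neq0$; (A1) there are $\sigma>0$ and $L>0$ such that $|\nabla h(\xi)-\nabla h(\xi_* )|\ge\sigma|\xi-\xi_*|^L$ for all $\xi,\xi_*\in G$; (A2) there are $\gamma>0$ and $\tau>n-1$ such that $|\langle k,\nabla h(\xi_0)\rangle|>\gamma/|k|^\tau$ for all $k\in\mathbb{Z}^n\setminus\{0\}$. Then there exists a sufficiently small constant $\varepsilon'>0$ such that if $0<\varepsilon<\varepsilon'$, there exists $y_\varepsilon\in G$ such that the Hamiltonian system $H$ at $y=y_\varepsilon$ admits an invariant torus with frequency $\nabla h(\xi_0)$.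
   Context: $\mathbb{T}^n$ is the standard $n$-torus (angle variable $x$), $y$ is the action variable, and $G\times\mathbb{T}^n$ carries the standard symplectic structure, so the equations of motion are $\dot y=-\partial_xH$, $\dot x=\partial_yH$. $G^o=G\setminus\partial G$ is the interior. For $k\in\mathbb{Z}^n$, $|k|=|k_1|+\cdots+|k_n|$. $\deg(g,\Omega,p)$ is the Brouwer degree of a continuous map $g:\bar\Omega\to\mathbb{R}^n$ at $p\notin g(\partial\Omega)$; condition (A0) includes that it is defined. Real analyticity on $G\times\mathbb{T}^n$ means analytic extension to a complex neighbourhood $\{(y,x):\mathrm{dist}(y,G)<s,\ |\mathrm{Im}\,x|<r\}$ for some $0<s,r<1$; the supremum norm of $P$ on this neighbourhood is bounded uniformly in $\varepsilon$. An invariant torus with frequency $\omega$ is an invariant $n$-torus of the flow on which the motion is conjugate to the linear flow $\dot\theta=\omega$ on $\mathbb{T}^n$; "at $y=y_\varepsilon$" means that the torus is obtained, as a deformation of the unperturbed torus, after translating the action variable to be centred at $y_\varepsilon$. *)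

theory Defs
  imports "HOL-Analysis.Analysis"
begin

definition gradient :: "('a::real_inner \<Rightarrow> real) \<Rightarrow> 'a \<Rightarrow> 'a" where
  "gradient f x = (THE D. GDERIV f x :> D)"

definition closed_region :: "'a::topological_space set \<Rightarrow> bool" where
  "closed_region G \<longleftrightarrow>
     interior G \<noteq> {} \<and> connected (interior G) \<and> closure (interior G) = G"

definition ivec :: "int ^ 'n \<Rightarrow> real ^ 'n::finite" where
  "ivec k = (\<chi> i. of_int (k $ i))"

definition l1norm :: "int ^ 'n::finite \<Rightarrow> real" where
  "l1norm k = (\<Sum>i\<in>UNIV. \<bar>of_int (k $ i)\<bar>)"

text \<open>
  The degree of \<open>g\<close> on the bounded open set \<open>\<Omega>\<close> at \<open>p\<close>, with \<open>p\<close> outside the image of the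
  boundary, is the signed count of preimages of \<open>p\<close> under any map \<open>f\<close> that is continuous
  on the closure, \<open>C\<^sup>1\<close> on \<open>\<Omega>\<close>, has \<open>p\<close> as a regular value, and is uniformly closer to
  \<open>g\<close> than \<open>p\<close> is to the image of the boundary. Such \<open>f\<close> exist by Sard's theorem, and the
  count does not depend on \<open>f\<close> by homotopy invariance. For such \<open>f\<close> the preimage of \<open>p\<close> is
  compact and discrete, hence finite.
\<close>

definition has_brouwer_degree ::
    "(real ^ 'n::finite \<Rightarrow> real ^ 'n) \<Rightarrow> (real ^ 'n) set \<Rightarrow> real ^ 'n \<Rightarrow> int \<Rightarrow> bool" where
  "has_brouwer_degree g \<Omega> p d \<longleftrightarrow>
     open \<Omega> \<and> bounded \<Omega> \<and> continuous_on (closure \<Omega>) g \<and> p \<notin> g ` frontier \<Omega> \<and>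
     (\<forall>f. continuous_on (closure \<Omega>) f \<and> f differentiable_on \<Omega> \<and>
          continuous_on \<Omega> (\<lambda>x. jacobian f (at x)) \<and>
          (\<forall>x\<in>closure \<Omega>. \<forall>z\<in>frontier \<Omega>. dist (f x) (g x) < dist p (g z)) \<and>
          (\<forall>x\<in>\<Omega>. f x = p \<longrightarrow> det (jacobian f (at x)) \<noteq> 0) \<longrightarrow>
          of_int d = (\<Sum>x | x \<in> \<Omega> \<and> f x = p. sgn (det (jacobian f (at x)))))"

text \<open>The value is 0 where the degree is undefined, so a nonzero value includes definedness.\<close>

definition brouwer_degree ::
    "(real ^ 'n::finite \<Rightarrow> real ^ 'n) \<Rightarrow> (real ^ 'n) set \<Rightarrow> real ^ 'n \<Rightarrow> int" where
  "brouwer_degree g \<Omega> p =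
     (if \<exists>!d. has_brouwer_degree g \<Omega> p d then THE d. has_brouwer_degree g \<Omega> p d else 0)"

definition cvec :: "real ^ 'n \<Rightarrow> complex ^ 'n::finite" where
  "cvec v = (\<chi> i. complex_of_real (v $ i))"

definition complex_nbhd ::
    "(real ^ 'n::finite) set \<Rightarrow> real \<Rightarrow> real \<Rightarrow> ((complex ^ 'n) \<times> (complex ^ 'n)) set" where
  "complex_nbhd G s r =
     {(y, x). infdist y (cvec ` G) < s \<and> norm (\<chi> i. Im (x $ i)) < r}"

definition cholomorphic_on ::
    "((complex ^ 'n::finite) \<times> (complex ^ 'n) \<Rightarrow> complex) \<Rightarrow> ((complex ^ 'n) \<times> (complex ^ 'n)) set \<Rightarrow> bool"
  where
  "cholomorphic_on F U \<longleftrightarrow>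
     (\<forall>z\<in>U. \<exists>D. (F has_derivative D) (at z) \<and>
        (\<forall>c v w. D (c *s v, c *s w) = c * D (v, w)))"

text \<open>
  Functions on the phase space take the action \<open>y\<close> and a lift \<open>x\<close> of the angle to \<open>\<real>\<^sup>n\<close>.
  They are identified with their extension to the real points of the complex neighbourhood,
  which gives derivatives at boundary points of \<open>G\<close> their meaning.
\<close>

definition analytic_extension ::
    "(real ^ 'n::finite \<Rightarrow> real ^ 'n \<Rightarrow> real) \<Rightarrow> ((complex ^ 'n) \<times> (complex ^ 'n) \<Rightarrow> complex) \<Rightarrow>
     (real ^ 'n) set \<Rightarrow> real \<Rightarrow> real \<Rightarrow> bool" where
  "analytic_extension f F G s r \<longleftrightarrow>
     cholomorphic_on F (complex_nbhd G s r) \<and>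
     (\<forall>y x. infdist y G < s \<longrightarrow> F (cvec y, cvec x) = complex_of_real (f y x))"

text \<open>The standard torus is the quotient of \<open>\<real>\<^sup>n\<close> by \<open>2\<pi>\<int>\<^sup>n\<close>.\<close>

definition torus_eq :: "real ^ 'n::finite \<Rightarrow> real ^ 'n \<Rightarrow> bool" where
  "torus_eq x x' \<longleftrightarrow> (\<exists>k. x - x' = (2 * pi) *\<^sub>R ivec k)"

definition torus_periodic :: "(real ^ 'n::finite \<Rightarrow> 'b) \<Rightarrow> bool" where
  "torus_periodic f \<longleftrightarrow> (\<forall>x x'. torus_eq x x' \<longrightarrow> f x = f x')"

definition hamiltonian_motion ::
    "(real ^ 'n::finite \<Rightarrow> real ^ 'n \<Rightarrow> real) \<Rightarrow> (real \<Rightarrow> real ^ 'n) \<Rightarrow> (real \<Rightarrow> real ^ 'n) \<Rightarrow> bool"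
  where
  "hamiltonian_motion H y x \<longleftrightarrow>
     (\<forall>t. (y has_vector_derivative - gradient (\<lambda>q. H (y t) q) (x t)) (at t) \<and>
          (x has_vector_derivative gradient (\<lambda>p. H p (x t)) (y t)) (at t))"

text \<open>
  The map \<open>\<theta> \<mapsto> (y\<^sub>0 + v \<theta>, \<theta> + u \<theta>)\<close> induces a continuous injection of the (compact) torus
  into \<open>G\<close> times the torus, hence a homeomorphism onto its image, and it conjugates the linear
  flow with frequency \<open>\<omega>\<close> to the Hamiltonian flow on that image. The unperturbed torus at
  \<open>y\<^sub>0\<close> is the case \<open>u = v = 0\<close>.
\<close>

definition invariant_torus ::
    "(real ^ 'n::finite \<Rightarrow> real ^ 'n \<Rightarrow> real) \<Rightarrow> (real ^ 'n) set \<Rightarrow> real ^ 'n \<Rightarrow> real ^ 'n \<Rightarrow>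
     (real ^ 'n \<Rightarrow> real ^ 'n) \<Rightarrow> (real ^ 'n \<Rightarrow> real ^ 'n) \<Rightarrow> bool" where
  "invariant_torus H G \<omega> y\<^sub>0 v u \<longleftrightarrow>
     continuous_on UNIV v \<and> continuous_on UNIV u \<and> torus_periodic v \<and> torus_periodic u \<and>
     (\<forall>\<theta>. y\<^sub>0 + v \<theta> \<in> G) \<and>
     (\<forall>\<theta> \<phi>. v \<theta> = v \<phi> \<and> torus_eq (\<theta> + u \<theta>) (\<phi> + u \<phi>) \<longrightarrow> torus_eq \<theta> \<phi>) \<and>
     (\<forall>\<theta>. hamiltonian_motion H
            (\<lambda>t. y\<^sub>0 + v (\<theta> + t *\<^sub>R \<omega>))
            (\<lambda>t. \<theta> + t *\<^sub>R \<omega> + u (\<theta> + t *\<^sub>R \<omega>)))"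

end

theory Submission
  imports Defs "HOL-Complex_Analysis.Conformal_Mappings"
begin

text \<open>
  For each \<open>p\<close> near \<open>\<xi>\<^sub>0\<close> one looks for an embedded torus \<open>\<theta> \<mapsto> (p + v \<theta>, \<theta> + u \<theta>)\<close> on which the
  Hamiltonian \<open>H - l \<bullet> y\<close> induces the linear flow with the fixed Diophantine frequency
  \<open>\<omega> = \<nabla>h(\<xi>\<^sub>0)\<close>, the counterterm \<open>l = l(p)\<close> being an unknown. Starting from \<open>u = v = 0\<close> and
  \<open>l = \<nabla>h(p) - \<omega>\<close>, a Newton iteration on shrinking complex strips solves this problem. Exactness of
  the symplectic form makes the linearised equations solvable, the mean of the remaining one is
  absorbed by \<open>l\<close>, and no nondegeneracy of the Hessian of \<open>h\<close> enters. The result is continuous in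
  \<open>p\<close>, with \<open>l(p) = \<nabla>h(p) - \<omega> + O(\<epsilon>)\<close>. By (A1) \<open>\<nabla>h\<close> is injective near \<open>\<xi>\<^sub>0\<close>, hence a
  homeomorphism onto a neighbourhood of \<open>\<omega>\<close> by invariance of domain, and Brouwer's fixed point
  theorem gives a \<open>p\<close> with \<open>l(p) = 0\<close>; this is \<open>y\<^sub>\<epsilon>\<close>.
\<close>

section \<open>Holomorphic functions of several variables\<close>

text \<open>A torus is kept as a parametrisation and tested against the same Hamiltonian in every
  step, instead of transforming the Hamiltonian. The domain of \<open>H\<close> never shrinks; only
  the strip in \<theta> loses width. The loss in step m is proportional to 2^-m, so small divisor
  factors grow geometrically, which the quadratic error of a Newton step absorbs.

  The delicate point is the correction of the counterterm. It solves a linear system whose matrix is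
  a mean over the torus. For u = v = 0 this matrix is the identity, whatever the Hessian of h; in
  general it deviates by c1 times a constant with a small divisor factor. If that factor were the
  one of step m, c1 would have to tend to 0. But a mean only sees the real torus, so a fixed width
  \<open>d0\<close> may be spent on this estimate, and one c1 serves all steps.

  Brouwer's theorem acts on all p at once. So the iteration runs over a compact ball of p, inside a
  class \<open>tfam\<close> that records joint continuity, periodicity and reality; Fourier sums,
  inverse matrices and limits have to stay in it.\<close>

definition ddir :: "(complex ^ 'm::finite \<Rightarrow> complex) \<Rightarrow> complex ^ 'm \<Rightarrow> complex ^ 'm \<Rightarrow> complex" where
  "ddir F z v = deriv (\<lambda>t. F (z + t *s v)) 0"

text \<open>Frechet differentiability with a complex linear derivative. No continuity of the
  derivative is built in; on open sets all further smoothness is derived by restriction to complex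
  lines.\<close>

definition holo :: "(complex ^ 'm::finite \<Rightarrow> complex) \<Rightarrow> (complex ^ 'm) set \<Rightarrow> bool" where
  "holo F U \<longleftrightarrow> (\<forall>z\<in>U. \<exists>D. (F has_derivative D) (at z) \<and> (\<forall>c v. D (c *s v) = c * D v))"

lemma holo_derivI:
  assumes "\<And>z. z \<in> U \<Longrightarrow> (F has_derivative D z) (at z)"
    and "\<And>z c v. z \<in> U \<Longrightarrow> D z (c *s v) = c * D z v"
  shows "holo F U"
  unfolding holo_def using assms by blast

lemma norm_csmult: "norm (c *s (v :: complex ^ 'm::finite)) = cmod c * norm v"
  by (simp add: norm_vec_def norm_mult L2_set_right_distrib)

lemma scaleR_eq_csmult: "a *\<^sub>R (v :: complex ^ 'm) = complex_of_real a *s v"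
  by (simp add: vec_eq_iff scaleR_conv_of_real[where 'a = complex])

lemma bounded_linear_csmult: "bounded_linear (\<lambda>t. t *s (v :: complex ^ 'm::finite))"
  by (rule bounded_linear_intro[where K = "norm v"])
     (auto simp: vec_eq_iff algebra_simps norm_csmult scaleR_conv_of_real[where 'a = complex])

lemma has_derivative_line:
  assumes "(F has_derivative D) (at (z + t *s v))" "\<And>c v. D (c *s v) = c * D v"
  shows "((\<lambda>t. F (z + t *s (v :: complex ^ 'm::finite))) has_field_derivative D v) (at t)"
proof -
  have "((\<lambda>t. z + t *s v) has_derivative (\<lambda>t. 0 + t *s v)) (at t)"
    by (intro has_derivative_add has_derivative_const bounded_linear.has_derivative[OF bounded_linear_csmult] has_derivative_ident)
  from has_derivative_compose[OF this assms(1)]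
  have "((\<lambda>t. F (z + t *s v)) has_derivative (\<lambda>x. D v * x)) (at t)"
    by (simp add: assms(2) mult.commute)
  then show ?thesis by (simp add: has_field_derivative_def)
qed

lemma ddir_eqI:
  assumes "(F has_derivative D) (at z)" "\<And>c v. D (c *s v) = c * D v"
  shows "ddir F z v = D v"
  unfolding ddir_def by (rule DERIV_imp_deriv, rule has_derivative_line) (use assms in auto)

lemma holo_has_derivative:
  assumes "holo F U" "z \<in> U"
  shows "(F has_derivative ddir F z) (at z)"
proof -
  obtain D where D: "(F has_derivative D) (at z)" "\<And>c v. D (c *s v) = c * D v"
    using assms by (auto simp: holo_def)
  have "ddir F z = D" using ddir_eqI[OF D] by blast
  with D show ?thesis by simp
qed

lemma holo_ddir_scale:
  assumes "holo F U" "z \<in> U"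
  shows "ddir F z (c *s v) = c * ddir F z v"
proof -
  obtain D where D: "(F has_derivative D) (at z)" "\<And>c v. D (c *s v) = c * D v"
    using assms by (auto simp: holo_def)
  have "ddir F z = D" using ddir_eqI[OF D] by blast
  with D show ?thesis by simp
qed

lemma holo_ddir_linear:
  assumes "holo F U" "z \<in> U"
  shows "linear (ddir F z)"
  using holo_has_derivative[OF assms] has_derivative_linear by blast

lemma holo_line:
  assumes "holo F U" "z + t *s v \<in> U"
  shows "((\<lambda>t. F (z + t *s v)) has_field_derivative ddir F (z + t *s v) v) (at t)"
  by (rule has_derivative_line[OF holo_has_derivative[OF assms]]) (rule holo_ddir_scale[OF assms])

lemma holo_line_holomorphic:
  assumes "holo F U" "\<And>t. t \<in> S \<Longrightarrow> z + t *s v \<in> U"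
  shows "(\<lambda>t. F (z + t *s v)) holomorphic_on S"
  unfolding holomorphic_on_def field_differentiable_def
  using holo_line[OF assms(1) assms(2)] DERIV_subset by blast

lemma holo_continuous_on: "holo F U \<Longrightarrow> continuous_on U F"
  by (meson continuous_at_imp_continuous_on has_derivative_continuous holo_has_derivative)

lemma holo_subset: "holo F U \<Longrightarrow> V \<subseteq> U \<Longrightarrow> holo F V"
  unfolding holo_def by blast

lemma holo_cong:
  assumes "open U" "\<And>z. z \<in> U \<Longrightarrow> F z = G z"
  shows "holo F U \<longleftrightarrow> holo G U"
proof -
  have "(F has_derivative D) (at z) \<longleftrightarrow> (G has_derivative D) (at z)" if "z \<in> U" for D z
    using has_derivative_transform_within_open[OF _ assms(1) that] assms(2) by (metis (no_types, lifting))
  then show ?thesis unfolding holo_def by blast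
qed

lemma ddir_cong:
  assumes "open U" "\<And>z. z \<in> U \<Longrightarrow> F z = G z" "z \<in> U"
  shows "ddir F z v = ddir G z v"
proof -
  have "continuous (at 0) (\<lambda>t. z + t *s v)"
    by (intro continuous_intros bounded_linear.continuous[OF bounded_linear_csmult])
  then have "\<forall>\<^sub>F t in nhds 0. z + t *s v \<in> U"
    using assms(1,3) by (auto simp: continuous_at eventually_nhds_conv_at tendsto_def)
  then have "\<forall>\<^sub>F t in nhds 0. F (z + t *s v) = G (z + t *s v)"
    by eventually_elim (use assms in auto)
  then show ?thesis unfolding ddir_def by (rule deriv_cong_ev) auto
qed

text \<open>The Cauchy inequality on discs of radius R/2 about the points of the half disc gives
  |g''| \<le> 2C/(R/2)^2. This is the origin of the 8 here and in the later Taylor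
  remainders.\<close>

lemma taylor2_line:
  assumes "open S" "cball 0 R \<subseteq> S" "g holomorphic_on S" "0 < R"
    and "\<And>t. cmod t \<le> R \<Longrightarrow> cmod (g t) \<le> C" and "cmod s \<le> R / 2"
  shows "cmod (g s - g 0 - s * deriv g 0) \<le> 8 * C * (cmod s)\<^sup>2 / R\<^sup>2"
proof -
  define f where "f = (\<lambda>i::nat. (deriv ^^ i) g)"
  have hol: "(deriv ^^ i) g holomorphic_on S" for i
    by (rule holomorphic_higher_deriv) (use assms in auto)
  have fd: "(f i has_field_derivative f (Suc i) x) (at x within cball 0 (R/2))" if "x \<in> cball 0 (R/2)" for i x
  proof -
    have "x \<in> S" using that assms(2,4) by auto
    then show ?thesis unfolding f_def funpow.simps o_def
      using hol assms(1) holomorphic_derivI DERIV_subset by (metis subset_UNIV)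
  qed
  have B: "cmod (f (Suc 1) x) \<le> 8 * C / R\<^sup>2" if "x \<in> cball 0 (R/2)" for x
  proof -
    have sub: "cball x (R/2) \<subseteq> cball 0 R"
    proof
      fix y assume "y \<in> cball x (R/2)"
      then show "y \<in> cball 0 R" using that norm_triangle_ineq[of x "y - x"] by (auto simp: dist_norm norm_minus_commute)
    qed
    have "norm ((deriv ^^ 2) g x) \<le> fact 2 * C / (R/2) ^ 2"
    proof (rule Cauchy_inequality)
      show "g holomorphic_on ball x (R/2)"
        using assms sub by (meson ball_subset_cball holomorphic_on_subset order_trans)
      show "continuous_on (cball x (R/2)) g"
        using assms sub by (meson holomorphic_on_imp_continuous_on holomorphic_on_subset order_trans)
      show "norm (g y) \<le> C" if "norm (x - y) = R / 2" for y
        using that sub assms(5) by (auto simp: dist_norm subset_iff)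
    qed (use assms in auto)
    then show ?thesis by (simp add: f_def power_divide numeral_2_eq_2)
  qed
  have "cmod (f 0 s - (\<Sum>i\<le>1. f i 0 * (s - 0) ^ i / fact i)) \<le> (8 * C / R\<^sup>2) * cmod (s - 0) ^ Suc 1 / fact 1"
    by (rule complex_Taylor[where S = "cball 0 (R/2)"]) (use assms fd B in auto)
  then show ?thesis by (simp add: f_def algebra_simps power2_eq_square)
qed

lemma taylor2_dir:
  assumes U: "open U" and F: "holo F U" and R: "0 < R" "\<And>t. cmod t \<le> R \<Longrightarrow> z + t *s v \<in> U"
    and C: "\<And>t. cmod t \<le> R \<Longrightarrow> cmod (F (z + t *s v)) \<le> C" and "cmod s \<le> R / 2"
  shows "cmod (F (z + s *s v) - F z - s * ddir F z v) \<le> 8 * C * (cmod s)\<^sup>2 / R\<^sup>2"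
proof -
  define S where "S = (\<lambda>t. z + t *s v) -` U"
  have cont: "continuous_on UNIV (\<lambda>t. z + t *s v)"
    by (intro continuous_intros bounded_linear.continuous_on[OF bounded_linear_csmult])
  have "open S" unfolding S_def using cont U by (simp add: open_vimage)
  moreover have "cball 0 R \<subseteq> S" using R by (auto simp: S_def)
  moreover have "(\<lambda>t. F (z + t *s v)) holomorphic_on S"
    by (rule holo_line_holomorphic[OF F]) (auto simp: S_def)
  ultimately have "cmod ((\<lambda>t. F (z + t *s v)) s - (\<lambda>t. F (z + t *s v)) 0 - s * deriv (\<lambda>t. F (z + t *s v)) 0) \<le> 8 * C * (cmod s)\<^sup>2 / R\<^sup>2"
    by (rule taylor2_line) (use assms in auto)
  then show ?thesis by (simp add: ddir_def)
qed

lemma ddir_bound: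
  assumes U: "open U" and F: "holo F U" and R: "0 < R" "\<And>t. cmod t \<le> R \<Longrightarrow> z + t *s v \<in> U"
    and C: "\<And>t. cmod t \<le> R \<Longrightarrow> cmod (F (z + t *s v)) \<le> C"
  shows "cmod (ddir F z v) \<le> C / R"
proof -
  have hol: "(\<lambda>t. F (z + t *s v)) holomorphic_on cball 0 R"
    by (rule holo_line_holomorphic[OF F]) (use R in auto)
  have "norm ((deriv ^^ 1) (\<lambda>t. F (z + t *s v)) 0) \<le> fact 1 * C / R ^ 1"
    by (rule Cauchy_inequality)
       (use hol R C in \<open>auto intro: holomorphic_on_subset holomorphic_on_imp_continuous_on\<close>)
  then show ?thesis by (simp add: ddir_def)
qed

text \<open>A continuous function that is holomorphic along complex lines, with additive directional
  derivatives, is totally differentiable: the Cauchy estimates bound the Taylor remainder along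
  all lines at once.\<close>

lemma holoI:
  fixes F :: "complex ^ 'm::finite \<Rightarrow> complex"
  assumes U: "open U" and cont: "continuous_on U F"
    and line: "\<And>z v. z \<in> U \<Longrightarrow> (\<lambda>t. F (z + t *s v)) field_differentiable (at 0)"
    and add: "\<And>z v w. z \<in> U \<Longrightarrow> ddir F z (v + w) = ddir F z v + ddir F z w"
  shows "holo F U"
  unfolding holo_def
proof
  fix z assume z: "z \<in> U"
  have fd: "((\<lambda>t. F (y + t *s v)) has_field_derivative ddir F y v) (at 0)" if "y \<in> U" for y v
    using line[OF that] by (simp add: ddir_def DERIV_deriv_iff_field_differentiable)
  have fd': "((\<lambda>t. F (y + t *s v)) has_field_derivative ddir F (y + t *s v) v) (at t)" if "y + t *s v \<in> U" for y v t
  proof -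
    have "((\<lambda>s. F ((y + t *s v) + s *s v)) has_field_derivative ddir F (y + t *s v) v) (at 0)"
      by (rule fd[OF that])
    then have "((\<lambda>s. F (y + (s + t) *s v)) has_field_derivative ddir F (y + t *s v) v) (at 0)"
      by (simp add: vector_sadd_rdistrib ac_simps)
    then show ?thesis using DERIV_shift[of "\<lambda>s. F (y + s *s v)" _ 0 t] by simp
  qed
  have scale: "ddir F y (c *s v) = c * ddir F y v" if "y \<in> U" for y c v
  proof -
    have "((\<lambda>t. F (y + (c * t) *s v)) has_field_derivative (ddir F y v * c)) (at 0)"
    proof -
      have "((\<lambda>t. F (y + t *s v)) has_field_derivative ddir F y v) (at (c * 0))"
        using fd[OF that] by simp
      from DERIV_chain2[OF this DERIV_cmult_Id[of c]] show ?thesis by simp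
    qed
    then have "((\<lambda>t. F (y + t *s (c *s v))) has_field_derivative (ddir F y v * c)) (at 0)"
      by (simp add: mult.commute)
    then show ?thesis by (simp add: ddir_def DERIV_imp_deriv mult.commute)
  qed
  have lin: "linear (ddir F z)"
    by (rule linearI) (auto simp: add[OF z] scaleR_eq_csmult scale[OF z] scaleR_conv_of_real[where 'a = complex])
  then have blin: "bounded_linear (ddir F z)" by (simp add: linear_conv_bounded_linear)
  obtain \<rho> where \<rho>: "\<rho> > 0" "cball z \<rho> \<subseteq> U"
    using U z open_contains_cball by blast
  have "compact (F ` cball z \<rho>)"
    using cont \<rho> by (intro compact_continuous_image) (auto intro: continuous_on_subset)
  then obtain C where "\<forall>x\<in>F ` cball z \<rho>. cmod x \<le> C"
    by (meson bounded_iff compact_imp_bounded)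
  then have C: "\<And>y. y \<in> cball z \<rho> \<Longrightarrow> cmod (F y) \<le> C" by blast
  have C0: "C \<ge> 0" using order_trans[OF norm_ge_zero C[of z]] \<rho> by simp
  have est: "cmod (F (z + h) - F z - ddir F z h) \<le> 8 * C / \<rho>\<^sup>2 * (norm h)\<^sup>2" if h: "norm h \<le> \<rho> / 2" for h
  proof (cases "h = 0")
    case True
    then show ?thesis using linear_0[OF lin] by simp
  next
    case False
    \<comment> \<open>On the line through z in direction h the disc of radius R stays in the ball of
      radius \<rho>. As R \<ge> 2, the point t = 1 lies in its half disc, and 1/R^2 becomes a
      multiple of (norm h)^2 with a constant that does not depend on the direction.\<close>
    define R where "R = \<rho> / norm h"
    have R: "R \<ge> 2" "R > 0" using False h \<rho> by (auto simp: R_def field_simps)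
    define S where "S = (\<lambda>t. z + t *s h) -` U"
    have "open S" unfolding S_def using U
      by (intro open_vimage continuous_intros bounded_linear.continuous_on[OF bounded_linear_csmult])
    moreover have inb: "z + t *s h \<in> cball z \<rho>" if "cmod t \<le> R" for t
      using that False by (simp add: dist_norm norm_csmult R_def field_simps)
    then have "cball 0 R \<subseteq> S" using \<rho>(2) unfolding S_def
      by (intro subsetI vimageI2) (rule subsetD[OF \<rho>(2)], rule inb, simp)
    moreover have "(\<lambda>t. F (z + t *s h)) holomorphic_on S"
      unfolding holomorphic_on_def field_differentiable_def S_def
      using fd' DERIV_subset by blast
    ultimately have "cmod ((\<lambda>t. F (z + t *s h)) 1 - (\<lambda>t. F (z + t *s h)) 0 - 1 * deriv (\<lambda>t. F (z + t *s h)) 0) \<le> 8 * C * (cmod 1)\<^sup>2 / R\<^sup>2"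
      by (rule taylor2_line) (use R inb C in auto)
    then show ?thesis by (simp add: ddir_def R_def power_divide)
  qed
  have "(F has_derivative ddir F z) (at z)"
    unfolding has_derivative_at
  proof (intro conjI blin)
    show "(\<lambda>h. norm (F (z + h) - F z - ddir F z h) / norm h) \<midarrow>0\<rightarrow> 0"
    proof (rule Lim_null_comparison)
      show "\<forall>\<^sub>F h in at 0. norm (norm (F (z + h) - F z - ddir F z h) / norm h) \<le> 8 * C / \<rho>\<^sup>2 * norm h"
        unfolding eventually_at
      proof (intro exI conjI ballI impI)
        show "\<rho> / 2 > 0" using \<rho> by simp
        fix h :: "complex ^ 'm" assume "h \<noteq> 0 \<and> dist h 0 < \<rho> / 2"
        then have "cmod (F (z + h) - F z - ddir F z h) \<le> 8 * C / \<rho>\<^sup>2 * (norm h)\<^sup>2" and "norm h > 0"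
          using est by auto
        then show "norm (norm (F (z + h) - F z - ddir F z h) / norm h) \<le> 8 * C / \<rho>\<^sup>2 * norm h"
          using \<rho>(1) by (simp add: divide_le_eq power2_eq_square mult.assoc)
      qed
      show "((\<lambda>h::complex^'m. 8 * C / \<rho>\<^sup>2 * norm h) \<longlongrightarrow> 0) (at 0)"
        using \<rho>(1) by (auto intro!: tendsto_eq_intros)
    qed
  qed
  then show "\<exists>D. (F has_derivative D) (at z) \<and> (\<forall>c v. D (c *s v) = c * D v)"
    using scale[OF z] by blast
qed


section \<open>Second derivatives and uniform limits\<close>

lemma holo_bounded_at:
  fixes F :: "complex ^ 'm::finite \<Rightarrow> complex"
  assumes "open U" "holo F U" "z \<in> U"
  obtains \<rho> C where "\<rho> > 0" "cball z \<rho> \<subseteq> U" "\<And>y. y \<in> cball z \<rho> \<Longrightarrow> cmod (F y) \<le> C"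
proof -
  obtain \<rho> where \<rho>: "\<rho> > 0" "cball z \<rho> \<subseteq> U"
    using assms open_contains_cball by blast
  have "compact (F ` cball z \<rho>)"
    using holo_continuous_on[OF assms(2)] \<rho> by (intro compact_continuous_image) (auto intro: continuous_on_subset)
  then obtain C where "\<forall>x\<in>F ` cball z \<rho>. cmod x \<le> C"
    by (meson bounded_iff compact_imp_bounded)
  then have "\<And>y. y \<in> cball z \<rho> \<Longrightarrow> cmod (F y) \<le> C" by blast
  with \<rho> show thesis by (rule that)
qed

text \<open>As s tends to 0, the difference quotients of F in direction w converge uniformly on a
  small disc in direction v. By the one-variable Weierstrass theorem their t-derivatives converge
  too. At t = 0 this yields at once the existence of the second directional derivative and its
  symmetry.\<close>

lemma ddir_mixed:
  fixes F :: "complex ^ 'm::finite \<Rightarrow> complex"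
  assumes U: "open U" and F: "holo F U" and z: "z \<in> U"
  shows "((\<lambda>s. ddir F (z + s *s w) v) has_field_derivative ddir (\<lambda>y. ddir F y w) z v) (at 0)"
proof -
  obtain \<rho> C where \<rho>: "\<rho> > 0" "cball z \<rho> \<subseteq> U" and C: "\<And>y. y \<in> cball z \<rho> \<Longrightarrow> cmod (F y) \<le> C"
    using holo_bounded_at[OF assms] by blast
  have C0: "C \<ge> 0" using order_trans[OF norm_ge_zero C[of z]] \<rho> by simp
  define r where "r = \<rho> / (norm v + norm w + 1)"
  have den: "norm v + norm w + 1 > 0" by (smt (verit) norm_ge_zero)
  have r: "r > 0" using \<rho> den by (simp add: r_def)
  have inb: "z + t *s v + s *s w \<in> cball z \<rho>" if "cmod t \<le> r" "cmod s \<le> r" for s t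
  proof -
    have "dist z (z + t *s v + s *s w) = norm (t *s v + s *s w)"
      by (metis add.assoc add_diff_cancel_left' dist_commute dist_norm)
    also have "\<dots> \<le> cmod t * norm v + cmod s * norm w"
      by (metis norm_csmult norm_triangle_ineq)
    also have "\<dots> \<le> r * norm v + r * norm w"
      using that by (intro add_mono mult_right_mono) auto
    also have "\<dots> \<le> r * (norm v + norm w + 1)" using r by (simp add: algebra_simps)
    also have "\<dots> = \<rho>" using den by (simp add: r_def)
    finally show ?thesis by simp
  qed
  define G where "G = (\<lambda>s t. (F (z + t *s v + s *s w) - F (z + t *s v)) / s)"
  define G' where "G' = (\<lambda>s t. (ddir F (z + t *s v + s *s w) v - ddir F (z + t *s v) v) / s)"
  have d1: "((\<lambda>t. F (z + t *s v + s *s w)) has_field_derivative ddir F (z + t *s v + s *s w) v) (at t)"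
    if "cmod t \<le> r" "cmod s \<le> r" for s t
    using holo_line[OF F, of "z + s *s w" t v] inb[OF that] \<rho> by (auto simp: algebra_simps)
  have d0: "((\<lambda>t. F (z + t *s v)) has_field_derivative ddir F (z + t *s v) v) (at t)" if "cmod t \<le> r" for t
    using d1[OF that, of 0] r by simp
  have dG: "(G s has_field_derivative G' s t) (at t)" if "cmod t \<le> r" "cmod s \<le> r" for s t
    unfolding G_def G'_def by (intro DERIV_cdivide DERIV_diff d1 d0 that)
  have bd: "cmod (G s t - ddir F (z + t *s v) w) \<le> 8 * C / r\<^sup>2 * cmod s"
    if "cmod t \<le> r" "cmod s \<le> r / 2" "s \<noteq> 0" for s t
  proof -
    have "cmod (F (z + t *s v + s *s w) - F (z + t *s v) - s * ddir F (z + t *s v) w) \<le> 8 * C * (cmod s)\<^sup>2 / r\<^sup>2"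
      by (rule taylor2_dir[OF U F r]) (use that inb \<rho> C in auto)
    moreover have "G s t - ddir F (z + t *s v) w = (F (z + t *s v + s *s w) - F (z + t *s v) - s * ddir F (z + t *s v) w) / s"
      using that by (simp add: G_def field_simps)
    ultimately show ?thesis using that
      by (simp add: norm_divide divide_le_eq power2_eq_square mult.assoc)
  qed
  have ul: "uniform_limit (cball 0 r) G (\<lambda>t. ddir F (z + t *s v) w) (at 0)"
  proof (rule uniform_limitI)
    fix e :: real assume e: "e > 0"
    define d where "d = min (r / 2) (e / (8 * C / r\<^sup>2 + 1))"
    have den2: "8 * C / r\<^sup>2 + 1 > 0" using C0 r by (smt (verit) divide_nonneg_nonneg mult_nonneg_nonneg zero_le_power2)
    have "d > 0" using r e den2 by (simp add: d_def)
    have "dist (G s t) (ddir F (z + t *s v) w) < e" if "t \<in> cball 0 r" "s \<noteq> 0" "dist s 0 < d" for s t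
    proof -
      have s: "cmod s < r / 2" "cmod s < e / (8 * C / r\<^sup>2 + 1)" using that by (auto simp: d_def)
      have "dist (G s t) (ddir F (z + t *s v) w) \<le> 8 * C / r\<^sup>2 * cmod s"
        using bd[of t s] that s by (simp add: dist_norm)
      also have "\<dots> \<le> (8 * C / r\<^sup>2 + 1) * cmod s" by (simp add: algebra_simps)
      also have "\<dots> < e" using s(2) den2 by (simp add: field_simps)
      finally show ?thesis .
    qed
    then show "\<forall>\<^sub>F s in at 0. \<forall>t\<in>cball 0 r. dist (G s t) (ddir F (z + t *s v) w) < e"
      unfolding eventually_at using \<open>d > 0\<close> by blast
  qed
  have ev: "\<forall>\<^sub>F s in at 0. continuous_on (cball 0 r) (G s) \<and> (\<forall>t\<in>ball 0 r. (G s has_field_derivative G' s t) (at t))"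
    unfolding eventually_at
  proof (intro exI conjI ballI impI)
    show "r > 0" by fact
    fix s :: complex assume s: "s \<noteq> 0 \<and> dist s 0 < r"
    show "continuous_on (cball 0 r) (G s)"
      by (rule DERIV_continuous_on[of _ _ "G' s"], rule has_field_derivative_at_within, rule dG) (use s in auto)
    show "(G s has_field_derivative G' s t) (at t)" if "t \<in> ball 0 r" for t
      using dG that s by auto
  qed
  obtain g' where g': "\<And>t. t \<in> ball 0 r \<Longrightarrow> ((\<lambda>t. ddir F (z + t *s v) w) has_field_derivative g' t) (at t) \<and> ((\<lambda>s. G' s t) \<longlongrightarrow> g' t) (at 0)"
    using has_complex_derivative_uniform_limit[OF ev ul _ r] by (metis at_neq_bot)
  have "g' 0 = ddir (\<lambda>y. ddir F y w) z v"
    using g'[of 0] r by (auto intro!: DERIV_imp_deriv[symmetric] simp: ddir_def[of "\<lambda>y. ddir F y w"])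
  moreover have "((\<lambda>s. (ddir F (z + s *s w) v - ddir F z v) / s) \<longlongrightarrow> g' 0) (at 0)"
    using g'[of 0] r by (simp add: G'_def)
  ultimately show ?thesis by (simp add: DERIV_def)
qed

lemma ddir_sym:
  assumes "open U" "holo F U" "z \<in> U"
  shows "ddir (\<lambda>y. ddir F y v) z w = ddir (\<lambda>y. ddir F y w) z v"
  using ddir_mixed[OF assms, of w v] by (simp add: ddir_def[of "\<lambda>y. ddir F y v"] DERIV_imp_deriv)

text \<open>When the base point moves, the restrictions of F to discs in direction v converge
  uniformly, by uniform continuity on a compact ball; hence their derivatives at the centre
  converge.\<close>

lemma ddir_continuous_on:
  fixes F :: "complex ^ 'm::finite \<Rightarrow> complex"
  assumes U: "open U" and F: "holo F U"
  shows "continuous_on U (\<lambda>z. ddir F z v)"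
proof (rule continuous_at_imp_continuous_on, rule ballI)
  fix z assume z: "z \<in> U"
  obtain \<rho> where \<rho>: "\<rho> > 0" "cball z \<rho> \<subseteq> U"
    using U z open_contains_cball by blast
  define r where "r = \<rho> / (2 * (norm v + 1))"
  have den: "norm v + 1 > 0" by (smt (verit) norm_ge_zero)
  have r: "r > 0" using \<rho> den by (simp add: r_def)
  have inb: "y + t *s v \<in> cball z \<rho>" if "cmod t \<le> r" "dist y z < \<rho> / 2" for y t
  proof -
    have "cmod t * norm v \<le> r * (norm v + 1)"
      using that r by (intro mult_mono) auto
    also have "\<dots> = \<rho> / 2" using den by (simp add: r_def field_simps)
    finally have "norm (t *s v) \<le> \<rho> / 2" by (simp add: norm_csmult)
    moreover have "dist z (y + t *s v) \<le> dist z y + norm (t *s v)"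
      by (metis add_diff_cancel_left' dist_norm dist_triangle norm_minus_commute)
    ultimately show ?thesis using that by (auto simp: dist_commute)
  qed
  have uc: "uniformly_continuous_on (cball z \<rho>) F"
    using holo_continuous_on[OF F] \<rho> by (intro compact_uniformly_continuous) (auto intro: continuous_on_subset)
  have ul: "uniform_limit (cball 0 r) (\<lambda>y t. F (y + t *s v)) (\<lambda>t. F (z + t *s v)) (at z)"
  proof (rule uniform_limitI)
    fix e :: real assume "e > 0"
    then obtain d where d: "d > 0" "\<And>x x'. x \<in> cball z \<rho> \<Longrightarrow> x' \<in> cball z \<rho> \<Longrightarrow> dist x' x < d \<Longrightarrow> dist (F x') (F x) < e"
      using uc unfolding uniformly_continuous_on_def by metis
    show "\<forall>\<^sub>F y in at z. \<forall>t\<in>cball 0 r. dist (F (y + t *s v)) (F (z + t *s v)) < e"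
      unfolding eventually_at
    proof (intro exI conjI ballI impI)
      show "min d (\<rho> / 2) > 0" using d \<rho> by simp
      fix y t assume y: "y \<noteq> z \<and> dist y z < min d (\<rho> / 2)" and t: "t \<in> cball (0::complex) r"
      show "dist (F (y + t *s v)) (F (z + t *s v)) < e"
        by (rule d(2)) (use inb y t \<rho> in auto)
    qed
  qed
  have ev: "\<forall>\<^sub>F y in at z. continuous_on (cball 0 r) (\<lambda>t. F (y + t *s v)) \<and>
      (\<forall>t\<in>ball 0 r. ((\<lambda>t. F (y + t *s v)) has_field_derivative ddir F (y + t *s v) v) (at t))"
    unfolding eventually_at
  proof (intro exI conjI ballI impI)
    show "\<rho> / 2 > 0" using \<rho> by simp
    fix y assume y: "y \<noteq> z \<and> dist y z < \<rho> / 2"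
    have d: "((\<lambda>t. F (y + t *s v)) has_field_derivative ddir F (y + t *s v) v) (at t)" if "cmod t \<le> r" for t
      by (rule holo_line[OF F]) (use inb that y \<rho> in auto)
    show "continuous_on (cball 0 r) (\<lambda>t. F (y + t *s v))"
      by (rule DERIV_continuous_on[of _ _ "\<lambda>t. ddir F (y + t *s v) v"], rule has_field_derivative_at_within, rule d) auto
    show "((\<lambda>t. F (y + t *s v)) has_field_derivative ddir F (y + t *s v) v) (at t)" if "t \<in> ball 0 r" for t
      using d that by auto
  qed
  obtain g' where g': "\<And>t. t \<in> ball 0 r \<Longrightarrow> ((\<lambda>t. F (z + t *s v)) has_field_derivative g' t) (at t) \<and> ((\<lambda>y. ddir F (y + t *s v) v) \<longlongrightarrow> g' t) (at z)"
    using has_complex_derivative_uniform_limit[OF ev ul _ r] by (metis trivial_limit_at)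
  have "g' 0 = ddir F z v"
    using g'[of 0] r by (auto intro!: DERIV_imp_deriv[symmetric] simp: ddir_def[of F z])
  then show "isCont (\<lambda>z. ddir F z v) z"
    using g'[of 0] r by (simp add: isCont_def)
qed

text \<open>Through \<open>holoI\<close>. Additivity of a second derivative in its outer direction
  is not evident; symmetry moves that direction inside, where the first derivative is
  linear.\<close>

lemma holo_ddir:
  assumes U: "open U" and F: "holo F U"
  shows "holo (\<lambda>z. ddir F z v) U"
proof (rule holoI[OF U ddir_continuous_on[OF U F]])
  fix z v' w assume z: "z \<in> U"
  show "(\<lambda>t. ddir F (z + t *s v') v) field_differentiable at 0"
    using ddir_mixed[OF U F z] field_differentiable_def by blast
  have "ddir (\<lambda>y. ddir F y v) z (v' + w) = ddir (\<lambda>y. ddir F y (v' + w)) z v"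
    by (rule ddir_sym[OF U F z])
  also have "\<dots> = ddir (\<lambda>y. ddir F y v' + ddir F y w) z v"
    by (rule ddir_cong[OF U _ z]) (simp add: linear_add[OF holo_ddir_linear[OF F]])
  also have "\<dots> = ddir (\<lambda>y. ddir F y v') z v + ddir (\<lambda>y. ddir F y w) z v"
    unfolding ddir_def[of "\<lambda>y. ddir F y v' + ddir F y w"]
    using ddir_mixed[OF U F z, of v v'] ddir_mixed[OF U F z, of v w]
    by (intro DERIV_imp_deriv DERIV_add) (simp_all add: ddir_sym[OF U F z, of v])
  also have "\<dots> = ddir (\<lambda>y. ddir F y v) z v' + ddir (\<lambda>y. ddir F y v) z w"
    by (simp add: ddir_sym[OF U F z])
  finally show "ddir (\<lambda>y. ddir F y v) z (v' + w) = ddir (\<lambda>y. ddir F y v) z v' + ddir (\<lambda>y. ddir F y v) z w" .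
qed

text \<open>The Weierstrass theorem on each complex line gives differentiability along lines and the
  limit of the derivatives; additivity in the direction passes to the limit. The filter is general
  because both sequences and nets of finite Fourier sums occur.\<close>

lemma holo_uniform_limit:
  assumes U: "open U" and f: "\<forall>\<^sub>F n in N. holo (f n) U" and ul: "uniform_limit U f g N" and N: "N \<noteq> bot"
  shows "holo g U" and "z \<in> U \<Longrightarrow> ((\<lambda>n. ddir (f n) z v) \<longlongrightarrow> ddir g z v) N"
proof -
  have key: "(\<lambda>t. g (z + t *s v)) field_differentiable at 0 \<and> ((\<lambda>n. ddir (f n) z v) \<longlongrightarrow> ddir g z v) N"
    if z: "z \<in> U" for z v
  proof -
    obtain \<rho> where \<rho>: "\<rho> > 0" "cball z \<rho> \<subseteq> U"
      using U z open_contains_cball by blast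
    define r where "r = \<rho> / (norm v + 1)"
    have den: "norm v + 1 > 0" by (smt (verit) norm_ge_zero)
    have r: "r > 0" using \<rho> den by (simp add: r_def)
    have inb: "z + t *s v \<in> U" if "cmod t \<le> r" for t
    proof -
      have "cmod t * norm v \<le> r * (norm v + 1)"
        using that r by (intro mult_mono) auto
      also have "\<dots> = \<rho>" using den by (simp add: r_def field_simps)
      finally show ?thesis using \<rho> by (auto simp: dist_norm norm_csmult subset_iff)
    qed
    have ul': "uniform_limit (cball 0 r) (\<lambda>n t. f n (z + t *s v)) (\<lambda>t. g (z + t *s v)) N"
      unfolding uniform_limit_iff
    proof (intro allI impI)
      fix e :: real assume "e > 0"
      then have "\<forall>\<^sub>F n in N. \<forall>x\<in>U. dist (f n x) (g x) < e" using ul by (simp add: uniform_limit_iff)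
      then show "\<forall>\<^sub>F n in N. \<forall>t\<in>cball 0 r. dist (f n (z + t *s v)) (g (z + t *s v)) < e"
        by eventually_elim (use inb in auto)
    qed
    have ev: "\<forall>\<^sub>F n in N. continuous_on (cball 0 r) (\<lambda>t. f n (z + t *s v)) \<and>
      (\<forall>t\<in>ball 0 r. ((\<lambda>t. f n (z + t *s v)) has_field_derivative ddir (f n) (z + t *s v) v) (at t))"
      using f
    proof eventually_elim
      case (elim n)
      have d: "((\<lambda>t. f n (z + t *s v)) has_field_derivative ddir (f n) (z + t *s v) v) (at t)" if "cmod t \<le> r" for t
        by (rule holo_line[OF elim]) (use inb that in auto)
      have "continuous_on (cball 0 r) (\<lambda>t. f n (z + t *s v))"
        by (rule DERIV_continuous_on[of _ _ "\<lambda>t. ddir (f n) (z + t *s v) v"], rule has_field_derivative_at_within, rule d) auto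
      with d show ?case by auto
    qed
    obtain g' where g': "\<And>t. t \<in> ball 0 r \<Longrightarrow> ((\<lambda>t. g (z + t *s v)) has_field_derivative g' t) (at t) \<and> ((\<lambda>n. ddir (f n) (z + t *s v) v) \<longlongrightarrow> g' t) N"
      using has_complex_derivative_uniform_limit[OF ev ul' N r] by metis
    have "g' 0 = ddir g z v"
      using g'[of 0] r by (auto intro!: DERIV_imp_deriv[symmetric] simp: ddir_def[of g])
    then show ?thesis using g'[of 0] r field_differentiable_def by force
  qed
  then show "z \<in> U \<Longrightarrow> ((\<lambda>n. ddir (f n) z v) \<longlongrightarrow> ddir g z v) N" by blast
  show "holo g U"
  proof (rule holoI[OF U])
    show "continuous_on U g"
      by (rule uniform_limit_theorem[OF _ ul N]) (use f in eventually_elim, simp add: holo_continuous_on)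
    fix z v w assume z: "z \<in> U"
    show "(\<lambda>t. g (z + t *s v)) field_differentiable at 0" using key z by blast
    have "((\<lambda>n. ddir (f n) z (v + w)) \<longlongrightarrow> ddir g z v + ddir g z w) N"
    proof (rule Lim_transform_eventually)
      show "((\<lambda>n. ddir (f n) z v + ddir (f n) z w) \<longlongrightarrow> ddir g z v + ddir g z w) N"
        using key z by (intro tendsto_add) auto
      show "\<forall>\<^sub>F n in N. ddir (f n) z v + ddir (f n) z w = ddir (f n) z (v + w)"
        using f by eventually_elim (simp add: linear_add[OF holo_ddir_linear[OF _ z]])
    qed
    moreover have "((\<lambda>n. ddir (f n) z (v + w)) \<longlongrightarrow> ddir g z (v + w)) N" using key z by blast
    ultimately show "ddir g z (v + w) = ddir g z v + ddir g z w"
      using N tendsto_unique by blast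
  qed
qed

section \<open>Partial derivatives and the rules of calculus\<close>

definition pd :: "'m::finite \<Rightarrow> (complex ^ 'm \<Rightarrow> complex) \<Rightarrow> complex ^ 'm \<Rightarrow> complex" where
  "pd a F z = ddir F z (axis a 1)"

lemma ddir_eq_sum_pd:
  assumes "holo F U" "z \<in> U"
  shows "ddir F z v = (\<Sum>a\<in>UNIV. v $ a * pd a F z)"
proof -
  have "v = (\<Sum>a\<in>UNIV. v $ a *s axis a 1)"
    by (simp add: basis_expansion)
  then have "ddir F z v = ddir F z (\<Sum>a\<in>UNIV. v $ a *s axis a 1)" by simp
  also have "\<dots> = (\<Sum>a\<in>UNIV. v $ a * pd a F z)"
    by (simp add: linear_sum[OF holo_ddir_linear[OF assms]] holo_ddir_scale[OF assms] pd_def)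
  finally show ?thesis .
qed

lemma holo_pd: "open U \<Longrightarrow> holo F U \<Longrightarrow> holo (pd a F) U"
  unfolding pd_def[abs_def] by (rule holo_ddir)

lemma pd_sym: "open U \<Longrightarrow> holo F U \<Longrightarrow> z \<in> U \<Longrightarrow> pd a (pd b F) z = pd b (pd a F) z"
  unfolding pd_def[abs_def] by (rule ddir_sym)

lemma holo_const: "holo (\<lambda>z. c) U" and ddir_const: "ddir (\<lambda>z. c) z v = 0"
  unfolding holo_def by (auto intro!: exI[of _ "\<lambda>v. 0"] simp: ddir_def)

lemma holo_nth: "holo (\<lambda>z :: complex ^ 'm::finite. z $ i) U"
  and ddir_nth: "ddir (\<lambda>z :: complex ^ 'm. z $ i) z v = v $ i"
proof -
  have D: "((\<lambda>z. z $ i) has_derivative (\<lambda>z. z $ i)) (at (z :: complex ^ 'm::finite))" for z i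
    by (rule bounded_linear.has_derivative[OF bounded_linear_vec_nth has_derivative_ident])
  then show "holo (\<lambda>z. z $ i) U" unfolding holo_def by (auto intro!: exI[of _ "\<lambda>z. z $ i"])
  show "ddir (\<lambda>z. z $ i) z v = v $ i" by (rule ddir_eqI[OF D]) simp
qed

lemma
  assumes "holo F U" "holo G U"
  shows holo_add: "holo (\<lambda>z. F z + G z) U"
    and ddir_add: "z \<in> U \<Longrightarrow> ddir (\<lambda>z. F z + G z) z v = ddir F z v + ddir G z v"
    and holo_diff: "holo (\<lambda>z. F z - G z) U"
    and ddir_diff: "z \<in> U \<Longrightarrow> ddir (\<lambda>z. F z - G z) z v = ddir F z v - ddir G z v"
    and holo_mult: "holo (\<lambda>z. F z * G z) U"
    and ddir_mult: "z \<in> U \<Longrightarrow> ddir (\<lambda>z. F z * G z) z v = F z * ddir G z v + ddir F z v * G z"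
proof -
  note D = holo_has_derivative[OF assms(1)] holo_has_derivative[OF assms(2)]
  note S = holo_ddir_scale[OF assms(1)] holo_ddir_scale[OF assms(2)]
  have a: "((\<lambda>z. F z + G z) has_derivative (\<lambda>v. ddir F z v + ddir G z v)) (at z)" if "z \<in> U" for z
    by (intro has_derivative_add D that)
  have d: "((\<lambda>z. F z - G z) has_derivative (\<lambda>v. ddir F z v - ddir G z v)) (at z)" if "z \<in> U" for z
    by (intro has_derivative_diff D that)
  have m: "((\<lambda>z. F z * G z) has_derivative (\<lambda>v. F z * ddir G z v + ddir F z v * G z)) (at z)" if "z \<in> U" for z
    by (intro has_derivative_mult D that)
  show "holo (\<lambda>z. F z + G z) U"
    by (rule holo_derivI[OF a]) (auto simp: S algebra_simps)
  show "holo (\<lambda>z. F z - G z) U"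
    by (rule holo_derivI[OF d]) (auto simp: S algebra_simps)
  show "holo (\<lambda>z. F z * G z) U"
    by (rule holo_derivI[OF m]) (auto simp: S algebra_simps)
  show "z \<in> U \<Longrightarrow> ddir (\<lambda>z. F z + G z) z v = ddir F z v + ddir G z v"
    by (rule ddir_eqI[OF a]) (auto simp: S algebra_simps)
  show "z \<in> U \<Longrightarrow> ddir (\<lambda>z. F z - G z) z v = ddir F z v - ddir G z v"
    by (rule ddir_eqI[OF d]) (auto simp: S algebra_simps)
  show "z \<in> U \<Longrightarrow> ddir (\<lambda>z. F z * G z) z v = F z * ddir G z v + ddir F z v * G z"
    by (rule ddir_eqI[OF m]) (auto simp: S algebra_simps)
qed

lemma
  assumes "\<And>i. i \<in> I \<Longrightarrow> holo (F i) U"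
  shows holo_sum: "holo (\<lambda>z. \<Sum>i\<in>I. F i z) U"
    and ddir_sum: "z \<in> U \<Longrightarrow> ddir (\<lambda>z. \<Sum>i\<in>I. F i z) z v = (\<Sum>i\<in>I. ddir (F i) z v)"
proof -
  have d: "((\<lambda>z. \<Sum>i\<in>I. F i z) has_derivative (\<lambda>v. \<Sum>i\<in>I. ddir (F i) z v)) (at z)" if "z \<in> U" for z
    by (intro has_derivative_sum holo_has_derivative[OF assms] that)
  have S: "(\<Sum>i\<in>I. ddir (F i) z (c *s v)) = c * (\<Sum>i\<in>I. ddir (F i) z v)" if "z \<in> U" for z c v
    by (simp add: sum_distrib_left holo_ddir_scale[OF assms that])
  show "holo (\<lambda>z. \<Sum>i\<in>I. F i z) U"
    by (rule holo_derivI[OF d]) (auto simp: S)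
  show "z \<in> U \<Longrightarrow> ddir (\<lambda>z. \<Sum>i\<in>I. F i z) z v = (\<Sum>i\<in>I. ddir (F i) z v)"
    by (rule ddir_eqI[OF d]) (auto simp: S)
qed

lemma
  assumes F: "holo F U" and K: "\<And>a. holo (\<lambda>z. K z $ a) S" and sub: "\<And>z. z \<in> S \<Longrightarrow> K z \<in> U"
  shows holo_compose: "holo (\<lambda>z. F (K z)) S"
    and ddir_compose: "z \<in> S \<Longrightarrow> ddir (\<lambda>z. F (K z)) z v = (\<Sum>a\<in>UNIV. pd a F (K z) * ddir (\<lambda>z. K z $ a) z v)"
proof -
  define L where "L z v = (\<Sum>a\<in>UNIV. ddir (\<lambda>z. K z $ a) z v *s axis a 1)" for z v
  have "(K has_derivative L z) (at z)" if "z \<in> S" for z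
  proof -
    have "((\<lambda>z. \<Sum>a\<in>UNIV. K z $ a *s axis a 1) has_derivative L z) (at z)"
      unfolding L_def
      by (intro has_derivative_sum bounded_linear.has_derivative[OF bounded_linear_csmult] holo_has_derivative[OF K that])
    then show ?thesis by (simp add: basis_expansion)
  qed
  from has_derivative_compose[OF this holo_has_derivative[OF F sub]]
  have d: "((\<lambda>z. F (K z)) has_derivative (\<lambda>v. ddir F (K z) (L z v))) (at z)" if "z \<in> S" for z
    using that by blast
  have e: "ddir F (K z) (L z v) = (\<Sum>a\<in>UNIV. pd a F (K z) * ddir (\<lambda>z. K z $ a) z v)" if "z \<in> S" for z v
    unfolding ddir_eq_sum_pd[OF F sub[OF that]] L_def
    by (intro sum.cong) (auto simp: axis_def if_distrib if_distribR cong: if_cong)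
  have S: "ddir F (K z) (L z (c *s v)) = c * ddir F (K z) (L z v)" if "z \<in> S" for z c v
    unfolding e[OF that] sum_distrib_left by (intro sum.cong) (auto simp: holo_ddir_scale[OF K that])
  show "holo (\<lambda>z. F (K z)) S"
    by (rule holo_derivI[OF d]) (auto simp: S)
  show "z \<in> S \<Longrightarrow> ddir (\<lambda>z. F (K z)) z v = (\<Sum>a\<in>UNIV. pd a F (K z) * ddir (\<lambda>z. K z $ a) z v)"
    by (subst e[symmetric], assumption, rule ddir_eqI[OF d]) (auto simp: S)
qed

lemma
  assumes "holo F U" "\<And>z. z \<in> U \<Longrightarrow> F z \<in> T" "open T" "g holomorphic_on T"
  shows holo_compose1: "holo (\<lambda>z. g (F z)) U"
    and ddir_compose1: "z \<in> U \<Longrightarrow> ddir (\<lambda>z. g (F z)) z v = deriv g (F z) * ddir F z v"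
proof -
  have d: "((\<lambda>z. g (F z)) has_derivative (\<lambda>v. deriv g (F z) * ddir F z v)) (at z)" if "z \<in> U" for z
  proof -
    have "(g has_field_derivative deriv g (F z)) (at (F z))"
      using assms that holomorphic_derivI by blast
    then have "(g has_derivative (\<lambda>x. deriv g (F z) * x)) (at (F z))"
      by (simp add: has_field_derivative_def)
    from has_derivative_compose[OF holo_has_derivative[OF assms(1) that] this] show ?thesis .
  qed
  show "holo (\<lambda>z. g (F z)) U"
    by (rule holo_derivI[OF d]) (auto simp: holo_ddir_scale[OF assms(1)])
  show "z \<in> U \<Longrightarrow> ddir (\<lambda>z. g (F z)) z v = deriv g (F z) * ddir F z v"
    by (rule ddir_eqI[OF d]) (auto simp: holo_ddir_scale[OF assms(1)])
qed


section \<open>Periodic functions on complex strips\<close>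

definition torus_box :: "(real ^ 'n::finite) set" where
  "torus_box = cbox (\<chi> i. - pi) (\<chi> i. pi)"

definition tmean :: "(real ^ 'n::finite \<Rightarrow> complex) \<Rightarrow> complex" where
  "tmean g = inverse (measure lborel (torus_box :: (real ^ 'n) set)) *\<^sub>R integral torus_box g"

lemma content_torus_box: "measure lborel (torus_box :: (real ^ 'n::finite) set) = (2 * pi) ^ CARD('n)"
proof -
  have "(0 :: real ^ 'n) \<in> cbox (\<chi> i. - pi) (\<chi> i. pi)" by (simp add: mem_box_cart)
  then have "cbox (\<chi> i. - pi) (\<chi> i. pi :: real ^ 'n) \<noteq> {}" by blast
  then show ?thesis unfolding torus_box_def by (subst content_cbox_cart) auto
qed

lemma integrable_torus_box: "continuous_on UNIV (g :: real ^ 'n::finite \<Rightarrow> complex) \<Longrightarrow> g integrable_on torus_box"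
  unfolding torus_box_def by (rule integrable_continuous) (rule continuous_on_subset, auto)

lemma tmean_const: "tmean (\<lambda>x :: real ^ 'n::finite. c) = c"
proof -
  have "integral (torus_box :: (real ^ 'n) set) (\<lambda>x. c) = measure lborel (torus_box :: (real ^ 'n) set) *\<^sub>R c"
    unfolding torus_box_def by (rule integral_const)
  moreover have "measure lborel (torus_box :: (real ^ 'n) set) \<noteq> 0" by (simp add: content_torus_box)
  ultimately show ?thesis unfolding tmean_def by simp
qed

lemma tmean_add:
  assumes "continuous_on UNIV f" "continuous_on UNIV g"
  shows "tmean (\<lambda>x. f x + g x) = tmean f + tmean g"
  unfolding tmean_def by (simp add: integral_add[OF assms[THEN integrable_torus_box]] algebra_simps)

lemma tmean_diff:
  assumes "continuous_on UNIV f" "continuous_on UNIV g"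
  shows "tmean (\<lambda>x. f x - g x) = tmean f - tmean g"
  unfolding tmean_def by (simp add: integral_diff[OF assms[THEN integrable_torus_box]] algebra_simps)

lemma tmean_cmult: "tmean (\<lambda>x. c * f x) = c * tmean f"
  unfolding tmean_def by simp

lemma tmean_sum:
  assumes "\<And>i. i \<in> I \<Longrightarrow> continuous_on UNIV (f i)"
  shows "tmean (\<lambda>x. \<Sum>i\<in>I. f i x) = (\<Sum>i\<in>I. tmean (f i))"
  using assms
proof (induction I rule: infinite_finite_induct)
  case (insert i I)
  then show ?case by (simp add: tmean_add continuous_on_sum)
qed (auto simp: tmean_const)

lemma tmean_bound:
  assumes "continuous_on UNIV (f :: real ^ 'n::finite \<Rightarrow> complex)" "\<And>x. cmod (f x) \<le> C"
  shows "cmod (tmean f) \<le> C"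
proof -
  have "C \<ge> 0" using assms(2)[of 0] norm_ge_zero order_trans by blast
  then have "norm (integral torus_box f) \<le> C * measure lborel (torus_box :: (real ^ 'n) set)"
    unfolding torus_box_def
    by (rule has_integral_bound[OF _ integrable_integral])
       (use assms integrable_torus_box in \<open>auto simp: torus_box_def[symmetric]\<close>)
  moreover have "measure lborel (torus_box :: (real ^ 'n) set) > 0" by (simp add: content_torus_box)
  ultimately show ?thesis unfolding tmean_def by (simp add: field_simps)
qed

lemma tmean_cnj: 
  assumes "continuous_on UNIV f" shows "tmean (\<lambda>x. cnj (f x)) = cnj (tmean f)"
  unfolding tmean_def using integral_cnj by (metis complex_cnj_scaleR)

lemma tmean_cong: "(\<And>x. f x = g x) \<Longrightarrow> tmean f = tmean g" by presburger

text \<open>Shifting the cube by t along axis j moves a slab beyond the face at pi. By periodicity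
  it may be translated back by 2 pi, where it fills exactly the slab left free at the opposite face.
  With t in [0, 2 pi] a single cut is enough.\<close>

lemma tmean_translate:
  fixes g :: "real ^ 'n::finite \<Rightarrow> complex"
  assumes g: "continuous_on UNIV g" and per: "\<And>x. g (x + axis j (2 * pi)) = g x"
    and t: "0 \<le> t" "t \<le> 2 * pi"
  shows "tmean (\<lambda>x. g (x + axis j t)) = tmean g"
proof -
  define a b :: "real ^ 'n" where "a = (\<chi> i. - pi)" and "b = (\<chi> i. pi)"
  define c d where "c = axis j t" and "d = (axis j (2 * pi) :: real ^ 'n)"
  have int: "g integrable_on cbox u v" for u v
    by (rule integrable_continuous) (rule continuous_on_subset[OF g], auto)
  have k: "(axis j 1 :: real ^ 'n) \<in> Basis" by (simp add: axis_in_Basis_iff)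
  have all: "(\<forall>i. P i) \<longleftrightarrow> P j \<and> (\<forall>i. i \<noteq> j \<longrightarrow> P i)" for P by metis
  have in_axis: "x \<bullet> axis j 1 = x $ j" for x :: "real ^ 'n" by (simp add: inner_axis)
  have "integral (cbox a b) (g \<circ> (+) c) = integral (cbox (a + c) (b + c)) g"
    by (rule integral_shift_cbox_plus)
  also have "\<dots> = integral (cbox (a + c) (b + c) \<inter> {x. x \<bullet> axis j 1 \<le> pi}) g + integral (cbox (a + c) (b + c) \<inter> {x. pi \<le> x \<bullet> axis j 1}) g"
    by (rule integral_split[OF int k])
  also have "cbox (a + c) (b + c) \<inter> {x. x \<bullet> axis j 1 \<le> pi} = cbox a b \<inter> {x. - pi + t \<le> x \<bullet> axis j 1}"
    unfolding set_eq_iff Int_iff mem_box_cart mem_Collect_eq in_axis a_def b_def c_def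
    by (subst (1 2) all) (use t in \<open>auto simp: axis_def\<close>)
  also have "cbox (a + c) (b + c) \<inter> {x. pi \<le> x \<bullet> axis j 1} = cbox (a + d) ((b + c - d) + d)"
    unfolding set_eq_iff Int_iff mem_box_cart mem_Collect_eq in_axis a_def b_def c_def d_def
    by (subst (1 2) all) (use t in \<open>auto simp: axis_def\<close>)
  also have "integral \<dots> g = integral (cbox a (b + c - d)) (g \<circ> (+) d)"
    by (rule integral_shift_cbox_plus[symmetric])
  also have "g \<circ> (+) d = g" using per by (auto simp: o_def d_def add.commute)
  also have "cbox a (b + c - d) = cbox a b \<inter> {x. x \<bullet> axis j 1 \<le> - pi + t}"
    unfolding set_eq_iff Int_iff mem_box_cart mem_Collect_eq in_axis a_def b_def c_def d_def
    by (subst (1 2) all) (use t in \<open>auto simp: axis_def\<close>)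
  also have "integral (cbox a b \<inter> {x. - pi + t \<le> x \<bullet> axis j 1}) g + integral (cbox a b \<inter> {x. x \<bullet> axis j 1 \<le> - pi + t}) g
    = integral (cbox a b) g"
    using integral_split[OF int k, of a b "- pi + t"] by simp
  finally show ?thesis
    unfolding tmean_def torus_box_def a_def b_def c_def o_def by (simp add: add.commute)
qed

text \<open>Each coordinate is bounded separately: modulo periods the strip is then a box, and
  shifting the contour according to the signs of k gains the full l1 norm of k in the Fourier
  estimates.\<close>

definition strip :: "real \<Rightarrow> (complex ^ 'n::finite) set" where
  "strip r = {\<theta>. \<forall>i. \<bar>Im (\<theta> $ i)\<bar> < r}"

definition pvec :: "int ^ 'n \<Rightarrow> complex ^ 'n::finite" where
  "pvec k = cvec ((2 * pi) *\<^sub>R ivec k)"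

definition per :: "(complex ^ 'n::finite \<Rightarrow> complex) \<Rightarrow> real \<Rightarrow> bool" where
  "per f r \<longleftrightarrow> (\<forall>\<theta>\<in>strip r. \<forall>k. f (\<theta> + pvec k) = f \<theta>)"

lemma cvec_nth [simp]: "cvec x $ i = complex_of_real (x $ i)"
  by (simp add: cvec_def)

lemma pvec_nth: "pvec k $ i = complex_of_real (2 * pi * of_int (k $ i))"
  by (simp add: pvec_def ivec_def)

lemma cvec_add: "cvec (x + y) = cvec x + cvec y" by (simp add: vec_eq_iff)

lemma cvec_axis: "cvec (axis j t) = axis j (complex_of_real t)"
  by (simp add: vec_eq_iff axis_def)

lemma csmult_axis: "c *s axis j (1::complex) = axis j c"
  by (simp add: vec_eq_iff axis_def)

lemma strip_add_pvec [simp]: "\<theta> + pvec k \<in> strip r \<longleftrightarrow> \<theta> \<in> strip r"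
  by (simp add: strip_def pvec_nth)

lemma cvec_in_strip [simp]: "r > 0 \<Longrightarrow> cvec x \<in> strip r"
  by (simp add: strip_def)

lemma strip_mono: "r \<le> r' \<Longrightarrow> strip r \<subseteq> strip r'"
  unfolding strip_def using less_le_trans by blast

lemma open_strip: "open (strip r)"
proof -
  have "strip r = (\<Inter>i\<in>UNIV. {\<theta>. \<bar>Im (\<theta> $ i)\<bar> < r})" by (auto simp: strip_def)
  also have "open \<dots>" by (intro open_INT) (auto intro!: open_Collect_less continuous_intros)
  finally show ?thesis .
qed

lemma continuous_on_cvec: "continuous_on S cvec"
  unfolding cvec_def[abs_def] by (intro continuous_intros)

lemma continuous_on_strip_real:
  assumes "continuous_on (strip r) f" "r > 0"
  shows "continuous_on S (\<lambda>x. f (cvec x))"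
  by (rule continuous_on_compose2[OF assms(1) continuous_on_cvec]) (use assms in auto)

lemma pvec_axis: "pvec (axis j 1) = axis j (complex_of_real (2 * pi))"
  by (simp add: vec_eq_iff pvec_nth axis_def)

lemma strip_disc:
  assumes "\<theta> \<in> strip (r - d)" "cmod t \<le> R" "\<And>i. R * cmod (v $ i) \<le> d"
  shows "\<theta> + t *s v \<in> strip r"
  unfolding strip_def
proof (intro CollectI allI)
  fix i
  have "\<bar>Im (t * v $ i)\<bar> \<le> cmod (t * v $ i)" by (rule abs_Im_le_cmod)
  also have "\<dots> \<le> R * cmod (v $ i)" using assms(2) by (simp add: norm_mult mult_right_mono)
  also have "\<dots> \<le> d" by (rule assms(3))
  finally show "\<bar>Im ((\<theta> + t *s v) $ i)\<bar> < r"
    using assms(1) by (auto simp: strip_def dest!: spec[of _ i])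
qed

text \<open>Stands in for compactness of the torus: a closed box of height r' < r meets every period
  class of the narrower strip and lies inside the wider one.\<close>

lemma strip_fundamental_domain:
  assumes "r' < r"
  obtains K :: "(complex ^ 'n::finite) set" where "compact K" "K \<subseteq> strip r"
    "\<And>\<theta>. \<theta> \<in> strip r' \<Longrightarrow> \<exists>k. \<theta> + pvec k \<in> K"
proof -
  define K :: "(complex ^ 'n) set" where "K = {\<theta>. \<forall>i. \<theta> $ i \<in> cbox (Complex (- pi) (- r')) (Complex pi r')}"
  have "K = cbox (\<chi> i. Complex (- pi) (- r')) (\<chi> i. Complex pi r')"
    unfolding K_def by (auto simp: mem_box Basis_vec_def inner_axis)
  then have "compact K" by simp
  moreover have "K \<subseteq> strip r"
    using assms by (auto simp: K_def strip_def in_cbox_complex_iff) (smt (verit))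
  moreover have "\<exists>k. \<theta> + pvec k \<in> K" if "\<theta> \<in> strip r'" for \<theta>
  proof -
    define k :: "int ^ 'n" where "k = (\<chi> i. - \<lfloor>(Re (\<theta> $ i) + pi) / (2 * pi)\<rfloor>)"
    have "\<theta> + pvec k \<in> K"
      unfolding K_def
    proof (intro CollectI allI)
      fix i
      define y where "y = (Re (\<theta> $ i) + pi) / (2 * pi)"
      have "Re ((\<theta> + pvec k) $ i) = 2 * pi * (y - \<lfloor>y\<rfloor>) - pi"
        by (simp add: pvec_nth k_def y_def field_simps)
      moreover have "0 \<le> y - \<lfloor>y\<rfloor>" "y - \<lfloor>y\<rfloor> \<le> 1" by linarith+
      then have "0 \<le> 2 * pi * (y - \<lfloor>y\<rfloor>)" "2 * pi * (y - \<lfloor>y\<rfloor>) \<le> 2 * pi * 1"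
        by (intro mult_nonneg_nonneg mult_left_mono; simp)+
      ultimately have "- pi \<le> Re ((\<theta> + pvec k) $ i)" "Re ((\<theta> + pvec k) $ i) \<le> pi" by linarith+
      moreover have "\<bar>Im ((\<theta> + pvec k) $ i)\<bar> < r'" using that by (simp add: strip_def pvec_nth)
      ultimately show "(\<theta> + pvec k) $ i \<in> cbox (Complex (- pi) (- r')) (Complex pi r')"
        unfolding in_cbox_complex_iff complex.sel atLeastAtMost_iff by linarith
    qed
    then show ?thesis by blast
  qed
  ultimately show thesis by (rule that)
qed

lemma bounded_on_strip:
  fixes f :: "complex ^ 'n::finite \<Rightarrow> complex"
  assumes f: "continuous_on (strip r) f" "per f r" and r': "r' < r"
  obtains C where "\<And>\<theta>. \<theta> \<in> strip r' \<Longrightarrow> cmod (f \<theta>) \<le> C" "C \<ge> 0"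
proof -
  obtain K :: "(complex ^ 'n) set" where K: "compact K" "K \<subseteq> strip r" "\<And>\<theta>. \<theta> \<in> strip r' \<Longrightarrow> \<exists>k. \<theta> + pvec k \<in> K"
    using strip_fundamental_domain[OF r'] by blast
  then have "compact (f ` K)" using f(1) by (meson compact_continuous_image continuous_on_subset)
  then obtain C where C: "\<forall>x\<in>f ` K. cmod x \<le> C" by (meson bounded_iff compact_imp_bounded)
  have "cmod (f \<theta>) \<le> max C 0" if \<theta>: "\<theta> \<in> strip r'" for \<theta>
  proof -
    obtain k where "\<theta> + pvec k \<in> K" using K \<theta> by blast
    moreover have "\<theta> \<in> strip r" using \<theta> strip_mono[of r' r] r' by auto
    ultimately show ?thesis using C f(2) unfolding per_def by (metis image_eqI max.coboundedI1)
  qed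
  then show thesis using that by (metis max.cobounded2)
qed

section \<open>Means over the real torus under complex shifts\<close>

definition cmean :: "(complex ^ 'n::finite \<Rightarrow> complex) \<Rightarrow> complex" where
  "cmean f = tmean (\<lambda>x. f (cvec x))"

lemma per_ddir:
  fixes f :: "complex ^ 'n::finite \<Rightarrow> complex"
  assumes "holo f (strip r)" "per f r"
  shows "per (\<lambda>z. ddir f z v) r"
  unfolding per_def
proof (intro ballI allI)
  fix \<theta> :: "complex ^ 'n" and k assume \<theta>: "\<theta> \<in> strip r"
  define S where "S = (\<lambda>t. \<theta> + t *s v) -` strip r"
  have "open S" unfolding S_def using open_strip
    by (intro open_vimage continuous_intros bounded_linear.continuous_on[OF bounded_linear_csmult])
  moreover have "0 \<in> S" using \<theta> by (simp add: S_def)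
  ultimately have "\<forall>\<^sub>F t in nhds 0. t \<in> S" by (simp add: eventually_nhds_in_open)
  then have "\<forall>\<^sub>F t in nhds 0. f (\<theta> + pvec k + t *s v) = f (\<theta> + t *s v)"
    by eventually_elim (use assms(2) in \<open>auto simp: per_def S_def algebra_simps\<close>)
  then show "ddir f (\<theta> + pvec k) v = ddir f \<theta> v"
    unfolding ddir_def by (rule deriv_cong_ev) simp
qed

text \<open>Differentiation under the integral for a complex shift. Periodicity makes f bounded on a
  narrower strip, and this bound gives a Taylor remainder that is uniform in the base point.\<close>

lemma cmean_line_derivative:
  fixes f :: "complex ^ 'n::finite \<Rightarrow> complex"
  assumes f: "holo f (strip r)" "per f r" and r: "r > 0"
  shows "((\<lambda>s. cmean (\<lambda>\<theta>. f (\<theta> + s *s v))) has_field_derivative cmean (\<lambda>\<theta>. ddir f \<theta> v)) (at 0)"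
proof -
  obtain C where C: "\<And>\<theta>. \<theta> \<in> strip (r / 2) \<Longrightarrow> cmod (f \<theta>) \<le> C" "C \<ge> 0"
    using bounded_on_strip[OF holo_continuous_on[OF f(1)] f(2), of "r / 2"] r by auto
  \<comment> \<open>Real points are moved by at most r/4 in each coordinate, so they stay in the
    strip of width r/2 on which f is bounded.\<close>
  define R where "R = r / (4 * (norm v + 1))"
  have den: "norm v + 1 > 0" by (smt (verit) norm_ge_zero)
  have R: "R > 0" using r den by (simp add: R_def)
  have Rv: "R * cmod (v $ i) \<le> r / 4" for i
  proof -
    have "R * cmod (v $ i) \<le> R * (norm v + 1)"
      using Finite_Cartesian_Product.norm_nth_le[of v i] R by (intro mult_left_mono) auto
    also have "\<dots> = r / 4" using den unfolding R_def by (simp add: divide_simps)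
    finally show ?thesis .
  qed
  have in2: "cvec x + t *s v \<in> strip (r / 2)" if "cmod t \<le> R" for x t
    by (rule strip_disc[where R = R and d = "r / 4"]) (use that Rv r in auto)
  have in1: "cvec x + t *s v \<in> strip r" if "cmod t \<le> R" for x t
    using in2[OF that, of x] strip_mono[of "r / 2" r] r by auto
  have cont: "continuous_on UNIV (\<lambda>x. f (cvec x + t *s v))" if "cmod t \<le> R" for t
    by (rule continuous_on_compose2[OF holo_continuous_on[OF f(1)], where f = "\<lambda>x. cvec x + t *s v"])
       (use in1 that in \<open>auto intro!: continuous_intros continuous_on_cvec\<close>)
  have cont': "continuous_on UNIV (\<lambda>x. ddir f (cvec x) v)"
    by (rule continuous_on_strip_real[OF ddir_continuous_on[OF open_strip f(1)] r])
  have est: "cmod (f (cvec x + s *s v) - f (cvec x) - s * ddir f (cvec x) v) \<le> 8 * C * (cmod s)\<^sup>2 / R\<^sup>2"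
    if "cmod s \<le> R / 2" for x s
    by (rule taylor2_dir[OF open_strip f(1) R]) (use that in1 in2 C in auto)
  define G where "G s = cmean (\<lambda>\<theta>. f (\<theta> + s *s v))" for s
  define D where "D = cmean (\<lambda>\<theta>. ddir f \<theta> v)"
  have G: "cmod (G s - G 0 - s * D) \<le> 8 * C * (cmod s)\<^sup>2 / R\<^sup>2" if s: "cmod s \<le> R / 2" for s
  proof -
    have s': "cmod s \<le> R" using s R by simp
    have c0: "continuous_on UNIV (\<lambda>x. f (cvec x))" using cont[of 0] R by simp
    have "G s - G 0 - s * D = tmean (\<lambda>x. f (cvec x + s *s v) - f (cvec x) - s * ddir f (cvec x) v)"
      unfolding G_def D_def cmean_def
      using cont[OF s'] c0 cont' by (simp add: tmean_diff tmean_cmult continuous_on_diff continuous_on_mult_left)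
    also have "cmod \<dots> \<le> 8 * C * (cmod s)\<^sup>2 / R\<^sup>2"
      by (rule tmean_bound) (use est s in \<open>auto intro!: continuous_intros cont s' c0 cont'\<close>)
    finally show ?thesis .
  qed
  have "(\<lambda>s. (G s - G 0) / s - D) \<midarrow>0\<rightarrow> 0"
  proof (rule Lim_null_comparison)
    show "\<forall>\<^sub>F s in at 0. norm ((G s - G 0) / s - D) \<le> 8 * C / R\<^sup>2 * cmod s"
      unfolding eventually_at
    proof (intro exI conjI ballI impI)
      show "R / 2 > 0" using R by simp
      fix s :: complex assume s: "s \<noteq> 0 \<and> dist s 0 < R / 2"
      then have "(G s - G 0) / s - D = (G s - G 0 - s * D) / s" by (simp add: field_simps)
      then have "norm ((G s - G 0) / s - D) = cmod (G s - G 0 - s * D) / cmod s" by (simp add: norm_divide)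
      also have "\<dots> \<le> 8 * C * (cmod s)\<^sup>2 / R\<^sup>2 / cmod s"
        using G[of s] s by (intro divide_right_mono) auto
      also have "\<dots> = 8 * C / R\<^sup>2 * cmod s" using s by (simp add: power2_eq_square)
      finally show "norm ((G s - G 0) / s - D) \<le> 8 * C / R\<^sup>2 * cmod s" .
    qed
    show "(\<lambda>s. 8 * C / R\<^sup>2 * cmod s) \<midarrow>0\<rightarrow> 0" using R by (auto intro!: tendsto_eq_intros)
  qed
  then have "(\<lambda>s. (G s - G 0) / s) \<midarrow>0\<rightarrow> D" using Lim_null by blast
  then show ?thesis by (simp add: DERIV_def G_def D_def)
qed

text \<open>The mean does not change under real shifts, and its derivative in a complex shift
  exists; evaluated along the real increments 1/(n+1) it is 0.\<close>

lemma cmean_pd: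
  fixes f :: "complex ^ 'n::finite \<Rightarrow> complex"
  assumes f: "holo f (strip r)" "per f r" and r: "r > 0"
  shows "cmean (pd j f) = 0"
proof -
  define G where "G s = cmean (\<lambda>\<theta>. f (\<theta> + s *s axis j 1))" for s :: complex
  have D: "(G has_field_derivative cmean (pd j f)) (at 0)"
    using cmean_line_derivative[OF f r, of "axis j 1"] unfolding G_def pd_def .
  have const: "G (complex_of_real t) = G 0" if "0 \<le> t" "t \<le> 2 * pi" for t
  proof -
    have c: "continuous_on UNIV (\<lambda>x. f (cvec x))"
      by (rule continuous_on_strip_real[OF holo_continuous_on[OF f(1)] r])
    have p: "f (cvec (x + axis j (2 * pi))) = f (cvec x)" for x
      using f(2) r by (simp add: cvec_add cvec_axis pvec_axis[symmetric] per_def del: of_real_mult)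
    have "G (complex_of_real t) = tmean (\<lambda>x. f (cvec (x + axis j t)))"
      by (simp add: G_def cmean_def cvec_add cvec_axis csmult_axis)
    moreover have "G 0 = tmean (\<lambda>x. f (cvec x))" by (simp add: G_def cmean_def)
    ultimately show ?thesis using tmean_translate[OF c p that] by simp
  qed
  have "(\<lambda>n. (G (0 + complex_of_real (inverse (real (Suc n)))) - G 0) / complex_of_real (inverse (real (Suc n)))) \<longlonglongrightarrow> cmean (pd j f)"
  proof (rule filterlim_compose[OF D[unfolded DERIV_def]])
    have "(\<lambda>n. complex_of_real (inverse (real (Suc n)))) \<longlonglongrightarrow> complex_of_real 0"
      by (intro tendsto_of_real LIMSEQ_inverse_real_of_nat)
    then show "filterlim (\<lambda>n. complex_of_real (inverse (real (Suc n)))) (at 0) sequentially"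
      unfolding filterlim_at by (auto simp del: of_real_inverse of_nat_Suc)
  qed
  moreover have "inverse (real (Suc n)) \<le> 2 * pi" for n
    using pi_gt3 by (smt (verit) inverse_le_1_iff of_nat_le_0_iff of_nat_Suc of_nat_0_le_iff)
  then have "G (0 + complex_of_real (inverse (real (Suc n)))) = G 0" for n
    using const[of "inverse (real (Suc n))"] by simp
  ultimately show ?thesis by (simp add: LIMSEQ_const_iff)
qed

lemma cmean_ddir:
  assumes f: "holo f (strip r)" "per f r" and r: "r > 0"
  shows "cmean (\<lambda>\<theta>. ddir f \<theta> v) = 0"
proof -
  have "cmean (\<lambda>\<theta>. ddir f \<theta> v) = tmean (\<lambda>x. \<Sum>a\<in>UNIV. v $ a * pd a f (cvec x))"
    unfolding cmean_def by (rule tmean_cong) (rule ddir_eq_sum_pd[OF f(1)], use r in auto)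
  also have "\<dots> = (\<Sum>a\<in>UNIV. tmean (\<lambda>x. v $ a * pd a f (cvec x)))"
    by (rule tmean_sum) (intro continuous_on_mult_left continuous_on_strip_real[OF holo_continuous_on[OF holo_pd[OF open_strip f(1)]] r])
  also have "\<dots> = 0"
    using cmean_pd[OF f r] by (simp add: tmean_cmult cmean_def)
  finally show ?thesis .
qed

lemma per_translate: "per f r \<Longrightarrow> (\<And>\<theta>. \<theta> \<in> strip r' \<Longrightarrow> \<theta> + c \<in> strip r) \<Longrightarrow> per (\<lambda>\<theta>. f (\<theta> + c)) r'"
  unfolding per_def by (metis add.assoc add.commute)

lemma holo_translate: "holo f (strip r) \<Longrightarrow> (\<And>\<theta>. \<theta> \<in> strip r' \<Longrightarrow> \<theta> + c \<in> strip r) \<Longrightarrow> holo (\<lambda>\<theta>. f (\<theta> + c)) (strip r')"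
  by (rule holo_compose[where K = "\<lambda>\<theta>. \<theta> + c"]) (auto intro!: holo_add holo_nth holo_const)

text \<open>Cauchy's contour shift without contour integrals: along the segment from 0 to c the
  derivative of the mean is the mean of a derivative, which vanishes.\<close>

lemma cmean_shift:
  fixes f :: "complex ^ 'n::finite \<Rightarrow> complex"
  assumes f: "holo f (strip r)" "per f r" and c: "c \<in> strip r"
  shows "cmean (\<lambda>\<theta>. f (\<theta> + c)) = cmean f"
proof -
  define G where "G s = cmean (\<lambda>\<theta>. f (\<theta> + s *s c))" for s
  \<comment> \<open>The width that is left after a shift by c; every point of the segment leaves at
    least this much.\<close>
  define r2 where "r2 = r - Max (range (\<lambda>i. \<bar>Im (c $ i)\<bar>))"
  have "Max (range (\<lambda>i. \<bar>Im (c $ i)\<bar>)) < r"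
    using c by (subst Max_less_iff) (auto simp: strip_def)
  then have r2: "r2 > 0" by (simp add: r2_def)
  have tr: "\<theta> + s *s c \<in> strip r" if \<theta>s: "\<theta> \<in> strip r2" "s \<in> closed_segment 0 1" for \<theta> s
    unfolding strip_def
  proof (intro CollectI allI)
    fix i
    obtain u where u: "s = complex_of_real u" "0 \<le> u" "u \<le> 1"
      using \<theta>s(2) by (auto simp: in_segment scaleR_conv_of_real)
    have "\<bar>Im (c $ i)\<bar> \<le> r - r2" unfolding r2_def by (simp add: Max_ge)
    moreover have "\<bar>u * Im (c $ i)\<bar> \<le> \<bar>Im (c $ i)\<bar>" using u by (simp add: abs_mult mult_left_le_one_le)
    moreover have "\<bar>Im (\<theta> $ i)\<bar> < r2" using \<theta>s by (simp add: strip_def)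
    ultimately show "\<bar>Im ((\<theta> + s *s c) $ i)\<bar> < r" using u by simp
  qed
  have der: "(G has_field_derivative 0) (at s within closed_segment 0 1)" if s: "s \<in> closed_segment 0 1" for s
  proof -
    have h: "holo (\<lambda>\<theta>. f (\<theta> + s *s c)) (strip r2)" "per (\<lambda>\<theta>. f (\<theta> + s *s c)) r2"
      using holo_translate[OF f(1) tr] per_translate[OF f(2) tr] s by blast+
    have "((\<lambda>t. cmean (\<lambda>\<theta>. f (\<theta> + t *s c + s *s c))) has_field_derivative 0) (at 0)"
      using cmean_line_derivative[OF h r2, of c] cmean_ddir[OF h r2, of c] by simp
    then have "((\<lambda>t. G (t + s)) has_field_derivative 0) (at 0)"
      by (simp add: G_def vector_sadd_rdistrib ac_simps)
    then have "(G has_field_derivative 0) (at s)" using DERIV_shift[of G 0 0 s] by simp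
    then show ?thesis by (rule has_field_derivative_at_within)
  qed
  have "G 1 = G 0"
    using has_field_derivative_zero_constant[OF convex_closed_segment der] by (metis ends_in_segment)
  then show ?thesis by (simp add: G_def)
qed


section \<open>Fourier expansion\<close>

definition ee :: "int ^ 'n \<Rightarrow> complex ^ 'n::finite \<Rightarrow> complex" where
  "ee k \<theta> = exp (\<i> * (\<Sum>j\<in>UNIV. of_int (k $ j) * \<theta> $ j))"

lemma ee_add_index: "ee (k + l) \<theta> = ee k \<theta> * ee l \<theta>"
  by (simp add: ee_def exp_add[symmetric] algebra_simps sum.distrib)

lemma ee_add_arg: "ee k (\<theta> + \<phi>) = ee k \<theta> * ee k \<phi>"
  by (simp add: ee_def exp_add[symmetric] algebra_simps sum.distrib)

lemma ee_zero [simp]: "ee 0 \<theta> = 1" "ee k 0 = 1"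
  by (simp_all add: ee_def)

lemma ee_uminus_mult: "ee (- k) \<theta> * ee k \<theta> = 1"
  by (metis ee_add_index ee_zero(1) left_minus)

lemma ee_pvec: "ee k (pvec m) = 1"
proof -
  have e: "\<i> * (\<Sum>j\<in>UNIV. of_int (k $ j) * pvec m $ j) = (2 * of_int (\<Sum>j\<in>UNIV. k $ j * m $ j) * of_real pi) * \<i>"
    by (simp add: pvec_nth sum_distrib_left sum_distrib_right ac_simps)
  show ?thesis unfolding ee_def e using exp_integer_2pi[OF Ints_of_int, of "\<Sum>j\<in>UNIV. k $ j * m $ j"]
    by (simp only: of_real_mult of_real_of_int_eq of_real_numeral)
qed

lemma per_ee: "per (ee k) r"
  by (simp add: per_def ee_add_arg ee_pvec)

lemma holo_ee: "holo (ee k) U"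
  and ddir_ee: "ddir (ee k) \<theta> v = \<i> * (\<Sum>j\<in>UNIV. of_int (k $ j) * v $ j) * ee k \<theta>"
proof -
  let ?g = "\<lambda>\<theta>. \<i> * (\<Sum>j\<in>UNIV. of_int (k $ j) * \<theta> $ j)"
  have h: "holo ?g U" for U by (intro holo_mult holo_sum holo_const holo_nth)
  have hs: "holo (\<lambda>\<theta>. \<Sum>j\<in>UNIV. of_int (k $ j) * \<theta> $ j) UNIV"
    by (intro holo_mult holo_sum holo_const holo_nth)
  have hj: "holo (\<lambda>\<theta>. of_int (k $ j) * \<theta> $ j) UNIV" for j
    by (intro holo_mult holo_sum holo_const holo_nth)
  have e: "exp holomorphic_on UNIV" by (intro holomorphic_intros)
  show "holo (ee k) U"
    unfolding ee_def[abs_def] by (rule holo_compose1[OF h _ open_UNIV e]) simp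
  have "ddir (ee k) \<theta> v = deriv exp (?g \<theta>) * ddir ?g \<theta> v"
    unfolding ee_def[abs_def] by (rule ddir_compose1[OF h[of UNIV] _ open_UNIV e]) auto
  also have "deriv exp (?g \<theta>) = ee k \<theta>" by (simp add: ee_def DERIV_imp_deriv DERIV_exp)
  also have "ddir ?g \<theta> v = \<i> * (\<Sum>j\<in>UNIV. of_int (k $ j) * v $ j)"
    by (simp add: ddir_mult[OF holo_const hs] ddir_const ddir_sum[OF hj] ddir_mult[OF holo_const holo_nth, of _ UNIV] ddir_nth)
  finally show "ddir (ee k) \<theta> v = \<i> * (\<Sum>j\<in>UNIV. of_int (k $ j) * v $ j) * ee k \<theta>" by simp
qed

lemma cmod_ee: "cmod (ee k \<theta>) = exp (- (\<Sum>j\<in>UNIV. of_int (k $ j) * Im (\<theta> $ j)))"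
  by (simp add: ee_def)

lemma cmod_ee_le:
  assumes "\<And>j. \<bar>Im (\<theta> $ j)\<bar> \<le> r"
  shows "cmod (ee k \<theta>) \<le> exp (r * l1norm k)"
proof -
  have "- (of_int (k $ j) * Im (\<theta> $ j)) \<le> r * \<bar>of_int (k $ j)\<bar>" for j
  proof -
    have "- (of_int (k $ j) * Im (\<theta> $ j)) \<le> \<bar>of_int (k $ j)\<bar> * \<bar>Im (\<theta> $ j)\<bar>"
      by (metis abs_ge_minus_self abs_mult)
    also have "\<dots> \<le> \<bar>of_int (k $ j)\<bar> * r" by (intro mult_left_mono assms) simp
    finally show ?thesis by (simp add: mult.commute)
  qed
  then have "(\<Sum>j\<in>UNIV. - (of_int (k $ j) * Im (\<theta> $ j))) \<le> (\<Sum>j\<in>UNIV. r * \<bar>of_int (k $ j)\<bar>)"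
    by (rule sum_mono)
  then show ?thesis by (simp add: cmod_ee l1norm_def sum_distrib_left sum_negf)
qed

lemma continuous_on_ee: "continuous_on S (ee k)"
  by (rule holo_continuous_on[OF holo_ee])

lemma continuous_on_ee_real: "continuous_on S (\<lambda>x. ee k (cvec x))"
  by (rule continuous_on_compose2[OF continuous_on_ee continuous_on_cvec]) auto

lemma cmod_ee_real: "cmod (ee k (cvec x)) = 1"
  by (simp add: cmod_ee)

lemma cmean_ee: "cmean (ee k) = (if k = 0 then 1 else 0)"
proof (cases "k = 0")
  case True
  then have "ee k = (\<lambda>\<theta>. 1)" by auto
  then show ?thesis using True by (simp add: cmean_def tmean_const)
next
  case False
  then obtain j where j: "k $ j \<noteq> 0" by (auto simp: vec_eq_iff)
  have pd: "pd j (ee k) \<theta> = \<i> * of_int (k $ j) * ee k \<theta>" for \<theta>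
    unfolding pd_def ddir_ee by (simp add: axis_def if_distrib cong: if_cong)
  have "cmean (pd j (ee k)) = 0"
    by (rule cmean_pd[where r = 1]) (auto intro: holo_ee per_ee)
  then have "\<i> * of_int (k $ j) * cmean (ee k) = 0"
    by (simp add: pd[abs_def] cmean_def tmean_cmult)
  then show ?thesis using j False by simp
qed

section \<open>Fourier coefficients\<close>

definition coef :: "(complex ^ 'n::finite \<Rightarrow> complex) \<Rightarrow> int ^ 'n \<Rightarrow> complex" where
  "coef f k = cmean (\<lambda>\<theta>. f \<theta> * ee (- k) \<theta>)"

lemma coef_zero: "coef f 0 = cmean f"
  by (simp add: coef_def)

lemma per_mult: "per f r \<Longrightarrow> per g r \<Longrightarrow> per (\<lambda>\<theta>. f \<theta> * g \<theta>) r"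
  by (simp add: per_def)

text \<open>Integration by parts: the product of f with a character is periodic, so its derivative
  has mean zero.\<close>

lemma coef_ddir:
  assumes f: "holo f (strip r)" "per f r" and r: "r > 0"
  shows "coef (\<lambda>\<theta>. ddir f \<theta> v) k = \<i> * (\<Sum>j\<in>UNIV. of_int (k $ j) * v $ j) * coef f k"
proof -
  let ?s = "\<i> * (\<Sum>j\<in>UNIV. of_int (k $ j) * v $ j)"
  have "0 = cmean (\<lambda>\<theta>. ddir (\<lambda>\<theta>. f \<theta> * ee (- k) \<theta>) \<theta> v)"
    using cmean_ddir[OF holo_mult[OF f(1) holo_ee] per_mult[OF f(2) per_ee] r] by metis
  also have "\<dots> = tmean (\<lambda>x. ddir f (cvec x) v * ee (- k) (cvec x) - ?s * (f (cvec x) * ee (- k) (cvec x)))"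
    unfolding cmean_def
    by (rule tmean_cong) (use r in \<open>simp add: ddir_mult[OF f(1) holo_ee] ddir_ee sum_negf algebra_simps\<close>)
  also have "\<dots> = coef (\<lambda>\<theta>. ddir f \<theta> v) k - ?s * coef f k"
    unfolding coef_def cmean_def tmean_cmult[symmetric]
    by (intro tmean_diff continuous_intros continuous_on_ee_real continuous_on_strip_real[OF holo_continuous_on[OF f(1)] r]
         continuous_on_strip_real[OF ddir_continuous_on[OF open_strip f(1)] r])
  finally show ?thesis by simp
qed

lemma coef_translate:
  assumes f: "holo f (strip r)" "per f r" and c: "c \<in> strip r"
  shows "coef (\<lambda>\<theta>. f (\<theta> + c)) k = ee k c * coef f k"
proof -
  have e: "f (\<theta> + c) * ee (- k) \<theta> = ee k c * (f (\<theta> + c) * ee (- k) (\<theta> + c))" for \<theta>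
    using ee_uminus_mult[of k c] by (simp add: ee_add_arg algebra_simps)
  have "coef (\<lambda>\<theta>. f (\<theta> + c)) k = ee k c * cmean (\<lambda>\<theta>. f (\<theta> + c) * ee (- k) (\<theta> + c))"
    unfolding coef_def e by (simp add: cmean_def tmean_cmult)
  also have "cmean (\<lambda>\<theta>. f (\<theta> + c) * ee (- k) (\<theta> + c)) = coef f k"
    unfolding coef_def using cmean_shift[OF holo_mult[OF f(1) holo_ee] per_mult[OF f(2) per_ee] c] .
  finally show ?thesis .
qed

text \<open>Shifting the contour by \<rho> in the imaginary direction in which the character decays
  gives the bound for every \<rho> < r. The strip is open, so \<rho> = r is reached only in the
  limit.\<close>

lemma coef_bound:
  fixes f :: "complex ^ 'n::finite \<Rightarrow> complex"
  assumes f: "holo f (strip r)" "per f r" and C: "\<And>\<theta>. \<theta> \<in> strip r \<Longrightarrow> cmod (f \<theta>) \<le> C" and r: "r > 0"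
  shows "cmod (coef f k) \<le> C * exp (- r * l1norm k)"
proof -
  have "cmod (f 0) \<le> C" by (rule C) (use r in \<open>simp add: strip_def\<close>)
  then have C0: "C \<ge> 0" using norm_ge_zero order_trans by blast
  have b: "cmod (coef f k) \<le> C * exp (- \<rho> * l1norm k)" if \<rho>: "0 \<le> \<rho>" "\<rho> < r" for \<rho>
  proof -
    \<comment> \<open>With these signs all terms of the exponent have the same sign and add up to
      -\<rho> times the l1 norm of k.\<close>
    define c :: "complex ^ 'n" where "c = (\<chi> j. - \<i> * of_real (\<rho> * sgn (of_int (k $ j))))"
    have c: "c \<in> strip r" using \<rho> by (auto simp: strip_def c_def abs_mult sgn_if)
    have "ee (- k) \<theta> = ee (- k) (\<theta> + c) * ee k c" for \<theta>
      using ee_uminus_mult[of k c] by (simp add: ee_add_arg algebra_simps)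
    have "cmod (ee (- k) c) = exp (- (\<Sum>j\<in>UNIV. of_int (k $ j) * \<rho> * sgn (of_int (k $ j))))"
      by (simp add: cmod_ee c_def algebra_simps sum_negf)
    also have "(\<Sum>j\<in>UNIV. of_int (k $ j) * \<rho> * sgn (of_int (k $ j))) = \<rho> * l1norm k"
      unfolding l1norm_def sum_distrib_left by (intro sum.cong) (auto simp: sgn_if)
    finally have ec: "cmod (ee (- k) c) = exp (- \<rho> * l1norm k)" by simp
    have "coef f k = cmean (\<lambda>\<theta>. f (\<theta> + c) * ee (- k) (\<theta> + c))"
      unfolding coef_def using cmean_shift[OF holo_mult[OF f(1) holo_ee] per_mult[OF f(2) per_ee] c] by simp
    also have "cmod \<dots> \<le> C * exp (- \<rho> * l1norm k)"
      unfolding cmean_def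
    proof (rule tmean_bound)
      have sub: "cvec x + c \<in> strip r" for x using c by (simp add: strip_def)
      show "continuous_on UNIV (\<lambda>x. f (cvec x + c) * ee (- k) (cvec x + c))"
        using sub by (intro continuous_on_mult continuous_on_compose2[OF holo_continuous_on[OF f(1)], where f = "\<lambda>x. cvec x + c"]
           continuous_on_compose2[OF continuous_on_ee[of UNIV], where f = "\<lambda>x. cvec x + c"] continuous_intros continuous_on_cvec) auto
      show "cmod (f (cvec x + c) * ee (- k) (cvec x + c)) \<le> C * exp (- \<rho> * l1norm k)" for x
        unfolding norm_mult ee_add_arg cmod_ee_real ec using C[OF sub] by (simp add: mult_right_mono)
    qed
    finally show ?thesis .
  qed
  have lim: "((\<lambda>\<rho>. C * exp (- \<rho> * l1norm k)) \<longlongrightarrow> C * exp (- r * l1norm k)) (at_left r)"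
    by (intro tendsto_intros)
  have ev: "\<forall>\<^sub>F \<rho> in at_left r. cmod (coef f k) \<le> C * exp (- \<rho> * l1norm k)"
    using eventually_at_left_real[OF r] by eventually_elim (use b in auto)
  show ?thesis by (rule tendsto_lowerbound[OF lim ev]) simp
qed

lemma tmean_uniform_limit:
  fixes f :: "'i \<Rightarrow> real ^ 'n::finite \<Rightarrow> complex"
  assumes "uniform_limit UNIV f g N" "\<And>n. continuous_on UNIV (f n)" "continuous_on UNIV g"
  shows "((\<lambda>n. tmean (f n)) \<longlongrightarrow> tmean g) N"
proof (rule tendstoI)
  fix e :: real assume e: "e > 0"
  then have "\<forall>\<^sub>F n in N. \<forall>x\<in>UNIV. dist (f n x) (g x) < e / 2"
    using assms(1) half_gt_zero[OF e] unfolding uniform_limit_iff by blast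
  then show "\<forall>\<^sub>F n in N. dist (tmean (f n)) (tmean g) < e"
  proof eventually_elim
    case (elim n)
    have "cmod (tmean (\<lambda>x. f n x - g x)) \<le> e / 2"
      using elim by (intro tmean_bound continuous_intros assms) (auto simp: dist_norm intro: less_imp_le)
    then show ?case using e by (simp add: tmean_diff assms dist_norm)
  qed
qed

text \<open>A continuous function orthogonal to all characters is orthogonal to the powers of the kernel
  \<open>\<Prod>i. (1 + cos (x $ i)) / 2\<close>, which concentrate at the origin.\<close>

lemma fourier_uniqueness_at_0:
  fixes F :: "real ^ 'n::finite \<Rightarrow> complex"
  assumes F: "continuous_on UNIV F" and orth: "\<And>k. tmean (\<lambda>x. F x * ee k (cvec x)) = 0"
  shows "F 0 = 0"
proof (rule ccontr)
  assume F0: "F 0 \<noteq> 0"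
  define F' where "F' x = F x / F 0" for x
  have F': "continuous_on UNIV F'" unfolding F'_def using F F0 by (intro continuous_intros) auto
  have orth': "tmean (\<lambda>x. F' x * ee k (cvec x)) = 0" for k
    using tmean_cmult[of "inverse (F 0)" "\<lambda>x. F x * ee k (cvec x)"] orth[of k]
    by (simp add: F'_def field_simps)
  define T where "T x = (\<Prod>i\<in>UNIV. (1 + cos (x $ i)) / 2)" for x :: "real ^ 'n"
  have contT: "continuous_on S T" for S
    unfolding T_def by (intro continuous_intros) auto
  \<comment> \<open>Multiplication by one factor (1 + cos (x $ j)) / 2 only mixes the characters k,
    k + \<open>axis j 1\<close> and k - \<open>axis j 1\<close>. The property defined here is stable
    under it and therefore holds for all powers of the kernel.\<close>
  define Q where "Q g \<longleftrightarrow> continuous_on UNIV g \<and> (\<forall>k. tmean (\<lambda>x. F' x * of_real (g x) * ee k (cvec x)) = 0)" for g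
  have Q1: "Q (\<lambda>x. 1)" using orth' by (simp add: Q_def)
  have Qs: "Q (\<lambda>x. g x * ((1 + cos (x $ j)) / 2))" if "Q g" for g j
  proof -
    have g: "continuous_on UNIV g" and o: "\<And>k. tmean (\<lambda>x. F' x * of_real (g x) * ee k (cvec x)) = 0"
      using that by (auto simp: Q_def)
    have c: "continuous_on UNIV (\<lambda>x. F' x * of_real (g x) * ee k (cvec x))" for k
      by (intro continuous_intros F' g continuous_on_ee_real)
    have cosj: "complex_of_real (cos (x $ j)) = (ee (axis j 1) (cvec x) + ee (- axis j 1) (cvec x)) / 2" for x
    proof -
      have "(\<Sum>i\<in>UNIV. of_int (axis j 1 $ i) * cvec x $ i) = complex_of_real (x $ j)"
        by (simp add: axis_def if_distrib if_distribR cong: if_cong)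
      moreover have "(\<Sum>i\<in>UNIV. of_int ((- axis j 1) $ i) * cvec x $ i) = - complex_of_real (x $ j)"
        using calculation by (simp add: sum_negf)
      ultimately show ?thesis
        by (simp add: ee_def cos_of_real[symmetric] cos_exp_eq)
    qed
    have "tmean (\<lambda>x. F' x * of_real (g x * ((1 + cos (x $ j)) / 2)) * ee k (cvec x)) = 0" for k
    proof -
      define V where "V l x = F' x * of_real (g x) * ee l (cvec x)" for l x
      have cV: "continuous_on UNIV (V l)" for l unfolding V_def by (rule c)
      have oV: "tmean (V l) = 0" for l unfolding V_def by (rule o)
      have "F' x * of_real (g x * ((1 + cos (x $ j)) / 2)) * ee k (cvec x)
        = (1/2) * V k x + (1/4) * V (k + axis j 1) x + (1/4) * V (k - axis j 1) x" for x
        unfolding V_def diff_conv_add_uminus ee_add_index of_real_mult of_real_divide of_real_add cosj by (simp add: field_simps)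
      then have "tmean (\<lambda>x. F' x * of_real (g x * ((1 + cos (x $ j)) / 2)) * ee k (cvec x))
        = tmean (\<lambda>x. (1/2) * V k x + (1/4) * V (k + axis j 1) x + (1/4) * V (k - axis j 1) x)"
        by (simp only:)
      also have "\<dots> = (1/2) * tmean (V k) + (1/4) * tmean (V (k + axis j 1)) + (1/4) * tmean (V (k - axis j 1))"
        unfolding tmean_cmult[symmetric]
        by (subst tmean_add, (intro continuous_on_add continuous_on_mult_left cV)+)+ (rule refl)
      finally show ?thesis by (simp add: oV)
    qed
    moreover have "continuous_on UNIV (\<lambda>x. g x * ((1 + cos (x $ j)) / 2))" by (intro continuous_intros g) auto
    ultimately show ?thesis by (simp add: Q_def)
  qed
  have Qp: "Q (\<lambda>x. g x * (\<Prod>i\<in>I. (1 + cos (x $ i)) / 2))" if "Q g" for g I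
    using finite[of I]
  proof (induction I rule: finite_induct)
    case (insert i I)
    have "Q (\<lambda>x. (g x * (\<Prod>i\<in>I. (1 + cos (x $ i)) / 2)) * ((1 + cos (x $ i)) / 2))"
      by (rule Qs[OF insert.IH])
    then show ?case using insert.hyps by (simp add: ac_simps)
  qed (use that in simp)
  have QT: "Q (\<lambda>x. T x ^ N)" for N
  proof (induction N)
    case (Suc N)
    from Qp[OF this, of UNIV] show ?case by (simp add: T_def mult.commute)
  qed (use Q1 in simp)
  have int0: "integral torus_box (\<lambda>x. F' x * of_real (T x ^ N)) = 0" for N
  proof -
    have "tmean (\<lambda>x. F' x * of_real (T x ^ N) * ee 0 (cvec x)) = 0" using QT[of N] unfolding Q_def by blast
    moreover have "measure lborel (torus_box :: (real ^ 'n) set) \<noteq> 0" by (simp add: content_torus_box)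
    ultimately show ?thesis by (simp add: tmean_def)
  qed
  obtain B where B: "\<And>x. x \<in> torus_box \<Longrightarrow> cmod (F' x) \<le> B" "B \<ge> 0"
  proof -
    have "compact (F' ` torus_box)" unfolding torus_box_def
      by (rule compact_continuous_image) (auto intro: continuous_on_subset[OF F'])
    then obtain B where "\<forall>x\<in>F' ` torus_box. cmod x \<le> B" by (meson bounded_iff compact_imp_bounded)
    then show thesis using that[of "max B 0"] by (simp add: le_max_iff_disj)
  qed
  have "isCont F' 0" using F' by (simp add: continuous_on_eq_continuous_at)
  then obtain d0 where d0: "d0 > 0" "\<And>x. dist x 0 < d0 \<Longrightarrow> dist (F' x) (F' 0) < 1 / 2"
    unfolding continuous_at_eps_delta by (metis half_gt_zero_iff zero_less_one)
  define d where "d = min 1 (d0 / (2 * real CARD('n)))"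
  have d: "0 < d" "d \<le> 1" using d0 by (auto simp: d_def)
  have near: "Re (F' x) \<ge> 1 / 2" if "\<And>i. \<bar>x $ i\<bar> \<le> d" for x
  proof -
    have "norm x \<le> (\<Sum>i\<in>UNIV. \<bar>x $ i\<bar>)" by (rule norm_le_l1_cart)
    also have "\<dots> \<le> real CARD('n) * d" using that by (intro sum_bounded_above) auto
    also have "\<dots> \<le> real CARD('n) * (d0 / (2 * real CARD('n)))" by (intro mult_left_mono) (auto simp: d_def)
    also have "\<dots> < d0" using d0 by simp
    finally have "dist (F' x) (F' 0) < 1 / 2" using d0 by simp
    moreover have "F' 0 = 1" using F0 by (simp add: F'_def)
    ultimately show ?thesis using abs_Re_le_cmod[of "F' x - 1"] by (simp add: dist_norm)
  qed
  define q where "q = (1 + cos d) / 2"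
  have cosd: "cos d < 1" using cos_monotone_0_pi[of 0 d] d pi_gt3 by simp
  have "cos d > 0" using d pi_gt3 by (intro cos_gt_zero) auto
  then have q: "0 < q" "q < 1" using cosd by (auto simp: q_def)
  have Tge: "0 \<le> T x" for x
    unfolding T_def by (intro prod_nonneg) (use cos_ge_minus_one in \<open>auto simp: add_increasing\<close>, smt (verit) cos_ge_minus_one)
  have Tfar: "T x \<le> q" if x: "x \<in> torus_box" and "\<bar>x $ i\<bar> \<ge> d" for x i
  proof -
    have "\<bar>x $ i\<bar> \<le> pi" using x by (auto simp: torus_box_def mem_box_cart abs_le_iff minus_le_iff)
    then have "cos (x $ i) \<le> cos d"
      using cos_monotone_0_pi_le[of d "\<bar>x $ i\<bar>"] that d by simp
    then have a: "(1 + cos (x $ i)) / 2 \<le> q" by (simp add: q_def)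
    have le1: "0 \<le> (1 + cos (x $ i)) / 2 \<and> (1 + cos (x $ i)) / 2 \<le> 1" for i
      using cos_ge_minus_one[of "x $ i"] cos_le_one[of "x $ i"] by (simp; linarith)
    have "T x = (1 + cos (x $ i)) / 2 * (\<Prod>i\<in>UNIV - {i}. (1 + cos (x $ i)) / 2)"
      unfolding T_def by (rule prod.remove) auto
    also have "\<dots> \<le> q * 1"
      using le1 a q by (intro mult_mono prod_le_1) (auto intro!: prod_nonneg)
    finally show ?thesis by simp
  qed
  \<comment> \<open>A level strictly between the bound q of the kernel away from 0 and its value 1
    at 0. On a small cube about 0 the kernel is at least q', and (q / q') ^ N tends to 0 while the
    volume of that cube stays fixed.\<close>
  define q' where "q' = (1 + q) / 2"
  have q': "q < q'" "q' < 1" using q by (auto simp: q'_def)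
  have "isCont T 0" using contT[of UNIV] by (simp add: continuous_on_eq_continuous_at)
  moreover have "T 0 = 1" by (simp add: T_def)
  ultimately have "\<exists>d1>0. \<forall>x. dist x 0 < d1 \<longrightarrow> dist (T x) 1 < 1 - q'"
    using q' unfolding continuous_at_eps_delta by (metis diff_gt_0_iff_gt)
  then obtain d1 where d1: "d1 > 0" "\<And>x. dist x 0 < d1 \<Longrightarrow> dist (T x) 1 < 1 - q'" by blast
  define d' where "d' = min d (d1 / (2 * real CARD('n)))"
  have d': "0 < d'" "d' \<le> d" using d d1 by (auto simp: d'_def)
  have Tnear: "T x \<ge> q'" if "\<And>i. \<bar>x $ i\<bar> \<le> d'" for x
  proof -
    have "norm x \<le> (\<Sum>i\<in>UNIV. \<bar>x $ i\<bar>)" by (rule norm_le_l1_cart)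
    also have "\<dots> \<le> real CARD('n) * d'" using that by (intro sum_bounded_above) auto
    also have "\<dots> \<le> real CARD('n) * (d1 / (2 * real CARD('n)))" by (intro mult_left_mono) (auto simp: d'_def)
    also have "\<dots> < d1" using d1 by simp
    finally have "dist (T x) 1 < 1 - q'" using d1 by simp
    then show ?thesis by (simp add: dist_real_def)
  qed
  define sb :: "(real ^ 'n) set" where "sb = cbox (\<chi> i. - d') (\<chi> i. d')"
  have sb_sub: "sb \<subseteq> torus_box" using d' d pi_gt3 unfolding sb_def torus_box_def
    by (auto simp: mem_box_cart) (smt (verit))+
  have "(0 :: real ^ 'n) \<in> cbox (\<chi> i. - d') (\<chi> i. d')" using d' by (simp add: mem_box_cart)
  then have "cbox (\<chi> i. - d') (\<chi> i. d' :: real ^ 'n) \<noteq> {}" by blast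
  then have vol: "measure lborel sb = (2 * d') ^ CARD('n)"
    unfolding sb_def by (subst content_cbox_cart) auto
  have main: "1 / 2 * q' ^ N * (2 * d') ^ CARD('n) \<le> B * q ^ N * (2 * pi) ^ CARD('n)" for N
  proof -
    \<comment> \<open>Adding B q ^ N makes the integrand nonnegative on the whole box, so its
      integral dominates the one over the small cube. The term with F' integrates to 0 by
      orthogonality; only the integral of the small constant is left on the other side.\<close>
    define G where "G x = Re (F' x) * T x ^ N + B * q ^ N" for x
    have cG: "continuous_on S G" for S
      unfolding G_def by (intro continuous_intros continuous_on_subset[OF F'] contT) auto
    have iG: "G integrable_on torus_box" "G integrable_on sb"
      unfolding torus_box_def sb_def by (intro integrable_continuous cG)+
    have G0: "0 \<le> G x" if x: "x \<in> torus_box" for x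
    proof (cases "\<exists>i. \<bar>x $ i\<bar> \<ge> d")
      case True
      then have "T x ^ N \<le> q ^ N" using Tfar[OF x] Tge by (intro power_mono) auto
      moreover have "\<bar>Re (F' x)\<bar> \<le> B" using B(1)[OF x] abs_Re_le_cmod order_trans by blast
      ultimately have "\<bar>Re (F' x) * T x ^ N\<bar> \<le> B * q ^ N"
        unfolding abs_mult using Tge B by (intro mult_mono) auto
      then show ?thesis by (simp add: G_def)
    next
      case False
      then have "Re (F' x) \<ge> 1 / 2" using near[of x] by (meson less_imp_le not_le)
      then show ?thesis using Tge[of x] B q by (simp add: G_def)
    qed
    have G1: "1 / 2 * q' ^ N \<le> G x" if "x \<in> sb" for x
    proof -
      have xi: "\<bar>x $ i\<bar> \<le> d'" for i using that by (auto simp: sb_def mem_box_cart abs_le_iff minus_le_iff)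
      then have "Re (F' x) \<ge> 1 / 2" using near[of x] d' by (meson order_trans)
      moreover have "T x ^ N \<ge> q' ^ N" using Tnear[of x] xi q q' by (intro power_mono) auto
      ultimately have "1 / 2 * q' ^ N \<le> Re (F' x) * T x ^ N" using q q' by (intro mult_mono) auto
      moreover have "0 \<le> B * q ^ N" using B q by simp
      ultimately show ?thesis unfolding G_def by linarith
    qed
    have "1 / 2 * q' ^ N * (2 * d') ^ CARD('n) = integral sb (\<lambda>x. 1 / 2 * q' ^ N)"
      using vol unfolding sb_def by (simp add: integral_const mult.commute)
    also have "\<dots> \<le> integral sb G"
      by (rule integral_le) (use iG G1 in \<open>auto simp: sb_def\<close>)
    also have "\<dots> \<le> integral torus_box G"
      by (rule integral_subset_le[OF sb_sub iG(2,1)]) (use G0 in auto)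
    also have "\<dots> = integral torus_box (\<lambda>x. Re (F' x * of_real (T x ^ N))) + integral (torus_box :: (real ^ 'n) set) (\<lambda>x. B * q ^ N)"
    proof -
      have "(\<lambda>x. Re (F' x) * T x ^ N) integrable_on torus_box"
        unfolding torus_box_def by (intro integrable_continuous continuous_intros continuous_on_subset[OF F'] contT) auto
      moreover have "(\<lambda>x. B * q ^ N) integrable_on (torus_box :: (real ^ 'n) set)"
        unfolding torus_box_def by (rule integrable_const)
      ultimately show ?thesis unfolding G_def by (simp add: integral_add)
    qed
    also have "integral torus_box (\<lambda>x. Re (F' x * of_real (T x ^ N))) = Re (integral torus_box (\<lambda>x. F' x * of_real (T x ^ N)))"
    proof -
      have "(\<lambda>x. F' x * of_real (T x ^ N)) integrable_on torus_box"
        by (intro integrable_torus_box continuous_intros F' contT)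
      from integral_linear[OF this bounded_linear_Re] show ?thesis by (simp add: o_def)
    qed
    also have "\<dots> = 0" by (simp only: int0) simp
    also have "0 + integral (torus_box :: (real ^ 'n) set) (\<lambda>x. B * q ^ N) = B * q ^ N * (2 * pi) ^ CARD('n)"
      using content_torus_box[where 'n = 'n] unfolding torus_box_def by (simp add: integral_const mult.commute)
    finally show ?thesis .
  qed
  define A where "A = (2 * d') ^ CARD('n)"
  have A: "A > 0" using d' by (simp add: A_def)
  have lim: "(\<lambda>N. B * (q / q') ^ N * (2 * pi) ^ CARD('n)) \<longlonglongrightarrow> B * 0 * (2 * pi) ^ CARD('n)"
    using q q' by (intro tendsto_intros LIMSEQ_realpow_zero) auto
  have le: "1 / 2 * A \<le> B * (q / q') ^ N * (2 * pi) ^ CARD('n)" for N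
    using main[of N] q q' by (simp add: A_def power_divide field_simps)
  have "1 / 2 * A \<le> B * 0 * (2 * pi) ^ CARD('n)"
    by (rule LIMSEQ_le_const[OF lim]) (use le in blast)
  then show False using A by simp
qed


section \<open>Exponential sums over the integer lattice\<close>

lemma geometric_int_sum:
  assumes x: "(0::real) < x" "x \<le> 1" and F: "finite F"
  shows "(\<Sum>m\<in>F. exp (- x * \<bar>of_int m\<bar>)) \<le> 4 / x"
proof -
  define q where "q = exp (- x)"
  have q: "0 < q" "q < 1" using x by (auto simp: q_def)
  \<comment> \<open>From exp x \<ge> 1 + x one gets 1 - q \<ge> q x, which suffices if q \<ge> 1/2.
    Otherwise 1 - q > 1/2 \<ge> x/2, because x \<le> 1.\<close>
  have q1: "1 - q \<ge> x / 2"
  proof -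
    have "exp (- x) * (1 + x) \<le> exp (- x) * exp x" by (intro mult_left_mono exp_ge_add_one_self) simp
    then have "q * (1 + x) \<le> 1" by (simp add: q_def exp_add[symmetric])
    then have "1 - q \<ge> q * x" by (simp add: algebra_simps)
    moreover have "q * x \<ge> 0" using q x by simp
    ultimately show ?thesis using x
    proof (cases "q \<ge> 1 / 2")
      case True
      then have "q * x \<ge> 1 / 2 * x" using x by (intro mult_right_mono) auto
      then show ?thesis using \<open>1 - q \<ge> q * x\<close> by simp
    qed auto
  qed
  have fin: "\<exists>N. F \<subseteq> int ` {..<N} \<union> (\<lambda>m. - int m) ` {..<N}"
  proof -
    define N where "N = Suc (nat (Max (insert 0 (abs ` F))))"
    have "m \<in> int ` {..<N} \<union> (\<lambda>m. - int m) ` {..<N}" if "m \<in> F" for m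
    proof -
      have "\<bar>m\<bar> \<le> Max (insert 0 (abs ` F))" using F that by simp
      then have "nat \<bar>m\<bar> < N" unfolding N_def less_Suc_eq_le by (rule nat_mono)
      then show ?thesis by (cases "m \<ge> 0") (auto intro: rev_image_eqI[of "nat \<bar>m\<bar>"])
    qed
    then show ?thesis by blast
  qed
  then obtain N where N: "F \<subseteq> int ` {..<N} \<union> (\<lambda>m. - int m) ` {..<N}" by blast
  let ?w = "\<lambda>m. exp (- x * \<bar>of_int m\<bar>)"
  have "sum ?w F \<le> sum ?w (int ` {..<N} \<union> (\<lambda>m. - int m) ` {..<N})"
    by (rule sum_mono2) (use N in auto)
  also have "\<dots> \<le> sum ?w (int ` {..<N}) + sum ?w ((\<lambda>m. - int m) ` {..<N})"
    by (subst sum.union_inter[symmetric]) (auto intro!: add_increasing2 sum_nonneg)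
  also have "\<dots> = 2 * (\<Sum>m<N. q ^ m)"
    by (subst (1 2) sum.reindex) (auto simp: inj_on_def q_def exp_of_nat_mult[symmetric] mult.commute sum.distrib[symmetric] sum_distrib_left)
  also have "(\<Sum>m<N. q ^ m) \<le> 1 / (1 - q)"
    using q by (simp add: sum_gp_strict divide_right_mono)
  also have "1 / (1 - q) \<le> 1 / (x / 2)" using q1 x by (intro divide_left_mono) auto
  finally show ?thesis by (simp add: field_simps)
qed

lemma exp_l1norm: "exp (- x * l1norm k) = (\<Prod>i\<in>UNIV. exp (- x * \<bar>of_int (k $ i)\<bar>))"
  by (simp add: l1norm_def sum_distrib_left sum_negf[symmetric] exp_sum[symmetric])

text \<open>The exponential of the l1 norm is a product over coordinates. Enclosing the finite set
  in a box turns the sum into a product of one-dimensional sums, each at most 4/x.\<close>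

lemma sum_exp_l1norm:
  fixes A :: "(int ^ 'n::finite) set"
  assumes x: "(0::real) < x" "x \<le> 1" and A: "finite A"
  shows "(\<Sum>k\<in>A. exp (- x * l1norm k)) \<le> (4 / x) ^ CARD('n)"
proof -
  define B where "B = (\<Union>k\<in>A. range (\<lambda>i. k $ i))"
  have B: "finite B" unfolding B_def using A by auto
  have "(\<Sum>k\<in>A. exp (- x * l1norm k)) = (\<Sum>k\<in>A. \<Prod>i\<in>UNIV. exp (- x * \<bar>of_int (k $ i)\<bar>))"
    by (simp only: exp_l1norm)
  also have "\<dots> = (\<Sum>g\<in>vec_nth ` A. \<Prod>i\<in>UNIV. exp (- x * \<bar>of_int (g i)\<bar>))"
    by (subst sum.reindex) (auto simp: inj_on_def vec_nth_inject)
  also have "\<dots> \<le> (\<Sum>g\<in>PiE (UNIV :: 'n set) (\<lambda>_. B). \<Prod>i\<in>UNIV. exp (- x * \<bar>of_int (g i)\<bar>))"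
    by (rule sum_mono2) (use B in \<open>auto simp: B_def intro!: finite_PiE prod_nonneg\<close>)
  also have "\<dots> = (\<Prod>i\<in>(UNIV::'n set). \<Sum>m\<in>B. exp (- x * \<bar>of_int m\<bar>))"
    by (rule prod_sum_PiE[symmetric]) (use B in auto)
  also have "\<dots> = (\<Sum>m\<in>B. exp (- x * \<bar>of_int m\<bar>)) ^ CARD('n)" by simp
  also have "\<dots> \<le> (4 / x) ^ CARD('n)"
    by (intro power_mono geometric_int_sum x B sum_nonneg) auto
  finally show ?thesis .
qed

lemma nonneg_sums_bound:
  fixes f :: "'a \<Rightarrow> real"
  assumes "\<And>x. f x \<ge> 0" "\<And>A. finite A \<Longrightarrow> sum f A \<le> C"
  shows "f summable_on UNIV" "infsum f UNIV \<le> C"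
proof -
  show s: "f summable_on UNIV"
    by (rule nonneg_bdd_above_summable_on) (use assms in \<open>auto simp: bdd_above_def\<close>)
  have "infsum f UNIV \<le> C"
    by (rule infsum_le_finite_sums[OF s]) (use assms in auto)
  then show "infsum f UNIV \<le> C" .
qed

lemma power_le_fact_exp: "0 \<le> (x::real) \<Longrightarrow> x ^ N \<le> fact N * exp x"
proof -
  assume x: "0 \<le> x"
  have "(\<Sum>n\<in>{N}. x ^ n / fact n) \<le> (\<Sum>n. x ^ n / fact n)"
    by (rule sum_le_suminf) (use x summable_exp[of x] in \<open>auto simp: field_simps\<close>)
  also have "\<dots> = exp x" by (simp add: exp_def scaleR_conv_of_real field_simps)
  finally show ?thesis by (simp add: field_simps)
qed

lemma l1norm_nonneg: "0 \<le> l1norm k" by (simp add: l1norm_def sum_nonneg)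

lemma l1norm_ge_1: "k \<noteq> 0 \<Longrightarrow> 1 \<le> l1norm k"
proof -
  assume "k \<noteq> 0"
  then obtain i where "k $ i \<noteq> 0" by (auto simp: vec_eq_iff)
  then have "1 \<le> \<bar>of_int (k $ i) :: real\<bar>" by linarith
  also have "\<dots> \<le> l1norm k" unfolding l1norm_def by (rule member_le_sum) auto
  finally show ?thesis .
qed

text \<open>The cost of one Fourier mode: |k|^\<tau> / \<gamma> for the divisor, against the decay
  gained by giving up the width \<delta>. At k = 0 the value is 0, because
  \<open>0 powr \<tau>\<close> is 0.\<close>

definition sd_weight :: "real \<Rightarrow> real \<Rightarrow> real \<Rightarrow> int ^ 'n::finite \<Rightarrow> real" where
  "sd_weight \<gamma> \<tau> \<delta> k = l1norm k powr \<tau> / \<gamma> * exp (- \<delta> * l1norm k)"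

definition sd_const :: "'n itself \<Rightarrow> real \<Rightarrow> real \<Rightarrow> real" where
  "sd_const n \<gamma> \<tau> = fact (nat \<lceil>\<tau>\<rceil>) / \<gamma> * 8 ^ (nat \<lceil>\<tau>\<rceil> + CARD('n))"

text \<open>Half of the exponential absorbs the power of |k|, with \<tau> rounded up to a natural
  number N; the other half is summed over the lattice with x = \<delta>/2. The resulting 2^N and 8^n
  are merged into the base 8 of \<open>sd_const\<close>.\<close>

lemma sd_weight_sum:
  fixes \<gamma> \<tau> \<delta> :: real
  assumes \<gamma>: "\<gamma> > 0" and \<tau>: "\<tau> \<ge> 0" and \<delta>: "0 < \<delta>" "\<delta> \<le> 1"
  shows "sd_weight \<gamma> \<tau> \<delta> summable_on (UNIV :: (int ^ 'n::finite) set)"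
    and "infsum (sd_weight \<gamma> \<tau> \<delta>) (UNIV :: (int ^ 'n) set) \<le> sd_const TYPE('n) \<gamma> \<tau> * (1 / \<delta>) ^ (nat \<lceil>\<tau>\<rceil> + CARD('n))"
proof -
  define N where "N = nat \<lceil>\<tau>\<rceil>"
  have N: "\<tau> \<le> real N" using \<tau> unfolding N_def by linarith
  have w: "sd_weight \<gamma> \<tau> \<delta> k \<le> fact N / \<gamma> * (2 / \<delta>) ^ N * exp (- (\<delta> / 2) * l1norm k)" for k :: "int ^ 'n"
  proof (cases "k = 0")
    case True
    then show ?thesis using \<gamma> \<delta> by (simp add: sd_weight_def l1norm_def)
  next
    case False
    define y where "y = l1norm k"
    have y: "y \<ge> 1" using l1norm_ge_1[OF False] by (simp add: y_def)
    have "y powr \<tau> \<le> y ^ N" using y N by (simp add: powr_realpow[symmetric] powr_mono)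
    also have "y ^ N = (2 / \<delta>) ^ N * (\<delta> / 2 * y) ^ N" using \<delta> by (simp add: power_mult_distrib[symmetric])
    also have "\<dots> \<le> (2 / \<delta>) ^ N * (fact N * exp (\<delta> / 2 * y))"
      using \<delta> y by (intro mult_left_mono power_le_fact_exp) auto
    finally have "y powr \<tau> / \<gamma> * exp (- \<delta> * y) \<le> (2 / \<delta>) ^ N * (fact N * exp (\<delta> / 2 * y)) / \<gamma> * exp (- \<delta> * y)"
      using \<gamma> by (intro mult_right_mono divide_right_mono) auto
    also have "\<dots> = fact N / \<gamma> * (2 / \<delta>) ^ N * (exp (\<delta> / 2 * y) * exp (- \<delta> * y))" by simp
    also have "exp (\<delta> / 2 * y) * exp (- \<delta> * y) = exp (- (\<delta> / 2) * y)"
      by (simp add: exp_add[symmetric] algebra_simps)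
    finally show ?thesis by (simp add: sd_weight_def y_def)
  qed
  have s: "sum (sd_weight \<gamma> \<tau> \<delta>) A \<le> sd_const TYPE('n) \<gamma> \<tau> * (1 / \<delta>) ^ (nat \<lceil>\<tau>\<rceil> + CARD('n))"
    if A: "finite A" for A :: "(int ^ 'n) set"
  proof -
    have "sum (sd_weight \<gamma> \<tau> \<delta>) A \<le> (\<Sum>k\<in>A. fact N / \<gamma> * (2 / \<delta>) ^ N * exp (- (\<delta> / 2) * l1norm k))"
      by (rule sum_mono) (rule w)
    also have "\<dots> = fact N / \<gamma> * (2 / \<delta>) ^ N * (\<Sum>k\<in>A. exp (- (\<delta> / 2) * l1norm k))"
      by (simp only: sum_distrib_left)
    also have "\<dots> \<le> fact N / \<gamma> * (2 / \<delta>) ^ N * (4 / (\<delta> / 2)) ^ CARD('n)"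
      using \<gamma> \<delta> A by (intro mult_left_mono sum_exp_l1norm) auto
    also have "\<dots> = fact N / \<gamma> * (1 / \<delta>) ^ (N + CARD('n)) * (2 ^ N * 8 ^ CARD('n))"
      by (simp add: power_add power_divide field_simps)
    also have "\<dots> \<le> fact N / \<gamma> * (1 / \<delta>) ^ (N + CARD('n)) * (8 ^ N * 8 ^ CARD('n))"
      using \<gamma> \<delta> by (intro mult_left_mono mult_right_mono power_mono) auto
    finally show ?thesis by (simp add: sd_const_def N_def power_add field_simps)
  qed
  have nn: "sd_weight \<gamma> \<tau> \<delta> k \<ge> 0" for k :: "int ^ 'n" using \<gamma> by (simp add: sd_weight_def)
  show "sd_weight \<gamma> \<tau> \<delta> summable_on (UNIV :: (int ^ 'n::finite) set)"
    and "infsum (sd_weight \<gamma> \<tau> \<delta>) (UNIV :: (int ^ 'n) set) \<le> sd_const TYPE('n) \<gamma> \<tau> * (1 / \<delta>) ^ (nat \<lceil>\<tau>\<rceil> + CARD('n))"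
    using nonneg_sums_bound[OF nn s] by blast+
qed

lemma summable_exp_l1norm:
  assumes "0 < (\<rho>::real)"
  shows "(\<lambda>k :: int ^ 'n::finite. exp (- \<rho> * l1norm k)) summable_on UNIV"
proof -
  have "sum (\<lambda>k :: int ^ 'n. exp (- \<rho> * l1norm k)) A \<le> (4 / min \<rho> 1) ^ CARD('n)" if "finite A" for A
  proof -
    have "sum (\<lambda>k :: int ^ 'n. exp (- \<rho> * l1norm k)) A \<le> sum (\<lambda>k. exp (- min \<rho> 1 * l1norm k)) A"
      by (intro sum_mono) (simp add: mult_right_mono l1norm_nonneg)
    also have "\<dots> \<le> (4 / min \<rho> 1) ^ CARD('n)" by (rule sum_exp_l1norm) (use assms that in auto)
    finally show ?thesis .
  qed
  then show ?thesis by (intro nonneg_sums_bound(1)) auto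
qed

text \<open>The decay of the coefficients makes the series converge uniformly, so it may be averaged
  term by term and its sum has the same coefficients as f. The difference is orthogonal to all
  characters and vanishes at 0.\<close>

lemma fourier_at_0:
  fixes f :: "complex ^ 'n::finite \<Rightarrow> complex"
  assumes f: "holo f (strip r)" "per f r" and r: "r > 0"
  shows "(coef f has_sum f 0) UNIV"
proof -
  have r2: "holo f (strip (r / 2))" "per f (r / 2)"
    using holo_subset[OF f(1) strip_mono[of "r / 2" r]] f(2) r strip_mono[of "r / 2" r] by (auto simp: per_def)
  obtain C where C: "\<And>\<theta>. \<theta> \<in> strip (r / 2) \<Longrightarrow> cmod (f \<theta>) \<le> C"
    using bounded_on_strip[OF holo_continuous_on[OF f(1)] f(2), of "r / 2"] r by auto
  define M where "M k = C * exp (- (r / 2) * l1norm k)" for k :: "int ^ 'n"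
  have cM: "cmod (coef f k) \<le> M k" for k
    unfolding M_def using coef_bound[OF r2 C] r by auto
  have sM: "M summable_on UNIV"
    unfolding M_def by (intro summable_on_cmult_right summable_exp_l1norm) (use r in auto)
  define S where "S x = (\<Sum>\<^sub>\<infinity>k. coef f k * ee k (cvec x))" for x
  define SA where "SA A x = (\<Sum>k\<in>A. coef f k * ee k (cvec x))" for A x
  have ul: "uniform_limit UNIV SA S (finite_subsets_at_top UNIV)"
    unfolding S_def SA_def
    by (rule Weierstrass_m_test_general[OF _ sM]) (use cM in \<open>simp add: norm_mult cmod_ee_real\<close>)
  have cSA: "continuous_on UNIV (SA A)" for A
    unfolding SA_def by (intro continuous_intros continuous_on_ee_real)
  have cS: "continuous_on UNIV S"
    by (rule uniform_limit_theorem[OF _ ul]) (auto simp: cSA)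
  have cf: "continuous_on UNIV (\<lambda>x. f (cvec x))"
    by (rule continuous_on_strip_real[OF holo_continuous_on[OF f(1)] r])
  have tS: "tmean (\<lambda>x. S x * ee l (cvec x)) = coef f (- l)" for l
  proof -
    have "uniform_limit UNIV (\<lambda>A x. SA A x * ee l (cvec x)) (\<lambda>x. S x * ee l (cvec x)) (finite_subsets_at_top UNIV)"
      using ul unfolding uniform_limit_iff by (simp add: dist_norm left_diff_distrib[symmetric] norm_mult cmod_ee_real)
    then have "((\<lambda>A. tmean (\<lambda>x. SA A x * ee l (cvec x))) \<longlongrightarrow> tmean (\<lambda>x. S x * ee l (cvec x))) (finite_subsets_at_top UNIV)"
      by (rule tmean_uniform_limit) (intro continuous_intros cSA cS continuous_on_ee_real)+
    moreover have "((\<lambda>A. tmean (\<lambda>x. SA A x * ee l (cvec x))) \<longlongrightarrow> coef f (- l)) (finite_subsets_at_top UNIV)"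
    proof (rule tendsto_eventually)
      show "\<forall>\<^sub>F A in finite_subsets_at_top UNIV. tmean (\<lambda>x. SA A x * ee l (cvec x)) = coef f (- l)"
        unfolding eventually_finite_subsets_at_top
      proof (intro exI[of _ "{- l}"] conjI allI impI)
        fix A :: "(int ^ 'n) set" assume A: "finite A \<and> {- l} \<subseteq> A \<and> A \<subseteq> UNIV"
        have "tmean (\<lambda>x. SA A x * ee l (cvec x)) = tmean (\<lambda>x. \<Sum>k\<in>A. coef f k * ee (k + l) (cvec x))"
          by (simp add: SA_def sum_distrib_right ee_add_index mult.assoc)
        also have "\<dots> = (\<Sum>k\<in>A. coef f k * tmean (\<lambda>x. ee (k + l) (cvec x)))"
          by (subst tmean_sum) (simp_all add: tmean_cmult continuous_on_mult_left continuous_on_ee_real)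
        also have "\<dots> = (\<Sum>k\<in>A. if k = - l then coef f k else 0)"
          by (intro sum.cong) (auto simp: cmean_ee[unfolded cmean_def] eq_neg_iff_add_eq_0)
        also have "\<dots> = coef f (- l)" using A by simp
        finally show "tmean (\<lambda>x. SA A x * ee l (cvec x)) = coef f (- l)" .
      qed auto
    qed
    ultimately show ?thesis by (rule tendsto_unique[OF finite_subsets_at_top_neq_bot])
  qed
  have "(\<lambda>x. f (cvec x) - S x) 0 = 0"
  proof (rule fourier_uniqueness_at_0)
    show "continuous_on UNIV (\<lambda>x. f (cvec x) - S x)" by (intro continuous_intros cf cS)
    fix k
    have "tmean (\<lambda>x. (f (cvec x) - S x) * ee k (cvec x)) = tmean (\<lambda>x. f (cvec x) * ee k (cvec x)) - tmean (\<lambda>x. S x * ee k (cvec x))"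
      unfolding left_diff_distrib by (intro tmean_diff continuous_intros cf cS continuous_on_ee_real)
    also have "tmean (\<lambda>x. f (cvec x) * ee k (cvec x)) = coef f (- k)"
      by (simp add: coef_def cmean_def)
    finally show "tmean (\<lambda>x. (f (cvec x) - S x) * ee k (cvec x)) = 0" by (simp add: tS)
  qed
  moreover have "cvec (0 :: real ^ 'n) = 0" by (simp add: vec_eq_iff)
  ultimately have "infsum (coef f) UNIV = f 0" by (simp add: S_def)
  moreover have "coef f summable_on UNIV"
  proof (rule abs_summable_summable)
    show "(\<lambda>k. norm (coef f k)) summable_on UNIV"
      by (rule summable_on_comparison_test[OF sM]) (use cM in auto)
  qed
  ultimately show ?thesis by (metis has_sum_infsum)
qed

text \<open>Translating f by \<theta> brings the point to 0, and the coefficients of the translate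
  are those of f times \<open>ee k \<theta>\<close>. A complex \<theta> is allowed, at the price of
  a narrower strip for the translate.\<close>

theorem fourier_expansion:
  fixes f :: "complex ^ 'n::finite \<Rightarrow> complex"
  assumes f: "holo f (strip r)" "per f r" and \<theta>: "\<theta> \<in> strip r"
  shows "((\<lambda>k. coef f k * ee k \<theta>) has_sum f \<theta>) UNIV"
proof -
  define r2 where "r2 = r - Max (range (\<lambda>i. \<bar>Im (\<theta> $ i)\<bar>))"
  have "Max (range (\<lambda>i. \<bar>Im (\<theta> $ i)\<bar>)) < r"
    using \<theta> by (subst Max_less_iff) (auto simp: strip_def)
  then have r2: "r2 > 0" by (simp add: r2_def)
  have tr: "\<phi> + \<theta> \<in> strip r" if \<phi>: "\<phi> \<in> strip r2" for \<phi>
    unfolding strip_def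
  proof (intro CollectI allI)
    fix i
    have "\<bar>Im (\<theta> $ i)\<bar> \<le> r - r2" unfolding r2_def by (simp add: Max_ge)
    moreover have "\<bar>Im (\<phi> $ i)\<bar> < r2" using \<phi> by (simp add: strip_def)
    ultimately show "\<bar>Im ((\<phi> + \<theta>) $ i)\<bar> < r" by simp
  qed
  have "(coef (\<lambda>\<phi>. f (\<phi> + \<theta>)) has_sum f (0 + \<theta>)) UNIV"
    by (rule fourier_at_0[OF holo_translate[OF f(1) tr] per_translate[OF f(2) tr] r2])
  moreover have "coef (\<lambda>\<phi>. f (\<phi> + \<theta>)) = (\<lambda>k. coef f k * ee k \<theta>)"
    by (rule ext) (simp add: coef_translate[OF f \<theta>] mult.commute)
  ultimately show ?thesis by simp
qed


section \<open>Analytic families and small divisors\<close>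

text \<open>Families of real analytic functions on the torus, depending continuously on a parameter
  \<open>p \<in> \<Xi>\<close> and extended holomorphically in the angle to the strip of width \<open>r\<close>.\<close>

definition tfam :: "'p::metric_space set \<Rightarrow> real \<Rightarrow> ('p \<Rightarrow> complex ^ 'n::finite \<Rightarrow> complex) \<Rightarrow> bool" where
  "tfam \<Xi> r f \<longleftrightarrow> continuous_on (\<Xi> \<times> strip r) (\<lambda>(p, \<theta>). f p \<theta>) \<and>
     (\<forall>p\<in>\<Xi>. holo (f p) (strip r) \<and> per (f p) r \<and> (\<forall>x. f p (cvec x) \<in> \<real>))"

definition bnd :: "'p set \<Rightarrow> real \<Rightarrow> ('p \<Rightarrow> complex ^ 'n::finite \<Rightarrow> complex) \<Rightarrow> real \<Rightarrow> bool" where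
  "bnd \<Xi> r f C \<longleftrightarrow> (\<forall>p\<in>\<Xi>. \<forall>\<theta>\<in>strip r. cmod (f p \<theta>) \<le> C)"

lemma tfamD:
  assumes "tfam \<Xi> r f"
  shows tfam_continuous: "continuous_on (\<Xi> \<times> strip r) (\<lambda>(p, \<theta>). f p \<theta>)"
    and tfam_holo: "p \<in> \<Xi> \<Longrightarrow> holo (f p) (strip r)"
    and tfam_per: "p \<in> \<Xi> \<Longrightarrow> per (f p) r"
    and tfam_real: "p \<in> \<Xi> \<Longrightarrow> f p (cvec x) \<in> \<real>"
  using assms by (auto simp: tfam_def)

lemma tfam_subset:
  assumes "tfam \<Xi> r f" "r' \<le> r"
  shows "tfam \<Xi> r' f"
  using assms strip_mono[OF assms(2)] unfolding tfam_def per_def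
  by (auto intro: continuous_on_subset holo_subset)

lemma tfam_param: "continuous_on \<Xi> c \<Longrightarrow> (\<And>p. p \<in> \<Xi> \<Longrightarrow> c p \<in> \<real>) \<Longrightarrow> tfam \<Xi> r (\<lambda>p \<theta>. c p)"
  unfolding tfam_def per_def split_beta
  by (auto intro!: holo_const continuous_on_compose2[of \<Xi> c _ fst] continuous_intros)

lemma tfam_const: "c \<in> \<real> \<Longrightarrow> tfam \<Xi> r (\<lambda>p \<theta>. c)"
  by (rule tfam_param) auto

lemma
  assumes "tfam \<Xi> r f" "tfam \<Xi> r g"
  shows tfam_add: "tfam \<Xi> r (\<lambda>p \<theta>. f p \<theta> + g p \<theta>)"
    and tfam_diff: "tfam \<Xi> r (\<lambda>p \<theta>. f p \<theta> - g p \<theta>)"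
    and tfam_mult: "tfam \<Xi> r (\<lambda>p \<theta>. f p \<theta> * g p \<theta>)"
  using assms unfolding tfam_def per_def split_beta
  by (auto intro!: continuous_intros holo_add holo_diff holo_mult)

lemma tfam_sum: "(\<And>i. i \<in> I \<Longrightarrow> tfam \<Xi> r (f i)) \<Longrightarrow> tfam \<Xi> r (\<lambda>p \<theta>. \<Sum>i\<in>I. f i p \<theta>)"
  by (induction I rule: infinite_finite_induct) (auto intro: tfam_const tfam_add)

lemma tfam_prod: "(\<And>i. i \<in> I \<Longrightarrow> tfam \<Xi> r (f i)) \<Longrightarrow> tfam \<Xi> r (\<lambda>p \<theta>. \<Prod>i\<in>I. f i p \<theta>)"
  by (induction I rule: infinite_finite_induct) (auto intro: tfam_const tfam_mult)

lemma tfam_inverse: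
  assumes "tfam \<Xi> r f" "\<And>p \<theta>. p \<in> \<Xi> \<Longrightarrow> \<theta> \<in> strip r \<Longrightarrow> f p \<theta> \<noteq> 0"
  shows "tfam \<Xi> r (\<lambda>p \<theta>. inverse (f p \<theta>))"
proof -
  have "holo (\<lambda>\<theta>. inverse (f p \<theta>)) (strip r)" if "p \<in> \<Xi>" for p
    by (rule holo_compose1[where T = "- {0}"]) (use assms that tfam_holo in \<open>auto intro!: holomorphic_intros\<close>)
  then show ?thesis using assms unfolding tfam_def per_def split_beta
    by (auto intro!: continuous_intros)
qed

lemma tfam_uniform_limit:
  fixes f :: "'i \<Rightarrow> 'p::metric_space \<Rightarrow> complex ^ 'n::finite \<Rightarrow> complex"
  assumes f: "\<And>n. tfam \<Xi> r (f n)" and ul: "uniform_limit (\<Xi> \<times> strip r) (\<lambda>n (p, \<theta>). f n p \<theta>) (\<lambda>(p, \<theta>). g p \<theta>) N"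
    and N: "N \<noteq> bot" and r: "r > 0"
  shows "tfam \<Xi> r g"
    and "p \<in> \<Xi> \<Longrightarrow> \<theta> \<in> strip r \<Longrightarrow> ((\<lambda>n. ddir (f n p) \<theta> v) \<longlongrightarrow> ddir (g p) \<theta> v) N"
proof -
  have ulp: "uniform_limit (strip r) (\<lambda>n. f n p) (g p) N" if "p \<in> \<Xi>" for p
    unfolding uniform_limit_iff
  proof (intro allI impI)
    fix e :: real assume "e > 0"
    then have "\<forall>\<^sub>F n in N. \<forall>x\<in>\<Xi> \<times> strip r. dist (case x of (p, \<theta>) \<Rightarrow> f n p \<theta>) (case x of (p, \<theta>) \<Rightarrow> g p \<theta>) < e"
      using ul unfolding uniform_limit_iff by blast
    then show "\<forall>\<^sub>F n in N. \<forall>\<theta>\<in>strip r. dist (f n p \<theta>) (g p \<theta>) < e"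
      by eventually_elim (use that in auto)
  qed
  have lim: "((\<lambda>n. f n p \<theta>) \<longlongrightarrow> g p \<theta>) N" if "p \<in> \<Xi>" "\<theta> \<in> strip r" for p \<theta>
    using tendsto_uniform_limitI[OF ulp] that by blast
  have "continuous_on (\<Xi> \<times> strip r) (\<lambda>(p, \<theta>). g p \<theta>)"
    by (rule uniform_limit_theorem[OF _ ul N]) (use tfam_continuous[OF f] in \<open>auto simp: always_eventually\<close>)
  moreover have "holo (g p) (strip r)" if "p \<in> \<Xi>" for p
    by (rule holo_uniform_limit(1)[OF open_strip _ ulp[OF that] N]) (use tfam_holo[OF f that] in auto)
  moreover have "per (g p) r" if p: "p \<in> \<Xi>" for p
    unfolding per_def
  proof (intro ballI allI)
    fix \<theta> :: "complex ^ 'n" and k assume \<theta>: "\<theta> \<in> strip r"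
    have "(\<lambda>n. f n p (\<theta> + pvec k)) = (\<lambda>n. f n p \<theta>)"
      using tfam_per[OF f p] \<theta> by (auto simp: per_def)
    moreover have "((\<lambda>n. f n p (\<theta> + pvec k)) \<longlongrightarrow> g p (\<theta> + pvec k)) N" by (rule lim) (use p \<theta> in auto)
    ultimately show "g p (\<theta> + pvec k) = g p \<theta>" using lim[OF p \<theta>] tendsto_unique[OF N] by metis
  qed
  moreover have "g p (cvec x) \<in> \<real>" if p: "p \<in> \<Xi>" for p x
    by (rule Lim_in_closed_set[OF closed_complex_Reals _ N lim[OF p]]) (use tfam_real[OF f p] r in auto)
  ultimately show "tfam \<Xi> r g" unfolding tfam_def by blast
  show "p \<in> \<Xi> \<Longrightarrow> \<theta> \<in> strip r \<Longrightarrow> ((\<lambda>n. ddir (f n p) \<theta> v) \<longlongrightarrow> ddir (g p) \<theta> v) N"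
    by (rule holo_uniform_limit(2)[OF open_strip _ ulp N]) (use tfam_holo[OF f] in auto)
qed

lemma tfam_bounded:
  fixes f :: "'p::metric_space \<Rightarrow> complex ^ 'n::finite \<Rightarrow> complex"
  assumes \<Xi>: "compact \<Xi>" and f: "tfam \<Xi> r f" and r': "r' < r"
  obtains C where "bnd \<Xi> r' f C" "C \<ge> 0"
proof -
  obtain K :: "(complex ^ 'n) set" where K: "compact K" "K \<subseteq> strip r" "\<And>\<theta>. \<theta> \<in> strip r' \<Longrightarrow> \<exists>k. \<theta> + pvec k \<in> K"
    using strip_fundamental_domain[OF r'] by blast
  have "compact ((\<lambda>(p, \<theta>). f p \<theta>) ` (\<Xi> \<times> K))"
    by (rule compact_continuous_image[OF continuous_on_subset[OF tfam_continuous[OF f]]])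
       (use K \<Xi> in \<open>auto intro: compact_Times\<close>)
  then obtain C where C: "\<forall>x\<in>(\<lambda>(p, \<theta>). f p \<theta>) ` (\<Xi> \<times> K). cmod x \<le> C"
    by (meson bounded_iff compact_imp_bounded)
  have "cmod (f p \<theta>) \<le> max C 0" if p: "p \<in> \<Xi>" and \<theta>: "\<theta> \<in> strip r'" for p \<theta>
  proof -
    obtain k where k: "\<theta> + pvec k \<in> K" using K \<theta> by blast
    have "\<theta> \<in> strip r" using \<theta> strip_mono[of r' r] r' by auto
    then have "f p \<theta> = f p (\<theta> + pvec k)" using tfam_per[OF f p] by (simp add: per_def)
    moreover have "cmod (f p (\<theta> + pvec k)) \<le> C" using C k p by auto
    ultimately show ?thesis by simp
  qed
  then show thesis using that[of "max C 0"] by (simp add: bnd_def)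
qed

text \<open>The derivative is a limit of difference quotients with real increments, and the reals
  are closed.\<close>

lemma ddir_real:
  assumes U: "open U" "holo F U" "z \<in> U" and real: "\<And>t::real. z + of_real t *s v \<in> U \<Longrightarrow> F (z + of_real t *s v) \<in> \<real>"
  shows "ddir F z v \<in> \<real>"
proof -
  have D: "((\<lambda>t. F (z + t *s v)) has_field_derivative ddir F z v) (at 0)"
    using holo_line[OF U(2), of z 0 v] U(3) by simp
  define c where "c n = complex_of_real (inverse (real (Suc n)))" for n
  have c0: "c \<longlonglongrightarrow> 0"
    unfolding c_def using tendsto_of_real[OF LIMSEQ_inverse_real_of_nat, where 'a = complex]
    by (simp only: of_real_0)
  then have c: "filterlim c (at 0) sequentially"
    unfolding filterlim_at c_def by (auto simp del: of_real_inverse of_nat_Suc)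
  have lim: "(\<lambda>n. (F (z + (0 + c n) *s v) - F (z + 0 *s v)) / c n) \<longlonglongrightarrow> ddir F z v"
    using filterlim_compose[OF D[unfolded DERIV_def] c] .
  have "(\<lambda>n. z + c n *s v) \<longlonglongrightarrow> z + 0 *s v"
    by (intro tendsto_intros bounded_linear.tendsto[OF bounded_linear_csmult] c0)
  then have "\<forall>\<^sub>F n in sequentially. z + c n *s v \<in> U"
    using U(1,3) by (intro topological_tendstoD) auto
  then have "\<forall>\<^sub>F n in sequentially. (F (z + (0 + c n) *s v) - F (z + 0 *s v)) / c n \<in> \<real>"
  proof eventually_elim
    case (elim n)
    have "F (z + c n *s v) \<in> \<real>" using real[of "inverse (real (Suc n))"] elim by (simp add: c_def)
    moreover have "F z \<in> \<real>" using real[of 0] U(3) by simp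
    ultimately show ?case by (simp add: c_def)
  qed
  then show ?thesis
    by (rule Lim_in_closed_set[OF closed_complex_Reals _ sequentially_bot lim])
qed

text \<open>The point is joint continuity of the derivative in p and \<theta>. On a narrower strip
  it is a uniform limit of difference quotients, whose remainder is controlled by a bound of f
  uniform over the compact \<Xi>. The direction is real, so the real increments leave the strip
  invariant.\<close>

lemma tfam_ddir:
  fixes f :: "'p::metric_space \<Rightarrow> complex ^ 'n::finite \<Rightarrow> complex"
  assumes \<Xi>: "compact \<Xi>" and f: "tfam \<Xi> r f" and r: "r > 0"
  shows "tfam \<Xi> r (\<lambda>p \<theta>. ddir (f p) \<theta> (cvec v))"
proof -
  let ?v = "cvec v"
  have loc: "continuous_on (\<Xi> \<times> strip r') (\<lambda>(p, \<theta>). ddir (f p) \<theta> ?v)" if r': "0 < r'" "r' < r" for r'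
  proof -
    define r1 where "r1 = (r' + r) / 2"
    have r1: "r' < r1" "r1 < r" using r' by (auto simp: r1_def)
    obtain C where C: "bnd \<Xi> r1 f C" "C \<ge> 0" using tfam_bounded[OF \<Xi> f r1(2)] by blast
    define R where "R = (r1 - r') / (norm ?v + 1)"
    have den: "norm ?v + 1 > 0" by (smt (verit) norm_ge_zero)
    have R: "R > 0" using r1 den by (simp add: R_def)
    have Rv: "R * cmod (?v $ i) \<le> r1 - r'" for i
    proof -
      have "R * cmod (?v $ i) \<le> R * (norm ?v + 1)"
        using Finite_Cartesian_Product.norm_nth_le[of ?v i] R by (intro mult_left_mono) auto
      also have "\<dots> = r1 - r'" using den by (simp add: R_def)
      finally show ?thesis .
    qed
    have in1: "\<theta> + t *s ?v \<in> strip r1" if "\<theta> \<in> strip r'" "cmod t \<le> R" for \<theta> t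
      by (rule strip_disc[where R = R and d = "r1 - r'"]) (use that Rv in auto)
    define c where "c n = complex_of_real (inverse (real (Suc n)))" for n
    have c0: "c \<longlonglongrightarrow> 0"
      unfolding c_def using tendsto_of_real[OF LIMSEQ_inverse_real_of_nat, where 'a = complex]
    by (simp only: of_real_0)
    have cn: "c n \<noteq> 0" for n unfolding c_def by (simp del: of_real_inverse of_nat_Suc)
    define g where "g n = (\<lambda>(p, \<theta>). (f p (\<theta> + c n *s ?v) - f p \<theta>) / c n)" for n
    have strip_c: "\<theta> + c n *s ?v \<in> strip r' \<longleftrightarrow> \<theta> \<in> strip r'" for \<theta> n
      by (simp add: strip_def c_def del: of_real_inverse)
    have sub: "strip r' \<subseteq> strip r" using r' by (intro strip_mono) auto
    have cf: "continuous_on (\<Xi> \<times> strip r') (\<lambda>(p, \<theta>). f p \<theta>)"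
      by (rule continuous_on_subset[OF tfam_continuous[OF f]]) (use sub in auto)
    have cg: "continuous_on (\<Xi> \<times> strip r') (g n)" for n
    proof -
      have "continuous_on (\<Xi> \<times> strip r') (\<lambda>x. (\<lambda>(p, \<theta>). f p \<theta>) (fst x, snd x + c n *s ?v))"
        by (rule continuous_on_compose2[OF cf]) (auto simp: strip_c intro!: continuous_intros)
      then show ?thesis unfolding g_def using cf cn unfolding split_beta
        by (auto intro!: continuous_intros simp: split_beta)
    qed
    have ul: "uniform_limit (\<Xi> \<times> strip r') g (\<lambda>(p, \<theta>). ddir (f p) \<theta> ?v) sequentially"
    proof (rule uniform_limitI)
      fix e :: real assume e: "e > 0"
      have "(\<lambda>n. 8 * C / R\<^sup>2 * cmod (c n)) \<longlonglongrightarrow> 8 * C / R\<^sup>2 * cmod 0"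
        by (intro tendsto_intros c0)
      then have ev1: "\<forall>\<^sub>F n in sequentially. 8 * C / R\<^sup>2 * cmod (c n) < e"
        using e by (intro order_tendstoD(2)) auto
      have "(\<lambda>n. cmod (c n)) \<longlonglongrightarrow> cmod 0" by (intro tendsto_intros c0)
      then have ev2: "\<forall>\<^sub>F n in sequentially. cmod (c n) < R / 2"
        using R by (intro order_tendstoD(2)) auto
      show "\<forall>\<^sub>F n in sequentially. \<forall>x\<in>\<Xi> \<times> strip r'. dist (g n x) (case x of (p, \<theta>) \<Rightarrow> ddir (f p) \<theta> ?v) < e"
        using ev1 ev2
      proof eventually_elim
        case (elim n)
        have "dist (g n (p, \<theta>)) (ddir (f p) \<theta> ?v) < e" if p: "p \<in> \<Xi>" and \<theta>: "\<theta> \<in> strip r'" for p \<theta>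
        proof -
          have *: "cmod (f p (\<theta> + c n *s ?v) - f p \<theta> - c n * ddir (f p) \<theta> ?v) \<le> 8 * C * (cmod (c n))\<^sup>2 / R\<^sup>2"
            by (rule taylor2_dir[OF open_strip tfam_holo[OF f p] R])
               (use in1[OF \<theta>] strip_mono[of r1 r] r1 C p elim in \<open>auto simp: bnd_def\<close>)
          moreover have "g n (p, \<theta>) - ddir (f p) \<theta> ?v = (f p (\<theta> + c n *s ?v) - f p \<theta> - c n * ddir (f p) \<theta> ?v) / c n"
            using cn[of n] by (simp add: g_def diff_divide_distrib)
          ultimately have "dist (g n (p, \<theta>)) (ddir (f p) \<theta> ?v) \<le> 8 * C * (cmod (c n))\<^sup>2 / R\<^sup>2 / cmod (c n)"
            using divide_right_mono[OF *, of "cmod (c n)"] by (simp only: dist_norm norm_divide) simp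
          also have "\<dots> = 8 * C / R\<^sup>2 * cmod (c n)" using cn[of n] by (simp add: power2_eq_square)
          finally show ?thesis using elim by simp
        qed
        then show ?case by auto
      qed
    qed
    show ?thesis by (rule uniform_limit_theorem[OF _ ul]) (use cg in auto)
  qed
  have "continuous_on (\<Xi> \<times> strip r) (\<lambda>(p, \<theta>). ddir (f p) \<theta> ?v)"
    unfolding continuous_on_eq_continuous_within
  proof (rule ballI, clarify)
    fix p and \<theta> :: "complex ^ 'n" assume p: "p \<in> \<Xi>" and \<theta>: "\<theta> \<in> strip r"
    have "Max (range (\<lambda>i. \<bar>Im (\<theta> $ i)\<bar>)) < r"
      using \<theta> by (subst Max_less_iff) (auto simp: strip_def)
    \<comment> \<open>Continuity is local: each \<theta> lies in a strictly narrower strip, which is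
      open and on which the uniform limit is available.\<close>
    then obtain r' where r': "Max (range (\<lambda>i. \<bar>Im (\<theta> $ i)\<bar>)) < r'" "r' < r" using dense by blast
    then have \<theta>': "\<theta> \<in> strip r'" by (subst (asm) Max_less_iff) (auto simp: strip_def)
    then have "r' > 0" by (auto simp: strip_def intro: le_less_trans[OF abs_ge_zero])
    then have "continuous (at (p, \<theta>) within \<Xi> \<times> strip r') (\<lambda>(p, \<theta>). ddir (f p) \<theta> ?v)"
      using loc[of r'] r' p \<theta>' by (simp add: continuous_on_eq_continuous_within)
    moreover have "at (p, \<theta>) within \<Xi> \<times> strip r' = at (p, \<theta>) within \<Xi> \<times> strip r"
    proof (rule at_within_nhd)
      show "(p, \<theta>) \<in> UNIV \<times> strip r'" using \<theta>' by simp
      show "open (UNIV \<times> strip r')" by (intro open_Times open_strip open_UNIV)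
      show "\<Xi> \<times> strip r' \<inter> UNIV \<times> strip r' - {(p, \<theta>)} = \<Xi> \<times> strip r \<inter> UNIV \<times> strip r' - {(p, \<theta>)}"
        using strip_mono[of r' r] r' by auto
    qed
    ultimately show "continuous (at (p, \<theta>) within \<Xi> \<times> strip r) (\<lambda>(p, \<theta>). ddir (f p) \<theta> ?v)" by simp
  qed
  moreover have "ddir (f p) (cvec x) ?v \<in> \<real>" if p: "p \<in> \<Xi>" for p x
  proof (rule ddir_real[OF open_strip tfam_holo[OF f p]])
    have "cvec x + complex_of_real t *s cvec v = cvec (x + t *\<^sub>R v)" for t
      by (simp add: vec_eq_iff)
    then show "f p (cvec x + complex_of_real t *s cvec v) \<in> \<real>" for t
      using tfam_real[OF f p] by simp
  qed (use r in simp)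
  ultimately show ?thesis unfolding tfam_def
    using holo_ddir[OF open_strip tfam_holo[OF f]] per_ddir[OF tfam_holo[OF f] tfam_per[OF f]] by blast
qed

lemma cvec_axis_1: "cvec (axis j 1) = axis j 1"
  by (simp add: cvec_axis)

lemma tfam_pd:
  assumes "compact \<Xi>" "tfam \<Xi> r f" "r > 0"
  shows "tfam \<Xi> r (\<lambda>p. pd j (f p))"
  using tfam_ddir[OF assms, of "axis j 1"] by (simp add: pd_def[abs_def] cvec_axis_1)

lemma bnd_pd:
  fixes f :: "'p::metric_space \<Rightarrow> complex ^ 'n::finite \<Rightarrow> complex"
  assumes "tfam \<Xi> r f" "bnd \<Xi> r f C" "d > 0"
  shows "bnd \<Xi> (r - d) (\<lambda>p. pd j (f p)) (C / d)"
  unfolding bnd_def pd_def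
proof (intro ballI ddir_bound[OF open_strip tfam_holo[OF assms(1)]])
  fix p and \<theta> :: "complex ^ 'n" and t
  assume a: "p \<in> \<Xi>" "\<theta> \<in> strip (r - d)" "cmod t \<le> d"
  show *: "\<theta> + t *s axis j 1 \<in> strip r"
    by (rule strip_disc[where R = d and d = d]) (use a assms(3) in \<open>auto simp: axis_def\<close>)
  show "cmod (f p (\<theta> + t *s axis j 1)) \<le> C"
    using * assms(2) a by (auto simp: bnd_def)
qed (use assms in auto)

lemma continuous_on_coef:
  fixes f :: "'p::metric_space \<Rightarrow> complex ^ 'n::finite \<Rightarrow> complex"
  assumes f: "tfam \<Xi> r f" and r: "r > 0"
  shows "continuous_on \<Xi> (\<lambda>p. coef (f p) k)"
proof -
  have "continuous_on (\<Xi> \<times> torus_box) (\<lambda>x. (\<lambda>(p, \<theta>). f p \<theta>) (fst x, cvec (snd x)) * ee (- k) (cvec (snd x)))"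
    by (intro continuous_on_mult continuous_on_compose2[OF tfam_continuous[OF f]] continuous_on_compose2[OF continuous_on_ee_real[of UNIV]] 
          continuous_on_Pair continuous_on_compose2[OF continuous_on_cvec[of UNIV]] continuous_intros) (use r in auto)
  then have "continuous_on (\<Xi> \<times> cbox (\<chi> i. - pi) (\<chi> i. pi)) (\<lambda>(p, x). f p (cvec x) * ee (- k) (cvec x))"
    by (simp add: split_beta torus_box_def)
  from integral_continuous_on_param[OF this] show ?thesis
    unfolding coef_def cmean_def tmean_def torus_box_def by (intro continuous_intros)
qed

lemma cnj_coef:
  assumes f: "\<And>x. f (cvec x) \<in> \<real>" and c: "continuous_on UNIV (\<lambda>x. f (cvec x))"
  shows "cnj (coef f k) = coef f (- k)"
proof -
  have "cnj (ee (- k) (cvec x)) = ee k (cvec x)" for x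
    by (simp add: ee_def exp_cnj sum_negf)
  then show ?thesis
    unfolding coef_def cmean_def
    by (subst tmean_cnj[symmetric]) (use f c in \<open>auto intro!: continuous_intros continuous_on_ee_real simp: Reals_cnj_iff\<close>)
qed

text \<open>Real because the coefficient at k = 0 is its own conjugate. The mean does not depend on
  \<theta>, hence the arbitrary width r'.\<close>

lemma tfam_cmean:
  assumes f: "tfam \<Xi> r f" and r: "r > 0"
  shows "tfam \<Xi> r' (\<lambda>p \<theta>. cmean (f p))"
proof (rule tfam_param)
  show "continuous_on \<Xi> (\<lambda>p. cmean (f p))"
    using continuous_on_coef[OF f r, of 0] by (simp add: coef_zero)
  fix p assume p: "p \<in> \<Xi>"
  have "cnj (coef (f p) 0) = coef (f p) (- 0)"
    by (rule cnj_coef[OF tfam_real[OF f p] continuous_on_strip_real[OF holo_continuous_on[OF tfam_holo[OF f p]] r]])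
  then show "cmean (f p) \<in> \<real>" by (simp add: coef_zero Reals_cnj_iff)
qed

lemma bnd_cmean:
  assumes f: "tfam \<Xi> r f" "bnd \<Xi> r f C" and r: "r > 0"
  shows "bnd \<Xi> r' (\<lambda>p \<theta>. cmean (f p)) C"
  unfolding bnd_def cmean_def
  by (intro ballI tmean_bound continuous_on_strip_real[OF holo_continuous_on[OF tfam_holo[OF f(1)]] r])
     (use f(2) r in \<open>auto simp: bnd_def\<close>)


lemma bnd_mono: "bnd \<Xi> r f C \<Longrightarrow> r' \<le> r \<Longrightarrow> C \<le> C' \<Longrightarrow> bnd \<Xi> r' f C'"
  unfolding bnd_def using strip_mono[of r' r] by (meson order_trans subsetD)

lemma bnd_add: "bnd \<Xi> r f C \<Longrightarrow> bnd \<Xi> r g C' \<Longrightarrow> bnd \<Xi> r (\<lambda>p \<theta>. f p \<theta> + g p \<theta>) (C + C')"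
  unfolding bnd_def by (meson add_mono norm_triangle_ineq order_trans)

lemma bnd_diff: "bnd \<Xi> r f C \<Longrightarrow> bnd \<Xi> r g C' \<Longrightarrow> bnd \<Xi> r (\<lambda>p \<theta>. f p \<theta> - g p \<theta>) (C + C')"
  unfolding bnd_def by (meson add_mono norm_triangle_ineq4 order_trans)

lemma bnd_mult: "bnd \<Xi> r f C \<Longrightarrow> bnd \<Xi> r g C' \<Longrightarrow> bnd \<Xi> r (\<lambda>p \<theta>. f p \<theta> * g p \<theta>) (C * C')"
  unfolding bnd_def norm_mult by (meson mult_mono norm_ge_zero order_trans)

lemma bnd_sum:
  fixes f :: "'i::finite \<Rightarrow> 'p \<Rightarrow> complex ^ 'n::finite \<Rightarrow> complex"
  assumes "\<And>i. bnd \<Xi> r (f i) C"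
  shows "bnd \<Xi> r (\<lambda>p \<theta>. \<Sum>i\<in>UNIV. f i p \<theta>) (real CARD('i) * C)"
  unfolding bnd_def
proof (intro ballI)
  fix p and \<theta> :: "complex ^ 'n" assume "p \<in> \<Xi>" "\<theta> \<in> strip r"
  then show "cmod (\<Sum>i\<in>UNIV. f i p \<theta>) \<le> real CARD('i) * C"
    using assms sum_norm_bound[of UNIV "\<lambda>i. f i p \<theta>" C] by (simp add: bnd_def)
qed

section \<open>Diophantine frequencies and the cohomological equation\<close>

definition dioph :: "real ^ 'n::finite \<Rightarrow> real \<Rightarrow> real \<Rightarrow> bool" where
  "dioph \<omega> \<gamma> \<tau> \<longleftrightarrow> 0 < \<gamma> \<and> 0 \<le> \<tau> \<and> (\<forall>k. k \<noteq> 0 \<longrightarrow> \<gamma> / l1norm k powr \<tau> < \<bar>ivec k \<bullet> \<omega>\<bar>)"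

definition sd_bound :: "'n::finite itself \<Rightarrow> real \<Rightarrow> real \<Rightarrow> real \<Rightarrow> real" where
  "sd_bound n \<gamma> \<tau> \<delta> = sd_const n \<gamma> \<tau> * (1 / \<delta>) ^ (nat \<lceil>\<tau>\<rceil> + CARD('n))"

lemma ivec_inner: "(\<Sum>j\<in>UNIV. of_int (k $ j) * cvec \<omega> $ j) = complex_of_real (ivec k \<bullet> \<omega>)"
  by (simp add: inner_vec_def ivec_def)

lemma small_divisor_term:
  fixes k :: "int ^ 'n::finite"
  assumes d: "dioph \<omega> \<gamma> \<tau>" and c: "cmod c \<le> C * exp (- r * l1norm k)" and \<theta>: "\<theta> \<in> strip (r - \<delta>)"
  shows "cmod (c / (\<i> * complex_of_real (ivec k \<bullet> \<omega>)) * ee k \<theta>) \<le> C * sd_weight \<gamma> \<tau> \<delta> k"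
proof (cases "k = 0")
  case True
  \<comment> \<open>For k = 0 the left side contains a division by zero and is 0, and so is the
    weight.\<close>
  then have "ivec k = 0" by (simp add: ivec_def vec_eq_iff)
  then show ?thesis using True by (simp add: sd_weight_def l1norm_def)
next
  case False
  define l where "l = l1norm k"
  have l: "l \<ge> 1" using l1norm_ge_1[OF False] by (simp add: l_def)
  have dk: "\<gamma> / l powr \<tau> < \<bar>ivec k \<bullet> \<omega>\<bar>" and \<gamma>: "\<gamma> > 0" using d False by (auto simp: dioph_def l_def)
  have pos: "\<bar>ivec k \<bullet> \<omega>\<bar> > 0" by (rule less_trans[OF _ dk]) (use \<gamma> l in simp)
  have inv: "1 / \<bar>ivec k \<bullet> \<omega>\<bar> \<le> l powr \<tau> / \<gamma>"
    using dk pos \<gamma> l by (simp add: field_simps)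
  have e: "cmod (ee k \<theta>) \<le> exp ((r - \<delta>) * l)"
    unfolding l_def by (rule cmod_ee_le) (use \<theta> in \<open>auto simp: strip_def intro: less_imp_le\<close>)
  have "cmod (c / (\<i> * complex_of_real (ivec k \<bullet> \<omega>)) * ee k \<theta>) = cmod c * (1 / \<bar>ivec k \<bullet> \<omega>\<bar>) * cmod (ee k \<theta>)"
    by (simp add: norm_mult norm_divide)
  also have "\<dots> \<le> (C * exp (- r * l)) * (l powr \<tau> / \<gamma>) * exp ((r - \<delta>) * l)"
    using c inv e order_trans[OF norm_ge_zero c] by (intro mult_mono mult_nonneg_nonneg divide_nonneg_nonneg) (use \<gamma> in \<open>auto simp: l_def zero_le_mult_iff\<close>)
  also have "\<dots> = C * (l powr \<tau> / \<gamma>) * (exp (- r * l) * exp ((r - \<delta>) * l))" by simp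
  also have "exp (- r * l) * exp ((r - \<delta>) * l) = exp (- \<delta> * l)"
    by (simp add: exp_add[symmetric] algebra_simps)
  finally show ?thesis by (simp add: sd_weight_def l_def mult.assoc)
qed

text \<open>An a priori bound, valid however g was found. It serves for functions already at hand:
  for \<open>Bf\<close>, with a loss \<open>d0\<close> other than the one used to construct it, and
  for the Lagrangian defect \<open>Ld\<close>.\<close>

lemma small_divisor_estimate:
  fixes g :: "complex ^ 'n::finite \<Rightarrow> complex"
  assumes d: "dioph \<omega> \<gamma> \<tau>" and \<delta>: "0 < \<delta>" "\<delta> \<le> 1" "\<delta> < r"
    and g: "holo g (strip r)" "per g r" and m: "cmean g = 0"
    and C: "\<And>\<theta>. \<theta> \<in> strip r \<Longrightarrow> cmod (ddir g \<theta> (cvec \<omega>)) \<le> C" and \<theta>: "\<theta> \<in> strip (r - \<delta>)"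
  shows "cmod (g \<theta>) \<le> C * sd_bound TYPE('n) \<gamma> \<tau> \<delta>"
proof -
  have r: "r > 0" using \<delta> by simp
  have d': "\<gamma> > 0" "\<tau> \<ge> 0" using d by (auto simp: dioph_def)
  have \<theta>': "\<theta> \<in> strip r" using \<theta> strip_mono[of "r - \<delta>" r] \<delta> by auto
  have 0: "(0 :: complex ^ 'n) \<in> strip r" using r by (simp add: strip_def)
  have C0: "C \<ge> 0" using C[OF 0] norm_ge_zero order_trans by blast
  let ?D = "\<lambda>\<theta>. ddir g \<theta> (cvec \<omega>)"
  have cD: "cmod (coef ?D k) \<le> C * exp (- r * l1norm k)" for k
    by (rule coef_bound[OF holo_ddir[OF open_strip g(1)] per_ddir[OF g] C r])
  have cg: "coef g k = coef ?D k / (\<i> * complex_of_real (ivec k \<bullet> \<omega>))" for k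
  proof (cases "k = 0")
    case True
    then show ?thesis using m by (simp add: coef_zero ivec_def inner_vec_def)
  next
    case False
    have "ivec k \<bullet> \<omega> \<noteq> 0"
      using d False unfolding dioph_def by (smt (verit) divide_nonneg_nonneg powr_ge_zero)
    then show ?thesis using coef_ddir[OF g r, of "cvec \<omega>" k] by (simp only: ivec_inner) simp
  qed
  have hs: "((\<lambda>k. coef g k * ee k \<theta>) has_sum g \<theta>) UNIV" by (rule fourier_expansion[OF g \<theta>'])
  have b: "cmod (coef g k * ee k \<theta>) \<le> C * sd_weight \<gamma> \<tau> \<delta> k" for k
    unfolding cg by (rule small_divisor_term[OF d cD \<theta>])
  note w = sd_weight_sum[OF d' \<delta>(1,2), where 'n = 'n]
  have "norm (\<Sum>\<^sub>\<infinity>k. coef g k * ee k \<theta>) \<le> (\<Sum>\<^sub>\<infinity>k :: int ^ 'n. C * sd_weight \<gamma> \<tau> \<delta> k)"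
    by (rule norm_infsum_le[OF has_sum_infsum[OF has_sum_imp_summable[OF hs]] has_sum_infsum[OF summable_on_cmult_right[OF w(1)]] b])
  also have "\<dots> = C * infsum (sd_weight \<gamma> \<tau> \<delta>) (UNIV :: (int ^ 'n) set)"
    by (rule infsum_cmult_right) (use w in auto)
  also have "\<dots> \<le> C * sd_bound TYPE('n) \<gamma> \<tau> \<delta>"
    unfolding sd_bound_def by (intro mult_left_mono w C0)
  finally show ?thesis using infsumI[OF hs] by simp
qed

text \<open>Mode by mode division by the small divisors; on the strip narrowed by \<delta> the
  series converges uniformly in p and \<theta>, so the limit inherits continuity in p. To stay in
  \<open>tfam\<close>, the partial sums have to be real on real angles.\<close>

lemma tfam_solve:
  fixes f :: "'p::metric_space \<Rightarrow> complex ^ 'n::finite \<Rightarrow> complex"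
  assumes d: "dioph \<omega> \<gamma> \<tau>" and \<delta>: "0 < \<delta>" "\<delta> \<le> 1" "\<delta> < r"
    and f: "tfam \<Xi> r f" "bnd \<Xi> r f C" and m: "\<And>p. p \<in> \<Xi> \<Longrightarrow> cmean (f p) = 0"
  obtains g where "tfam \<Xi> (r - \<delta>) g" "bnd \<Xi> (r - \<delta>) g (C * sd_bound TYPE('n) \<gamma> \<tau> \<delta>)"
    "\<And>p \<theta>. p \<in> \<Xi> \<Longrightarrow> \<theta> \<in> strip (r - \<delta>) \<Longrightarrow> ddir (g p) \<theta> (cvec \<omega>) = f p \<theta>"
proof -
  have r: "r > 0" "r - \<delta> > 0" using \<delta> by auto
  have d': "\<gamma> > 0" "\<tau> \<ge> 0" using d by (auto simp: dioph_def)
  have sub: "strip (r - \<delta>) \<subseteq> strip r" using \<delta> by (intro strip_mono) auto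
  note w = sd_weight_sum[OF d' \<delta>(1,2), where 'n = 'n]
  define b where "b p k = coef (f p) k / (\<i> * complex_of_real (ivec k \<bullet> \<omega>))" for p k
  define g where "g p \<theta> = (\<Sum>\<^sub>\<infinity>k. b p k * ee k \<theta>)" for p \<theta>
  have cf: "cmod (coef (f p) k) \<le> C * exp (- r * l1norm k)" if "p \<in> \<Xi>" for p k
    by (rule coef_bound[OF tfam_holo[OF f(1) that] tfam_per[OF f(1) that] _ r(1)]) (use f(2) that in \<open>auto simp: bnd_def\<close>)
  have tb: "cmod (b p k * ee k \<theta>) \<le> C * sd_weight \<gamma> \<tau> \<delta> k" if "p \<in> \<Xi>" "\<theta> \<in> strip (r - \<delta>)" for p k \<theta>
    unfolding b_def by (rule small_divisor_term[OF d cf that(2)]) fact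
  have w': "(\<lambda>k. C * sd_weight \<gamma> \<tau> \<delta> k) summable_on (UNIV :: (int ^ 'n) set)"
    by (rule summable_on_cmult_right[OF w(1)])
  \<comment> \<open>Sums over sets symmetric under k \<mapsto> -k are real on real angles, since
    conjugation exchanges the two modes. Symmetrised finite sets still exhaust the lattice, so the
    limit is unchanged.\<close>
  define sy where "sy A = A \<union> uminus ` A" for A :: "(int ^ 'n) set"
  have fsy: "filterlim sy (finite_subsets_at_top UNIV) (finite_subsets_at_top UNIV)"
    unfolding filterlim_def le_filter_def eventually_filtermap eventually_finite_subsets_at_top
  proof (intro allI impI)
    fix P :: "(int ^ 'n) set \<Rightarrow> bool" assume "\<exists>X. finite X \<and> X \<subseteq> UNIV \<and> (\<forall>Y. finite Y \<and> X \<subseteq> Y \<and> Y \<subseteq> UNIV \<longrightarrow> P Y)"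
    then obtain X where X: "finite X" "\<And>Y. finite Y \<Longrightarrow> X \<subseteq> Y \<Longrightarrow> P Y" by auto
    show "\<exists>X. finite X \<and> X \<subseteq> UNIV \<and> (\<forall>Y. finite Y \<and> X \<subseteq> Y \<and> Y \<subseteq> UNIV \<longrightarrow> P (sy Y))"
      by (intro exI[of _ X] conjI X allI impI) (auto simp: sy_def)
  qed
  define G where "G A p \<theta> = (\<Sum>k\<in>sy A. b p k * ee k \<theta>)" for A p \<theta>
  have ul0: "uniform_limit (\<Xi> \<times> strip (r - \<delta>)) (\<lambda>A (p, \<theta>). \<Sum>k\<in>A. b p k * ee k \<theta>) (\<lambda>(p, \<theta>). g p \<theta>) (finite_subsets_at_top UNIV)"
    unfolding g_def split_beta by (rule Weierstrass_m_test_general[OF _ w']) (use tb in auto)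
  have ul: "uniform_limit (\<Xi> \<times> strip (r - \<delta>)) (\<lambda>A (p, \<theta>). G A p \<theta>) (\<lambda>(p, \<theta>). g p \<theta>) (finite_subsets_at_top UNIV)"
    using filterlim_compose[OF ul0 fsy] by (simp add: G_def)
  have b_minus: "cnj (b p k) = b p (- k)" if "p \<in> \<Xi>" for p k
  proof -
    have "ivec (- k) = - ivec k" by (simp add: ivec_def vec_eq_iff)
    then show ?thesis unfolding b_def
      using cnj_coef[OF tfam_real[OF f(1) that] continuous_on_strip_real[OF holo_continuous_on[OF tfam_holo[OF f(1) that]] r(1)]]
      by simp
  qed
  have sy_inv: "uminus ` sy A = sy A" for A by (auto simp: sy_def image_Un image_image)
  have tG: "tfam \<Xi> (r - \<delta>) (G A)" for A
    unfolding tfam_def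
  proof (intro conjI ballI allI)
    have cb: "continuous_on \<Xi> (\<lambda>p. b p k)" for k
      unfolding b_def divide_inverse by (intro continuous_intros continuous_on_coef[OF f(1) r(1)])
    show "continuous_on (\<Xi> \<times> strip (r - \<delta>)) (\<lambda>(p, \<theta>). G A p \<theta>)"
      unfolding G_def split_beta
      by (intro continuous_intros continuous_on_compose2[OF cb] continuous_on_compose2[OF continuous_on_ee[of UNIV]]) auto
    fix p assume p: "p \<in> \<Xi>"
    show "holo (G A p) (strip (r - \<delta>))"
      unfolding G_def[abs_def] by (intro holo_sum holo_mult holo_const holo_ee)
    show "per (G A p) (r - \<delta>)" by (simp add: per_def G_def ee_add_arg ee_pvec)
    fix x
    have "cnj (G A p (cvec x)) = (\<Sum>k\<in>sy A. b p (- k) * ee (- k) (cvec x))"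
      using p by (simp add: G_def b_minus ee_def exp_cnj sum_negf)
    also have "\<dots> = (\<Sum>k\<in>uminus ` sy A. b p k * ee k (cvec x))"
      by (subst sum.reindex) (auto simp: inj_on_def)
    also have "\<dots> = G A p (cvec x)" by (simp add: sy_inv G_def)
    finally show "G A p (cvec x) \<in> \<real>" by (simp add: Reals_cnj_iff)
  qed
  have nb: "finite_subsets_at_top (UNIV :: (int ^ 'n) set) \<noteq> bot" by simp
  note T = tfam_uniform_limit[OF tG ul nb r(2)]
  show thesis
  proof
    show "tfam \<Xi> (r - \<delta>) g" by (rule T(1))
    show "bnd \<Xi> (r - \<delta>) g (C * sd_bound TYPE('n) \<gamma> \<tau> \<delta>)"
      unfolding bnd_def
    proof (intro ballI)
      fix p and \<theta> :: "complex ^ 'n" assume p: "p \<in> \<Xi>" and \<theta>: "\<theta> \<in> strip (r - \<delta>)"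
      have "cmod (f p \<theta>) \<le> C" using f(2) p \<theta> sub by (auto simp: bnd_def)
      then have C0: "C \<ge> 0" using norm_ge_zero order_trans by blast
      have s: "(\<lambda>k. b p k * ee k \<theta>) summable_on UNIV"
      proof (rule abs_summable_summable)
        show "(\<lambda>k. norm (b p k * ee k \<theta>)) summable_on UNIV"
          by (rule summable_on_comparison_test[OF w']) (use tb[OF p \<theta>] in auto)
      qed
      have "norm (g p \<theta>) \<le> (\<Sum>\<^sub>\<infinity>k :: int ^ 'n. C * sd_weight \<gamma> \<tau> \<delta> k)"
        unfolding g_def by (rule norm_infsum_le[OF has_sum_infsum[OF s] has_sum_infsum[OF w'] tb[OF p \<theta>]])
      also have "\<dots> = C * infsum (sd_weight \<gamma> \<tau> \<delta>) (UNIV :: (int ^ 'n) set)"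
        by (rule infsum_cmult_right) (use w in auto)
      also have "\<dots> \<le> C * sd_bound TYPE('n) \<gamma> \<tau> \<delta>"
        unfolding sd_bound_def by (intro mult_left_mono w C0)
      finally show "cmod (g p \<theta>) \<le> C * sd_bound TYPE('n) \<gamma> \<tau> \<delta>" .
    qed
    fix p and \<theta> :: "complex ^ 'n" assume p: "p \<in> \<Xi>" and \<theta>: "\<theta> \<in> strip (r - \<delta>)"
    have "((\<lambda>A. ddir (G A p) \<theta> (cvec \<omega>)) \<longlongrightarrow> f p \<theta>) (finite_subsets_at_top UNIV)"
    proof (rule Lim_transform_eventually)
      have "((\<lambda>k. coef (f p) k * ee k \<theta>) has_sum f p \<theta>) UNIV"
        by (rule fourier_expansion[OF tfam_holo[OF f(1) p] tfam_per[OF f(1) p]]) (use \<theta> sub in auto)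
      then have "((\<lambda>A. \<Sum>k\<in>A. coef (f p) k * ee k \<theta>) \<longlongrightarrow> f p \<theta>) (finite_subsets_at_top UNIV)"
        by (simp add: has_sum_def)
      from filterlim_compose[OF this fsy]
      show "((\<lambda>A. \<Sum>k\<in>sy A. coef (f p) k * ee k \<theta>) \<longlongrightarrow> f p \<theta>) (finite_subsets_at_top UNIV)" .
      \<comment> \<open>At k = 0 the division by zero returned 0; there the identity rests on the
        zero mean of f.\<close>
      have "b p k * (\<i> * complex_of_real (ivec k \<bullet> \<omega>)) = coef (f p) k" for k
      proof (cases "k = 0")
        case True
        then show ?thesis using m[OF p] by (simp add: coef_zero ivec_def inner_vec_def)
      next
        case False
        have "ivec k \<bullet> \<omega> \<noteq> 0"
          using d False unfolding dioph_def by (smt (verit) divide_nonneg_nonneg powr_ge_zero)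
        then show ?thesis by (simp add: b_def)
      qed
      then have "ddir (\<lambda>\<theta>. b p k * ee k \<theta>) \<theta> (cvec \<omega>) = coef (f p) k * ee k \<theta>" for k
        unfolding ddir_mult[OF holo_const[of _ UNIV] holo_ee UNIV_I] ddir_const ddir_ee ivec_inner
        by (metis add.right_neutral mult.assoc mult_zero_left)
      then have "(\<Sum>k\<in>sy A. coef (f p) k * ee k \<theta>) = ddir (G A p) \<theta> (cvec \<omega>)" for A
        unfolding G_def[abs_def] by (subst ddir_sum[where U = UNIV]) (auto intro!: holo_mult holo_const holo_ee)
      then show "\<forall>\<^sub>F A in finite_subsets_at_top UNIV. (\<Sum>k\<in>sy A. coef (f p) k * ee k \<theta>) = ddir (G A p) \<theta> (cvec \<omega>)"
        by simp
    qed
    then show "ddir (g p) \<theta> (cvec \<omega>) = f p \<theta>"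
      by (rule tendsto_unique[OF nb T(2)[OF p \<theta>]])
  qed
qed

text \<open>At an index where |x i| is maximal, the n terms of the deviation, each with a factor at
  most 1/(2n), contribute at most half of this maximum.\<close>

lemma near_identity_bound:
  fixes X :: "'n::finite \<Rightarrow> 'n \<Rightarrow> complex"
  assumes X: "\<And>i j. cmod (X i j - (if i = j then 1 else 0)) \<le> 1 / (2 * real CARD('n))"
    and b: "\<And>i. cmod (\<Sum>k\<in>UNIV. X i k * x k) \<le> B"
  shows "cmod (x i) \<le> 2 * B"
proof -
  define m where "m = Max (range (\<lambda>i. cmod (x i)))"
  have m: "cmod (x i) \<le> m" for i unfolding m_def by simp
  have "m \<in> range (\<lambda>i. cmod (x i))" unfolding m_def by (rule Max_in) auto
  then obtain i0 where i0: "m = cmod (x i0)" by blast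
  have m0: "m \<ge> 0" unfolding i0 by simp
  have "x i0 = (\<Sum>k\<in>UNIV. X i0 k * x k) - (\<Sum>k\<in>UNIV. (X i0 k - (if i0 = k then 1 else 0)) * x k)"
  proof -
    have "(\<Sum>k\<in>UNIV. (if i0 = k then 1 else 0) * x k) = x i0" by (simp add: if_distrib if_distribR cong: if_cong)
    then show ?thesis unfolding left_diff_distrib sum_subtractf by (simp only:) simp
  qed
  also have "cmod \<dots> \<le> B + (\<Sum>k\<in>(UNIV::'n set). 1 / (2 * real CARD('n)) * m)"
    by (intro norm_triangle_le_diff add_mono b order_trans[OF norm_sum] sum_mono)
       (auto simp only: norm_mult intro!: mult_mono X m m0; simp)
  also have "(\<Sum>k\<in>(UNIV::'n set). 1 / (2 * real CARD('n)) * m) = m / 2" by simp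
  finally have "m \<le> 2 * B" using i0 by simp
  then show ?thesis using m order_trans by blast
qed

text \<open>Cramer's rule expresses the inverse by determinants and one reciprocal, operations under
  which \<open>tfam\<close> is closed. \<open>near_identity_bound\<close> enters twice: with B = 0
  it excludes a kernel, and with the columns of the identity it gives the bound 2.\<close>

lemma tfam_matrix_inverse:
  fixes X :: "'n \<Rightarrow> 'n \<Rightarrow> 'p::metric_space \<Rightarrow> complex ^ 'n::finite \<Rightarrow> complex"
  assumes X: "\<And>i j. tfam \<Xi> r (X i j)"
    and b: "\<And>i j. bnd \<Xi> r (\<lambda>p \<theta>. X i j p \<theta> - (if i = j then 1 else 0)) (1 / (2 * real CARD('n)))"
  obtains W where "\<And>i j. tfam \<Xi> r (W i j)" "\<And>i j. bnd \<Xi> r (W i j) 2"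
    "\<And>p \<theta> i j. p \<in> \<Xi> \<Longrightarrow> \<theta> \<in> strip r \<Longrightarrow> (\<Sum>k\<in>UNIV. X i k p \<theta> * W k j p \<theta>) = (if i = j then 1 else 0)"
    "\<And>p \<theta> i j. p \<in> \<Xi> \<Longrightarrow> \<theta> \<in> strip r \<Longrightarrow> (\<Sum>k\<in>UNIV. W i k p \<theta> * X k j p \<theta>) = (if i = j then 1 else 0)"
proof -
  define A :: "'p \<Rightarrow> complex ^ 'n \<Rightarrow> complex ^ 'n ^ 'n" where "A p \<theta> = (\<chi> i j. X i j p \<theta>)" for p \<theta>
  define Aj :: "'n \<Rightarrow> 'n \<Rightarrow> 'p \<Rightarrow> complex ^ 'n \<Rightarrow> complex ^ 'n ^ 'n"
    where "Aj i j p \<theta> = (\<chi> a c. if c = i then axis j 1 $ a else A p \<theta> $ a $ c)" for i j p \<theta>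
  define W where "W i j p \<theta> = det (Aj i j p \<theta>) * inverse (det (A p \<theta>))" for i j p \<theta>
  have bX: "cmod (X i j p \<theta> - (if i = j then 1 else 0)) \<le> 1 / (2 * real CARD('n))" if "p \<in> \<Xi>" "\<theta> \<in> strip r" for i j p \<theta>
    using b that by (simp add: bnd_def)
  have tdet: "tfam \<Xi> r (\<lambda>p \<theta>. det (M p \<theta>))" if "\<And>i j. tfam \<Xi> r (\<lambda>p \<theta>. M p \<theta> $ i $ j)" for M :: "'p \<Rightarrow> complex ^ 'n \<Rightarrow> complex ^ 'n ^ 'n"
    unfolding det_def by (intro tfam_sum tfam_mult tfam_const tfam_prod that) simp
  have nz: "det (A p \<theta>) \<noteq> 0" if "p \<in> \<Xi>" "\<theta> \<in> strip r" for p \<theta>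
  proof -
    have "x = 0" if "A p \<theta> *v x = 0" for x
    proof -
      have "(\<Sum>k\<in>UNIV. X i k p \<theta> * x $ k) = 0" for i
        using arg_cong[OF that, of "\<lambda>v. v $ i"] by (simp add: A_def matrix_vector_mult_def)
      then have "cmod (x $ i) \<le> 2 * 0" for i
        by (intro near_identity_bound[where X = "\<lambda>i j. X i j p \<theta>", OF bX]) (use \<open>p \<in> \<Xi>\<close> \<open>\<theta> \<in> strip r\<close> in auto)
      then show ?thesis by (simp add: vec_eq_iff)
    qed
    then have "\<exists>B. B ** A p \<theta> = mat 1" using matrix_left_invertible_ker by blast
    then show ?thesis
      using invertible_left_inverse invertible_det_nz by blast
  qed
  have AW: "A p \<theta> *v (\<chi> k. W k j p \<theta>) = axis j 1" if "p \<in> \<Xi>" "\<theta> \<in> strip r" for p \<theta> j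
    using cramer[OF nz[OF that], of "\<chi> k. W k j p \<theta>" "axis j 1"]
    by (simp add: W_def Aj_def divide_inverse)
  have XW: "(\<Sum>k\<in>UNIV. X i k p \<theta> * W k j p \<theta>) = (if i = j then 1 else 0)" if "p \<in> \<Xi>" "\<theta> \<in> strip r" for i j p \<theta>
    using arg_cong[OF AW[OF that, of j], of "\<lambda>v. v $ i"]
    by (simp add: A_def matrix_vector_mult_def axis_def)
  show thesis
  proof
    show "tfam \<Xi> r (W i j)" for i j
      unfolding W_def[abs_def]
    proof (intro tfam_mult tfam_inverse tdet nz)
      show "tfam \<Xi> r (\<lambda>p \<theta>. Aj i j p \<theta> $ a $ c)" for a c
        by (cases "c = i") (auto simp: Aj_def A_def axis_def intro!: X tfam_const)
    qed (auto simp: A_def intro!: X)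
    show "bnd \<Xi> r (W i j) 2" for i j
      unfolding bnd_def
    proof (intro ballI)
      fix p and \<theta> :: "complex ^ 'n" assume a: "p \<in> \<Xi>" "\<theta> \<in> strip r"
      have "cmod (W i j p \<theta>) \<le> 2 * 1"
        by (rule near_identity_bound[where X = "\<lambda>i j. X i j p \<theta>" and x = "\<lambda>k. W k j p \<theta>", OF bX[OF a]]) (simp add: XW[OF a])
      then show "cmod (W i j p \<theta>) \<le> 2" by simp
    qed
    fix p and \<theta> :: "complex ^ 'n" and i j assume a: "p \<in> \<Xi>" "\<theta> \<in> strip r"
    show "(\<Sum>k\<in>UNIV. X i k p \<theta> * W k j p \<theta>) = (if i = j then 1 else 0)" by (rule XW[OF a])
    define V :: "complex ^ 'n ^ 'n" where "V = (\<chi> i j. W i j p \<theta>)"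
    have "A p \<theta> ** V = mat 1"
      using XW[OF a] by (simp add: vec_eq_iff matrix_matrix_mult_def A_def V_def mat_def)
    then have "V ** A p \<theta> = mat 1" using matrix_left_right_inverse by blast
    from arg_cong[OF this, of "\<lambda>M. M $ i $ j"]
    show "(\<Sum>k\<in>UNIV. W i k p \<theta> * X k j p \<theta>) = (if i = j then 1 else 0)"
      by (simp add: matrix_matrix_mult_def A_def V_def mat_def)
  qed
qed


section \<open>Functions of zero mean\<close>

definition zmean :: "real \<Rightarrow> (complex ^ 'n::finite \<Rightarrow> complex) \<Rightarrow> bool" where
  "zmean r f \<longleftrightarrow> holo f (strip r) \<and> cmean f = 0"

lemma cmean_add:
  assumes "holo f (strip r)" "holo g (strip r)" "r > 0"
  shows "cmean (\<lambda>\<theta>. f \<theta> + g \<theta>) = cmean f + cmean g"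
  unfolding cmean_def
  using assms(3) by (intro tmean_add continuous_on_strip_real[OF holo_continuous_on[OF assms(1)]]
    continuous_on_strip_real[OF holo_continuous_on[OF assms(2)]])

lemma cmean_diff:
  assumes "holo f (strip r)" "holo g (strip r)" "r > 0"
  shows "cmean (\<lambda>\<theta>. f \<theta> - g \<theta>) = cmean f - cmean g"
  unfolding cmean_def
  using assms(3) by (intro tmean_diff continuous_on_strip_real[OF holo_continuous_on[OF assms(1)]]
    continuous_on_strip_real[OF holo_continuous_on[OF assms(2)]])

lemma cmean_cmult: "cmean (\<lambda>\<theta>. c * f \<theta>) = c * cmean f"
  by (simp add: cmean_def tmean_cmult)

lemma cmean_const: "cmean (\<lambda>\<theta>. c) = c"
  by (simp add: cmean_def tmean_const)

lemma cmean_cong: "r > 0 \<Longrightarrow> (\<And>\<theta>. \<theta> \<in> strip r \<Longrightarrow> f \<theta> = g \<theta>) \<Longrightarrow> cmean f = cmean g"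
  unfolding cmean_def by (rule tmean_cong) auto

lemma zmean_add: "r > 0 \<Longrightarrow> zmean r f \<Longrightarrow> zmean r g \<Longrightarrow> zmean r (\<lambda>\<theta>. f \<theta> + g \<theta>)"
  by (auto simp: zmean_def cmean_add intro: holo_add)

lemma zmean_diff: "r > 0 \<Longrightarrow> zmean r f \<Longrightarrow> zmean r g \<Longrightarrow> zmean r (\<lambda>\<theta>. f \<theta> - g \<theta>)"
  by (auto simp: zmean_def cmean_diff intro: holo_diff)

lemma zmean_cmult: "zmean r f \<Longrightarrow> zmean r (\<lambda>\<theta>. c * f \<theta>)"
  by (auto simp: zmean_def cmean_cmult intro: holo_mult holo_const)

lemma zmean_sum: "r > 0 \<Longrightarrow> (\<And>i. i \<in> I \<Longrightarrow> zmean r (f i)) \<Longrightarrow> zmean r (\<lambda>\<theta>. \<Sum>i\<in>I. f i \<theta>)"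
proof (induction I rule: infinite_finite_induct)
  case (insert i I)
  then show ?case using zmean_add[of r "f i" "\<lambda>\<theta>. \<Sum>i\<in>I. f i \<theta>"] by simp
qed (auto simp: zmean_def cmean_const holo_const)

lemma zmean_ddir:
  assumes "r > 0" "holo f (strip r)" "per f r"
  shows "zmean r (\<lambda>\<theta>. ddir f \<theta> v)"
  unfolding zmean_def using holo_ddir[OF open_strip assms(2)] cmean_ddir[OF assms(2,3,1)] by blast

lemma zmean_cong:
  assumes "zmean r f" "\<And>\<theta>. \<theta> \<in> strip r \<Longrightarrow> f \<theta> = g \<theta>" "r > 0"
  shows "zmean r g"
proof -
  have "holo g (strip r)" using holo_cong[OF open_strip, of r f g] assms by (simp add: zmean_def)
  moreover have "cmean g = cmean f" using cmean_cong[of r f g] assms by simp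
  ultimately show ?thesis using assms(1) by (simp add: zmean_def)
qed

text \<open>The bracket is a divergence, \<partial>a (f \<partial>b g) - \<partial>b (f \<partial>a
  g), since the mixed second derivatives of g cancel.\<close>

lemma zmean_bracket:
  fixes f g :: "complex ^ 'n::finite \<Rightarrow> complex"
  assumes r: "r > 0" and f: "holo f (strip r)" "per f r" and g: "holo g (strip r)" "per g r"
  shows "zmean r (\<lambda>\<theta>. ddir f \<theta> a * ddir g \<theta> b - ddir f \<theta> b * ddir g \<theta> a)"
proof -
  have h: "holo (\<lambda>\<theta>. ddir g \<theta> v) (strip r)" "per (\<lambda>\<theta>. ddir g \<theta> v) r" for v
    using holo_ddir[OF open_strip g(1)] per_ddir[OF g] by blast+
  have "zmean r (\<lambda>\<theta>. ddir (\<lambda>\<theta>. f \<theta> * ddir g \<theta> b) \<theta> a - ddir (\<lambda>\<theta>. f \<theta> * ddir g \<theta> a) \<theta> b)"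
    by (intro zmean_diff zmean_ddir holo_mult per_mult f h r)
  then show ?thesis
    by (rule zmean_cong) (simp_all add: ddir_mult[OF f(1) h(1)] ddir_sym[OF open_strip g(1), of _ b a] r)
qed

section \<open>Phase space and embedded tori\<close>

definition kpt :: "('n \<Rightarrow> real ^ 'n \<Rightarrow> complex ^ 'n \<Rightarrow> complex) \<Rightarrow> ('n \<Rightarrow> real ^ 'n \<Rightarrow> complex ^ 'n \<Rightarrow> complex) \<Rightarrow>
    real ^ 'n \<Rightarrow> complex ^ 'n \<Rightarrow> complex ^ ('n::finite + 'n)" where
  "kpt v u p \<theta> = (\<chi> a. case a of Inl i \<Rightarrow> complex_of_real (p $ i) + v i p \<theta> | Inr i \<Rightarrow> \<theta> $ i + u i p \<theta>)"

definition pdom :: "real ^ 'n \<Rightarrow> real \<Rightarrow> (complex ^ ('n::finite + 'n)) set" where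
  "pdom c \<rho> = {z. \<forall>i. cmod (z $ Inl i - complex_of_real (c $ i)) < \<rho> \<and> \<bar>Im (z $ Inr i)\<bar> < \<rho>}"

definition xshift :: "int ^ 'n \<Rightarrow> complex ^ ('n::finite + 'n)" where
  "xshift k = (\<chi> a. case a of Inl i \<Rightarrow> 0 | Inr i \<Rightarrow> pvec k $ i)"

text \<open>The class is closed under partial derivatives, so what is shown for a function along a
  torus applies to the gradient and the Hessian of the Hamiltonian as well.\<close>

definition hclass :: "real ^ 'n \<Rightarrow> real \<Rightarrow> (complex ^ ('n::finite + 'n) \<Rightarrow> complex) \<Rightarrow> bool" where
  "hclass c \<rho> F \<longleftrightarrow> holo F (pdom c \<rho>) \<and> (\<forall>z\<in>pdom c \<rho>. \<forall>k. F (z + xshift k) = F z) \<and>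
     (\<forall>z\<in>pdom c \<rho>. (\<forall>a. z $ a \<in> \<real>) \<longrightarrow> F z \<in> \<real>)"

lemma open_pdom: "open (pdom c \<rho>)"
proof -
  have "pdom c \<rho> = (\<Inter>i\<in>UNIV. {z. cmod (z $ Inl i - complex_of_real (c $ i)) < \<rho>} \<inter> {z. \<bar>Im (z $ Inr i)\<bar> < \<rho>})"
    by (auto simp: pdom_def)
  also have "open \<dots>" by (intro open_INT open_Int) (auto intro!: open_Collect_less continuous_intros)
  finally show ?thesis .
qed

lemma pdom_mono: "\<rho> \<le> \<rho>' \<Longrightarrow> pdom c \<rho> \<subseteq> pdom c \<rho>'"
  unfolding pdom_def using less_le_trans by blast

lemma xshift_pdom [simp]: "z + xshift k \<in> pdom c \<rho> \<longleftrightarrow> z \<in> pdom c \<rho>"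
  by (simp add: pdom_def xshift_def pvec_nth)

lemma pdom_disc:
  assumes "z \<in> pdom c (\<rho> - d)" "\<And>a. cmod (t * v $ a) \<le> d"
  shows "z + t *s v \<in> pdom c \<rho>"
  unfolding pdom_def
proof (intro CollectI allI conjI)
  fix i
  have "cmod ((z + t *s v) $ Inl i - complex_of_real (c $ i)) \<le> cmod (z $ Inl i - complex_of_real (c $ i)) + cmod (t * v $ Inl i)"
    using norm_triangle_ineq[of "z $ Inl i - complex_of_real (c $ i)" "t * v $ Inl i"] by (simp add: algebra_simps)
  also have "\<dots> < \<rho>" using assms(1) assms(2)[of "Inl i"] by (auto simp: pdom_def dest!: spec[of _ i])
  finally show "cmod ((z + t *s v) $ Inl i - complex_of_real (c $ i)) < \<rho>" .
  have "\<bar>Im (t * v $ Inr i)\<bar> \<le> d" using abs_Im_le_cmod assms(2) order_trans by blast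
  then show "\<bar>Im ((z + t *s v) $ Inr i)\<bar> < \<rho>" using assms(1) by (auto simp: pdom_def dest!: spec[of _ i])
qed

lemma pd_bound_pdom:
  assumes "holo F (pdom c \<rho>)" "\<And>z. z \<in> pdom c \<rho> \<Longrightarrow> cmod (F z) \<le> C" "d > 0" "z \<in> pdom c (\<rho> - d)"
  shows "cmod (pd a F z) \<le> C / d"
  unfolding pd_def
proof (rule ddir_bound[OF open_pdom assms(1)])
  show "z + t *s axis a 1 \<in> pdom c \<rho>" if "cmod t \<le> d" for t
    by (rule pdom_disc[OF assms(4)]) (use that assms(3) in \<open>auto simp: axis_def\<close>)
  then show "cmod (F (z + t *s axis a 1)) \<le> C" if "cmod t \<le> d" for t using that assms(2) by blast
qed (use assms in auto)

lemma hclass_pd: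
  assumes "hclass c \<rho> F"
  shows "hclass c \<rho> (pd a F)"
  unfolding hclass_def
proof (intro conjI ballI allI impI)
  have F: "holo F (pdom c \<rho>)" using assms by (simp add: hclass_def)
  show "holo (pd a F) (pdom c \<rho>)" by (rule holo_pd[OF open_pdom F])
  fix z assume z: "z \<in> pdom c \<rho>"
  define S where "S = (\<lambda>t. z + t *s axis a 1) -` pdom c \<rho>"
  have "open S" unfolding S_def using open_pdom
    by (intro open_vimage continuous_intros bounded_linear.continuous_on[OF bounded_linear_csmult])
  moreover have "0 \<in> S" using z by (simp add: S_def)
  ultimately have ev: "\<forall>\<^sub>F t in nhds 0. t \<in> S" by (simp add: eventually_nhds_in_open)
  show "pd a F (z + xshift k) = pd a F z" for k
  proof -
    have "\<forall>\<^sub>F t in nhds 0. F (z + xshift k + t *s axis a 1) = F (z + t *s axis a 1)"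
      using ev
    proof eventually_elim
      case (elim t)
      then have "F (z + t *s axis a 1 + xshift k) = F (z + t *s axis a 1)"
        using assms by (simp add: hclass_def S_def)
      then show ?case by (simp add: ac_simps)
    qed
    then show ?thesis unfolding pd_def ddir_def by (rule deriv_cong_ev) simp
  qed
  show "pd a F z \<in> \<real>" if "\<forall>a. z $ a \<in> \<real>"
    unfolding pd_def
  proof (rule ddir_real[OF open_pdom F z])
    fix t :: real assume "z + of_real t *s axis a 1 \<in> pdom c \<rho>"
    moreover have "\<forall>b. (z + of_real t *s axis a 1) $ b \<in> \<real>" using that by (simp add: axis_def)
    ultimately show "F (z + of_real t *s axis a 1) \<in> \<real>" using assms unfolding hclass_def by blast
  qed
qed

lemma sum_Plus_UNIV: "(\<Sum>a\<in>(UNIV :: ('m::finite + 'n::finite) set). f a) = (\<Sum>i\<in>UNIV. f (Inl i)) + (\<Sum>i\<in>UNIV. f (Inr i))"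
  by (subst UNIV_Plus_UNIV[symmetric], subst sum.Plus) (auto simp: o_def)

lemma
  fixes F :: "complex ^ ('n::finite + 'n) \<Rightarrow> complex"
  assumes F: "hclass c \<rho> F" and v: "\<And>i. tfam \<Xi> r (v i)" and u: "\<And>i. tfam \<Xi> r (u i)"
    and K: "\<And>p \<theta>. p \<in> \<Xi> \<Longrightarrow> \<theta> \<in> strip r \<Longrightarrow> kpt v u p \<theta> \<in> pdom c \<rho>" and r: "r > 0"
  shows tfam_kpt: "tfam \<Xi> r (\<lambda>p \<theta>. F (kpt v u p \<theta>))"
    and ddir_kpt: "p \<in> \<Xi> \<Longrightarrow> \<theta> \<in> strip r \<Longrightarrow> ddir (\<lambda>\<theta>. F (kpt v u p \<theta>)) \<theta> w =
      (\<Sum>i\<in>UNIV. pd (Inl i) F (kpt v u p \<theta>) * ddir (v i p) \<theta> w) +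
      (\<Sum>i\<in>UNIV. pd (Inr i) F (kpt v u p \<theta>) * (w $ i + ddir (u i p) \<theta> w))"
proof -
  have hF: "holo F (pdom c \<rho>)" using F by (simp add: hclass_def)
  have hK: "holo (\<lambda>\<theta>. kpt v u p \<theta> $ a) (strip r)" if "p \<in> \<Xi>" for p a
    by (cases a) (auto simp: kpt_def intro!: holo_add holo_const holo_nth tfam_holo[OF v that] tfam_holo[OF u that])
  have cK: "continuous_on (\<Xi> \<times> strip r) (\<lambda>(p, \<theta>). kpt v u p \<theta> $ a)" for a
  proof (cases a)
    case (Inl i)
    then show ?thesis using tfam_continuous[OF v, of i] unfolding split_beta
      by (auto simp: kpt_def intro!: continuous_intros)
  next
    case (Inr i)
    then show ?thesis using tfam_continuous[OF u, of i] unfolding split_beta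
      by (auto simp: kpt_def intro!: continuous_intros)
  qed
  have "continuous_on (\<Xi> \<times> strip r) (\<lambda>x. \<chi> a. kpt v u (fst x) (snd x) $ a)"
    using cK by (intro continuous_on_vec_lambda) (simp add: split_beta)
  then have "continuous_on (\<Xi> \<times> strip r) (\<lambda>x. kpt v u (fst x) (snd x))" by (simp add: vec_nth_inverse)
  then have "continuous_on (\<Xi> \<times> strip r) (\<lambda>x. F (kpt v u (fst x) (snd x)))"
    by (rule continuous_on_compose2[OF holo_continuous_on[OF hF]]) (use K in auto)
  then have "continuous_on (\<Xi> \<times> strip r) (\<lambda>(p, \<theta>). F (kpt v u p \<theta>))"
    by (simp add: split_beta)
  moreover have "holo (\<lambda>\<theta>. F (kpt v u p \<theta>)) (strip r)" if "p \<in> \<Xi>" for p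
    by (rule holo_compose[OF hF hK[OF that] K[OF that]])
  moreover have "per (\<lambda>\<theta>. F (kpt v u p \<theta>)) r" if p: "p \<in> \<Xi>" for p
    unfolding per_def
  proof (intro ballI allI)
    fix \<theta> :: "complex ^ 'n" and k assume \<theta>: "\<theta> \<in> strip r"
    have "kpt v u p (\<theta> + pvec k) = kpt v u p \<theta> + xshift k"
      using tfam_per[OF v p] tfam_per[OF u p] \<theta>
      by (auto simp: kpt_def xshift_def vec_eq_iff per_def split: sum.split)
    then show "F (kpt v u p (\<theta> + pvec k)) = F (kpt v u p \<theta>)"
      using F K[OF p \<theta>] by (simp add: hclass_def)
  qed
  moreover have "F (kpt v u p (cvec x)) \<in> \<real>" if p: "p \<in> \<Xi>" for p x
  proof -
    have "\<forall>a. kpt v u p (cvec x) $ a \<in> \<real>"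
      using tfam_real[OF v p] tfam_real[OF u p] by (auto simp: kpt_def split: sum.split)
    then show ?thesis using F K[OF p cvec_in_strip[OF r]] by (simp add: hclass_def)
  qed
  ultimately show "tfam \<Xi> r (\<lambda>p \<theta>. F (kpt v u p \<theta>))" unfolding tfam_def by blast
  assume p: "p \<in> \<Xi>" and \<theta>: "\<theta> \<in> strip r"
  have "ddir (\<lambda>\<theta>. kpt v u p \<theta> $ Inl i) \<theta> w = ddir (v i p) \<theta> w" for i
    using ddir_add[OF holo_const tfam_holo[OF v p], of \<theta>] \<theta> by (simp add: kpt_def ddir_const)
  moreover have "ddir (\<lambda>\<theta>. kpt v u p \<theta> $ Inr i) \<theta> w = w $ i + ddir (u i p) \<theta> w" for i
    using ddir_add[OF holo_nth tfam_holo[OF u p], of \<theta>] \<theta> by (simp add: kpt_def ddir_nth)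
  moreover have "ddir (\<lambda>\<theta>. F (kpt v u p \<theta>)) \<theta> w =
      (\<Sum>a\<in>UNIV. pd a F (kpt v u p \<theta>) * ddir (\<lambda>\<theta>. kpt v u p \<theta> $ a) \<theta> w)"
    by (rule ddir_compose[OF hF hK[OF p] K[OF p] \<theta>])
  ultimately show "ddir (\<lambda>\<theta>. F (kpt v u p \<theta>)) \<theta> w =
      (\<Sum>i\<in>UNIV. pd (Inl i) F (kpt v u p \<theta>) * ddir (v i p) \<theta> w) +
      (\<Sum>i\<in>UNIV. pd (Inr i) F (kpt v u p \<theta>) * (w $ i + ddir (u i p) \<theta> w))"
    by (simp add: sum_Plus_UNIV)
qed

text \<open>A solution is determined up to a constant. Normalising the mean costs the factor 2 and
  makes \<open>small_divisor_estimate\<close> applicable to the solution.\<close>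

lemma tfam_solve_zmean:
  fixes f :: "'p::metric_space \<Rightarrow> complex ^ 'n::finite \<Rightarrow> complex"
  assumes d: "dioph \<omega> \<gamma> \<tau>" and \<delta>: "0 < \<delta>" "\<delta> \<le> 1" "\<delta> < r"
    and f: "tfam \<Xi> r f" "bnd \<Xi> r f C" and m: "\<And>p. p \<in> \<Xi> \<Longrightarrow> cmean (f p) = 0"
  obtains g where "tfam \<Xi> (r - \<delta>) g" "bnd \<Xi> (r - \<delta>) g (2 * C * sd_bound TYPE('n) \<gamma> \<tau> \<delta>)"
    "\<And>p \<theta>. p \<in> \<Xi> \<Longrightarrow> \<theta> \<in> strip (r - \<delta>) \<Longrightarrow> ddir (g p) \<theta> (cvec \<omega>) = f p \<theta>"
    "\<And>p. p \<in> \<Xi> \<Longrightarrow> cmean (g p) = 0"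
proof -
  obtain g where g: "tfam \<Xi> (r - \<delta>) g" "bnd \<Xi> (r - \<delta>) g (C * sd_bound TYPE('n) \<gamma> \<tau> \<delta>)"
    "\<And>p \<theta>. p \<in> \<Xi> \<Longrightarrow> \<theta> \<in> strip (r - \<delta>) \<Longrightarrow> ddir (g p) \<theta> (cvec \<omega>) = f p \<theta>"
    using tfam_solve[OF assms] by blast
  have r: "r - \<delta> > 0" using \<delta> by simp
  define g' where "g' p \<theta> = g p \<theta> - cmean (g p)" for p \<theta>
  show thesis
  proof
    show "tfam \<Xi> (r - \<delta>) g'" unfolding g'_def[abs_def] by (rule tfam_diff[OF g(1) tfam_cmean[OF g(1) r]])
    show "bnd \<Xi> (r - \<delta>) g' (2 * C * sd_bound TYPE('n) \<gamma> \<tau> \<delta>)"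
      using bnd_diff[OF g(2) bnd_cmean[OF g(1,2) r]] by (simp add: g'_def[abs_def] mult.assoc)
    show "ddir (g' p) \<theta> (cvec \<omega>) = f p \<theta>" if "p \<in> \<Xi>" "\<theta> \<in> strip (r - \<delta>)" for p \<theta>
      unfolding g'_def[abs_def] ddir_diff[OF tfam_holo[OF g(1) that(1)] holo_const that(2)] ddir_const
      using g(3)[OF that] by simp
    show "cmean (g' p) = 0" if "p \<in> \<Xi>" for p
      unfolding g'_def[abs_def] cmean_diff[OF tfam_holo[OF g(1) that] holo_const r] cmean_const by simp
  qed
qed

text \<open>Turns a quantity obtained as a family over a strip into a function of p alone, which
  then belongs to \<open>tfam\<close> for every width.\<close>

lemma tfam_at_0:
  fixes f :: "'p::metric_space \<Rightarrow> complex ^ 'n::finite \<Rightarrow> complex"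
  assumes f: "tfam \<Xi> r f" and r: "r > 0"
  shows "tfam \<Xi> r' (\<lambda>p \<theta>. f p 0)"
proof (rule tfam_param)
  have 0: "(0 :: complex ^ 'n) \<in> strip r" using r by (simp add: strip_def)
  have "continuous_on \<Xi> (\<lambda>p. (\<lambda>(p, \<theta>). f p \<theta>) (p, 0))"
    by (rule continuous_on_compose2[OF tfam_continuous[OF f]]) (use 0 in \<open>auto intro!: continuous_intros\<close>)
  then show "continuous_on \<Xi> (\<lambda>p. f p 0)" by simp
  have "cvec (0 :: real ^ 'n) = 0" by (simp add: vec_eq_iff)
  then show "f p 0 \<in> \<real>" if "p \<in> \<Xi>" for p using tfam_real[OF f that, of 0] by simp
qed


section \<open>The invariance equation and the Newton step\<close>

lemma transpose_add: "transpose (A + B :: 'a::semiring_1 ^ 'n ^ 'm) = transpose A + transpose B"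
  and transpose_diff: "transpose (C - D :: 'b::ring_1 ^ 'n ^ 'm) = transpose C - transpose D"
  by (simp_all add: transpose_def vec_eq_iff)

text \<open>Pointwise linear algebra of the Newton step, with D the derivative along \<omega>, du =
  X a and dv = Y a + w. The columns of X and Y are tangent vectors and solve the linearised
  equations up to the derivatives E1, E2 of the defects, so the terms linear in a cancel up to E1 a
  and E2 a. The equation for b, the product of \<open>transpose X\<close> with w, removes the rest
  of the action equation up to E1 acting on w and the matrix of the pulled back symplectic form
  acting on Da. Every term left is a product of two small quantities.\<close>

lemma newton_residual:
  fixes X Y W DX DY E1 E2 Hyy Hyx Hxy Hxx :: "complex ^ 'n::finite ^ 'n"
  assumes DX: "DX = E1 + Hyx ** X + Hyy ** Y" and DY: "DY = E2 - (Hxx ** X + Hxy ** Y)"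
    and sym: "transpose Hyy = Hyy" "transpose Hyx = Hxy" and W: "X ** W = mat 1"
    and Dw: "transpose DX *v w + transpose X *v Dw = Db"
    and Db: "Db = transpose Y *v (dl + e1) - transpose X *v e2"
    and Da: "Da = W *v (Hyy *v w - dl - e1)"
  shows "DX *v a + X *v Da - Hyx *v (X *v a) - Hyy *v (Y *v a + w) + dl + e1 = E1 *v a"
    and "DY *v a + Y *v Da + Dw + Hxx *v (X *v a) + Hxy *v (Y *v a + w) + e2 =
      E2 *v a + transpose W *v ((transpose X ** Y - transpose Y ** X) *v Da - transpose E1 *v w)"
proof -
  note md = matrix_vector_mult_add_rdistrib matrix_vector_mult_diff_rdistrib
    matrix_vector_right_distrib matrix_vector_mult_diff_distrib matrix_vector_mul_assoc[symmetric]
  have mv_minus: "A *v (- z) = - (A *v z)" for A :: "complex ^ 'n ^ 'n" and z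
    by (simp add: matrix_vector_mult_def vec_eq_iff sum_negf)
  have XDa: "X *v Da = Hyy *v w - dl - e1"
    unfolding Da matrix_vector_mul_assoc W by simp
  show "DX *v a + X *v Da - Hyx *v (X *v a) - Hyy *v (Y *v a + w) + dl + e1 = E1 *v a"
    unfolding XDa DX by (simp add: md)
  have WX: "transpose W *v (transpose X *v z) = z" for z
    unfolding matrix_vector_mul_assoc matrix_transpose_mul[symmetric] W by (simp add: transpose_mat)
  have "transpose DX *v w = transpose E1 *v w + transpose X *v (Hxy *v w) + transpose Y *v (Hyy *v w)"
    unfolding DX transpose_add matrix_transpose_mul sym by (simp add: md)
  then have "transpose X *v Dw = - (transpose Y *v (X *v Da)) - transpose X *v (e2 + Hxy *v w) - transpose E1 *v w"
    using Dw unfolding Db XDa by (simp add: md algebra_simps)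
  then have "transpose W *v (transpose X *v Dw) = transpose W *v (- (transpose Y *v (X *v Da)) - transpose X *v (e2 + Hxy *v w) - transpose E1 *v w)"
    by simp
  then have Dw': "Dw = - (transpose W *v (transpose Y *v (X *v Da))) - (e2 + Hxy *v w) - transpose W *v (transpose E1 *v w)"
    unfolding WX matrix_vector_mult_diff_distrib by (simp add: mv_minus WX)
  show "DY *v a + Y *v Da + Dw + Hxx *v (X *v a) + Hxy *v (Y *v a + w) + e2 =
      E2 *v a + transpose W *v ((transpose X ** Y - transpose Y ** X) *v Da - transpose E1 *v w)"
    unfolding Dw' DY by (simp only: md WX) simp
qed

text \<open>A linear Hamiltonian flow preserves the symplectic form: the Hessian terms cancel by
  symmetry and only the forcing by E1 and E2 remains.\<close>

lemma lagrangian_defect: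
  fixes X Y DX DY E1 E2 Hyy Hyx Hxy Hxx :: "complex ^ 'n::finite ^ 'n"
  assumes DX: "DX = E1 + Hyx ** X + Hyy ** Y" and DY: "DY = E2 - (Hxx ** X + Hxy ** Y)"
    and sym: "transpose Hyy = Hyy" "transpose Hyx = Hxy" "transpose Hxx = Hxx"
  shows "transpose DX ** Y + transpose X ** DY - transpose DY ** X - transpose Y ** DX =
    transpose E1 ** Y + transpose X ** E2 - transpose E2 ** X - transpose Y ** E1"
proof -
  have sym': "transpose Hxy = Hyx" using sym(2) transpose_transpose by metis
  have d: "A ** (B - C) = A ** B - A ** C" "(B - C) ** A = B ** A - C ** A" "(B + C) ** A = B ** A + C ** A"
    for A B C :: "complex ^ 'n ^ 'n"
    by (simp_all add: matrix_matrix_mult_def vec_eq_iff sum_subtractf sum.distrib algebra_simps)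
  show ?thesis
    unfolding DX DY transpose_add transpose_diff matrix_transpose_mul sym sym'
    by (simp add: matrix_add_ldistrib d matrix_mul_assoc)
qed

section \<open>The data that stay fixed during the iteration\<close>

locale kam =
  fixes \<Xi> :: "(real ^ 'n::finite) set" and c :: "real ^ 'n" and \<rho> B \<gamma> \<tau> :: real
    and \<omega> :: "real ^ 'n" and H :: "complex ^ ('n + 'n) \<Rightarrow> complex"
  assumes compact_Xi: "compact \<Xi>" and Xi: "\<And>p i. p \<in> \<Xi> \<Longrightarrow> \<bar>p $ i - c $ i\<bar> \<le> \<rho> / 8"
    and rho: "0 < \<rho>" and H: "hclass c \<rho> H" and HB: "\<And>z. z \<in> pdom c \<rho> \<Longrightarrow> cmod (H z) \<le> B"
    and dioph: "dioph \<omega> \<gamma> \<tau>"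
begin

text \<open>The defects of \<open>\<theta> \<mapsto> (p + v \<theta>, \<theta> + u \<theta>)\<close> as an invariant torus of the Hamiltonian
  \<open>H - l \<bullet> y\<close>, in the angle and in the action equation.\<close>

definition e1 :: "('n \<Rightarrow> real ^ 'n \<Rightarrow> complex ^ 'n \<Rightarrow> complex) \<Rightarrow> ('n \<Rightarrow> real ^ 'n \<Rightarrow> complex ^ 'n \<Rightarrow> complex) \<Rightarrow>
    ('n \<Rightarrow> real ^ 'n \<Rightarrow> complex) \<Rightarrow> 'n \<Rightarrow> real ^ 'n \<Rightarrow> complex ^ 'n \<Rightarrow> complex" where
  "e1 v u l i p \<theta> = complex_of_real (\<omega> $ i) + ddir (u i p) \<theta> (cvec \<omega>) + l i p - pd (Inl i) H (kpt v u p \<theta>)"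

definition e2 :: "('n \<Rightarrow> real ^ 'n \<Rightarrow> complex ^ 'n \<Rightarrow> complex) \<Rightarrow> ('n \<Rightarrow> real ^ 'n \<Rightarrow> complex ^ 'n \<Rightarrow> complex) \<Rightarrow>
    'n \<Rightarrow> real ^ 'n \<Rightarrow> complex ^ 'n \<Rightarrow> complex" where
  "e2 v u i p \<theta> = ddir (v i p) \<theta> (cvec \<omega>) + pd (Inr i) H (kpt v u p \<theta>)"

lemma B_nonneg: "B \<ge> 0"
proof -
  have "(\<chi> a. case a of Inl i \<Rightarrow> complex_of_real (c $ i) | Inr i \<Rightarrow> 0) \<in> pdom c \<rho>"
    using rho by (simp add: pdom_def)
  from HB[OF this] show ?thesis using norm_ge_zero order_trans by blast
qed

lemma hclass_H: "hclass c \<rho> (pd a H)" "hclass c \<rho> (pd b (pd a H))"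
  by (intro hclass_pd H)+

lemma holo_H: "holo H (pdom c \<rho>)" "holo (pd a H) (pdom c \<rho>)" "holo (pd b (pd a H)) (pdom c \<rho>)"
  using H hclass_H by (auto simp: hclass_def)

text \<open>The radius budget of \<open>H\<close>: the torus stays in
  \<open>pdom c (\<rho> / 2)\<close>, and each of two derivatives costs \<rho>/4 of the other
  half.\<close>

lemma pd_H_bound: "z \<in> pdom c (3 * \<rho> / 4) \<Longrightarrow> cmod (pd a H z) \<le> 4 * B / \<rho>"
  using pd_bound_pdom[OF holo_H(1) HB, of "\<rho> / 4" z a] rho by (simp add: field_simps)

lemma pd_pd_H_bound:
  assumes "z \<in> pdom c (\<rho> / 2)"
  shows "cmod (pd b (pd a H) z) \<le> 16 * B / \<rho>\<^sup>2"
proof -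
  have "cmod (pd b (pd a H) z) \<le> 4 * B / \<rho> / (\<rho> / 4)"
  proof (rule pd_bound_pdom[OF holo_subset[OF holo_H(2) pdom_mono] pd_H_bound])
    show "3 * \<rho> / 4 \<le> \<rho>" using rho by simp
    show "z \<in> pdom c (3 * \<rho> / 4 - \<rho> / 4)" using assms by (simp add: field_simps)
  qed (use rho in auto)
  then show ?thesis using rho by (simp add: power2_eq_square field_simps)
qed

text \<open>This is \<open>taylor2_dir\<close> along w with s = 1. The disc radius \<rho>/(4d) keeps
  the points where first derivatives are bounded by 4B/\<rho>, and d \<le> \<rho>/8 makes it at
  least 2. The constant is 8 (4B/\<rho>) (4d/\<rho>)^2.\<close>

lemma taylor_pd_H:
  assumes z: "z \<in> pdom c (\<rho> / 2)" and w: "\<And>a. cmod (w $ a) \<le> d" and d: "0 \<le> d" "d \<le> \<rho> / 8"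
  shows "cmod (pd a H (z + w) - pd a H z - (\<Sum>b\<in>UNIV. w $ b * pd b (pd a H) z)) \<le> 512 * B / \<rho> ^ 3 * d\<^sup>2"
proof (cases "d = 0")
  case True
  then have "w = 0" using w by (simp add: vec_eq_iff)
  then show ?thesis using True by simp
next
  case False
  define R where "R = \<rho> / (4 * d)"
  have R: "R \<ge> 2" "R > 0" using d rho False by (auto simp: R_def field_simps)
  have zin: "z \<in> pdom c \<rho>" using z pdom_mono[of "\<rho> / 2" \<rho> c] rho by auto
  have in2: "z + t *s w \<in> pdom c (3 * \<rho> / 4)" if "cmod t \<le> R" for t
  proof (rule pdom_disc)
    show "z \<in> pdom c (3 * \<rho> / 4 - \<rho> / 4)" using z by (simp add: field_simps)
    fix b
    have "cmod (t * w $ b) \<le> R * d" unfolding norm_mult by (intro mult_mono that w) (use R in auto)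
    also have "\<dots> = \<rho> / 4" using False by (simp add: R_def)
    finally show "cmod (t * w $ b) \<le> \<rho> / 4" .
  qed
  have in1: "z + t *s w \<in> pdom c \<rho>" if "cmod t \<le> R" for t
    using in2[OF that] pdom_mono[of "3 * \<rho> / 4" \<rho> c] rho by auto
  have "cmod (pd a H (z + 1 *s w) - pd a H z - 1 * ddir (pd a H) z w) \<le> 8 * (4 * B / \<rho>) * (cmod 1)\<^sup>2 / R\<^sup>2"
    by (rule taylor2_dir[OF open_pdom holo_H(2)[of a] R(2) in1 pd_H_bound[OF in2]]) (use R in auto)
  also have "8 * (4 * B / \<rho>) * (cmod 1)\<^sup>2 / R\<^sup>2 = 512 * B / \<rho> ^ 3 * d\<^sup>2"
    using False rho by (simp add: R_def power2_eq_square power3_eq_cube field_simps)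
  finally show ?thesis by (simp add: ddir_eq_sum_pd[OF holo_H(2) zin])
qed

end

section \<open>Geometry of an approximate torus\<close>

locale kam_state = kam \<Xi> c \<rho> B \<gamma> \<tau> \<omega> H
  for \<Xi> :: "(real ^ 'n::finite) set" and c \<rho> B \<gamma> \<tau> \<omega> H +
  fixes v u :: "'n \<Rightarrow> real ^ 'n \<Rightarrow> complex ^ 'n \<Rightarrow> complex" and l :: "'n \<Rightarrow> real ^ 'n \<Rightarrow> complex" and r c1 :: real
  assumes r: "0 < r" "r \<le> \<rho> / 4"
    and v: "\<And>i. tfam \<Xi> r (v i)" and u: "\<And>i. tfam \<Xi> r (u i)" and l: "\<And>i. tfam \<Xi> r (\<lambda>p (\<theta> :: complex ^ 'n). l i p)"
    and bv: "\<And>i. bnd \<Xi> r (v i) c1" and bu: "\<And>i. bnd \<Xi> r (u i) c1"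
    and bdv: "\<And>i j. bnd \<Xi> r (\<lambda>p. pd j (v i p)) c1" and bdu: "\<And>i j. bnd \<Xi> r (\<lambda>p. pd j (u i p)) c1"
    and c1: "0 \<le> c1" "c1 \<le> \<rho> / 8" "c1 \<le> 1 / (2 * real CARD('n))"
begin

text \<open>\<open>X\<close> and \<open>Y\<close> are the angle and action parts of the Jacobian of
  the embedding; their columns are tangent vectors of the torus.\<close>

definition X where "X i j p \<theta> = (if i = j then 1 else 0) + pd j (u i p) \<theta>"
definition Y where "Y i j p \<theta> = pd j (v i p) \<theta>"
definition Q where "Q a b p \<theta> = pd b (pd a H) (kpt v u p \<theta>)"

text \<open>In the actions p and v take \<rho>/8 each; in the angles u takes \<rho>/8 and the strip
  \<rho>/4.\<close>

lemma kpt_dom: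
  assumes "p \<in> \<Xi>" "\<theta> \<in> strip r"
  shows "kpt v u p \<theta> \<in> pdom c (\<rho> / 2)"
  unfolding pdom_def
proof (intro CollectI allI conjI)
  fix i
  have "cmod (v i p \<theta>) \<le> c1" "cmod (u i p \<theta>) \<le> c1"
    using bv[of i] bu[of i] assms by (auto simp: bnd_def)
  then have "cmod (v i p \<theta>) \<le> \<rho> / 8" "cmod (u i p \<theta>) \<le> \<rho> / 8" using c1 by linarith+
  moreover have "cmod (kpt v u p \<theta> $ Inl i - complex_of_real (c $ i)) \<le> cmod (complex_of_real (p $ i - c $ i)) + cmod (v i p \<theta>)"
    using norm_triangle_ineq[of "complex_of_real (p $ i - c $ i)" "v i p \<theta>"] by (simp add: kpt_def algebra_simps)
  moreover have "cmod (complex_of_real (p $ i - c $ i)) \<le> \<rho> / 8" using Xi[OF assms(1)] by (simp only: norm_of_real)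
  ultimately show "cmod (kpt v u p \<theta> $ Inl i - complex_of_real (c $ i)) < \<rho> / 2" using rho by linarith
  have "\<bar>Im (u i p \<theta>)\<bar> \<le> \<rho> / 8" using \<open>cmod (u i p \<theta>) \<le> \<rho> / 8\<close> abs_Im_le_cmod order_trans by blast
  moreover have "\<bar>Im (\<theta> $ i)\<bar> < r" using assms(2) by (simp add: strip_def)
  then have "\<bar>Im (\<theta> $ i)\<bar> < \<rho> / 4" using r(2) by linarith
  ultimately show "\<bar>Im (kpt v u p \<theta> $ Inr i)\<bar> < \<rho> / 2"
    using rho abs_triangle_ineq[of "Im (\<theta> $ i)" "Im (u i p \<theta>)"] by (simp add: kpt_def)
qed

lemma kpt_dom': "p \<in> \<Xi> \<Longrightarrow> \<theta> \<in> strip r \<Longrightarrow> kpt v u p \<theta> \<in> pdom c \<rho>"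
  using kpt_dom pdom_mono[of "\<rho> / 2" \<rho> c] rho by auto

lemma tfam_Q: "tfam \<Xi> r (Q a b)"
  unfolding Q_def[abs_def] by (rule tfam_kpt[OF hclass_H(2) v u kpt_dom' r(1)])

lemma bnd_Q: "bnd \<Xi> r (Q a b) (16 * B / \<rho>\<^sup>2)"
  unfolding bnd_def Q_def using pd_pd_H_bound kpt_dom by blast

lemma tfam_X: "tfam \<Xi> r (X i j)" and tfam_Y: "tfam \<Xi> r (Y i j)"
  unfolding X_def[abs_def] Y_def[abs_def]
  by (intro tfam_add tfam_const tfam_pd compact_Xi u v r; simp)+

lemma bnd_X: "bnd \<Xi> r (X i j) 2" and bnd_Y: "bnd \<Xi> r (Y i j) c1"
proof -
  have "1 \<le> real CARD('n)" by (simp add: Suc_leI)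
  then have "1 / (2 * real CARD('n)) \<le> 1 / 1" by (intro divide_left_mono) linarith+
  then have "c1 \<le> 1" using c1(3) by linarith
  moreover have "bnd \<Xi> r (\<lambda>p (\<theta> :: complex ^ 'n). if i = j then 1 else 0) 1" by (simp add: bnd_def)
  from bnd_add[OF this bdu] have "bnd \<Xi> r (X i j) (1 + c1)" unfolding X_def[abs_def] .
  ultimately show "bnd \<Xi> r (X i j) 2" by (elim bnd_mono) auto
  show "bnd \<Xi> r (Y i j) c1" unfolding Y_def[abs_def] by (rule bdv)
qed

lemma tfam_H: "hclass c \<rho> F \<Longrightarrow> tfam \<Xi> r (\<lambda>p \<theta>. F (kpt v u p \<theta>))"
  by (rule tfam_kpt[OF _ v u kpt_dom' r(1)])

lemma ddir_H:
  assumes "hclass c \<rho> F" "p \<in> \<Xi>" "\<theta> \<in> strip r"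
  shows "ddir (\<lambda>\<theta>. F (kpt v u p \<theta>)) \<theta> w =
      (\<Sum>i\<in>UNIV. pd (Inl i) F (kpt v u p \<theta>) * ddir (v i p) \<theta> w) +
      (\<Sum>i\<in>UNIV. pd (Inr i) F (kpt v u p \<theta>) * (w $ i + ddir (u i p) \<theta> w))"
  by (rule ddir_kpt[OF assms(1) v u kpt_dom' r(1) assms(2,3)])

lemma tfam_e1: "tfam \<Xi> r (e1 v u l i)"
  unfolding e1_def[abs_def]
  by (intro tfam_add tfam_diff tfam_const tfam_ddir tfam_H hclass_H compact_Xi u l r) simp

lemma tfam_e2: "tfam \<Xi> r (e2 v u i)"
  unfolding e2_def[abs_def] by (intro tfam_add tfam_ddir tfam_H hclass_H compact_Xi v r)

text \<open>The variational equation along the approximate torus: the defect is differentiated in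
  one angle, and this derivative is exchanged with the one along \<omega>. The counterterm drops out
  because it is constant in \<theta>.\<close>

lemma ddir_X:
  assumes p: "p \<in> \<Xi>" and \<theta>: "\<theta> \<in> strip r"
  shows "ddir (X i j p) \<theta> (cvec \<omega>) = pd j (e1 v u l i p) \<theta> +
     (\<Sum>k\<in>UNIV. Q (Inl i) (Inr k) p \<theta> * X k j p \<theta>) + (\<Sum>k\<in>UNIV. Q (Inl i) (Inl k) p \<theta> * Y k j p \<theta>)"
proof -
  have hu: "holo (u i p) (strip r)" by (rule tfam_holo[OF u p])
  have h1: "holo (\<lambda>\<theta>. ddir (u i p) \<theta> (cvec \<omega>)) (strip r)" by (rule holo_ddir[OF open_strip hu])
  have h2: "holo (\<lambda>\<theta>. pd (Inl i) H (kpt v u p \<theta>)) (strip r)"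
    by (rule tfam_holo[OF tfam_H[OF hclass_H(1)] p])
  have "ddir (X i j p) \<theta> (cvec \<omega>) = ddir (pd j (u i p)) \<theta> (cvec \<omega>)"
    unfolding X_def[abs_def] ddir_add[OF holo_const holo_pd[OF open_strip hu] \<theta>] ddir_const by simp
  also have "\<dots> = pd j (\<lambda>\<theta>. ddir (u i p) \<theta> (cvec \<omega>)) \<theta>"
    unfolding pd_def by (rule ddir_sym[OF open_strip hu \<theta>])
  finally have a: "ddir (X i j p) \<theta> (cvec \<omega>) = pd j (\<lambda>\<theta>. ddir (u i p) \<theta> (cvec \<omega>)) \<theta>" .
  have "pd j (e1 v u l i p) \<theta> = pd j (\<lambda>\<theta>. ddir (u i p) \<theta> (cvec \<omega>)) \<theta> - pd j (\<lambda>\<theta>. pd (Inl i) H (kpt v u p \<theta>)) \<theta>"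
    unfolding e1_def[abs_def] pd_def[of j]
    by (simp add: ddir_diff[OF holo_add[OF holo_add[OF holo_const h1] holo_const] h2 \<theta>]
        ddir_add[OF holo_add[OF holo_const h1] holo_const \<theta>] ddir_add[OF holo_const h1 \<theta>] ddir_const)
  moreover have "pd j (\<lambda>\<theta>. pd (Inl i) H (kpt v u p \<theta>)) \<theta> =
      (\<Sum>k\<in>UNIV. Q (Inl i) (Inl k) p \<theta> * Y k j p \<theta>) + (\<Sum>k\<in>UNIV. Q (Inl i) (Inr k) p \<theta> * X k j p \<theta>)"
    unfolding pd_def[of j "\<lambda>\<theta>. pd (Inl i) H (kpt v u p \<theta>)"] ddir_H[OF hclass_H(1) p \<theta>]
    by (intro arg_cong2[where f = "(+)"] sum.cong) (auto simp: Q_def X_def Y_def pd_def axis_def)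
  ultimately show ?thesis using a by simp
qed

lemma ddir_Y:
  assumes p: "p \<in> \<Xi>" and \<theta>: "\<theta> \<in> strip r"
  shows "ddir (Y i j p) \<theta> (cvec \<omega>) = pd j (e2 v u i p) \<theta> -
     ((\<Sum>k\<in>UNIV. Q (Inr i) (Inr k) p \<theta> * X k j p \<theta>) + (\<Sum>k\<in>UNIV. Q (Inr i) (Inl k) p \<theta> * Y k j p \<theta>))"
proof -
  have hv: "holo (v i p) (strip r)" by (rule tfam_holo[OF v p])
  have h1: "holo (\<lambda>\<theta>. ddir (v i p) \<theta> (cvec \<omega>)) (strip r)" by (rule holo_ddir[OF open_strip hv])
  have h2: "holo (\<lambda>\<theta>. pd (Inr i) H (kpt v u p \<theta>)) (strip r)"
    by (rule tfam_holo[OF tfam_H[OF hclass_H(1)] p])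
  have a: "ddir (Y i j p) \<theta> (cvec \<omega>) = pd j (\<lambda>\<theta>. ddir (v i p) \<theta> (cvec \<omega>)) \<theta>"
    unfolding Y_def[abs_def] pd_def by (rule ddir_sym[OF open_strip hv \<theta>])
  have "pd j (e2 v u i p) \<theta> = pd j (\<lambda>\<theta>. ddir (v i p) \<theta> (cvec \<omega>)) \<theta> + pd j (\<lambda>\<theta>. pd (Inr i) H (kpt v u p \<theta>)) \<theta>"
    unfolding e2_def[abs_def] pd_def[of j] by (rule ddir_add[OF h1 h2 \<theta>])
  moreover have "pd j (\<lambda>\<theta>. pd (Inr i) H (kpt v u p \<theta>)) \<theta> =
      (\<Sum>k\<in>UNIV. Q (Inr i) (Inl k) p \<theta> * Y k j p \<theta>) + (\<Sum>k\<in>UNIV. Q (Inr i) (Inr k) p \<theta> * X k j p \<theta>)"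
    unfolding pd_def[of j "\<lambda>\<theta>. pd (Inr i) H (kpt v u p \<theta>)"] ddir_H[OF hclass_H(1) p \<theta>]
    by (intro arg_cong2[where f = "(+)"] sum.cong) (auto simp: Q_def X_def Y_def pd_def axis_def)
  ultimately show ?thesis using a by simp
qed

lemma Q_sym: "p \<in> \<Xi> \<Longrightarrow> \<theta> \<in> strip r \<Longrightarrow> Q a b p \<theta> = Q b a p \<theta>"
  unfolding Q_def by (rule pd_sym[OF open_pdom holo_H(1) kpt_dom'])

text \<open>The right-hand side of the first cohomological equation has mean zero because, up to total
  derivatives, it is the derivative of \<open>H\<close> along the embedded torus.\<close>

lemma exactness:
  assumes p: "p \<in> \<Xi>"
  shows "cmean (\<lambda>\<theta>. \<Sum>i\<in>UNIV. Y i j p \<theta> * e1 v u l i p \<theta> - X i j p \<theta> * e2 v u i p \<theta>) = 0"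
proof -
  have hv: "holo (v i p) (strip r)" "per (v i p) r" for i using tfam_holo[OF v p] tfam_per[OF v p] by auto
  have hu: "holo (u i p) (strip r)" "per (u i p) r" for i using tfam_holo[OF u p] tfam_per[OF u p] by auto
  have tH: "tfam \<Xi> r (\<lambda>p \<theta>. H (kpt v u p \<theta>))" by (rule tfam_H[OF H])
  let ?e = "axis j (1::complex)"
  let ?D = "\<lambda>f \<theta>. ddir f \<theta> (cvec \<omega>)"
  \<comment> \<open>Each summand has mean zero: brackets of u and v, constants times derivatives of
    v, and the derivative of \<open>H\<close> along the torus. The single term in v j comes from the
    identity matrix contained in \<open>X\<close>.\<close>
  have "zmean r (\<lambda>\<theta>. (\<Sum>i\<in>UNIV. (ddir (v i p) \<theta> ?e * ?D (u i p) \<theta> - ?D (v i p) \<theta> * ddir (u i p) \<theta> ?e))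
      - ?D (v j p) \<theta> + (\<Sum>i\<in>UNIV. (complex_of_real (\<omega> $ i) + l i p) * ddir (v i p) \<theta> ?e)
      - ddir (\<lambda>\<theta>. H (kpt v u p \<theta>)) \<theta> ?e)"
    by (intro zmean_add zmean_diff zmean_sum zmean_cmult zmean_bracket zmean_ddir r hu hv tfam_holo[OF tH p] tfam_per[OF tH p])
  then have "zmean r (\<lambda>\<theta>. \<Sum>i\<in>UNIV. Y i j p \<theta> * e1 v u l i p \<theta> - X i j p \<theta> * e2 v u i p \<theta>)"
  proof (rule zmean_cong[OF _ _ r(1)])
    fix \<theta> :: "complex ^ 'n" assume \<theta>: "\<theta> \<in> strip r"
    have s: "?D (v j p) \<theta> = (\<Sum>i\<in>UNIV. (if i = j then 1 else 0) * ?D (v i p) \<theta>)"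
      by (simp add: if_distrib if_distribR cong: if_cong)
    have ax: "axis j 1 $ i = (if i = j then 1 else (0::complex))" for i by (simp add: axis_def)
    show "(\<Sum>i\<in>UNIV. (ddir (v i p) \<theta> ?e * ?D (u i p) \<theta> - ?D (v i p) \<theta> * ddir (u i p) \<theta> ?e))
      - ?D (v j p) \<theta> + (\<Sum>i\<in>UNIV. (complex_of_real (\<omega> $ i) + l i p) * ddir (v i p) \<theta> ?e)
      - ddir (\<lambda>\<theta>. H (kpt v u p \<theta>)) \<theta> ?e = (\<Sum>i\<in>UNIV. Y i j p \<theta> * e1 v u l i p \<theta> - X i j p \<theta> * e2 v u i p \<theta>)"
      unfolding ddir_H[OF H p \<theta>] s ax sum.distrib[symmetric] sum_subtractf[symmetric]
      by (intro sum.cong refl) (simp add: X_def Y_def e1_def e2_def pd_def[of j] algebra_simps)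
  qed
  then show ?thesis by (simp add: zmean_def)
qed

text \<open>The pullback of the symplectic form to the embedded torus.\<close>

definition Ld where "Ld i j p \<theta> = (\<Sum>k\<in>UNIV. X k i p \<theta> * Y k j p \<theta> - Y k i p \<theta> * X k j p \<theta>)"

lemma tfam_Ld: "tfam \<Xi> r (Ld i j)"
  unfolding Ld_def[abs_def] by (intro tfam_sum tfam_diff tfam_mult tfam_X tfam_Y)

text \<open>The pulled back form is exact: it consists of brackets of u and v and of derivatives of
  v.\<close>

lemma cmean_Ld:
  assumes p: "p \<in> \<Xi>"
  shows "cmean (Ld i j p) = 0"
proof -
  have hv: "holo (v i p) (strip r)" "per (v i p) r" for i using tfam_holo[OF v p] tfam_per[OF v p] by auto
  have hu: "holo (u i p) (strip r)" "per (u i p) r" for i using tfam_holo[OF u p] tfam_per[OF u p] by auto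
  let ?i = "axis i (1::complex)" and ?j = "axis j (1::complex)"
  have "zmean r (\<lambda>\<theta>. (\<Sum>k\<in>UNIV. (ddir (u k p) \<theta> ?i * ddir (v k p) \<theta> ?j - ddir (u k p) \<theta> ?j * ddir (v k p) \<theta> ?i))
      + (ddir (v i p) \<theta> ?j - ddir (v j p) \<theta> ?i))"
    by (intro zmean_add zmean_diff zmean_sum zmean_bracket zmean_ddir r hu hv)
  then have "zmean r (Ld i j p)"
  proof (rule zmean_cong[OF _ _ r(1)])
    fix \<theta> :: "complex ^ 'n"
    have "ddir (v i p) \<theta> ?j = (\<Sum>k\<in>UNIV. (if k = i then 1 else 0) * ddir (v k p) \<theta> ?j)"
      and "ddir (v j p) \<theta> ?i = (\<Sum>k\<in>UNIV. (if k = j then 1 else 0) * ddir (v k p) \<theta> ?i)"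
      by (simp_all add: if_distrib if_distribR cong: if_cong)
    then show "(\<Sum>k\<in>UNIV. (ddir (u k p) \<theta> ?i * ddir (v k p) \<theta> ?j - ddir (u k p) \<theta> ?j * ddir (v k p) \<theta> ?i))
      + (ddir (v i p) \<theta> ?j - ddir (v j p) \<theta> ?i) = Ld i j p \<theta>"
      unfolding Ld_def by (simp only: sum.distrib[symmetric] sum_subtractf[symmetric])
        (intro sum.cong refl, simp add: X_def Y_def pd_def algebra_simps)
  qed
  then show ?thesis by (simp add: zmean_def)
qed

text \<open>An exact solution would transport the form without change; here the rate of change is
  linear in the derivatives of the defects.\<close>

lemma ddir_Ld:
  assumes p: "p \<in> \<Xi>" and \<theta>: "\<theta> \<in> strip r"
  shows "ddir (Ld i j p) \<theta> (cvec \<omega>) = (\<Sum>k\<in>UNIV. pd i (e1 v u l k p) \<theta> * Y k j p \<theta> + X k i p \<theta> * pd j (e2 v u k p) \<theta>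
     - pd i (e2 v u k p) \<theta> * X k j p \<theta> - Y k i p \<theta> * pd j (e1 v u l k p) \<theta>)"
proof -
  let ?D = "\<lambda>f. ddir f \<theta> (cvec \<omega>)"
  define Xm Ym DX DY E1 E2 :: "complex ^ 'n ^ 'n"
    where "Xm = (\<chi> i j. X i j p \<theta>)" and "Ym = (\<chi> i j. Y i j p \<theta>)"
      and "DX = (\<chi> i j. ?D (X i j p))" and "DY = (\<chi> i j. ?D (Y i j p))"
      and "E1 = (\<chi> i j. pd j (e1 v u l i p) \<theta>)" and "E2 = (\<chi> i j. pd j (e2 v u i p) \<theta>)"
  define Hyy Hyx Hxy Hxx :: "complex ^ 'n ^ 'n"
    where "Hyy = (\<chi> i j. Q (Inl i) (Inl j) p \<theta>)" and "Hyx = (\<chi> i j. Q (Inl i) (Inr j) p \<theta>)"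
      and "Hxy = (\<chi> i j. Q (Inr i) (Inl j) p \<theta>)" and "Hxx = (\<chi> i j. Q (Inr i) (Inr j) p \<theta>)"
  have eq: "transpose DX ** Ym + transpose Xm ** DY - transpose DY ** Xm - transpose Ym ** DX =
    transpose E1 ** Ym + transpose Xm ** E2 - transpose E2 ** Xm - transpose Ym ** E1"
  proof (rule lagrangian_defect)
    show "DX = E1 + Hyx ** Xm + Hyy ** Ym" "DY = E2 - (Hxx ** Xm + Hxy ** Ym)"
      by (simp_all add: vec_eq_iff DX_def DY_def E1_def E2_def Hyx_def Hyy_def Hxx_def Hxy_def Xm_def Ym_def matrix_matrix_mult_def
          ddir_X[OF p \<theta>] ddir_Y[OF p \<theta>])
  qed (simp_all add: vec_eq_iff Hyx_def Hyy_def Hxx_def Hxy_def transpose_def Q_sym[OF p \<theta>])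
  have hX: "holo (X k i p) (strip r)" and hY: "holo (Y k i p) (strip r)" for k i
    using tfam_holo[OF tfam_X p] tfam_holo[OF tfam_Y p] by auto
  have "ddir (Ld i j p) \<theta> (cvec \<omega>) = (\<Sum>k\<in>UNIV. X k i p \<theta> * ?D (Y k j p) + ?D (X k i p) * Y k j p \<theta>
      - (Y k i p \<theta> * ?D (X k j p) + ?D (Y k i p) * X k j p \<theta>))"
    unfolding Ld_def[abs_def]
    by (simp add: ddir_sum[OF holo_diff[OF holo_mult[OF hX hY] holo_mult[OF hY hX]] \<theta>]
        ddir_diff[OF holo_mult[OF hX hY] holo_mult[OF hY hX] \<theta>] ddir_mult[OF hX hY \<theta>] ddir_mult[OF hY hX \<theta>])
  also have "\<dots> = (transpose DX ** Ym + transpose Xm ** DY - transpose DY ** Xm - transpose Ym ** DX) $ i $ j"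
    by (simp add: DX_def DY_def Xm_def Ym_def matrix_matrix_mult_def transpose_def sum.distrib sum_subtractf)
  also have "\<dots> = (\<Sum>k\<in>UNIV. pd i (e1 v u l k p) \<theta> * Y k j p \<theta> + X k i p \<theta> * pd j (e2 v u k p) \<theta>
     - pd i (e2 v u k p) \<theta> * X k j p \<theta> - Y k i p \<theta> * pd j (e1 v u l k p) \<theta>)"
    unfolding eq by (simp add: E1_def E2_def Xm_def Ym_def matrix_matrix_mult_def transpose_def sum.distrib sum_subtractf)
  finally show ?thesis .
qed

end


section \<open>Setting up one Newton step\<close>

lemma bnd_sum_mult:
  fixes f g :: "'i::finite \<Rightarrow> 'p \<Rightarrow> complex ^ 'n::finite \<Rightarrow> complex"
  assumes "\<And>k. bnd \<Xi> r (f k) C" "\<And>k. bnd \<Xi> r (g k) C'"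
  shows "bnd \<Xi> r (\<lambda>p \<theta>. \<Sum>k\<in>UNIV. f k p \<theta> * g k p \<theta>) (real CARD('i) * (C * C'))"
  by (intro bnd_sum bnd_mult assms)

lemma tfam_sum_mult:
  assumes "\<And>k. tfam \<Xi> r (f k)" "\<And>k. tfam \<Xi> r (g k)"
  shows "tfam \<Xi> r (\<lambda>p \<theta>. \<Sum>k\<in>UNIV. f k p \<theta> * g k p \<theta>)"
  by (intro tfam_sum tfam_mult assms)

lemma sum_pull:
  fixes A :: "'i::finite \<Rightarrow> complex" and C :: "'j::finite \<Rightarrow> 'i \<Rightarrow> complex"
  shows "(\<Sum>i\<in>UNIV. A i * (\<Sum>m\<in>UNIV. C m i * x m)) = (\<Sum>m\<in>UNIV. (\<Sum>i\<in>UNIV. A i * C m i) * x m)"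
  unfolding sum_distrib_left sum_distrib_right by (subst sum.swap) (simp add: mult.assoc)

text \<open>There are two losses of width: \<open>d\<close>, which shrinks from step to step and
  governs \<kappa>, and \<open>d0\<close>, which is spent on inverting the averaged matrix. The
  condition \<open>small\<close> is what this inversion demands of c1; the one on \<eta> keeps the
  corrected torus within reach of the Taylor estimate.\<close>

locale newton = kam_state \<Xi> c \<rho> B \<gamma> \<tau> \<omega> H v u l r c1
  for \<Xi> :: "(real ^ 'n::finite) set" and c \<rho> B \<gamma> \<tau> \<omega> H v u l r c1 +
  fixes \<eta> d d0 \<kappa> :: real
  assumes \<eta>: "0 \<le> \<eta>" "\<And>i. bnd \<Xi> r (e1 v u l i) \<eta>" "\<And>i. bnd \<Xi> r (e2 v u i) \<eta>"
    and d: "0 < d" "d \<le> 1" and d0: "0 < d0" "d0 \<le> 1" "3 * d + d0 < r"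
    and \<kappa>: "64 * real CARD('n) ^ 3 * (1 + 16 * B / \<rho>\<^sup>2) \<le> \<kappa>" "1 / d \<le> \<kappa>" "2 * sd_bound TYPE('n) \<gamma> \<tau> d \<le> \<kappa>" "512 * B / \<rho> ^ 3 \<le> \<kappa>"
    and small: "c1 * (2 * real CARD('n) + 4 * real CARD('n) ^ 3 * (16 * B / \<rho>\<^sup>2) * sd_bound TYPE('n) \<gamma> \<tau> d0) \<le> 1 / (2 * real CARD('n))"
    and \<eta>_small: "\<kappa> ^ 14 * \<eta> \<le> \<rho> / 8"
begin

text \<open>The constant \<open>\<kappa>\<close> dominates every factor lost by a single operation of the Newton step, so
  a quantity of first order is bounded by some \<open>E j\<close>, one of second order by some \<open>EE j\<close> (with
  \<open>\<eta>\<^sup>2\<close> for \<open>\<eta>\<close>), and each operation only raises \<open>j\<close>.\<close>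

definition nn :: real where "nn = real CARD('n)"
abbreviation B2 where "B2 \<equiv> 16 * B / \<rho>\<^sup>2"
definition sd where "sd = sd_bound TYPE('n) \<gamma> \<tau> d"
definition E where "E j = \<kappa> ^ j * \<eta>"

lemma nn: "1 \<le> nn" by (simp add: nn_def Suc_leI)

lemmas bsum = bnd_sum[where 'i = 'n, folded nn_def]
lemmas bsum_mult = bnd_sum_mult[where 'i = 'n, folded nn_def]
lemmas c1_nn = c1(3)[folded nn_def]

lemma B2: "0 \<le> B2" using B_nonneg rho by simp

lemma cubes: "nn \<le> nn ^ 3" "nn ^ 2 \<le> nn ^ 3"
  using nn by (auto intro: power_increasing self_le_power)

text \<open>The factor 64 leaves room for the numerical factors in sums of a few terms, so that each
  later comparison with a higher power of \<kappa> is linear arithmetic.\<close>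

lemma \<kappa>_ge: "64 * nn \<le> \<kappa>" "64 * (nn * (nn * (nn * B2))) \<le> \<kappa>" "64 * (nn * (nn * B2)) \<le> \<kappa>" "1 \<le> \<kappa>" "64 * (nn * nn) \<le> \<kappa>"
proof -
  have k: "64 * nn ^ 3 + 64 * (nn ^ 3 * B2) \<le> \<kappa>" using \<kappa>(1) by (simp add: nn_def algebra_simps)
  have p: "0 \<le> nn ^ 3 * B2" by (intro mult_nonneg_nonneg B2) (use nn in simp)
  have q: "nn ^ 2 * B2 \<le> nn ^ 3 * B2" by (rule mult_right_mono[OF cubes(2) B2])
  show "64 * nn \<le> \<kappa>" using k p cubes by linarith
  then show "1 \<le> \<kappa>" using nn by linarith
  show "64 * (nn * nn) \<le> \<kappa>" using k p cubes(2) unfolding power2_eq_square by linarith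
  show "64 * (nn * (nn * (nn * B2))) \<le> \<kappa>" using k nn unfolding power3_eq_cube by (simp only: mult.assoc) (smt (verit) mult_nonneg_nonneg)
  have "64 * (nn ^ 2 * B2) \<le> \<kappa>" using k q nn cubes by linarith
  then show "64 * (nn * (nn * B2)) \<le> \<kappa>" unfolding power2_eq_square by (simp only: mult.assoc)
qed

lemma E_nonneg: "0 \<le> E j" using \<eta> \<kappa>_ge(4) by (simp add: E_def)

lemma E_Suc: "\<kappa> * E j = E (Suc j)" by (simp add: E_def)

lemma E_mono: "i \<le> j \<Longrightarrow> E i \<le> E j"
  unfolding E_def using \<kappa>_ge(4) \<eta> by (intro mult_right_mono power_increasing)

lemma E_mult: "x \<le> \<kappa> \<Longrightarrow> x * E j \<le> E (Suc j)"
  unfolding E_Suc[symmetric] by (intro mult_right_mono E_nonneg)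

lemma E_nn: "64 * (nn * E j) \<le> E (Suc j)" and E_B2: "64 * (nn * (nn * (nn * (B2 * E j)))) \<le> E (Suc j)"
  and E_B2': "64 * (nn * (nn * (B2 * E j))) \<le> E (Suc j)" and E_sd: "2 * E j * sd \<le> E (Suc j)"
  using E_mult[OF \<kappa>_ge(1), of j] E_mult[OF \<kappa>_ge(2), of j] E_mult[OF \<kappa>_ge(3), of j] E_mult[OF \<kappa>(3)[folded sd_def], of j]
  by (simp_all only: mult_ac)

lemma nn_E_nonneg: "0 \<le> nn * E j" using nn E_nonneg by simp

lemma E_0: "E 0 = \<eta>" by (simp add: E_def)

lemma nn_2E: "nn * (2 * E j) \<le> E (Suc j)"
proof -
  have "nn * (2 * E j) = 2 * (nn * E j)" by simp
  then show ?thesis using E_nn[of j] nn_E_nonneg[of j] by linarith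
qed

lemma c1_le: "c1 \<le> 1"
proof -
  have "1 / (2 * nn) \<le> 1 / 1" using nn by (intro divide_left_mono) linarith+
  then show ?thesis using c1_nn by linarith
qed

text \<open>One choice for a whole family of right-hand sides; \<open>sd\<close> depends on the loss
  alone, so all solutions share the bound.\<close>

lemma solve_family:
  fixes f :: "'i \<Rightarrow> real ^ 'n \<Rightarrow> complex ^ 'n \<Rightarrow> complex"
  assumes r': "d < r'" and f: "\<And>j. tfam \<Xi> r' (f j)" "\<And>j. bnd \<Xi> r' (f j) C" and m: "\<And>j p. p \<in> \<Xi> \<Longrightarrow> cmean (f j p) = 0"
  obtains g where "\<And>j. tfam \<Xi> (r' - d) (g j)" "\<And>j. bnd \<Xi> (r' - d) (g j) (2 * C * sd)"
    "\<And>j p \<theta>. p \<in> \<Xi> \<Longrightarrow> \<theta> \<in> strip (r' - d) \<Longrightarrow> ddir (g j p) \<theta> (cvec \<omega>) = f j p \<theta>"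
    "\<And>j p. p \<in> \<Xi> \<Longrightarrow> cmean (g j p) = 0"
proof -
  have "\<forall>j. \<exists>g. tfam \<Xi> (r' - d) g \<and> bnd \<Xi> (r' - d) g (2 * C * sd) \<and>
     (\<forall>p\<in>\<Xi>. \<forall>\<theta>\<in>strip (r' - d). ddir (g p) \<theta> (cvec \<omega>) = f j p \<theta>) \<and> (\<forall>p\<in>\<Xi>. cmean (g p) = 0)"
  proof
    fix j
    obtain g where "tfam \<Xi> (r' - d) g" "bnd \<Xi> (r' - d) g (2 * C * sd)"
      "\<And>p \<theta>. p \<in> \<Xi> \<Longrightarrow> \<theta> \<in> strip (r' - d) \<Longrightarrow> ddir (g p) \<theta> (cvec \<omega>) = f j p \<theta>"
      "\<And>p. p \<in> \<Xi> \<Longrightarrow> cmean (g p) = 0"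
      using tfam_solve_zmean[OF dioph d r' f m, of j] unfolding sd_def by blast
    then show "\<exists>g. tfam \<Xi> (r' - d) g \<and> bnd \<Xi> (r' - d) g (2 * C * sd) \<and>
     (\<forall>p\<in>\<Xi>. \<forall>\<theta>\<in>strip (r' - d). ddir (g p) \<theta> (cvec \<omega>) = f j p \<theta>) \<and> (\<forall>p\<in>\<Xi>. cmean (g p) = 0)" by blast
  qed
  then obtain g where "\<forall>j. tfam \<Xi> (r' - d) (g j) \<and> bnd \<Xi> (r' - d) (g j) (2 * C * sd) \<and>
     (\<forall>p\<in>\<Xi>. \<forall>\<theta>\<in>strip (r' - d). ddir (g j p) \<theta> (cvec \<omega>) = f j p \<theta>) \<and> (\<forall>p\<in>\<Xi>. cmean (g j p) = 0)"
    using choice[of "\<lambda>j g. tfam \<Xi> (r' - d) g \<and> bnd \<Xi> (r' - d) g (2 * C * sd) \<and>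
     (\<forall>p\<in>\<Xi>. \<forall>\<theta>\<in>strip (r' - d). ddir (g p) \<theta> (cvec \<omega>) = f j p \<theta>) \<and> (\<forall>p\<in>\<Xi>. cmean (g p) = 0)"] by blast
  then show thesis using that[of g] by blast
qed

text \<open>One loss for the equation of b, one for the equation of a, and one for the Cauchy
  estimate of the derivatives of the corrections.\<close>

definition r1 where "r1 = r - d"
definition r2 where "r2 = r1 - d"
definition r3 where "r3 = r2 - d"

lemma radii: "0 < r3" "r3 < r2" "r2 < r1" "r1 < r" "d0 < r1" "0 < r1" "0 < r2" "d < r" "d < r1"
  using d d0 by (auto simp: r1_def r2_def r3_def)

lemmas tfam1 = tfam_subset[OF _ less_imp_le[OF radii(4)]]
lemmas bnd1 = bnd_mono[OF _ less_imp_le[OF radii(4)] order_refl]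
lemmas tfam2 = tfam_subset[OF _ less_imp_le[OF radii(3)]]
lemmas bnd2 = bnd_mono[OF _ less_imp_le[OF radii(3)] order_refl]
lemmas tfam3 = tfam_subset[OF _ less_imp_le[OF radii(2)]]
lemmas bnd3 = bnd_mono[OF _ less_imp_le[OF radii(2)] order_refl]

lemma bnd_Y1: "bnd \<Xi> r (Y i j) 1"
  by (rule bnd_mono[OF bnd_Y order_refl c1_le])

text \<open>The triangular linearised system. The correction \<open>dl\<close> of the counterterm is fixed by the
  solvability of the second cohomological equation.\<close>

lemma linearised_solution:
  obtains W b w a dl where
    "\<And>i j. tfam \<Xi> r (W i j)" "\<And>i j. bnd \<Xi> r (W i j) 2"
    "\<And>p \<theta> i j. p \<in> \<Xi> \<Longrightarrow> \<theta> \<in> strip r \<Longrightarrow> (\<Sum>k\<in>UNIV. X i k p \<theta> * W k j p \<theta>) = (if i = j then 1 else 0)"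
    "\<And>p \<theta> i j. p \<in> \<Xi> \<Longrightarrow> \<theta> \<in> strip r \<Longrightarrow> (\<Sum>k\<in>UNIV. W i k p \<theta> * X k j p \<theta>) = (if i = j then 1 else 0)"
    "\<And>i. tfam \<Xi> r1 (b i)"
    "\<And>j p \<theta>. p \<in> \<Xi> \<Longrightarrow> \<theta> \<in> strip r1 \<Longrightarrow> ddir (b j p) \<theta> (cvec \<omega>) =
       (\<Sum>i\<in>UNIV. Y i j p \<theta> * (dl i p + e1 v u l i p \<theta>)) - (\<Sum>i\<in>UNIV. X i j p \<theta> * e2 v u i p \<theta>)"
    "\<And>i. w i = (\<lambda>p \<theta>. \<Sum>j\<in>UNIV. W j i p \<theta> * b j p \<theta>)" "\<And>i. tfam \<Xi> r1 (w i)" "\<And>i. bnd \<Xi> r1 (w i) (E 8)"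
    "\<And>i. tfam \<Xi> r2 (a i)" "\<And>i. bnd \<Xi> r2 (a i) (E 11)" 
    "\<And>i p \<theta>. p \<in> \<Xi> \<Longrightarrow> \<theta> \<in> strip r2 \<Longrightarrow> ddir (a i p) \<theta> (cvec \<omega>) =
       (\<Sum>k\<in>UNIV. W i k p \<theta> * ((\<Sum>m\<in>UNIV. Q (Inl k) (Inl m) p \<theta> * w m p \<theta>) - dl k p - e1 v u l k p \<theta>))"
    "\<And>i. bnd \<Xi> r2 (\<lambda>p \<theta>. ddir (a i p) \<theta> (cvec \<omega>)) (E 10)"
    "\<And>i. tfam \<Xi> r (\<lambda>p (\<theta>::complex ^ 'n). dl i p)" "\<And>i. bnd \<Xi> r (\<lambda>p (\<theta>::complex ^ 'n). dl i p) (E 4)"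
proof -
  have bX: "bnd \<Xi> r (\<lambda>p \<theta>. X i j p \<theta> - (if i = j then 1 else 0)) c1" for i j
    using bdu[of j i] by (simp add: X_def)
  obtain W where W: "\<And>i j. tfam \<Xi> r (W i j)" "\<And>i j. bnd \<Xi> r (W i j) 2"
    "\<And>p \<theta> i j. p \<in> \<Xi> \<Longrightarrow> \<theta> \<in> strip r \<Longrightarrow> (\<Sum>k\<in>UNIV. X i k p \<theta> * W k j p \<theta>) = (if i = j then 1 else 0)"
    "\<And>p \<theta> i j. p \<in> \<Xi> \<Longrightarrow> \<theta> \<in> strip r \<Longrightarrow> (\<Sum>k\<in>UNIV. W i k p \<theta> * X k j p \<theta>) = (if i = j then 1 else 0)"
    using tfam_matrix_inverse[where 'n = 'n, folded nn_def, OF tfam_X bnd_mono[OF bX order_refl c1_nn]] by blast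
  have "bnd \<Xi> r (\<lambda>p \<theta>. Y i j p \<theta> * e1 v u l i p \<theta> - X i j p \<theta> * e2 v u i p \<theta>) (1 * \<eta> + 2 * \<eta>)" for i j
    by (intro bnd_diff bnd_mult bnd_Y1 bnd_X \<eta>)
  then have "bnd \<Xi> r (\<lambda>p \<theta>. \<Sum>i\<in>UNIV. Y i j p \<theta> * e1 v u l i p \<theta> - X i j p \<theta> * e2 v u i p \<theta>) (nn * (1 * \<eta> + 2 * \<eta>))" for j
    by (rule bsum)
  moreover have "nn * (1 * \<eta> + 2 * \<eta>) \<le> E 1"
  proof -
    have "nn * (1 * \<eta> + 2 * \<eta>) = 3 * (nn * E 0)" by (simp add: E_0)
    then show ?thesis using E_nn[of 0] nn_E_nonneg[of 0] unfolding One_nat_def by linarith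
  qed
  ultimately have brhs: "bnd \<Xi> r (\<lambda>p \<theta>. \<Sum>i\<in>UNIV. Y i j p \<theta> * e1 v u l i p \<theta> - X i j p \<theta> * e2 v u i p \<theta>) (E 1)" for j
    by (rule bnd_mono[OF _ order_refl])
  have trhs: "tfam \<Xi> r (\<lambda>p \<theta>. \<Sum>i\<in>UNIV. Y i j p \<theta> * e1 v u l i p \<theta> - X i j p \<theta> * e2 v u i p \<theta>)" for j
    by (intro tfam_sum tfam_diff tfam_mult tfam_X tfam_Y tfam_e1 tfam_e2)
  \<comment> \<open>The equation for b is affine in the unknown dl. Here it is solved for dl = 0;
    the functions \<open>Bf\<close> below are the responses to the single components of dl, and b
    will be b0 plus their combination with coefficients dl.\<close>
  obtain b0 where b0: "\<And>j. tfam \<Xi> r1 (b0 j)" "\<And>j. bnd \<Xi> r1 (b0 j) (2 * E 1 * sd)"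
    "\<And>j p \<theta>. p \<in> \<Xi> \<Longrightarrow> \<theta> \<in> strip r1 \<Longrightarrow> ddir (b0 j p) \<theta> (cvec \<omega>) = (\<Sum>i\<in>UNIV. Y i j p \<theta> * e1 v u l i p \<theta> - X i j p \<theta> * e2 v u i p \<theta>)"
    by (rule solve_family[where f = "\<lambda>j p \<theta>. \<Sum>i\<in>UNIV. Y i j p \<theta> * e1 v u l i p \<theta> - X i j p \<theta> * e2 v u i p \<theta>",
        OF radii(8) trhs brhs exactness, folded r1_def]; (rule that)?; assumption)
  have b0b: "bnd \<Xi> r1 (b0 j) (E 2)" for j
    by (rule bnd_mono[OF b0(2)]) (use E_sd[of 1] in \<open>auto simp: numeral_2_eq_2\<close>)
  have mY: "cmean (Y i j p) = 0" if "p \<in> \<Xi>" for i j p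
    unfolding Y_def[abs_def] by (rule cmean_pd[OF tfam_holo[OF v that] tfam_per[OF v that] r(1)])
  obtain Bf where Bf: "\<And>ij. tfam \<Xi> r1 (Bf ij)" "\<And>ij. bnd \<Xi> r1 (Bf ij) (2 * c1 * sd)"
    "\<And>ij p \<theta>. p \<in> \<Xi> \<Longrightarrow> \<theta> \<in> strip r1 \<Longrightarrow> ddir (Bf ij p) \<theta> (cvec \<omega>) = Y (fst ij) (snd ij) p \<theta>"
    "\<And>ij p. p \<in> \<Xi> \<Longrightarrow> cmean (Bf ij p) = 0"
    by (rule solve_family[where f = "\<lambda>ij. Y (fst ij) (snd ij)", OF radii(8) tfam_Y bnd_Y mY, folded r1_def]; (rule that)?; assumption)
  have sd0: "0 \<le> sd" using dioph unfolding sd_def sd_bound_def sd_const_def dioph_def using d by simp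
  have Bb: "bnd \<Xi> r1 (Bf ij) \<kappa>" for ij
  proof (rule bnd_mono[OF Bf(2) order_refl])
    have "2 * c1 * sd \<le> 2 * 1 * sd" using c1_le sd0 by (intro mult_right_mono mult_left_mono) auto
    then show "2 * c1 * sd \<le> \<kappa>" using \<kappa>(3) by (simp add: sd_def)
  qed
  define sd0 where "sd0 = sd_bound TYPE('n) \<gamma> \<tau> d0"
  have sd0_nonneg: "0 \<le> sd0" using dioph unfolding sd0_def sd_bound_def sd_const_def dioph_def using d0 by simp
  \<comment> \<open>A second bound of the same functions. The bound \<kappa> is too crude for
    inverting the averaged matrix; the loss \<open>d0\<close>, which can be kept fixed during the
    iteration, gives c1 times a constant that does not grow.\<close>
  have Bs: "bnd \<Xi> (r1 - d0) (Bf ij) (c1 * sd0)" for ij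
    unfolding bnd_def sd0_def
  proof (intro ballI small_divisor_estimate[OF dioph d0(1,2) radii(5) tfam_holo[OF Bf(1)] tfam_per[OF Bf(1)] Bf(4)])
    fix p and \<theta> :: "complex ^ 'n" assume a: "p \<in> \<Xi>" "\<theta> \<in> strip r1"
    then have "\<theta> \<in> strip r" using strip_mono[OF less_imp_le[OF radii(4)]] by blast
    then show "cmod (ddir (Bf ij p) \<theta> (cvec \<omega>)) \<le> c1"
      unfolding Bf(3)[OF a] using bnd_Y a(1) by (auto simp: bnd_def)
  qed
  define r4 where "r4 = r1 - d0"
  have r4: "0 < r4" "r4 \<le> r1" "r4 \<le> r" using radii d0 by (auto simp: r4_def)
  \<comment> \<open>S i m is the way in which a unit of dl m re-enters the equation for a: through
    b, then w, then the action part of the Hessian.\<close>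
  define S where "S i m p \<theta> = (\<Sum>k\<in>UNIV. W i k p \<theta> * (\<Sum>l\<in>UNIV. Q (Inl k) (Inl l) p \<theta> * (\<Sum>j\<in>UNIV. W j l p \<theta> * Bf (m, j) p \<theta>)))" for i m p \<theta>
  have tS: "tfam \<Xi> r1 (S i m)" for i m
    unfolding S_def[abs_def] by (intro tfam_sum_mult tfam1[OF W(1)] tfam1[OF tfam_Q] Bf(1))
  have bS: "bnd \<Xi> r4 (S i m) (nn * (2 * (nn * (B2 * (nn * (2 * (c1 * sd0)))))))" for i m
    unfolding S_def[abs_def] by (intro bsum_mult bnd_mono[OF W(2) r4(3) order_refl] bnd_mono[OF bnd_Q r4(3) order_refl] Bs[folded r4_def])
  have bWI: "bnd \<Xi> r4 (\<lambda>p \<theta>. W i m p \<theta> - (if i = m then 1 else 0)) (nn * (2 * c1))" for i m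
    unfolding bnd_def
  proof (intro ballI)
    fix p and \<theta> :: "complex ^ 'n" assume a: "p \<in> \<Xi>" "\<theta> \<in> strip r4"
    then have \<theta>: "\<theta> \<in> strip r" using strip_mono[OF r4(3)] by blast
    have "W i m p \<theta> - (if i = m then 1 else 0) = - (\<Sum>k\<in>UNIV. W i k p \<theta> * (X k m p \<theta> - (if k = m then 1 else 0)))"
    proof -
      have "(\<Sum>k\<in>UNIV. W i k p \<theta> * (if k = m then 1 else 0)) = W i m p \<theta>" by (simp add: if_distrib cong: if_cong)
      then show ?thesis unfolding right_diff_distrib sum_subtractf W(4)[OF a(1) \<theta>, of i m] by simp
    qed
    moreover have "bnd \<Xi> r (\<lambda>p \<theta>. \<Sum>k\<in>UNIV. W i k p \<theta> * (X k m p \<theta> - (if k = m then 1 else 0))) (nn * (2 * c1))"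
      by (intro bsum_mult W(2) bX)
    ultimately show "cmod (W i m p \<theta> - (if i = m then 1 else 0)) \<le> nn * (2 * c1)"
      using a(1) \<theta> by (simp add: bnd_def)
  qed
  \<comment> \<open>The matrix of the solvability condition. For u = v = 0 one has W = 1 and, since
    Y = 0 forces Bf = 0, also S = 0, so it is the identity; c1 controls the deviation.\<close>
  define Mm where "Mm i m p (\<theta> :: complex ^ 'n) = cmean (\<lambda>\<theta>. W i m p \<theta> - S i m p \<theta>)" for i m p \<theta>
  have tWS: "tfam \<Xi> r1 (\<lambda>p \<theta>. W i m p \<theta> - S i m p \<theta>)" for i m
    by (intro tfam_diff tfam1[OF W(1)] tS)
  have tM: "tfam \<Xi> r (Mm i m)" for i m
    unfolding Mm_def[abs_def] by (rule tfam_cmean[OF tWS radii(6)])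
  have bM: "bnd \<Xi> r (\<lambda>p \<theta>. Mm i m p \<theta> - (if i = m then 1 else 0)) (1 / (2 * nn))" for i m
  proof -
    have t: "tfam \<Xi> r4 (\<lambda>p \<theta>. (W i m p \<theta> - S i m p \<theta>) - (if i = m then 1 else 0))"
      by (intro tfam_diff tfam_subset[OF tWS r4(2)] tfam_const tfam_subset[OF tS r4(2)] tfam_subset[OF W(1) r4(3)]) simp
    have b4: "bnd \<Xi> r4 (\<lambda>p \<theta>. (W i m p \<theta> - (if i = m then 1 else 0)) - S i m p \<theta>) (nn * (2 * c1) + nn * (2 * (nn * (B2 * (nn * (2 * (c1 * sd0)))))))"
      by (intro bnd_diff bWI bS)
    have bb: "bnd \<Xi> r4 (\<lambda>p \<theta>. (W i m p \<theta> - S i m p \<theta>) - (if i = m then 1 else 0)) (1 / (2 * nn))"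
    proof -
      have "nn * (2 * c1) + nn * (2 * (nn * (B2 * (nn * (2 * (c1 * sd0)))))) = c1 * (2 * nn + 4 * nn ^ 3 * B2 * sd0)"
        by (simp add: algebra_simps power3_eq_cube)
      moreover have "(\<lambda>p \<theta>. (W i m p \<theta> - (if i = m then 1 else 0)) - S i m p \<theta>) = (\<lambda>p \<theta>. (W i m p \<theta> - S i m p \<theta>) - (if i = m then 1 else 0))"
        by (intro ext) simp
      ultimately show ?thesis using small[folded nn_def] bnd_mono[OF b4 order_refl] unfolding sd0_def by simp
    qed
    have "bnd \<Xi> r (\<lambda>p \<theta>. cmean (\<lambda>\<theta>. (W i m p \<theta> - S i m p \<theta>) - (if i = m then 1 else 0))) (1 / (2 * nn))"
      by (rule bnd_cmean[OF t bb r4(1)])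
    moreover have "cmean (\<lambda>\<theta>. (W i m p \<theta> - S i m p \<theta>) - (if i = m then 1 else 0)) = Mm i m p \<theta> - (if i = m then 1 else 0)"
      if "p \<in> \<Xi>" for p \<theta>
      unfolding Mm_def cmean_diff[OF tfam_holo[OF tWS that] holo_const radii(6)] cmean_const ..
    ultimately show ?thesis by (simp add: bnd_def)
  qed
  obtain V where V: "\<And>i j. tfam \<Xi> r (V i j)" "\<And>i j. bnd \<Xi> r (V i j) 2"
    "\<And>p \<theta> i j. p \<in> \<Xi> \<Longrightarrow> \<theta> \<in> strip r \<Longrightarrow> (\<Sum>k\<in>UNIV. Mm i k p \<theta> * V k j p \<theta>) = (if i = j then 1 else 0)"
    by (rule tfam_matrix_inverse[where X = Mm, folded nn_def, OF tM bM]; (rule that)?; assumption)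
  have 0: "(0 :: complex ^ 'n) \<in> strip r" using r by (simp add: strip_def)
  define g where "g i p \<theta> = (\<Sum>k\<in>UNIV. W i k p \<theta> * ((\<Sum>m\<in>UNIV. Q (Inl k) (Inl m) p \<theta> * (\<Sum>j\<in>UNIV. W j m p \<theta> * b0 j p \<theta>)) - e1 v u l k p \<theta>))" for i p \<theta>
  have tg: "tfam \<Xi> r1 (g i)" for i
    unfolding g_def[abs_def] by (intro tfam_sum_mult tfam_diff tfam1[OF W(1)] tfam1[OF tfam_Q] b0(1) tfam1[OF tfam_e1])
  have "bnd \<Xi> r1 (g i) (nn * (2 * (nn * (B2 * (nn * (2 * E 2))) + \<eta>)))" for i
    unfolding g_def[abs_def] by (intro bsum_mult bnd_diff bnd1[OF W(2)] bnd1[OF bnd_Q] b0b bnd1[OF \<eta>(2)])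
  moreover have "nn * (2 * (nn * (B2 * (nn * (2 * E 2))) + \<eta>)) \<le> E 3"
  proof -
    have "nn * (2 * (nn * (B2 * (nn * (2 * E 2))) + \<eta>)) = 4 * (nn * (nn * (nn * (B2 * E 2)))) + 2 * (nn * E 0)"
      by (simp add: E_0 algebra_simps)
    moreover have "64 * (nn * (nn * (nn * (B2 * E 2)))) \<le> E 3" using E_B2[of 2] by (simp add: eval_nat_numeral)
    moreover have "64 * (nn * E 0) \<le> E 3" using E_nn[of 0] E_mono[of 1 3] by simp
    ultimately show ?thesis using E_nonneg[of 3] by linarith
  qed
  ultimately have bg: "bnd \<Xi> r1 (g i) (E 3)" for i by (rule bnd_mono[OF _ order_refl])
  \<comment> \<open>The inverse V was produced as a family in \<theta>, although \<open>Mm\<close>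
    is constant in \<theta>; its value at 0 inverts the matrix.\<close>
  define dl where "dl i p = (\<Sum>m\<in>UNIV. V i m p 0 * cmean (g m p))" for i p
  have tdl: "tfam \<Xi> r (\<lambda>p (\<theta>::complex ^ 'n). dl i p)" for i
    unfolding dl_def by (intro tfam_sum_mult tfam_at_0[OF V(1) r(1)] tfam_cmean[OF tg radii(6)])
  have "bnd \<Xi> r (\<lambda>p (\<theta>::complex ^ 'n). V i m p 0) 2" for i m
    using V(2) 0 by (auto simp: bnd_def)
  then have "bnd \<Xi> r (\<lambda>p (\<theta>::complex ^ 'n). dl i p) (nn * (2 * E 3))" for i
    unfolding dl_def by (intro bsum_mult bnd_cmean[OF tg bg radii(6)])
  moreover have "nn * (2 * E 3) \<le> E 4" using nn_2E[of 3] by simp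
  ultimately have bdl: "bnd \<Xi> r (\<lambda>p (\<theta>::complex ^ 'n). dl i p) (E 4)" for i by (rule bnd_mono[OF _ order_refl])
  have Mdl: "(\<Sum>m\<in>UNIV. cmean (\<lambda>\<theta>. W i m p \<theta> - S i m p \<theta>) * dl m p) = cmean (g i p)" if "p \<in> \<Xi>" for i p
  proof -
    have "(\<Sum>m\<in>UNIV. Mm i m p 0 * dl m p) = (\<Sum>k\<in>UNIV. (\<Sum>m\<in>UNIV. Mm i m p 0 * V m k p 0) * cmean (g k p))"
      unfolding dl_def by (rule sum_pull[where C = "\<lambda>k m. V m k p 0"])
    also have "\<dots> = cmean (g i p)" unfolding V(3)[OF that 0] by (simp add: if_distrib if_distribR cong: if_cong)
    finally show ?thesis by (simp add: Mm_def)
  qed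
  define b where "b j p \<theta> = b0 j p \<theta> + (\<Sum>i\<in>UNIV. Bf (i, j) p \<theta> * dl i p)" for j p \<theta>
  have tb: "tfam \<Xi> r1 (b j)" for j
    unfolding b_def[abs_def] by (intro tfam_add tfam_sum_mult b0 Bf(1) tfam1[OF tdl])
  have "bnd \<Xi> r1 (b j) (E 2 + nn * (\<kappa> * E 4))" for j
    unfolding b_def[abs_def] by (intro bnd_add bsum_mult b0b Bb bnd1[OF bdl])
  moreover have "E 2 + nn * (\<kappa> * E 4) \<le> E 7"
  proof -
    have "64 * (nn * E 5) \<le> E 6" "64 * (nn * E 6) \<le> E 7" using E_nn[of 5] E_nn[of 6] by simp_all
    moreover have "\<kappa> * E 4 = E 5" using E_Suc[of 4] by simp
    moreover have "E 6 \<le> nn * E 6" using mult_right_mono[OF nn E_nonneg[of 6]] by simp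
    ultimately show ?thesis using E_mono[of 2 6] nn_E_nonneg[of 5] E_nonneg[of 6] by simp
  qed
  ultimately have bb: "bnd \<Xi> r1 (b j) (E 7)" for j by (rule bnd_mono[OF _ order_refl])
  have Db: "ddir (b j p) \<theta> (cvec \<omega>) = (\<Sum>i\<in>UNIV. Y i j p \<theta> * (dl i p + e1 v u l i p \<theta>)) - (\<Sum>i\<in>UNIV. X i j p \<theta> * e2 v u i p \<theta>)"
    if p: "p \<in> \<Xi>" and \<theta>: "\<theta> \<in> strip r1" for j p \<theta>
  proof -
    have h: "holo (\<lambda>\<theta>. Bf (i, j) p \<theta> * dl i p) (strip r1)" for i
      by (intro holo_mult holo_const tfam_holo[OF Bf(1) p])
    show ?thesis
      unfolding b_def[abs_def] ddir_add[OF tfam_holo[OF b0(1) p] holo_sum[OF h] \<theta>] ddir_sum[OF h \<theta>]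
        ddir_mult[OF tfam_holo[OF Bf(1) p] holo_const \<theta>] ddir_const b0(3)[OF p \<theta>] Bf(3)[OF p \<theta>]
      by (simp add: sum_subtractf sum.distrib algebra_simps)
  qed
  \<comment> \<open>As W inverts X, this makes b the product of \<open>transpose X\<close> with w,
    the form in which the residual computation uses it.\<close>
  define w where "w i = (\<lambda>p \<theta>. \<Sum>j\<in>UNIV. W j i p \<theta> * b j p \<theta>)" for i
  have tw: "tfam \<Xi> r1 (w i)" for i unfolding w_def by (intro tfam_sum_mult tfam1[OF W(1)] tb)
  have "bnd \<Xi> r1 (w i) (nn * (2 * E 7))" for i
    unfolding w_def by (intro bsum_mult bnd1[OF W(2)] bb)
  moreover have "nn * (2 * E 7) \<le> E 8" using nn_2E[of 7] by simp
  ultimately have bw: "bnd \<Xi> r1 (w i) (E 8)" for i by (rule bnd_mono[OF _ order_refl])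
  define R where "R i p \<theta> = (\<Sum>k\<in>UNIV. W i k p \<theta> * ((\<Sum>m\<in>UNIV. Q (Inl k) (Inl m) p \<theta> * w m p \<theta>) - dl k p - e1 v u l k p \<theta>))" for i p \<theta>
  have tR: "tfam \<Xi> r1 (R i)" for i
    unfolding R_def[abs_def] by (intro tfam_sum_mult tfam_diff tfam1[OF W(1)] tfam1[OF tfam_Q] tw tfam1[OF tdl] tfam1[OF tfam_e1])
  have "bnd \<Xi> r1 (R i) (nn * (2 * (nn * (B2 * E 8) + E 4 + \<eta>)))" for i
    unfolding R_def[abs_def] by (intro bsum_mult bnd_diff bnd1[OF W(2)] bnd1[OF bnd_Q] bw bnd1[OF bdl] bnd1[OF \<eta>(2)])
  moreover have "nn * (2 * (nn * (B2 * E 8) + E 4 + \<eta>)) \<le> E 10"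
  proof -
    have "64 * (nn * (nn * (B2 * E 8))) \<le> E 10" using E_B2'[of 8] E_mono[of 9 10] by (simp add: eval_nat_numeral)
    moreover have "64 * (nn * E 4) \<le> E 10" using E_nn[of 4] E_mono[of 5 10] by (simp add: eval_nat_numeral)
    moreover have "64 * (nn * \<eta>) \<le> E 10" using E_nn[of 0] E_mono[of 1 10] by (simp add: E_0)
    moreover have "nn * (2 * (nn * (B2 * E 8) + E 4 + \<eta>)) = 2 * (nn * (nn * (B2 * E 8))) + 2 * (nn * E 4) + 2 * (nn * \<eta>)"
      by (simp only: distrib_left mult.left_commute[of nn 2])
    ultimately show ?thesis using E_nonneg[of 10] by linarith
  qed
  ultimately have bR: "bnd \<Xi> r1 (R i) (E 10)" for i by (rule bnd_mono[OF _ order_refl])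
  \<comment> \<open>This is the condition by which dl was chosen: R is g minus the combination of
    the W - S with coefficients dl, and the two means agree by \<open>Mdl\<close>.\<close>
  have mR: "cmean (R i p) = 0" if p: "p \<in> \<Xi>" for i p
  proof -
    have Req: "R i p \<theta> = g i p \<theta> - (\<Sum>m\<in>UNIV. dl m p * (W i m p \<theta> - S i m p \<theta>))" for \<theta>
    proof -
      have wl: "w m p \<theta> = (\<Sum>j\<in>UNIV. W j m p \<theta> * b0 j p \<theta>) + (\<Sum>q\<in>UNIV. (\<Sum>j\<in>UNIV. W j m p \<theta> * Bf (q, j) p \<theta>) * dl q p)" for m
        unfolding w_def b_def distrib_left sum.distrib sum_pull ..
      have "(\<Sum>k\<in>UNIV. W i k p \<theta> * (\<Sum>m\<in>UNIV. Q (Inl k) (Inl m) p \<theta> * (\<Sum>q\<in>UNIV. (\<Sum>j\<in>UNIV. W j m p \<theta> * Bf (q, j) p \<theta>) * dl q p)))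
         = (\<Sum>q\<in>UNIV. S i q p \<theta> * dl q p)"
        unfolding S_def sum_pull[where C = "\<lambda>q m. \<Sum>j\<in>UNIV. W j m p \<theta> * Bf (q, j) p \<theta>"]
          sum_pull[where C = "\<lambda>q k. \<Sum>m\<in>UNIV. Q (Inl k) (Inl m) p \<theta> * (\<Sum>j\<in>UNIV. W j m p \<theta> * Bf (q, j) p \<theta>)"] ..
      then show ?thesis
        unfolding R_def g_def wl by (simp add: distrib_left right_diff_distrib sum.distrib sum_subtractf mult.commute)
    qed
    have h: "holo (\<lambda>\<theta>. dl m p * (W i m p \<theta> - S i m p \<theta>)) (strip r1)" for m
      by (intro holo_mult holo_const tfam_holo[OF tWS p])
    have "cmean (R i p) = cmean (g i p) - cmean (\<lambda>\<theta>. \<Sum>m\<in>UNIV. dl m p * (W i m p \<theta> - S i m p \<theta>))"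
      unfolding Req[abs_def] by (rule cmean_diff[OF tfam_holo[OF tg p] holo_sum[OF h] radii(6)])
    also have "cmean (\<lambda>\<theta>. \<Sum>m\<in>UNIV. dl m p * (W i m p \<theta> - S i m p \<theta>)) = (\<Sum>m\<in>UNIV. cmean (\<lambda>\<theta>. dl m p * (W i m p \<theta> - S i m p \<theta>)))"
      unfolding cmean_def by (rule tmean_sum[OF continuous_on_strip_real[OF holo_continuous_on[OF h] radii(6)]])
    also have "\<dots> = cmean (g i p)" unfolding cmean_cmult Mdl[OF p, symmetric] by (simp add: mult.commute)
    finally show ?thesis by simp
  qed
  obtain a where a: "\<And>i. tfam \<Xi> r2 (a i)" "\<And>i. bnd \<Xi> r2 (a i) (2 * E 10 * sd)"
    "\<And>i p \<theta>. p \<in> \<Xi> \<Longrightarrow> \<theta> \<in> strip r2 \<Longrightarrow> ddir (a i p) \<theta> (cvec \<omega>) = R i p \<theta>"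
    by (rule solve_family[where f = R, OF radii(9) tR bR mR, folded r2_def]; (rule that)?; assumption)
  have ab: "bnd \<Xi> r2 (a i) (E 11)" for i
    by (rule bnd_mono[OF a(2)]) (use E_sd[of 10] in \<open>auto simp: eval_nat_numeral\<close>)
  have Dab: "bnd \<Xi> r2 (\<lambda>p \<theta>. ddir (a i p) \<theta> (cvec \<omega>)) (E 10)" for i
    using bnd2[OF bR] a(3) by (simp add: bnd_def)
  show thesis
    by (rule that[OF W tb Db w_def tw bw a(1) ab a(3)[unfolded R_def] Dab tdl bdl])
qed

end


section \<open>Quadratic error of the Newton step\<close>

context newton
begin

definition EE where "EE j = \<kappa> ^ j * \<eta>\<^sup>2"

lemma EE_nonneg: "0 \<le> EE j" using \<kappa>_ge(4) by (simp add: EE_def)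

lemma EE_mono: "i \<le> j \<Longrightarrow> EE i \<le> EE j"
  unfolding EE_def using \<kappa>_ge(4) by (intro mult_right_mono power_increasing) auto

lemma EE_mult: "E i * E j = EE (i + j)"
  by (simp add: E_def EE_def power_add power2_eq_square mult_ac)

lemma EE_nn: "64 * (nn * EE j) \<le> EE (Suc j)" and EE_nn2: "64 * (nn * (nn * EE j)) \<le> EE (Suc j)"
proof -
  have *: "x * EE j \<le> EE (Suc j)" if "x \<le> \<kappa>" for x
    using mult_right_mono[OF that EE_nonneg[of j]] by (simp add: EE_def mult.assoc)
  show "64 * (nn * EE j) \<le> EE (Suc j)" "64 * (nn * (nn * EE j)) \<le> EE (Suc j)"
    using *[OF \<kappa>_ge(1)] *[OF \<kappa>_ge(5)] by (simp_all only: mult.assoc)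
qed

lemma bnd_pd_E:
  assumes "tfam \<Xi> r' f" "bnd \<Xi> r' f (E j)"
  shows "bnd \<Xi> (r' - d) (\<lambda>p. pd i (f p)) (E (Suc j))"
proof (rule bnd_mono[OF bnd_pd[OF assms d(1)] order_refl])
  show "E j / d \<le> E (Suc j)" using E_mult[OF \<kappa>(2), of j] by simp
qed

lemma bnd_de: "bnd \<Xi> r1 (\<lambda>p. pd j (e1 v u l i p)) (E 1)" "bnd \<Xi> r1 (\<lambda>p. pd j (e2 v u i p)) (E 1)"
  using bnd_pd_E[where j = 0 and i = j, OF tfam_e1[of i]] bnd_pd_E[where j = 0 and i = j, OF tfam_e2[of i]] \<eta>(2,3)
  by (auto simp: E_0 r1_def)

text \<open>The approximate torus is Lagrangian up to first order in \<eta>: the form has mean zero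
  and a first-order derivative along \<omega>, so the small divisor estimate bounds the form
  itself.\<close>

lemma bnd_Ld: "bnd \<Xi> r2 (Ld i j) (E 3)"
  unfolding bnd_def
proof (intro ballI)
  fix p and \<theta> :: "complex ^ 'n" assume p: "p \<in> \<Xi>" and \<theta>: "\<theta> \<in> strip r2"
  have "bnd \<Xi> r1 (\<lambda>p \<theta>. \<Sum>k\<in>UNIV. pd i (e1 v u l k p) \<theta> * Y k j p \<theta> + X k i p \<theta> * pd j (e2 v u k p) \<theta>
     - pd i (e2 v u k p) \<theta> * X k j p \<theta> - Y k i p \<theta> * pd j (e1 v u l k p) \<theta>) (nn * (E 1 * 1 + 2 * E 1 + E 1 * 2 + 1 * E 1))"
    by (intro bsum bnd_add bnd_diff bnd_mult bnd_de bnd1[OF bnd_X] bnd1[OF bnd_Y1])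
  moreover have "nn * (E 1 * 1 + 2 * E 1 + E 1 * 2 + 1 * E 1) \<le> E 2"
  proof -
    have "nn * (E 1 * 1 + 2 * E 1 + E 1 * 2 + 1 * E 1) = 6 * (nn * E 1)" by simp
    then show ?thesis using E_nn[of 1] nn_E_nonneg[of 1] unfolding Suc_1 by linarith
  qed
  ultimately have bD: "bnd \<Xi> r1 (\<lambda>p \<theta>. \<Sum>k\<in>UNIV. pd i (e1 v u l k p) \<theta> * Y k j p \<theta> + X k i p \<theta> * pd j (e2 v u k p) \<theta>
     - pd i (e2 v u k p) \<theta> * X k j p \<theta> - Y k i p \<theta> * pd j (e1 v u l k p) \<theta>) (E 2)"
    by (rule bnd_mono[OF _ order_refl])
  have "cmod (Ld i j p \<theta>) \<le> E 2 * sd"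
    unfolding sd_def
  proof (rule small_divisor_estimate[OF dioph d radii(9) tfam_holo[OF tfam1[OF tfam_Ld] p] tfam_per[OF tfam1[OF tfam_Ld] p] cmean_Ld[OF p]])
    show "cmod (ddir (Ld i j p) \<theta> (cvec \<omega>)) \<le> E 2" if "\<theta> \<in> strip r1" for \<theta>
      using bD p that strip_mono[OF less_imp_le[OF radii(4)]] ddir_Ld[OF p, of \<theta> i j] by (auto simp: bnd_def)
    show "\<theta> \<in> strip (r1 - d)" using \<theta> by (simp add: r2_def)
  qed
  also have "\<dots> \<le> E 3"
  proof -
    have "0 \<le> sd" using dioph unfolding sd_def sd_bound_def sd_const_def dioph_def using d by simp
    then have "0 \<le> E 2 * sd" using E_nonneg by simp
    moreover have "2 * (E 2 * sd) \<le> E 3" using E_sd[of 2] by (simp add: eval_nat_numeral)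
    ultimately show ?thesis by linarith
  qed
  finally show "cmod (Ld i j p \<theta>) \<le> E 3" .
qed

text \<open>The corrections are written in the moving frame of the torus. The new defect is the
  residual of the linearised equations plus the Taylor remainder of the gradient of
  \<open>H\<close>, and both are quadratic. The highest power of \<kappa> comes from the remainder:
  \<kappa> times the square of \<open>E 13\<close> is \<open>EE 27\<close>, and one further \<kappa>
  absorbs the sum.\<close>

theorem newton_step:
  obtains dv du dl where
    "\<And>i. tfam \<Xi> r2 (dv i)" "\<And>i. tfam \<Xi> r2 (du i)" "\<And>i. tfam \<Xi> r (\<lambda>p (\<theta> :: complex ^ 'n). dl i p)"
    "\<And>i. bnd \<Xi> r2 (dv i) (E 13)" "\<And>i. bnd \<Xi> r2 (du i) (E 13)"
    "\<And>i j. bnd \<Xi> r3 (\<lambda>p. pd j (dv i p)) (E 14)" "\<And>i j. bnd \<Xi> r3 (\<lambda>p. pd j (du i p)) (E 14)"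
    "\<And>i. bnd \<Xi> r (\<lambda>p (\<theta> :: complex ^ 'n). dl i p) (E 4)"
    "\<And>i. bnd \<Xi> r3 (e1 (\<lambda>i p \<theta>. v i p \<theta> + dv i p \<theta>) (\<lambda>i p \<theta>. u i p \<theta> + du i p \<theta>) (\<lambda>i p. l i p + dl i p) i) (EE 28)"
    "\<And>i. bnd \<Xi> r3 (e2 (\<lambda>i p \<theta>. v i p \<theta> + dv i p \<theta>) (\<lambda>i p \<theta>. u i p \<theta> + du i p \<theta>) i) (EE 28)"
proof -
  obtain W b w a dl where W: "\<And>i j. tfam \<Xi> r (W i j)" "\<And>i j. bnd \<Xi> r (W i j) 2"
    "\<And>p \<theta> i j. p \<in> \<Xi> \<Longrightarrow> \<theta> \<in> strip r \<Longrightarrow> (\<Sum>k\<in>UNIV. X i k p \<theta> * W k j p \<theta>) = (if i = j then 1 else 0)"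
    "\<And>p \<theta> i j. p \<in> \<Xi> \<Longrightarrow> \<theta> \<in> strip r \<Longrightarrow> (\<Sum>k\<in>UNIV. W i k p \<theta> * X k j p \<theta>) = (if i = j then 1 else 0)"
    and b: "\<And>i. tfam \<Xi> r1 (b i)"
    "\<And>j p \<theta>. p \<in> \<Xi> \<Longrightarrow> \<theta> \<in> strip r1 \<Longrightarrow> ddir (b j p) \<theta> (cvec \<omega>) =
       (\<Sum>i\<in>UNIV. Y i j p \<theta> * (dl i p + e1 v u l i p \<theta>)) - (\<Sum>i\<in>UNIV. X i j p \<theta> * e2 v u i p \<theta>)"
    and w: "\<And>i. w i = (\<lambda>p \<theta>. \<Sum>j\<in>UNIV. W j i p \<theta> * b j p \<theta>)" "\<And>i. tfam \<Xi> r1 (w i)" "\<And>i. bnd \<Xi> r1 (w i) (E 8)"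
    and a: "\<And>i. tfam \<Xi> r2 (a i)" "\<And>i. bnd \<Xi> r2 (a i) (E 11)" 
    "\<And>i p \<theta>. p \<in> \<Xi> \<Longrightarrow> \<theta> \<in> strip r2 \<Longrightarrow> ddir (a i p) \<theta> (cvec \<omega>) =
       (\<Sum>k\<in>UNIV. W i k p \<theta> * ((\<Sum>m\<in>UNIV. Q (Inl k) (Inl m) p \<theta> * w m p \<theta>) - dl k p - e1 v u l k p \<theta>))"
    "\<And>i. bnd \<Xi> r2 (\<lambda>p \<theta>. ddir (a i p) \<theta> (cvec \<omega>)) (E 10)"
    and dl: "\<And>i. tfam \<Xi> r (\<lambda>p (\<theta>::complex ^ 'n). dl i p)" "\<And>i. bnd \<Xi> r (\<lambda>p (\<theta>::complex ^ 'n). dl i p) (E 4)"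
    by (rule linearised_solution; (rule that)?; assumption)
  define du where "du i p \<theta> = (\<Sum>j\<in>UNIV. X i j p \<theta> * a j p \<theta>)" for i p \<theta>
  define dv where "dv i p \<theta> = (\<Sum>j\<in>UNIV. Y i j p \<theta> * a j p \<theta>) + w i p \<theta>" for i p \<theta>
  note t2 = tfam2[OF tfam1]
  note b2 = bnd2[OF bnd1]
  have tdu: "tfam \<Xi> r2 (du i)" for i
    unfolding du_def[abs_def] by (intro tfam_sum_mult t2 tfam_X a(1))
  have tdv: "tfam \<Xi> r2 (dv i)" for i
    unfolding dv_def[abs_def] by (intro tfam_add tfam_sum_mult t2[OF tfam_Y] a(1) tfam2[OF w(2)])
  have "bnd \<Xi> r2 (du i) (nn * (2 * E 11))" for i
    unfolding du_def[abs_def] by (intro bsum_mult b2 bnd_X a(2))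
  moreover have "nn * (2 * E 11) \<le> E 13" using nn_2E[of 11] E_mono[of 12 13] by simp
  ultimately have bdu: "bnd \<Xi> r2 (du i) (E 13)" for i by (rule bnd_mono[OF _ order_refl])
  have "bnd \<Xi> r2 (dv i) (nn * (1 * E 11) + E 8)" for i
    unfolding dv_def[abs_def] by (intro bnd_add bsum_mult b2[OF bnd_Y1] a(2) bnd2[OF w(3)])
  moreover have "nn * (1 * E 11) + E 8 \<le> E 13"
  proof -
    have "64 * (nn * E 11) \<le> E 12" "64 * (nn * E 12) \<le> E 13" using E_nn[of 11] E_nn[of 12] by simp_all
    moreover have "E 12 \<le> nn * E 12" using mult_right_mono[OF nn E_nonneg[of 12]] by simp
    ultimately show ?thesis using E_mono[of 8 12] nn_E_nonneg[of 11] E_nonneg[of 12] by simp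
  qed
  ultimately have bdv: "bnd \<Xi> r2 (dv i) (E 13)" for i by (rule bnd_mono[OF _ order_refl])
  have bpd: "bnd \<Xi> r3 (\<lambda>p. pd j (dv i p)) (E 14)" "bnd \<Xi> r3 (\<lambda>p. pd j (du i p)) (E 14)" for i j
    using bnd_pd_E[where i = j, OF tdv[of i] bdv[of i]] bnd_pd_E[where i = j, OF tdu[of i] bdu[of i]] by (simp_all add: r3_def)
  let ?v = "\<lambda>i p \<theta>. v i p \<theta> + dv i p \<theta>" and ?u = "\<lambda>i p \<theta>. u i p \<theta> + du i p \<theta>" and ?l = "\<lambda>i p. l i p + dl i p"
  have main: "cmod (e1 ?v ?u ?l i p \<theta>) \<le> EE 28 \<and> cmod (e2 ?v ?u i p \<theta>) \<le> EE 28"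
    if p: "p \<in> \<Xi>" and \<theta>3: "\<theta> \<in> strip r3" for i p and \<theta> :: "complex ^ 'n"
  proof -
    have \<theta>2: "\<theta> \<in> strip r2" using \<theta>3 strip_mono[OF less_imp_le[OF radii(2)]] by blast
    have \<theta>1: "\<theta> \<in> strip r1" using \<theta>2 strip_mono[OF less_imp_le[OF radii(3)]] by blast
    have \<theta>: "\<theta> \<in> strip r" using \<theta>1 strip_mono[OF less_imp_le[OF radii(4)]] by blast
    let ?D = "\<lambda>f. ddir f \<theta> (cvec \<omega>)"
    define Xm Ym DX DY E1 E2 Wm Hyy Hyx Hxy Hxx :: "complex ^ 'n ^ 'n"
      where "Xm = (\<chi> i j. X i j p \<theta>)" and "Ym = (\<chi> i j. Y i j p \<theta>)"
        and "DX = (\<chi> i j. ?D (X i j p))" and "DY = (\<chi> i j. ?D (Y i j p))"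
        and "E1 = (\<chi> i j. pd j (e1 v u l i p) \<theta>)" and "E2 = (\<chi> i j. pd j (e2 v u i p) \<theta>)"
        and "Wm = (\<chi> i j. W i j p \<theta>)"
        and "Hyy = (\<chi> i j. Q (Inl i) (Inl j) p \<theta>)" and "Hyx = (\<chi> i j. Q (Inl i) (Inr j) p \<theta>)"
        and "Hxy = (\<chi> i j. Q (Inr i) (Inl j) p \<theta>)" and "Hxx = (\<chi> i j. Q (Inr i) (Inr j) p \<theta>)"
    define av Da wv Dw e1v e2v dlv Db :: "complex ^ 'n"
      where "av = (\<chi> i. a i p \<theta>)" and "Da = (\<chi> i. ?D (a i p))" and "wv = (\<chi> i. w i p \<theta>)" and "Dw = (\<chi> i. ?D (w i p))"
        and "e1v = (\<chi> i. e1 v u l i p \<theta>)" and "e2v = (\<chi> i. e2 v u i p \<theta>)" and "dlv = (\<chi> i. dl i p)" and "Db = (\<chi> i. ?D (b i p))"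
    note mdefs = Xm_def Ym_def DX_def DY_def E1_def E2_def Wm_def Hyy_def Hyx_def Hxy_def Hxx_def
      av_def Da_def wv_def Dw_def e1v_def e2v_def dlv_def Db_def matrix_vector_mult_def matrix_matrix_mult_def transpose_def
    have hX: "holo (X k j p) (strip r1)" and hY: "holo (Y k j p) (strip r1)" and hw: "holo (w j p) (strip r1)" for k j
      using tfam_holo[OF tfam1[OF tfam_X] p] tfam_holo[OF tfam1[OF tfam_Y] p] tfam_holo[OF w(2) p] by auto
    have hX2: "holo (X k j p) (strip r2)" and hY2: "holo (Y k j p) (strip r2)" and ha: "holo (a j p) (strip r2)" and hw2: "holo (w j p) (strip r2)" for k j
      using tfam_holo[OF t2[OF tfam_X] p] tfam_holo[OF t2[OF tfam_Y] p] tfam_holo[OF a(1) p] tfam_holo[OF tfam2[OF w(2)] p] by auto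
    \<comment> \<open>Since w was built with the inverse of X, b is recovered from it on the whole
      strip r1. Differentiating this identity supplies the relation between Dw and Db needed in
      \<open>newton_residual\<close>.\<close>
    have bw: "b j p \<phi> = (\<Sum>i\<in>UNIV. X i j p \<phi> * w i p \<phi>)" if "\<phi> \<in> strip r1" for j \<phi>
    proof -
      have \<phi>: "\<phi> \<in> strip r" using that strip_mono[OF less_imp_le[OF radii(4)]] by blast
      have "(\<Sum>i\<in>UNIV. X i j p \<phi> * w i p \<phi>) = (\<Sum>k\<in>UNIV. (\<Sum>i\<in>UNIV. X i j p \<phi> * W k i p \<phi>) * b k p \<phi>)"
        unfolding w(1) by (rule sum_pull[where C = "\<lambda>k i. W k i p \<phi>"])
      also have "\<dots> = (\<Sum>k\<in>UNIV. (if k = j then 1 else 0) * b k p \<phi>)"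
        using W(4)[OF p \<phi>] by (simp add: mult.commute)
      also have "\<dots> = b j p \<phi>" by (simp add: if_distrib if_distribR cong: if_cong)
      finally show ?thesis by simp
    qed
    have Db': "?D (b j p) = (\<Sum>i\<in>UNIV. X i j p \<theta> * ?D (w i p) + ?D (X i j p) * w i p \<theta>)" for j
    proof -
      have "?D (b j p) = ?D (\<lambda>\<phi>. \<Sum>i\<in>UNIV. X i j p \<phi> * w i p \<phi>)"
        by (rule ddir_cong[OF open_strip bw \<theta>1])
      then show ?thesis by (simp add: ddir_sum[OF holo_mult[OF hX hw] \<theta>1] ddir_mult[OF hX hw \<theta>1])
    qed
    have f1: "DX = E1 + Hyx ** Xm + Hyy ** Ym" "DY = E2 - (Hxx ** Xm + Hxy ** Ym)"
      by (simp_all add: vec_eq_iff mdefs ddir_X[OF p \<theta>] ddir_Y[OF p \<theta>])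
    have f2: "transpose Hyy = Hyy" "transpose Hyx = Hxy"
      by (simp_all add: vec_eq_iff mdefs Q_sym[OF p \<theta>])
    have f3: "Xm ** Wm = mat 1" using W(3)[OF p \<theta>] by (simp add: vec_eq_iff mdefs mat_def)
    have f4: "transpose DX *v wv + transpose Xm *v Dw = Db"
      by (simp add: vec_eq_iff mdefs Db' sum.distrib add.commute)
    have f5: "Db = transpose Ym *v (dlv + e1v) - transpose Xm *v e2v"
      by (simp add: vec_eq_iff mdefs b(2)[OF p \<theta>1])
    have f6: "Da = Wm *v (Hyy *v wv - dlv - e1v)"
      by (simp add: vec_eq_iff mdefs a(3)[OF p \<theta>2])
    note R = newton_residual[OF f1 f2 f3 f4 f5 f6, of av]
    define \<Delta> where "\<Delta> = (\<chi> s. case s of Inl i \<Rightarrow> dv i p \<theta> | Inr i \<Rightarrow> du i p \<theta>)"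
    have kpt: "kpt ?v ?u p \<theta> = kpt v u p \<theta> + \<Delta>"
      by (auto simp: kpt_def \<Delta>_def vec_eq_iff split: sum.split)
    have \<Delta>: "cmod (\<Delta> $ s) \<le> E 13" for s
      using bdv bdu p \<theta>2 by (cases s) (auto simp: \<Delta>_def bnd_def)
    have "E 13 \<le> \<rho> / 8" using E_mono[of 13 14] \<eta>_small by (simp add: E_def)
    then have T: "cmod (pd s H (kpt v u p \<theta> + \<Delta>) - pd s H (kpt v u p \<theta>) - (\<Sum>t\<in>UNIV. \<Delta> $ t * Q s t p \<theta>)) \<le> EE 27" for s
    proof -
      have "cmod (pd s H (kpt v u p \<theta> + \<Delta>) - pd s H (kpt v u p \<theta>) - (\<Sum>t\<in>UNIV. \<Delta> $ t * Q s t p \<theta>)) \<le> 512 * B / \<rho> ^ 3 * (E 13)\<^sup>2"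
        unfolding Q_def by (rule taylor_pd_H[OF kpt_dom[OF p \<theta>] \<Delta> E_nonneg \<open>E 13 \<le> \<rho> / 8\<close>])
      also have "\<dots> \<le> \<kappa> * (E 13)\<^sup>2" by (rule mult_right_mono[OF \<kappa>(4)]) simp
      also have "\<dots> = EE 27" by (simp add: EE_def E_def power2_eq_square eval_nat_numeral mult_ac)
      finally show ?thesis .
    qed
    have Q\<Delta>: "(\<Sum>t\<in>UNIV. \<Delta> $ t * Q s t p \<theta>) = (\<Sum>k\<in>UNIV. Q s (Inl k) p \<theta> * dv k p \<theta>) + (\<Sum>k\<in>UNIV. Q s (Inr k) p \<theta> * du k p \<theta>)" for s
      unfolding sum_Plus_UNIV by (simp add: \<Delta>_def mult.commute)
    have Ddu: "?D (du k p) = (DX *v av + Xm *v Da) $ k" for k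
      unfolding du_def[abs_def] ddir_sum[OF holo_mult[OF hX2 ha] \<theta>2] ddir_mult[OF hX2 ha \<theta>2]
      by (simp add: mdefs sum.distrib add.commute)
    have Ddv: "?D (dv k p) = (DY *v av + Ym *v Da + Dw) $ k" for k
      unfolding dv_def[abs_def] ddir_add[OF holo_sum[OF holo_mult[OF hY2 ha]] hw2 \<theta>2] ddir_sum[OF holo_mult[OF hY2 ha] \<theta>2] ddir_mult[OF hY2 ha \<theta>2]
      by (simp add: mdefs sum.distrib add.commute)
    have Du: "?D (?u k p) = ?D (u k p) + ?D (du k p)" and Dv: "?D (?v k p) = ?D (v k p) + ?D (dv k p)" for k
      by (rule ddir_add[OF tfam_holo[OF t2[OF u] p] tfam_holo[OF tdu p] \<theta>2] ddir_add[OF tfam_holo[OF t2[OF v] p] tfam_holo[OF tdv p] \<theta>2])+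
    have duv: "(Xm *v av) $ k = du k p \<theta>" "(Ym *v av + wv) $ k = dv k p \<theta>" for k
      by (simp_all add: mdefs du_def dv_def)
    \<comment> \<open>The gradient of \<open>H\<close> is expanded at the old torus. Its linear
      part, the derivative of du, dl and the old defect together form the left side of the residual
      identity; what is left is the Taylor remainder.\<close>
    have e1': "e1 ?v ?u ?l i p \<theta> = (E1 *v av) $ i - (pd (Inl i) H (kpt v u p \<theta> + \<Delta>) - pd (Inl i) H (kpt v u p \<theta>) - (\<Sum>t\<in>UNIV. \<Delta> $ t * Q (Inl i) t p \<theta>))"
    proof -
      have "(Hyx *v (Xm *v av)) $ i = (\<Sum>k\<in>UNIV. Q (Inl i) (Inr k) p \<theta> * du k p \<theta>)"
        "(Hyy *v (Ym *v av + wv)) $ i = (\<Sum>k\<in>UNIV. Q (Inl i) (Inl k) p \<theta> * dv k p \<theta>)"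
        unfolding matrix_vector_mult_def[of Hyx] matrix_vector_mult_def[of Hyy] by (simp_all add: duv duv(2)[unfolded vector_add_component]) (simp_all add: Hyx_def Hyy_def)
      then have "(E1 *v av) $ i = ?D (du i p) - (\<Sum>t\<in>UNIV. \<Delta> $ t * Q (Inl i) t p \<theta>) + dl i p + e1 v u l i p \<theta>"
        unfolding R(1)[symmetric] Q\<Delta> Ddu by (simp add: dlv_def e1v_def)
      then show ?thesis unfolding e1_def[of ?v] kpt Du by (simp add: e1_def)
    qed
    have e2': "e2 ?v ?u i p \<theta> = (E2 *v av + transpose Wm *v ((transpose Xm ** Ym - transpose Ym ** Xm) *v Da - transpose E1 *v wv)) $ i
       + (pd (Inr i) H (kpt v u p \<theta> + \<Delta>) - pd (Inr i) H (kpt v u p \<theta>) - (\<Sum>t\<in>UNIV. \<Delta> $ t * Q (Inr i) t p \<theta>))"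
    proof -
      have "(Hxx *v (Xm *v av)) $ i = (\<Sum>k\<in>UNIV. Q (Inr i) (Inr k) p \<theta> * du k p \<theta>)"
        "(Hxy *v (Ym *v av + wv)) $ i = (\<Sum>k\<in>UNIV. Q (Inr i) (Inl k) p \<theta> * dv k p \<theta>)"
        unfolding matrix_vector_mult_def[of Hxx] matrix_vector_mult_def[of Hxy] by (simp_all add: duv duv(2)[unfolded vector_add_component]) (simp_all add: Hxx_def Hxy_def)
      then have "(E2 *v av + transpose Wm *v ((transpose Xm ** Ym - transpose Ym ** Xm) *v Da - transpose E1 *v wv)) $ i
        = ?D (dv i p) + (\<Sum>t\<in>UNIV. \<Delta> $ t * Q (Inr i) t p \<theta>) + e2 v u i p \<theta>"
        unfolding R(2)[symmetric] Q\<Delta> Ddv by (simp add: e2v_def)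
      then show ?thesis unfolding e2_def[of ?v] kpt Dv by (simp add: e2_def)
    qed
    have pt: "cmod (\<Sum>k\<in>UNIV. f k * g k) \<le> nn * (x * y)" if "\<And>k. cmod (f k) \<le> x" "\<And>k. cmod (g k) \<le> y" for f g :: "'n \<Rightarrow> complex" and x y
    proof -
      have "cmod (f k * g k) \<le> x * y" for k
        unfolding norm_mult using that order_trans[OF norm_ge_zero that(1)] by (intro mult_mono) auto
      then show ?thesis using sum_norm_bound[of UNIV "\<lambda>k. f k * g k" "x * y"] by (simp add: nn_def)
    qed
    have c: "cmod (a k p \<theta>) \<le> E 11" "cmod (?D (a k p)) \<le> E 10" "cmod (w k p \<theta>) \<le> E 8"
      "cmod (pd j (e1 v u l k p) \<theta>) \<le> E 1" "cmod (pd j (e2 v u k p) \<theta>) \<le> E 1" "cmod (Ld k j p \<theta>) \<le> E 3" "cmod (W k j p \<theta>) \<le> 2" for k j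
      using a(2,4) w(3) bnd_de bnd_Ld W(2) p \<theta>2 \<theta>1 \<theta> by (auto simp: bnd_def)
    have b1: "cmod ((E1 *v av) $ i) \<le> nn * EE 12" "cmod ((E2 *v av) $ i) \<le> nn * EE 12"
      using pt[of "\<lambda>j. pd j (e1 v u l i p) \<theta>" "E 1" "\<lambda>j. a j p \<theta>" "E 11"] pt[of "\<lambda>j. pd j (e2 v u i p) \<theta>" "E 1" "\<lambda>j. a j p \<theta>" "E 11"] c
      by (simp_all add: mdefs EE_mult)
    have LD: "((transpose Xm ** Ym - transpose Ym ** Xm) *v Da) $ k = (\<Sum>j\<in>UNIV. Ld k j p \<theta> * ?D (a j p))" for k
      by (simp add: mdefs Ld_def sum_subtractf)
    have b2: "cmod (((transpose Xm ** Ym - transpose Ym ** Xm) *v Da - transpose E1 *v wv) $ k) \<le> nn * EE 13 + nn * EE 9" for k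
    proof -
      have "cmod (((transpose Xm ** Ym - transpose Ym ** Xm) *v Da) $ k) \<le> nn * EE 13"
        unfolding LD using pt[of "\<lambda>j. Ld k j p \<theta>" "E 3" "\<lambda>j. ?D (a j p)" "E 10"] c by (simp add: EE_mult)
      moreover have "cmod ((transpose E1 *v wv) $ k) \<le> nn * EE 9"
        using pt[of "\<lambda>j. pd k (e1 v u l j p) \<theta>" "E 1" "\<lambda>j. w j p \<theta>" "E 8"] c by (simp add: mdefs EE_mult)
      ultimately show ?thesis
        unfolding vector_minus_component by (intro norm_triangle_le_diff) auto
    qed
    have "cmod ((transpose Wm *v ((transpose Xm ** Ym - transpose Ym ** Xm) *v Da - transpose E1 *v wv)) $ i) \<le> nn * (2 * (nn * EE 13 + nn * EE 9))"
      unfolding matrix_vector_mult_def[of "transpose Wm"]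
      using pt[of "\<lambda>k. W k i p \<theta>" 2 "\<lambda>k. ((transpose Xm ** Ym - transpose Ym ** Xm) *v Da - transpose E1 *v wv) $ k", OF c(7) b2]
      by (simp add: Wm_def transpose_def)
    then have b3: "cmod ((transpose Wm *v ((transpose Xm ** Ym - transpose Ym ** Xm) *v Da - transpose E1 *v wv)) $ i) \<le> EE 14"
    proof -
      have "nn * (2 * (nn * EE 13 + nn * EE 9)) = 2 * (nn * (nn * EE 13)) + 2 * (nn * (nn * EE 9))" by (simp add: algebra_simps)
      moreover have "64 * (nn * (nn * EE 13)) \<le> EE 14" using EE_nn2[of 13] by simp
      moreover have "64 * (nn * (nn * EE 9)) \<le> EE 14" using EE_nn2[of 9] EE_mono[of 10 14] by simp
      ultimately show ?thesis using \<open>cmod _ \<le> nn * (2 * (nn * EE 13 + nn * EE 9))\<close> EE_nonneg[of 14] by linarith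
    qed
    have s: "nn * EE 12 + EE 14 + EE 27 \<le> EE 28"
    proof -
      have "64 * (nn * EE 12) \<le> EE 27" using EE_nn[of 12] EE_mono[of 13 27] by simp
      moreover have "EE 14 \<le> EE 27" by (rule EE_mono) simp
      moreover have "EE 27 \<le> nn * EE 27" using mult_right_mono[OF nn EE_nonneg[of 27]] by simp
      moreover have "64 * (nn * EE 27) \<le> EE 28" using EE_nn[of 27] by simp
      ultimately show ?thesis using EE_nonneg[of 27] by linarith
    qed
    have "cmod (e1 ?v ?u ?l i p \<theta>) \<le> nn * EE 12 + EE 27"
      unfolding e1' using b1(1) T[of "Inl i"] by (intro norm_triangle_le_diff) auto
    moreover have "cmod (e2 ?v ?u i p \<theta>) \<le> (nn * EE 12 + EE 14) + EE 27"
      unfolding e2' vector_add_component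
      by (rule norm_triangle_le[OF add_mono[OF norm_triangle_le[OF add_mono[OF b1(2) b3]] T]])
    ultimately show ?thesis using s EE_nonneg[of 14] by linarith
  qed
  then have "bnd \<Xi> r3 (e1 ?v ?u ?l i) (EE 28)" "bnd \<Xi> r3 (e2 ?v ?u i) (EE 28)" for i
    by (auto simp: bnd_def)
  then show thesis
    using that[of dv du dl, OF tdv tdu dl(1) bdv bdu bpd dl(2)] by blast
qed

end


section \<open>Convergence of the Newton iteration\<close>

lemma geometric_uniform_limit:
  fixes f :: "nat \<Rightarrow> 'a \<Rightarrow> complex"
  assumes f: "\<And>n x. x \<in> A \<Longrightarrow> cmod (f (Suc n) x - f n x) \<le> \<zeta> * (1 / 2) ^ n" and \<zeta>: "0 \<le> \<zeta>"
  obtains g where "uniform_limit A f g sequentially" "\<And>x. x \<in> A \<Longrightarrow> cmod (g x - f 0 x) \<le> 2 * \<zeta>"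
proof -
  have "summable (\<lambda>n. \<zeta> * (1 / 2 :: real) ^ n)" by (intro summable_mult summable_geometric) simp
  then have ul: "uniform_limit A (\<lambda>n x. \<Sum>i<n. f (Suc i) x - f i x) (\<lambda>x. \<Sum>i. f (Suc i) x - f i x) sequentially"
    using f by (intro Weierstrass_m_test[where M = "\<lambda>n. \<zeta> * (1 / 2) ^ n"]) auto
  have tele: "(\<Sum>i<n. f (Suc i) x - f i x) = f n x - f 0 x" for n x
    using sum_lessThan_telescope[of "\<lambda>i. f i x" n] by simp
  define g where "g x = (\<Sum>i. f (Suc i) x - f i x) + f 0 x" for x
  have "uniform_limit A (\<lambda>n x. (\<Sum>i<n. f (Suc i) x - f i x) + f 0 x) g sequentially"
    unfolding g_def by (intro uniform_limit_add ul uniform_limit_const)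
  then have u: "uniform_limit A f g sequentially" unfolding tele by simp
  have "cmod (g x - f 0 x) \<le> 2 * \<zeta>" if x: "x \<in> A" for x
  proof -
    have "(\<lambda>n. cmod (f n x - f 0 x)) \<longlonglongrightarrow> cmod (g x - f 0 x)"
      by (intro tendsto_intros tendsto_uniform_limitI[OF u x])
    moreover have "cmod (f n x - f 0 x) \<le> 2 * \<zeta>" for n
    proof -
      have "f n x - f 0 x = (\<Sum>i<n. f (Suc i) x - f i x)" by (simp add: tele)
      also have "cmod \<dots> \<le> (\<Sum>i<n. \<zeta> * (1 / 2) ^ i)" by (intro sum_norm_le f x)
      also have "\<dots> = \<zeta> * (\<Sum>i<n. (1 / 2) ^ i)" by (simp add: sum_distrib_left)
      also have "(\<Sum>i<n. (1 / 2 :: real) ^ i) = 2 * (1 - (1 / 2) ^ n)" by (simp add: sum_gp_strict)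
      also have "\<zeta> * (2 * (1 - (1 / 2) ^ n)) \<le> \<zeta> * 2" using \<zeta> by (intro mult_left_mono) auto
      finally show ?thesis by simp
    qed
    ultimately show ?thesis by (intro LIMSEQ_le_const2) auto
  qed
  with u show thesis by (rule that)
qed

section \<open>Constants and invariants of the iteration\<close>

definition width :: "real \<Rightarrow> real" where "width \<rho> = min (\<rho> / 4) 1"

definition sd_exp :: "'n::finite itself \<Rightarrow> real \<Rightarrow> nat" where "sd_exp n \<tau> = nat \<lceil>\<tau>\<rceil> + CARD('n)"

text \<open>The sum of the four lower bounds that a Newton step puts on \<kappa>, taken at the first
  step, where the loss of width is a twelfth of \<open>width \<rho>\<close>.\<close>

definition kam_K :: "'n::finite itself \<Rightarrow> real \<Rightarrow> real \<Rightarrow> real \<Rightarrow> real \<Rightarrow> real" where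
  "kam_K n \<rho> B \<gamma> \<tau> = 64 * real CARD('n) ^ 3 * (1 + 16 * B / \<rho>\<^sup>2) + 12 / width \<rho> +
     2 * sd_const n \<gamma> \<tau> * (12 / width \<rho>) ^ sd_exp n \<tau> + 512 * B / \<rho> ^ 3"

text \<open>With x the factor of c1 in the condition \<open>small\<close>, the number 1/(2n (1 + x))
  is at most 1/(2n) and remains so after multiplication by x. The loss \<open>d0\<close> is an
  eighth of the initial width.\<close>

definition kam_c1 :: "'n::finite itself \<Rightarrow> real \<Rightarrow> real \<Rightarrow> real \<Rightarrow> real \<Rightarrow> real" where
  "kam_c1 n \<rho> B \<gamma> \<tau> = min (\<rho> / 8) (1 / (2 * real CARD('n) * (1 + 2 * real CARD('n) +
     4 * real CARD('n) ^ 3 * (16 * B / \<rho>\<^sup>2) * sd_bound n \<gamma> \<tau> (width \<rho> / 8))))"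

text \<open>A Newton step turns an error \<open>\<eta>\<close> into at most \<open>\<kappa> ^ 28 * \<eta>\<^sup>2\<close>; in step \<open>m\<close> of the iteration
  \<open>\<kappa> = kam_K * (2 ^ sd_exp) ^ m\<close>.\<close>

definition kam_C :: "'n::finite itself \<Rightarrow> real \<Rightarrow> real \<Rightarrow> real \<Rightarrow> real \<Rightarrow> real" where
  "kam_C n \<rho> B \<gamma> \<tau> = 2 * kam_K n \<rho> B \<gamma> \<tau> ^ 28 * (2 ^ sd_exp n \<tau>) ^ 28"

context kam
begin

definition "r0 = width \<rho>"
definition "K = kam_K TYPE('n) \<rho> B \<gamma> \<tau>"
definition "c0 = kam_c1 TYPE('n) \<rho> B \<gamma> \<tau>"
text \<open>Halving the loss of width multiplies the small divisor constant by q, which makes q the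
  growth rate of \<kappa>.\<close>

definition "q = (2 :: real) ^ sd_exp TYPE('n) \<tau>"
text \<open>The widths decrease from r0 towards r0/2. \<open>dd m\<close> is a third of the m-th
  decrement, because a Newton step loses its \<open>d\<close> three times.\<close>

definition "rr m = r0 / 2 + r0 / 2 * (1 / 2) ^ m" for m :: nat
definition "dd m = r0 / 12 * (1 / 2) ^ m" for m :: nat

lemma r0: "0 < r0" "r0 \<le> 1" "r0 \<le> \<rho> / 4" using rho by (auto simp: r0_def width_def)

lemma sd_const_nonneg: "0 \<le> sd_const TYPE('n) \<gamma> \<tau>"
  using dioph unfolding sd_const_def dioph_def by simp

lemma c0: "0 < c0" "c0 \<le> \<rho> / 8" "c0 \<le> 1 / (2 * real CARD('n))"
  "c0 * (2 * real CARD('n) + 4 * real CARD('n) ^ 3 * (16 * B / \<rho>\<^sup>2) * sd_bound TYPE('n) \<gamma> \<tau> (r0 / 8)) \<le> 1 / (2 * real CARD('n))"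
proof -
  define x where "x = 2 * real CARD('n) + 4 * real CARD('n) ^ 3 * (16 * B / \<rho>\<^sup>2) * sd_bound TYPE('n) \<gamma> \<tau> (r0 / 8)"
  define n where "n = real CARD('n)"
  have n: "n \<ge> 1" by (simp add: n_def Suc_leI)
  have "0 \<le> sd_bound TYPE('n) \<gamma> \<tau> (r0 / 8)" unfolding sd_bound_def using sd_const_nonneg r0 by simp
  then have x: "0 \<le> x" unfolding x_def using B_nonneg by (intro add_nonneg_nonneg mult_nonneg_nonneg) auto
  have c: "c0 = min (\<rho> / 8) (1 / (2 * n * (1 + x)))" by (simp add: c0_def kam_c1_def x_def n_def r0_def add.assoc)
  show "0 < c0" unfolding c using rho n x by simp
  show "c0 \<le> \<rho> / 8" unfolding c by simp
  have c': "c0 \<le> 1 / (2 * n * (1 + x))" unfolding c by simp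
  also have "\<dots> \<le> 1 / (2 * n)" using n x by (intro divide_left_mono) auto
  finally show "c0 \<le> 1 / (2 * real CARD('n))" by (simp add: n_def)
  have "c0 * x \<le> 1 / (2 * n * (1 + x)) * x" using c' x by (rule mult_right_mono)
  also have "\<dots> = 1 / (2 * n) * (x / (1 + x))" by simp
  also have "\<dots> \<le> 1 / (2 * n) * 1" using n x by (intro mult_left_mono) (auto simp: divide_le_eq)
  finally show "c0 * (2 * real CARD('n) + 4 * real CARD('n) ^ 3 * (16 * B / \<rho>\<^sup>2) * sd_bound TYPE('n) \<gamma> \<tau> (r0 / 8)) \<le> 1 / (2 * real CARD('n))"
    by (simp add: x_def n_def)
qed

lemma q: "2 \<le> q"
proof -
  have "1 \<le> sd_exp TYPE('n) \<tau>" by (simp add: sd_exp_def Suc_leI trans_le_add2)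
  then have "(2::real) ^ 1 \<le> 2 ^ sd_exp TYPE('n) \<tau>" by (intro power_increasing) auto
  then show ?thesis by (simp add: q_def)
qed

lemma kappa_bounds:
  fixes m :: nat
  defines "\<kappa> \<equiv> K * q ^ m"
  shows "64 * real CARD('n) ^ 3 * (1 + 16 * B / \<rho>\<^sup>2) \<le> \<kappa>" "1 / dd m \<le> \<kappa>" "2 * sd_bound TYPE('n) \<gamma> \<tau> (dd m) \<le> \<kappa>" "512 * B / \<rho> ^ 3 \<le> \<kappa>"
proof -
  define a1 a2 a3 a4 where "a1 = 64 * real CARD('n) ^ 3 * (1 + 16 * B / \<rho>\<^sup>2)" and "a2 = 12 / r0"
    and "a3 = 2 * sd_const TYPE('n) \<gamma> \<tau> * (12 / r0) ^ sd_exp TYPE('n) \<tau>" and "a4 = 512 * B / \<rho> ^ 3"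
  have K: "K = a1 + a2 + a3 + a4" by (simp add: K_def kam_K_def a1_def a2_def a3_def a4_def r0_def)
  have nn: "0 \<le> a1" "0 \<le> a2" "0 \<le> a3" "0 \<le> a4"
    using B_nonneg rho r0 sd_const_nonneg unfolding a1_def a2_def a3_def a4_def by auto
  have q1: "1 \<le> q ^ m" using q by (simp add: one_le_power)
  have le: "x * q ^ m \<le> \<kappa>" if "x \<le> K" for x unfolding \<kappa>_def using that q1 by (intro mult_right_mono) auto
  have le': "x \<le> \<kappa>" if "0 \<le> x" "x \<le> K" for x
    using le[OF that(2)] mult_left_mono[OF q1 that(1)] by simp
  show "64 * real CARD('n) ^ 3 * (1 + 16 * B / \<rho>\<^sup>2) \<le> \<kappa>" using le'[of a1] nn K unfolding a1_def by linarith
  show "512 * B / \<rho> ^ 3 \<le> \<kappa>" using le'[of a4] nn K unfolding a4_def by linarith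
  have "1 / dd m = a2 * 2 ^ m" by (simp add: dd_def a2_def power_divide)
  also have "\<dots> \<le> a2 * q ^ m" using nn q by (intro mult_left_mono power_mono) auto
  also have "\<dots> \<le> \<kappa>" by (rule le) (use nn K in linarith)
  finally show "1 / dd m \<le> \<kappa>" .
  have "2 * sd_bound TYPE('n) \<gamma> \<tau> (dd m) = 2 * sd_const TYPE('n) \<gamma> \<tau> * (12 / r0 * 2 ^ m) ^ sd_exp TYPE('n) \<tau>"
    by (simp add: sd_bound_def sd_exp_def dd_def power_divide)
  also have "\<dots> = a3 * q ^ m"
  proof -
    have "(2 ^ m :: real) ^ sd_exp TYPE('n) \<tau> = q ^ m" by (simp add: q_def power_mult[symmetric] mult.commute)
    then show ?thesis unfolding power_mult_distrib a3_def by simp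
  qed
  also have "\<dots> \<le> \<kappa>" by (rule le) (use nn K in linarith)
  finally show "2 * sd_bound TYPE('n) \<gamma> \<tau> (dd m) \<le> \<kappa>" .
qed

lemma K_ge_1: "1 \<le> K"
proof -
  have "64 * real CARD('n) ^ 3 * (1 + 16 * B / \<rho>\<^sup>2) \<le> K" using kappa_bounds(1)[of 0] by simp
  moreover have "1 \<le> real CARD('n) ^ 3" by (intro one_le_power) (simp add: Suc_leI)
  then have "1 * 1 \<le> 64 * real CARD('n) ^ 3 * (1 + 16 * B / \<rho>\<^sup>2)"
    using B_nonneg by (intro mult_mono) (linarith | simp)+
  ultimately show ?thesis by simp
qed

text \<open>Only geometric decay of the error is claimed, with ratio 1/(2 q ^ 28): multiplied by
  \<kappa> ^ 28 the error still decays like 2^-m, so \<zeta> 2^-m dominates every correction, and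
  the quadratic estimate reproduces the ratio as soon as \<zeta> \<le> 1/2.\<close>

definition "\<zeta> \<eta> = K ^ 28 * q ^ 28 * \<eta>"
definition "err \<eta> m = \<eta> * (1 / 2) ^ m / (q ^ 28) ^ m" for m :: nat

text \<open>The bound 2 \<zeta> (1 - 2^-m) is the sum of the increments \<zeta> 2^-j over j < m; it
  is 0 at the start and never exceeds 2 \<zeta>. The counterterm keeps the width r0 because it is
  constant in \<theta>.\<close>

definition state where
  "state \<eta> m = (\<lambda>(v, u, l). (\<forall>i. tfam \<Xi> (rr m) (v i) \<and> tfam \<Xi> (rr m) (u i) \<and> tfam \<Xi> r0 (\<lambda>p (\<theta> :: complex ^ 'n). l i p) \<and>
     bnd \<Xi> (rr m) (v i) (2 * \<zeta> \<eta> * (1 - (1 / 2) ^ m)) \<and> bnd \<Xi> (rr m) (u i) (2 * \<zeta> \<eta> * (1 - (1 / 2) ^ m)) \<and>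
     (\<forall>j. bnd \<Xi> (rr m) (\<lambda>p. pd j (v i p)) (2 * \<zeta> \<eta> * (1 - (1 / 2) ^ m)) \<and> bnd \<Xi> (rr m) (\<lambda>p. pd j (u i p)) (2 * \<zeta> \<eta> * (1 - (1 / 2) ^ m))) \<and>
     bnd \<Xi> (rr m) (e1 v u l i) (err \<eta> m) \<and> bnd \<Xi> (rr m) (e2 v u i) (err \<eta> m)))"

definition increment where
  "increment \<eta> m = (\<lambda>(v, u, l) (v', u', l'). \<forall>i. bnd \<Xi> (rr (Suc m)) (\<lambda>p \<theta>. v' i p \<theta> - v i p \<theta>) (\<zeta> \<eta> * (1 / 2) ^ m) \<and>
     bnd \<Xi> (rr (Suc m)) (\<lambda>p \<theta>. u' i p \<theta> - u i p \<theta>) (\<zeta> \<eta> * (1 / 2) ^ m) \<and>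
     bnd \<Xi> (rr (Suc m)) (\<lambda>p (\<theta> :: complex ^ 'n). l' i p - l i p) (\<zeta> \<eta> * (1 / 2) ^ m))"

lemma rr: "rr (Suc m) = rr m - dd m - dd m - dd m" "0 < dd m" "dd m \<le> 1" "r0 / 2 < rr m" "rr m \<le> r0" "3 * dd m + r0 / 8 < rr m"
proof -
  have p: "(1 / 2 :: real) ^ m \<le> 1" "0 < (1 / 2 :: real) ^ m" by (auto simp: power_le_one)
  show "rr (Suc m) = rr m - dd m - dd m - dd m" by (simp add: rr_def dd_def field_simps)
  show "0 < dd m" "r0 / 2 < rr m" using r0 p by (auto simp: rr_def dd_def)
  have "r0 * (1 / 2) ^ m \<le> r0 * 1" using r0 p by (intro mult_left_mono) auto
  then have a: "r0 * (1 / 2) ^ m \<le> r0" by simp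
  have "dd m = r0 * (1 / 2) ^ m / 12" "rr m = r0 / 2 + r0 * (1 / 2) ^ m / 2" by (simp_all add: dd_def rr_def)
  then show "dd m \<le> 1" "rr m \<le> r0" "3 * dd m + r0 / 8 < rr m" using a r0 p mult_pos_pos[OF r0(1) p(2)] by linarith+
qed

text \<open>The bound c0 on u, v and their derivatives holds for all m, so \<open>newton\<close> is
  instantiated with c1 = c0 and d0 = r0/8 throughout; only the width, d, \<kappa> and the error
  depend on m.\<close>

lemma newton_iteration_step:
  assumes h\<eta>: "0 \<le> \<eta>" "\<zeta> \<eta> \<le> 1 / 2" "2 * \<zeta> \<eta> \<le> c0" and s: "state \<eta> m (v, u, l)"
  shows "\<exists>s'. state \<eta> (Suc m) s' \<and> increment \<eta> m (v, u, l) s'"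
proof -
  define t where "t = (1 / 2 :: real) ^ m"
  have t: "0 < t" "t \<le> 1" by (auto simp: t_def power_le_one)
  have \<zeta>0: "0 \<le> \<zeta> \<eta>" using K_ge_1 q h\<eta> by (simp add: \<zeta>_def)
  have cb: "2 * \<zeta> \<eta> * (1 - t) \<le> c0"
  proof -
    have "2 * \<zeta> \<eta> * (1 - t) \<le> 2 * \<zeta> \<eta> * 1" using \<zeta>0 t by (intro mult_left_mono) auto
    then show ?thesis using h\<eta>(3) by simp
  qed
  define \<kappa> where "\<kappa> = K * q ^ m"
  have \<kappa>1: "1 \<le> \<kappa>" unfolding \<kappa>_def using mult_mono[OF K_ge_1 one_le_power[of q m]] q K_ge_1 by simp
  have \<kappa>28: "\<kappa> ^ 28 * err \<eta> m = \<zeta> \<eta> / q ^ 28 * t"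
    using q by (simp add: \<kappa>_def err_def \<zeta>_def t_def power_mult_distrib power_mult[symmetric] mult.commute[of 28])
  have err0: "0 \<le> err \<eta> m" using h\<eta> q by (simp add: err_def)
  have "\<zeta> \<eta> / q ^ 28 * t \<le> \<zeta> \<eta> / 1 * t"
    using \<zeta>0 t q one_le_power[of q 28] by (intro mult_right_mono divide_left_mono) auto
  then have \<kappa>28': "\<kappa> ^ 28 * err \<eta> m \<le> \<zeta> \<eta> * t" by (simp add: \<kappa>28)
  have \<kappa>j: "\<kappa> ^ j * err \<eta> m \<le> \<zeta> \<eta> * t" if "j \<le> 28" for j
    using \<kappa>28' mult_right_mono[OF power_increasing[OF that \<kappa>1] err0] by linarith
  have "\<zeta> \<eta> * t \<le> \<zeta> \<eta> * 1" using \<zeta>0 t by (intro mult_left_mono) auto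
  then have small: "\<kappa> ^ 14 * err \<eta> m \<le> \<rho> / 8" using \<kappa>j[of 14] h\<eta>(3) c0(2) \<zeta>0 by simp
  interpret newton \<Xi> c \<rho> B \<gamma> \<tau> \<omega> H v u l "rr m" c0 "err \<eta> m" "dd m" "r0 / 8" \<kappa>
  proof (unfold_locales)
    show "0 < rr m" "rr m \<le> \<rho> / 4" using rr(4,5)[of m] r0 by linarith+
    show "tfam \<Xi> (rr m) (v i)" "tfam \<Xi> (rr m) (u i)" "bnd \<Xi> (rr m) (e1 v u l i) (err \<eta> m)" "bnd \<Xi> (rr m) (e2 v u i) (err \<eta> m)" for i
      using s by (auto simp: state_def)
    show "tfam \<Xi> (rr m) (\<lambda>p (\<theta> :: complex ^ 'n). l i p)" for i
      using s tfam_subset rr(5)[of m] by (fastforce simp: state_def)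
    show "bnd \<Xi> (rr m) (v i) c0" "bnd \<Xi> (rr m) (u i) c0" "bnd \<Xi> (rr m) (\<lambda>p. pd j (v i p)) c0" "bnd \<Xi> (rr m) (\<lambda>p. pd j (u i p)) c0" for i j
      by (rule bnd_mono[OF _ order_refl cb], use s in \<open>simp add: state_def t_def\<close>)+
    show "64 * real CARD('n) ^ 3 * (1 + 16 * B / \<rho>\<^sup>2) \<le> \<kappa>" "1 / dd m \<le> \<kappa>" "2 * sd_bound TYPE('n) \<gamma> \<tau> (dd m) \<le> \<kappa>" "512 * B / \<rho> ^ 3 \<le> \<kappa>"
      unfolding \<kappa>_def by (rule kappa_bounds)+
  qed (use c0 rr r0 err0 small in auto)
  obtain dv du dl where N: 
    "\<And>i. tfam \<Xi> r2 (dv i)" "\<And>i. tfam \<Xi> r2 (du i)" "\<And>i. tfam \<Xi> (rr m) (\<lambda>p (\<theta> :: complex ^ 'n). dl i p)"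
    "\<And>i. bnd \<Xi> r2 (dv i) (E 13)" "\<And>i. bnd \<Xi> r2 (du i) (E 13)"
    "\<And>i j. bnd \<Xi> r3 (\<lambda>p. pd j (dv i p)) (E 14)" "\<And>i j. bnd \<Xi> r3 (\<lambda>p. pd j (du i p)) (E 14)"
    "\<And>i. bnd \<Xi> (rr m) (\<lambda>p (\<theta> :: complex ^ 'n). dl i p) (E 4)"
    "\<And>i. bnd \<Xi> r3 (e1 (\<lambda>i p \<theta>. v i p \<theta> + dv i p \<theta>) (\<lambda>i p \<theta>. u i p \<theta> + du i p \<theta>) (\<lambda>i p. l i p + dl i p) i) (EE 28)"
    "\<And>i. bnd \<Xi> r3 (e2 (\<lambda>i p \<theta>. v i p \<theta> + dv i p \<theta>) (\<lambda>i p \<theta>. u i p \<theta> + du i p \<theta>) i) (EE 28)"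
    by (rule newton_step; (rule that)?; assumption)
  have r3: "rr (Suc m) = r3" by (simp add: r3_def r2_def r1_def rr(1))
  have le: "r3 \<le> r2" "r3 \<le> rr m" using radii by auto
  have Eb: "E j \<le> \<zeta> \<eta> * t" if "j \<le> 28" for j using \<kappa>j[OF that] by (simp add: E_def)
  have bd: "bnd \<Xi> r3 (dv i) (\<zeta> \<eta> * t)" "bnd \<Xi> r3 (du i) (\<zeta> \<eta> * t)" "bnd \<Xi> r3 (\<lambda>p (\<theta> :: complex ^ 'n). dl i p) (\<zeta> \<eta> * t)"
    "bnd \<Xi> r3 (\<lambda>p. pd j (dv i p)) (\<zeta> \<eta> * t)" "bnd \<Xi> r3 (\<lambda>p. pd j (du i p)) (\<zeta> \<eta> * t)" for i j
    by (rule bnd_mono[OF N(4) le(1) Eb] bnd_mono[OF N(5) le(1) Eb] bnd_mono[OF N(8) le(2) Eb] bnd_mono[OF N(6) order_refl Eb] bnd_mono[OF N(7) order_refl Eb], simp)+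
  \<comment> \<open>Of the two error factors one is multiplied by \<kappa> ^ 28 and becomes \<zeta>
    q^-28 2^-m. With \<zeta> \<le> 1/2 the product is at most the other factor divided by 2 q ^ 28,
    which is the next error.\<close>
  have errS: "EE 28 \<le> err \<eta> (Suc m)"
  proof -
    have "EE 28 = (\<kappa> ^ 28 * err \<eta> m) * err \<eta> m" by (simp add: EE_def power2_eq_square)
    also have "\<dots> = \<zeta> \<eta> * t * (err \<eta> m / q ^ 28)" by (simp add: \<kappa>28)
    also have "\<dots> \<le> 1 / 2 * (err \<eta> m / q ^ 28)"
    proof (rule mult_right_mono)
      have "\<zeta> \<eta> * t \<le> \<zeta> \<eta> * 1" using \<zeta>0 t by (intro mult_left_mono) auto
      then show "\<zeta> \<eta> * t \<le> 1 / 2" using h\<eta>(2) by simp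
    qed (use err0 q in simp)
    also have "\<dots> = err \<eta> (Suc m)" by (simp add: err_def)
    finally show ?thesis .
  qed
  have sum: "2 * \<zeta> \<eta> * (1 - t) + \<zeta> \<eta> * t = 2 * \<zeta> \<eta> * (1 - (1 / 2) ^ Suc m)" by (simp add: t_def algebra_simps)
  let ?v = "\<lambda>i p \<theta>. v i p \<theta> + dv i p \<theta>" and ?u = "\<lambda>i p \<theta>. u i p \<theta> + du i p \<theta>" and ?l = "\<lambda>i p. l i p + dl i p"
  have pdadd: "bnd \<Xi> r3 (\<lambda>p. pd j (\<lambda>\<theta>. f p \<theta> + g p \<theta>)) (2 * \<zeta> \<eta> * (1 - (1 / 2) ^ Suc m))"
    if "tfam \<Xi> r3 f" "tfam \<Xi> r3 g" "bnd \<Xi> r3 (\<lambda>p. pd j (f p)) (2 * \<zeta> \<eta> * (1 - t))" "bnd \<Xi> r3 (\<lambda>p. pd j (g p)) (\<zeta> \<eta> * t)"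
    for f g :: "real ^ 'n \<Rightarrow> complex ^ 'n \<Rightarrow> complex" and j
  proof -
    have "pd j (\<lambda>\<theta>. f p \<theta> + g p \<theta>) \<theta> = pd j (f p) \<theta> + pd j (g p) \<theta>" if "p \<in> \<Xi>" "\<theta> \<in> strip r3" for p \<theta>
      unfolding pd_def by (rule ddir_add[OF tfam_holo[OF \<open>tfam \<Xi> r3 f\<close> that(1)] tfam_holo[OF \<open>tfam \<Xi> r3 g\<close> that(1)] that(2)])
    with bnd_add[OF that(3,4)] show ?thesis unfolding sum by (simp add: bnd_def)
  qed
  have st: "bnd \<Xi> r3 (v i) (2 * \<zeta> \<eta> * (1 - t))" "bnd \<Xi> r3 (u i) (2 * \<zeta> \<eta> * (1 - t))"
    "bnd \<Xi> r3 (\<lambda>p. pd j (v i p)) (2 * \<zeta> \<eta> * (1 - t))" "bnd \<Xi> r3 (\<lambda>p. pd j (u i p)) (2 * \<zeta> \<eta> * (1 - t))" for i j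
    by (rule bnd_mono[OF _ le(2) order_refl], use s in \<open>simp add: state_def t_def\<close>)+
  have tl: "tfam \<Xi> r0 (\<lambda>p (\<theta> :: complex ^ 'n). dl i p)" for i
    using tfam_at_0[OF N(3)] rr(4)[of m] r0 by simp
  have tv: "tfam \<Xi> r3 (v i)" "tfam \<Xi> r3 (u i)" "tfam \<Xi> r3 (dv i)" "tfam \<Xi> r3 (du i)" for i
    by (rule tfam_subset[OF v le(2)] tfam_subset[OF u le(2)] tfam_subset[OF N(1) le(1)] tfam_subset[OF N(2) le(1)])+
  have "state \<eta> (Suc m) (?v, ?u, ?l)"
    unfolding state_def split_conv r3
  proof (intro allI conjI)
    fix i j
    show "tfam \<Xi> r3 (?v i)" "tfam \<Xi> r3 (?u i)" by (intro tfam_add tv)+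
    have "tfam \<Xi> r0 (\<lambda>p (\<theta> :: complex ^ 'n). l i p)" using s by (simp add: state_def)
    then show "tfam \<Xi> r0 (\<lambda>p (\<theta> :: complex ^ 'n). ?l i p)" by (rule tfam_add[OF _ tl])
    show "bnd \<Xi> r3 (?v i) (2 * \<zeta> \<eta> * (1 - (1 / 2) ^ Suc m))" "bnd \<Xi> r3 (?u i) (2 * \<zeta> \<eta> * (1 - (1 / 2) ^ Suc m))"
      unfolding sum[symmetric] by (intro bnd_add st bd)+
    show "bnd \<Xi> r3 (\<lambda>p. pd j (?v i p)) (2 * \<zeta> \<eta> * (1 - (1 / 2) ^ Suc m))" "bnd \<Xi> r3 (\<lambda>p. pd j (?u i p)) (2 * \<zeta> \<eta> * (1 - (1 / 2) ^ Suc m))"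
      by (intro pdadd tv st bd)+
    show "bnd \<Xi> r3 (e1 ?v ?u ?l i) (err \<eta> (Suc m))" "bnd \<Xi> r3 (e2 ?v ?u i) (err \<eta> (Suc m))"
      by (rule bnd_mono[OF N(9) order_refl errS] bnd_mono[OF N(10) order_refl errS])+
  qed
  moreover have "increment \<eta> m (v, u, l) (?v, ?u, ?l)"
    unfolding increment_def split_conv r3 using bd by (simp add: t_def)
  ultimately show ?thesis by blast
qed

end


section \<open>The limit torus\<close>

lemma tfam_geometric_limit:
  fixes F :: "nat \<Rightarrow> 'p::metric_space \<Rightarrow> complex ^ 'n::finite \<Rightarrow> complex"
  assumes F: "\<And>m. tfam \<Xi> r (F m)" and inc: "\<And>m. bnd \<Xi> r (\<lambda>p \<theta>. F (Suc m) p \<theta> - F m p \<theta>) (\<zeta> * (1 / 2) ^ m)"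
    and \<zeta>: "0 \<le> \<zeta>" and r: "0 < r"
  obtains G where "tfam \<Xi> r G" "bnd \<Xi> r (\<lambda>p \<theta>. G p \<theta> - F 0 p \<theta>) (2 * \<zeta>)"
    "\<And>p \<theta>. p \<in> \<Xi> \<Longrightarrow> \<theta> \<in> strip r \<Longrightarrow> (\<lambda>m. F m p \<theta>) \<longlonglongrightarrow> G p \<theta>"
    "\<And>p \<theta> w. p \<in> \<Xi> \<Longrightarrow> \<theta> \<in> strip r \<Longrightarrow> (\<lambda>m. ddir (F m p) \<theta> w) \<longlonglongrightarrow> ddir (G p) \<theta> w"
proof -
  have *: "cmod ((\<lambda>(p, \<theta>). F (Suc m) p \<theta>) x - (\<lambda>(p, \<theta>). F m p \<theta>) x) \<le> \<zeta> * (1 / 2) ^ m" if "x \<in> \<Xi> \<times> strip r" for m x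
    using inc[of m] that by (auto simp: bnd_def)
  obtain g where
    g: "uniform_limit (\<Xi> \<times> strip r) (\<lambda>m (p, \<theta>). F m p \<theta>) g sequentially"
    and b: "\<And>x. x \<in> \<Xi> \<times> strip r \<Longrightarrow> cmod (g x - (\<lambda>(p, \<theta>). F 0 p \<theta>) x) \<le> 2 * \<zeta>"
    by (rule geometric_uniform_limit[where A = "\<Xi> \<times> strip r" and f = "\<lambda>m (p, \<theta>). F m p \<theta>", OF * \<zeta>]; (rule that)?; assumption)
  define G where "G p \<theta> = g (p, \<theta>)" for p \<theta>
  have "g = (\<lambda>(p, \<theta>). G p \<theta>)" by (auto simp: G_def)
  with g have ul: "uniform_limit (\<Xi> \<times> strip r) (\<lambda>m (p, \<theta>). F m p \<theta>) (\<lambda>(p, \<theta>). G p \<theta>) sequentially" by simp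
  note T = tfam_uniform_limit[OF F ul sequentially_bot r]
  show thesis
  proof (rule that[of G])
    show "bnd \<Xi> r (\<lambda>p \<theta>. G p \<theta> - F 0 p \<theta>) (2 * \<zeta>)" using b by (auto simp: bnd_def G_def)
    show "(\<lambda>m. F m p \<theta>) \<longlonglongrightarrow> G p \<theta>" if "p \<in> \<Xi>" "\<theta> \<in> strip r" for p \<theta>
      using tendsto_uniform_limitI[OF ul, of "(p, \<theta>)"] that by simp
  qed (use T in auto)
qed

context kam
begin

text \<open>The bounds on v, u and l - l0 are an explicit constant times \<eta>. This linear
  dependence later makes l close to \<nabla>h - \<omega> and lets the tori converge as \<epsilon>
  tends to 0.\<close>

theorem kam_torus:
  assumes h\<eta>: "0 \<le> \<eta>" "kam_C TYPE('n) \<rho> B \<gamma> \<tau> * \<eta> \<le> 1" "kam_C TYPE('n) \<rho> B \<gamma> \<tau> * \<eta> \<le> kam_c1 TYPE('n) \<rho> B \<gamma> \<tau>"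
    and l0: "\<And>i. tfam \<Xi> (width \<rho>) (\<lambda>p (\<theta> :: complex ^ 'n). l0 i p)"
    and err1: "\<And>i. bnd \<Xi> (width \<rho>) (e1 (\<lambda>i p \<theta>. 0) (\<lambda>i p \<theta>. 0) l0 i) \<eta>"
    and err2: "\<And>i. bnd \<Xi> (width \<rho>) (e2 (\<lambda>i p \<theta>. 0) (\<lambda>i p \<theta>. 0) i) \<eta>"
  obtains v u l r where "r > 0" "\<And>i. tfam \<Xi> r (v i)" "\<And>i. tfam \<Xi> r (u i)" "\<And>i. tfam \<Xi> r (\<lambda>p (\<theta> :: complex ^ 'n). l i p)"
    "\<And>i. bnd \<Xi> r (v i) (kam_C TYPE('n) \<rho> B \<gamma> \<tau> * \<eta>)" "\<And>i. bnd \<Xi> r (u i) (kam_C TYPE('n) \<rho> B \<gamma> \<tau> * \<eta>)"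
    "\<And>i. bnd \<Xi> r (\<lambda>p (\<theta> :: complex ^ 'n). l i p - l0 i p) (kam_C TYPE('n) \<rho> B \<gamma> \<tau> * \<eta>)"
    "\<And>i j. bnd \<Xi> r (\<lambda>p. pd j (u i p)) (1 / (2 * real CARD('n)))"
    "\<And>i p \<theta>. p \<in> \<Xi> \<Longrightarrow> \<theta> \<in> strip r \<Longrightarrow> kpt v u p \<theta> \<in> pdom c (\<rho> / 2) \<and> e1 v u l i p \<theta> = 0 \<and> e2 v u i p \<theta> = 0"
proof -
  have C: "kam_C TYPE('n) \<rho> B \<gamma> \<tau> * \<eta> = 2 * \<zeta> \<eta>"
    by (simp add: kam_C_def \<zeta>_def K_def q_def)
  have \<eta>': "\<zeta> \<eta> \<le> 1 / 2" "2 * \<zeta> \<eta> \<le> c0" using h\<eta> unfolding C c0_def by auto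
  have \<zeta>0: "0 \<le> \<zeta> \<eta>" using K_ge_1 q h\<eta> by (simp add: \<zeta>_def)
  have pd0: "pd j (\<lambda>\<theta> :: complex ^ 'n. 0) \<theta> = 0" for j \<theta> by (simp add: pd_def ddir_const)
  have rr0: "rr 0 = width \<rho>" by (simp add: rr_def r0_def)
  have "state \<eta> 0 (\<lambda>i p \<theta>. 0, \<lambda>i p \<theta>. 0, l0)"
    unfolding state_def split_conv rr0 using l0 err1 err2
    by (auto intro: tfam_const simp: bnd_def pd0 err_def r0_def)
  \<comment> \<open>Dependent choice of the iterates; the clause for m = 0 pins the start of the
    sequence to the unperturbed torus.\<close>
  then obtain f where f: "\<And>m. state \<eta> m (f m)" "f 0 = (\<lambda>i p \<theta>. 0, \<lambda>i p \<theta>. 0, l0)" "\<And>m. increment \<eta> m (f m) (f (Suc m))"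
    using dependent_nat_choice[of "\<lambda>m s. state \<eta> m s \<and> (m = 0 \<longrightarrow> s = (\<lambda>i p \<theta>. 0, \<lambda>i p \<theta>. 0, l0))" "\<lambda>m s s'. increment \<eta> m s s'"]
      newton_iteration_step[OF h\<eta>(1) \<eta>'] by (metis nat.distinct(1) prod_cases3)
  define V where "V m = fst (f m)" for m
  define U where "U m = fst (snd (f m))" for m
  define L where "L m = snd (snd (f m))" for m
  have fm: "f m = (V m, U m, L m)" for m by (simp add: V_def U_def L_def)
  define r where "r = r0 / 2"
  have r: "0 < r" "r \<le> r0" "r \<le> \<rho> / 4" using r0 by (auto simp: r_def)
  have rm: "r \<le> rr m" for m using rr(4)[of m] by (simp add: r_def)
  have le: "2 * \<zeta> \<eta> * (1 - (1 / 2) ^ m) \<le> c0" for m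
  proof -
    have "2 * \<zeta> \<eta> * (1 - (1 / 2) ^ m) \<le> 2 * \<zeta> \<eta> * 1" using \<zeta>0 by (intro mult_left_mono) auto
    then show ?thesis using \<eta>' by simp
  qed
  have st: "tfam \<Xi> r (V m i)" "tfam \<Xi> r (U m i)" "tfam \<Xi> r (\<lambda>p (\<theta> :: complex ^ 'n). L m i p)"
    "bnd \<Xi> r (\<lambda>p. pd j (V m i p)) c0" "bnd \<Xi> r (\<lambda>p. pd j (U m i p)) c0"
    "bnd \<Xi> r (e1 (V m) (U m) (L m) i) (err \<eta> m)" "bnd \<Xi> r (e2 (V m) (U m) i) (err \<eta> m)" for m i j
    using f(1)[of m] unfolding fm state_def split_conv
    by (auto intro: tfam_subset[OF _ rm] tfam_subset[OF _ r(2)] bnd_mono[OF _ rm le] bnd_mono[OF _ rm order_refl])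
  have inc: "bnd \<Xi> r (\<lambda>p \<theta>. V (Suc m) i p \<theta> - V m i p \<theta>) (\<zeta> \<eta> * (1 / 2) ^ m)"
    "bnd \<Xi> r (\<lambda>p \<theta>. U (Suc m) i p \<theta> - U m i p \<theta>) (\<zeta> \<eta> * (1 / 2) ^ m)"
    "bnd \<Xi> r (\<lambda>p (\<theta> :: complex ^ 'n). L (Suc m) i p - L m i p) (\<zeta> \<eta> * (1 / 2) ^ m)" for m i
    using f(3)[of m] unfolding fm increment_def split_conv by (auto intro: bnd_mono[OF _ rm order_refl])
  have init: "V 0 = (\<lambda>i p \<theta>. 0)" "U 0 = (\<lambda>i p \<theta>. 0)" "L 0 = l0" by (simp_all add: V_def U_def L_def f(2))
  define lim where "lim F G \<longleftrightarrow> tfam \<Xi> r G \<and> bnd \<Xi> r (\<lambda>p \<theta>. G p \<theta> - F 0 p \<theta>) (2 * \<zeta> \<eta>) \<and>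
    (\<forall>p\<in>\<Xi>. \<forall>\<theta>\<in>strip r. (\<lambda>m. F m p \<theta>) \<longlonglongrightarrow> G p \<theta> \<and> (\<forall>w. (\<lambda>m. ddir (F m p) \<theta> w) \<longlonglongrightarrow> ddir (G p) \<theta> w))"
    for F and G :: "real ^ 'n \<Rightarrow> complex ^ 'n \<Rightarrow> complex"
  have ex: "\<exists>G. lim F G" if F: "\<And>m. tfam \<Xi> r (F m)" and I: "\<And>m. bnd \<Xi> r (\<lambda>p \<theta>. F (Suc m) p \<theta> - F m p \<theta>) (\<zeta> \<eta> * (1 / 2) ^ m)" for F
  proof -
    obtain G where "tfam \<Xi> r G" "bnd \<Xi> r (\<lambda>p \<theta>. G p \<theta> - F 0 p \<theta>) (2 * \<zeta> \<eta>)"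
      "\<And>p \<theta>. p \<in> \<Xi> \<Longrightarrow> \<theta> \<in> strip r \<Longrightarrow> (\<lambda>m. F m p \<theta>) \<longlonglongrightarrow> G p \<theta>"
      "\<And>p \<theta> w. p \<in> \<Xi> \<Longrightarrow> \<theta> \<in> strip r \<Longrightarrow> (\<lambda>m. ddir (F m p) \<theta> w) \<longlonglongrightarrow> ddir (G p) \<theta> w"
      by (rule tfam_geometric_limit[OF F I \<zeta>0 r(1)]; (rule that)?; assumption)
    then show ?thesis unfolding lim_def by blast
  qed
  obtain v where v: "\<And>i. lim (\<lambda>m. V m i) (v i)"
    using choice[of "\<lambda>i G. lim (\<lambda>m. V m i) G"] ex[of "\<lambda>m. V m i" for i, OF st(1) inc(1)] by blast
  obtain u where u: "\<And>i. lim (\<lambda>m. U m i) (u i)"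
    using choice[of "\<lambda>i G. lim (\<lambda>m. U m i) G"] ex[of "\<lambda>m. U m i" for i, OF st(2) inc(2)] by blast
  obtain l' where l': "\<And>i. lim (\<lambda>m p \<theta>. L m i p) (l' i)"
    using choice[of "\<lambda>i G. lim (\<lambda>m p \<theta>. L m i p) G"] ex[of "\<lambda>m p \<theta>. L m i p" for i, OF st(3) inc(3)] by blast
  \<comment> \<open>The limit was taken among families in \<theta>; its terms are constant there,
    and the value at 0 is the limiting counterterm.\<close>
  define l where "l i p = l' i p 0" for i p
  have 0: "(0 :: complex ^ 'n) \<in> strip r" using r by (simp add: strip_def)
  have limL: "(\<lambda>m. L m i p) \<longlonglongrightarrow> l i p" if "p \<in> \<Xi>" for i p
    using l'[of i] that 0 by (auto simp: lim_def l_def)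
  have tl: "tfam \<Xi> r (\<lambda>p (\<theta> :: complex ^ 'n). l i p)" for i
    unfolding l_def by (rule tfam_at_0[OF _ r(1)]) (use l' in \<open>simp add: lim_def\<close>)
  have bl: "bnd \<Xi> r (\<lambda>p (\<theta> :: complex ^ 'n). l i p - l0 i p) (2 * \<zeta> \<eta>)" for i
    using l'[of i] 0 by (auto simp: lim_def bnd_def l_def init)
  have bv: "bnd \<Xi> r (v i) (2 * \<zeta> \<eta>)" "bnd \<Xi> r (u i) (2 * \<zeta> \<eta>)" for i
    using v[of i] u[of i] by (simp_all add: lim_def init)
  have bpd: "bnd \<Xi> r (\<lambda>p. pd j (v i p)) c0" "bnd \<Xi> r (\<lambda>p. pd j (u i p)) c0" for i j
  proof -
    have *: "bnd \<Xi> r (\<lambda>p. pd j (G p)) c0" if G: "lim F G" and b: "\<And>m. bnd \<Xi> r (\<lambda>p. pd j (F m p)) c0" for F G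
      unfolding bnd_def
    proof (intro ballI)
      fix p and \<theta> :: "complex ^ 'n" assume a: "p \<in> \<Xi>" "\<theta> \<in> strip r"
      have "(\<lambda>m. cmod (pd j (F m p) \<theta>)) \<longlonglongrightarrow> cmod (pd j (G p) \<theta>)"
        using G a unfolding lim_def pd_def by (intro tendsto_norm) blast
      then show "cmod (pd j (G p) \<theta>) \<le> c0"
        by (rule LIMSEQ_le_const2) (use b a in \<open>auto simp: bnd_def\<close>)
    qed
    show "bnd \<Xi> r (\<lambda>p. pd j (v i p)) c0" "bnd \<Xi> r (\<lambda>p. pd j (u i p)) c0"
      by (rule *[OF v st(4)] *[OF u st(5)])+
  qed
  interpret S: kam_state \<Xi> c \<rho> B \<gamma> \<tau> \<omega> H v u l r c0
    by unfold_locales (use r v u tl bnd_mono[OF bv(1) order_refl \<eta>'(2)] bnd_mono[OF bv(2) order_refl \<eta>'(2)] bpd c0 in \<open>auto simp: lim_def\<close>)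
  have errlim: "err \<eta> \<longlonglongrightarrow> 0"
  proof (rule tendsto_sandwich[OF _ _ tendsto_const])
    show "\<forall>\<^sub>F m in sequentially. 0 \<le> err \<eta> m" using h\<eta> q by (simp add: err_def)
    show "\<forall>\<^sub>F m in sequentially. err \<eta> m \<le> \<eta> * (1 / 2) ^ m"
    proof (intro always_eventually allI)
      fix m
      have "1 \<le> (q ^ 28) ^ m" using q by (simp add: one_le_power)
      then have "\<eta> * (1 / 2) ^ m / (q ^ 28) ^ m \<le> \<eta> * (1 / 2) ^ m / 1" using h\<eta> by (intro divide_left_mono) auto
      then show "err \<eta> m \<le> \<eta> * (1 / 2) ^ m" by (simp add: err_def)
    qed
    have "(\<lambda>m. \<eta> * (1 / 2) ^ m) \<longlonglongrightarrow> \<eta> * 0" by (intro tendsto_intros LIMSEQ_realpow_zero) auto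
    then show "(\<lambda>m. \<eta> * (1 / 2) ^ m) \<longlonglongrightarrow> 0" by simp
  qed
  \<comment> \<open>The defects contain derivatives of u and v along \<omega>. They pass to the
    limit because uniform convergence of holomorphic functions carries over to their
    derivatives.\<close>
  have zero: "e1 v u l i p \<theta> = 0 \<and> e2 v u i p \<theta> = 0" if p: "p \<in> \<Xi>" and \<theta>: "\<theta> \<in> strip r" for i p \<theta>
  proof -
    have K: "(\<lambda>m. kpt (V m) (U m) p \<theta>) \<longlonglongrightarrow> kpt v u p \<theta>"
    proof (rule vec_tendstoI)
      fix s show "(\<lambda>m. kpt (V m) (U m) p \<theta> $ s) \<longlonglongrightarrow> kpt v u p \<theta> $ s"
        by (cases s) (use v u p \<theta> in \<open>auto simp: kpt_def lim_def intro!: tendsto_intros\<close>)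
    qed
    have pdK: "(\<lambda>m. pd s H (kpt (V m) (U m) p \<theta>)) \<longlonglongrightarrow> pd s H (kpt v u p \<theta>)" for s
    proof (rule isCont_tendsto_compose[OF _ K])
      show "isCont (pd s H) (kpt v u p \<theta>)"
        by (rule has_derivative_continuous[OF holo_has_derivative[OF holo_H(2) S.kpt_dom'[OF p \<theta>]]])
    qed
    have "(\<lambda>m. e1 (V m) (U m) (L m) i p \<theta>) \<longlonglongrightarrow> e1 v u l i p \<theta>"
      unfolding e1_def using u[of i] p \<theta> by (intro tendsto_intros pdK limL) (auto simp: lim_def)
    moreover have "(\<lambda>m. e1 (V m) (U m) (L m) i p \<theta>) \<longlonglongrightarrow> 0"
      by (rule Lim_null_comparison[OF _ errlim]) (use st(6) p \<theta> in \<open>auto simp: bnd_def\<close>)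
    moreover have "(\<lambda>m. e2 (V m) (U m) i p \<theta>) \<longlonglongrightarrow> e2 v u i p \<theta>"
      unfolding e2_def using v[of i] p \<theta> by (intro tendsto_intros pdK) (auto simp: lim_def)
    moreover have "(\<lambda>m. e2 (V m) (U m) i p \<theta>) \<longlonglongrightarrow> 0"
      by (rule Lim_null_comparison[OF _ errlim]) (use st(7) p \<theta> in \<open>auto simp: bnd_def\<close>)
    ultimately show ?thesis using LIMSEQ_unique by blast
  qed
  show thesis
  proof (rule that[of r v u l])
    show "bnd \<Xi> r (\<lambda>p. pd j (u i p)) (1 / (2 * real CARD('n)))" for i j
      by (rule bnd_mono[OF bpd(2) order_refl c0(3)])
  qed (use r v u tl bv bl zero S.kpt_dom in \<open>auto simp: lim_def C\<close>)
qed

end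


section \<open>Hamiltonian motions on the torus\<close>

definition jn :: "complex ^ 'n \<Rightarrow> complex ^ 'n \<Rightarrow> complex ^ ('n::finite + 'n)" where
  "jn y x = (\<chi> a. case a of Inl i \<Rightarrow> y $ i | Inr i \<Rightarrow> x $ i)"

lemma jn_nth [simp]: "jn y x $ Inl i = y $ i" "jn y x $ Inr i = x $ i"
  by (simp_all add: jn_def)

lemma jn_axis:
  "jn (y + t *s axis i 1) x = jn y x + t *s axis (Inl i) 1" "jn y (x + t *s axis i 1) = jn y x + t *s axis (Inr i) 1"
  by (auto simp: vec_eq_iff jn_def axis_def split: sum.split)

lemma bounded_linear_cvec: "bounded_linear (cvec :: real ^ 'n::finite \<Rightarrow> complex ^ 'n)"
proof -
  have "linear (cvec :: real ^ 'n \<Rightarrow> complex ^ 'n)"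
    by (rule linearI) (auto simp: vec_eq_iff scaleR_conv_of_real[where 'a = complex])
  then show ?thesis by (simp add: linear_conv_bounded_linear)
qed

text \<open>\<open>gradient\<close> is a definite description, so its value needs uniqueness:
  testing two candidates on their difference shows that the difference is 0.\<close>

lemma gradient_of_holo:
  fixes F :: "complex ^ 'm::finite \<Rightarrow> complex"
  assumes U: "open U" "holo F U" "cvec p \<in> U" and f: "\<And>y. cvec y \<in> U \<Longrightarrow> F (cvec y) = complex_of_real (f y)"
  shows "GDERIV f p :> (\<chi> i. Re (pd i F (cvec p)))" and "gradient f p = (\<chi> i. Re (pd i F (cvec p)))"
    and "pd i F (cvec p) \<in> \<real>"
proof -
  have "((\<lambda>y. F (cvec y)) has_derivative (\<lambda>v. ddir F (cvec p) (cvec v))) (at p)"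
    by (rule has_derivative_compose[OF bounded_linear_imp_has_derivative[OF bounded_linear_cvec] holo_has_derivative[OF U(2,3)]])
  then have "((\<lambda>y. Re (F (cvec y))) has_derivative (\<lambda>v. Re (ddir F (cvec p) (cvec v)))) (at p)"
    by (rule bounded_linear.has_derivative[OF bounded_linear_Re])
  moreover have "open (cvec -` U)" using U(1) continuous_on_cvec[of UNIV] by (rule open_vimage)
  ultimately have "(f has_derivative (\<lambda>v. Re (ddir F (cvec p) (cvec v)))) (at p)"
    by (rule has_derivative_transform_within_open) (use U(3) f in auto)
  moreover have "(\<lambda>v. Re (ddir F (cvec p) (cvec v))) = (\<lambda>v. v \<bullet> (\<chi> i. Re (pd i F (cvec p))))"
    by (simp add: ddir_eq_sum_pd[OF U(2,3)] inner_vec_def)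
  ultimately show g: "GDERIV f p :> (\<chi> i. Re (pd i F (cvec p)))" by (simp add: gderiv_def)
  show "gradient f p = (\<chi> i. Re (pd i F (cvec p)))"
    unfolding gradient_def
  proof (rule the_equality, rule g)
    fix D assume "GDERIV f p :> D"
    then have "(\<lambda>v. v \<bullet> D) = (\<lambda>v. v \<bullet> (\<chi> i. Re (pd i F (cvec p))))"
      using g unfolding gderiv_def by (rule has_derivative_unique)
    from fun_cong[OF this, of "D - (\<chi> i. Re (pd i F (cvec p)))"]
    have "(D - (\<chi> i. Re (pd i F (cvec p)))) \<bullet> (D - (\<chi> i. Re (pd i F (cvec p)))) = 0"
      by (simp only: inner_diff_right)
    then show "D = (\<chi> i. Re (pd i F (cvec p)))" by simp
  qed
  show "pd i F (cvec p) \<in> \<real>"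
    unfolding pd_def
  proof (rule ddir_real[OF U])
    fix t :: real assume a: "cvec p + of_real t *s axis i 1 \<in> U"
    have "cvec p + of_real t *s axis i 1 = cvec (p + t *\<^sub>R axis i 1)" by (simp add: vec_eq_iff axis_def)
    then show "F (cvec p + of_real t *s axis i 1) \<in> \<real>" using f a by simp
  qed
qed

lemma
  fixes F :: "complex ^ ('n::finite + 'n) \<Rightarrow> complex"
  assumes F: "holo F (pdom c \<rho>)" and z: "jn (cvec y) (cvec x) \<in> pdom c \<rho>"
    and f: "\<And>y x. jn (cvec y) (cvec x) \<in> pdom c \<rho> \<Longrightarrow> F (jn (cvec y) (cvec x)) = complex_of_real (f y x)"
  shows gradient_action: "gradient (\<lambda>y. f y x) y = (\<chi> i. Re (pd (Inl i) F (jn (cvec y) (cvec x))))"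
    and gradient_angle: "gradient (\<lambda>x. f y x) x = (\<chi> i. Re (pd (Inr i) F (jn (cvec y) (cvec x))))"
    and pd_action_real: "pd (Inl i) F (jn (cvec y) (cvec x)) \<in> \<real>"
proof -
  define U1 where "U1 = (\<lambda>w. jn w (cvec x)) -` pdom c \<rho>"
  define U2 where "U2 = (\<lambda>w. jn (cvec y) w) -` pdom c \<rho>"
  have c1: "continuous_on UNIV (\<lambda>w. jn w (cvec x))" and c2: "continuous_on UNIV (\<lambda>w. jn (cvec y) w)"
    unfolding jn_def by (intro continuous_on_vec_lambda; rename_tac a; case_tac a; auto intro!: continuous_intros)+
  have o: "open U1" "open U2" unfolding U1_def U2_def by (intro open_vimage open_pdom c1 c2)+
  have h1: "holo (\<lambda>w. F (jn w (cvec x))) U1"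
  proof (rule holo_compose[OF F])
    show "holo (\<lambda>w. jn w (cvec x) $ a) U1" for a by (cases a) (auto simp: holo_nth holo_const)
  qed (simp add: U1_def)
  have h2: "holo (\<lambda>w. F (jn (cvec y) w)) U2"
  proof (rule holo_compose[OF F])
    show "holo (\<lambda>w. jn (cvec y) w $ a) U2" for a by (cases a) (auto simp: holo_nth holo_const)
  qed (simp add: U2_def)
  have p: "pd i (\<lambda>w. F (jn w (cvec x))) w = pd (Inl i) F (jn w (cvec x))" "pd i (\<lambda>w. F (jn (cvec y) w)) w = pd (Inr i) F (jn (cvec y) w)" for i w
    by (simp_all add: pd_def ddir_def jn_axis)
  note g1 = gradient_of_holo[OF o(1) h1, of y "\<lambda>y. f y x", unfolded p]
  note g2 = gradient_of_holo[OF o(2) h2, of x "\<lambda>x. f y x", unfolded p]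
  show "gradient (\<lambda>y. f y x) y = (\<chi> i. Re (pd (Inl i) F (jn (cvec y) (cvec x))))" "pd (Inl i) F (jn (cvec y) (cvec x)) \<in> \<real>"
    using g1(2,3) z f by (auto simp: U1_def)
  show "gradient (\<lambda>x. f y x) x = (\<chi> i. Re (pd (Inr i) F (jn (cvec y) (cvec x))))"
    using g2(2) z f by (auto simp: U2_def)
qed

lemma convex_pdom: "convex (pdom c \<rho> :: (complex ^ ('n::finite + 'n)) set)"
proof -
  have lin: "linear (\<lambda>z :: complex ^ ('n + 'n). z $ a)" "linear (\<lambda>z :: complex ^ ('n + 'n). Im (z $ a))" for a
    using bounded_linear.linear[OF bounded_linear_vec_nth] bounded_linear.linear[OF bounded_linear_compose[OF bounded_linear_Im bounded_linear_vec_nth]]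
    by auto
  have "pdom c \<rho> = (\<Inter>i. (\<lambda>z. z $ Inl i) -` ball (complex_of_real (c $ i)) \<rho> \<inter> (\<lambda>z. Im (z $ Inr i)) -` {- \<rho> <..< \<rho>})"
    by (auto simp: pdom_def dist_norm norm_minus_commute abs_less_iff minus_less_iff)
  also have "convex \<dots>"
    by (intro convex_INT convex_Int convex_linear_vimage lin convex_ball convex_real_interval)
  finally show ?thesis .
qed

text \<open>Write z = a + \<i> b with real a and b. The function t \<mapsto> F (a + t b) vanishes at
  all admissible real t, and z belongs to t = \<i>. The set of admissible t is convex, hence
  connected, so the one-variable identity theorem applies.\<close>

lemma pdom_identity:
  fixes F :: "complex ^ ('n::finite + 'n) \<Rightarrow> complex"
  assumes F: "holo F (pdom c \<rho>)" and zero: "\<And>y x. jn (cvec y) (cvec x) \<in> pdom c \<rho> \<Longrightarrow> F (jn (cvec y) (cvec x)) = 0"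
    and z: "z \<in> pdom c \<rho>"
  shows "F z = 0"
proof -
  define a b :: "complex ^ ('n + 'n)" where "a = (\<chi> s. of_real (Re (z $ s)))" and "b = (\<chi> s. of_real (Im (z $ s)))"
  define T where "T = (\<lambda>t. a + t *s b) -` pdom c \<rho>"
  have zab: "z = a + \<i> *s b" by (simp add: a_def b_def vec_eq_iff complex_eq mult.commute)
  have op: "open T" unfolding T_def using open_pdom
    by (intro open_vimage continuous_intros bounded_linear.continuous_on[OF bounded_linear_csmult])
  have "convex T"
  proof (rule convexI)
    fix t1 t2 :: complex and u v :: real assume t: "t1 \<in> T" "t2 \<in> T" "0 \<le> u" "0 \<le> v" "u + v = 1"
    have "a + (u *\<^sub>R t1 + v *\<^sub>R t2) *s b = u *\<^sub>R (a + t1 *s b) + v *\<^sub>R (a + t2 *s b)"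
    proof -
      have "a = u *\<^sub>R a + v *\<^sub>R a" using t(5) by (metis scaleR_add_left scaleR_one)
      then show ?thesis by (simp add: vec_eq_iff algebra_simps)
    qed
    then show "u *\<^sub>R t1 + v *\<^sub>R t2 \<in> T"
      using convexD[OF convex_pdom _ _ t(3-5)] t(1,2) by (auto simp: T_def)
  qed
  then have conn: "connected T" by (rule convex_connected)
  have "a \<in> pdom c \<rho>"
  proof -
    have "cmod (a $ Inl i - complex_of_real (c $ i)) < \<rho>" "0 < \<rho>" for i
    proof -
      have "cmod (a $ Inl i - complex_of_real (c $ i)) = \<bar>Re (z $ Inl i - complex_of_real (c $ i))\<bar>"
        by (simp add: a_def flip: of_real_diff)
      also have "\<dots> \<le> cmod (z $ Inl i - complex_of_real (c $ i))" by (rule abs_Re_le_cmod)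
      also have z: "\<dots> < \<rho>" using z by (simp add: pdom_def)
      finally show "cmod (a $ Inl i - complex_of_real (c $ i)) < \<rho>" .
      show "0 < \<rho>" using le_less_trans[OF norm_ge_zero z] .
    qed
    then show ?thesis by (simp add: pdom_def a_def)
  qed
  then have 0: "0 \<in> T" by (simp add: T_def)
  have "F (a + \<i> *s b) = 0"
  proof (rule analytic_continuation[where f = "\<lambda>t. F (a + t *s b)" and S = T and U = "T \<inter> \<real>" and \<xi> = 0])
    show "(\<lambda>t. F (a + t *s b)) holomorphic_on T"
      by (rule holo_line_holomorphic[OF F]) (simp add: T_def)
    show "0 islimpt T \<inter> \<real>"
      unfolding islimpt_approachable
    proof (intro allI impI)
      fix e :: real assume "e > 0"
      obtain d where d: "d > 0" "ball 0 d \<subseteq> T" using op 0 open_contains_ball by blast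
      define t where "t = complex_of_real (min d e / 2)"
      have "t \<in> T \<inter> \<real>" "t \<noteq> 0" "dist t 0 < e"
        using d \<open>e > 0\<close> by (auto simp: t_def subset_iff dist_norm norm_of_real simp del: of_real_divide)
      then show "\<exists>x'\<in>T \<inter> \<real>. x' \<noteq> 0 \<and> dist x' 0 < e" by blast
    qed
    show "F (a + t *s b) = 0" if "t \<in> T \<inter> \<real>" for t
    proof -
      obtain s where s: "t = complex_of_real s" using \<open>t \<in> T \<inter> \<real>\<close> by (auto elim: Reals_cases)
      have "a + t *s b = jn (cvec (\<chi> i. Re (z $ Inl i) + s * Im (z $ Inl i))) (cvec (\<chi> i. Re (z $ Inr i) + s * Im (z $ Inr i)))"
        by (auto simp: vec_eq_iff jn_def a_def b_def s split: sum.split)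
      then show ?thesis using zero that by (auto simp: T_def)
    qed
    show "\<i> \<in> T" using z zab by (simp add: T_def)
  qed (use op conn 0 in auto)
  then show ?thesis by (simp add: zab)
qed

lemma real_lipschitz:
  fixes f :: "complex ^ 'n::finite \<Rightarrow> complex"
  assumes f: "holo f (strip r)" and r: "r > 0" and b: "\<And>j \<theta>. \<theta> \<in> strip r \<Longrightarrow> cmod (pd j f \<theta>) \<le> C"
  shows "cmod (f (cvec x) - f (cvec y)) \<le> C * (\<Sum>j\<in>UNIV. \<bar>x $ j - y $ j\<bar>)"
proof -
  define w where "w = cvec (x - y)"
  have in_strip: "cvec y + t *s w \<in> strip r" if t: "t \<in> closed_segment 0 1" for t
  proof -
    obtain s where s: "t = complex_of_real s" using t by (auto simp: in_segment scaleR_conv_of_real)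
    have "cvec y + t *s w = cvec (y + s *\<^sub>R (x - y))" by (simp add: vec_eq_iff w_def s)
    then show ?thesis using r by simp
  qed
  have "cmod ((\<lambda>t. f (cvec y + t *s w)) 1 - (\<lambda>t. f (cvec y + t *s w)) 0) \<le> (C * (\<Sum>j\<in>UNIV. \<bar>x $ j - y $ j\<bar>)) * cmod (1 - 0)"
  proof (rule field_differentiable_bound[where S = "closed_segment 0 1" and f' = "\<lambda>t. ddir f (cvec y + t *s w) w"])
    fix t :: complex assume t: "t \<in> closed_segment 0 1"
    show "((\<lambda>t. f (cvec y + t *s w)) has_field_derivative ddir f (cvec y + t *s w) w) (at t within closed_segment 0 1)"
      by (rule has_field_derivative_at_within[OF holo_line[OF f in_strip[OF t]]])
    have "cmod (ddir f (cvec y + t *s w) w) \<le> (\<Sum>j\<in>UNIV. \<bar>x $ j - y $ j\<bar> * C)"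
      unfolding ddir_eq_sum_pd[OF f in_strip[OF t]]
    proof (rule sum_norm_le)
      fix j
      show "cmod (w $ j * pd j f (cvec y + t *s w)) \<le> \<bar>x $ j - y $ j\<bar> * C"
        unfolding norm_mult using b[OF in_strip[OF t], of j]
        by (intro mult_mono) (auto simp: w_def norm_of_real simp flip: of_real_diff)
    qed
    then show "cmod (ddir f (cvec y + t *s w) w) \<le> C * (\<Sum>j\<in>UNIV. \<bar>x $ j - y $ j\<bar>)"
      by (simp add: sum_distrib_left mult.commute)
  qed auto
  moreover have "cvec y + 1 *s w = cvec x" by (simp add: vec_eq_iff w_def)
  ultimately show ?thesis by simp
qed

lemma has_vector_derivative_real_trace:
  fixes f :: "'i::finite \<Rightarrow> complex ^ 'n::finite \<Rightarrow> complex"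
  assumes f: "\<And>i. holo (f i) (strip r)" and r: "r > 0"
  shows "((\<lambda>t. \<chi> i. Re (f i (cvec (\<theta> + t *\<^sub>R \<omega>)))) has_vector_derivative (\<chi> i. Re (ddir (f i) (cvec (\<theta> + t *\<^sub>R \<omega>)) (cvec \<omega>)))) (at t)"
proof -
  have "((\<lambda>t. \<theta> + t *\<^sub>R \<omega>) has_derivative (\<lambda>s. s *\<^sub>R \<omega>)) (at t)"
    by (auto intro!: derivative_eq_intros)
  from has_derivative_compose[OF this bounded_linear_imp_has_derivative[OF bounded_linear_cvec]]
  have "((\<lambda>t. cvec (\<theta> + t *\<^sub>R \<omega>)) has_derivative (\<lambda>s. cvec (s *\<^sub>R \<omega>))) (at t)" .
  from has_derivative_compose[OF this holo_has_derivative[OF f]]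
  have "((\<lambda>t. f i (cvec (\<theta> + t *\<^sub>R \<omega>))) has_derivative (\<lambda>s. ddir (f i) (cvec (\<theta> + t *\<^sub>R \<omega>)) (cvec (s *\<^sub>R \<omega>)))) (at t)" for i
    using r by simp
  then have "((\<lambda>t. Re (f i (cvec (\<theta> + t *\<^sub>R \<omega>)))) has_derivative (\<lambda>s. Re (ddir (f i) (cvec (\<theta> + t *\<^sub>R \<omega>)) (cvec (s *\<^sub>R \<omega>))))) (at t)" for i
    by (rule bounded_linear.has_derivative[OF bounded_linear_Re])
  moreover have "Re (ddir (f i) (cvec (\<theta> + t *\<^sub>R \<omega>)) (cvec (s *\<^sub>R \<omega>))) = s *\<^sub>R Re (ddir (f i) (cvec (\<theta> + t *\<^sub>R \<omega>)) (cvec \<omega>))" for i s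
  proof -
    have "cvec (s *\<^sub>R \<omega>) = complex_of_real s *s cvec \<omega>" by (simp add: vec_eq_iff)
    then show ?thesis using holo_ddir_scale[OF f cvec_in_strip[OF r]] by simp
  qed
  ultimately have "((\<lambda>t. Re (f i (cvec (\<theta> + t *\<^sub>R \<omega>)))) has_vector_derivative Re (ddir (f i) (cvec (\<theta> + t *\<^sub>R \<omega>)) (cvec \<omega>))) (at t)" for i
    by (simp add: has_vector_derivative_def)
  then show ?thesis
    unfolding has_vector_derivative_def has_derivative_componentwise_within[of "\<lambda>t. \<chi> i. Re (f i (cvec (\<theta> + t *\<^sub>R \<omega>)))"]
    by (auto simp: Basis_vec_def inner_axis)
qed

text \<open>With l = 0, vanishing defects are Hamilton's equations along the lines \<theta> + t
  \<omega>. The embedding must also be injective modulo periods, which follows from the bound 1/(2n)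
  on the derivatives of u.\<close>

lemma (in kam) invariant_torus_of_solution:
  assumes fH: "\<And>y x. jn (cvec y) (cvec x) \<in> pdom c \<rho> \<Longrightarrow> H (jn (cvec y) (cvec x)) = complex_of_real (f y x)"
    and G: "\<And>y. (\<And>i. \<bar>y $ i - c $ i\<bar> < \<rho> / 2) \<Longrightarrow> y \<in> G"
    and r: "0 < r" and v: "\<And>i. tfam \<Xi> r (v i)" and u: "\<And>i. tfam \<Xi> r (u i)"
    and bu: "\<And>i j. bnd \<Xi> r (\<lambda>p. pd j (u i p)) (1 / (2 * real CARD('n)))"
    and sol: "\<And>i p \<theta>. p \<in> \<Xi> \<Longrightarrow> \<theta> \<in> strip r \<Longrightarrow> kpt v u p \<theta> \<in> pdom c (\<rho> / 2) \<and> e1 v u l i p \<theta> = 0 \<and> e2 v u i p \<theta> = 0"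
    and p: "p \<in> \<Xi>" and l: "\<And>i. l i p = 0"
  shows "invariant_torus f G \<omega> p (\<lambda>\<theta>. \<chi> i. Re (v i p (cvec \<theta>))) (\<lambda>\<theta>. \<chi> i. Re (u i p (cvec \<theta>)))"
proof -
  define vr ur where "vr \<theta> = (\<chi> i. Re (v i p (cvec \<theta>)))" and "ur \<theta> = (\<chi> i. Re (u i p (cvec \<theta>)))" for \<theta>
  have re: "v i p (cvec \<theta>) = complex_of_real (vr \<theta> $ i)" "u i p (cvec \<theta>) = complex_of_real (ur \<theta> $ i)" for i \<theta>
    using tfam_real[OF v p] tfam_real[OF u p] by (simp_all add: vr_def ur_def of_real_Re)
  have K: "kpt v u p (cvec \<theta>) = jn (cvec (p + vr \<theta>)) (cvec (\<theta> + ur \<theta>))" for \<theta>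
    by (auto simp: kpt_def jn_def vec_eq_iff re split: sum.split)
  have dom2: "jn (cvec (p + vr \<theta>)) (cvec (\<theta> + ur \<theta>)) \<in> pdom c (\<rho> / 2)" for \<theta>
    using sol[OF p cvec_in_strip[OF r]] by (simp add: K)
  then have dom: "jn (cvec (p + vr \<theta>)) (cvec (\<theta> + ur \<theta>)) \<in> pdom c \<rho>" for \<theta>
    using pdom_mono[of "\<rho> / 2" \<rho> c] rho by auto
  have cont: "continuous_on UNIV vr" "continuous_on UNIV ur"
    unfolding vr_def ur_def
    by (intro continuous_on_vec_lambda continuous_on_Re continuous_on_strip_real[OF holo_continuous_on[OF tfam_holo[OF v p]] r]
        continuous_on_strip_real[OF holo_continuous_on[OF tfam_holo[OF u p]] r])+
  have per: "vr \<theta> = vr \<phi> \<and> ur \<theta> = ur \<phi>" if eq: "torus_eq \<theta> \<phi>" for \<theta> \<phi>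
  proof -
    obtain k where "\<theta> - \<phi> = (2 * pi) *\<^sub>R ivec k" using eq by (auto simp: torus_eq_def)
    then have "\<theta> = \<phi> + (2 * pi) *\<^sub>R ivec k" by (simp add: algebra_simps)
    then have "cvec \<theta> = cvec \<phi> + pvec k" by (simp add: cvec_add pvec_def)
    then show ?thesis
      using tfam_per[OF v p] tfam_per[OF u p] r by (simp add: vr_def ur_def per_def)
  qed
  have inG: "p + vr \<theta> \<in> G" for \<theta>
  proof (rule G)
    fix i
    have "cmod (jn (cvec (p + vr \<theta>)) (cvec (\<theta> + ur \<theta>)) $ Inl i - complex_of_real (c $ i)) < \<rho> / 2"
      using dom2 by (simp add: pdom_def del: jn_nth)
    then show "\<bar>(p + vr \<theta>) $ i - c $ i\<bar> < \<rho> / 2" by (simp flip: of_real_add of_real_diff)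
  qed
  \<comment> \<open>If two images agree, each coordinate of \<theta> - \<phi> is a difference of
    values of u and hence at most S/(2n), with S the l1 distance. Summation gives S \<le>
    S/2.\<close>
  have inj: "\<theta> = \<phi>" if "\<theta> + ur \<theta> = \<phi> + ur \<phi>" for \<theta> \<phi>
  proof -
    define S where "S = (\<Sum>j\<in>UNIV. \<bar>\<theta> $ j - \<phi> $ j\<bar>)"
    have "\<bar>\<theta> $ i - \<phi> $ i\<bar> \<le> 1 / (2 * real CARD('n)) * S" for i
    proof -
      have "\<theta> $ i + ur \<theta> $ i = \<phi> $ i + ur \<phi> $ i" using arg_cong[OF that, of "\<lambda>x. x $ i"] by simp
      then have "\<theta> $ i - \<phi> $ i = ur \<phi> $ i - ur \<theta> $ i" by linarith
      then have "\<bar>\<theta> $ i - \<phi> $ i\<bar> = cmod (u i p (cvec \<theta>) - u i p (cvec \<phi>))"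
        by (simp add: re norm_of_real abs_minus_commute flip: of_real_diff)
      also have "\<dots> \<le> 1 / (2 * real CARD('n)) * S"
        unfolding S_def by (rule real_lipschitz[OF tfam_holo[OF u p] r]) (use bu p in \<open>auto simp: bnd_def\<close>)
      finally show ?thesis .
    qed
    then have "S \<le> real CARD('n) * (1 / (2 * real CARD('n)) * S)"
      unfolding S_def by (intro sum_bounded_above)
    then have "S \<le> 0" by simp
    then have "\<bar>\<theta> $ j - \<phi> $ j\<bar> \<le> 0" for j
      using member_le_sum[of j UNIV "\<lambda>j. \<bar>\<theta> $ j - \<phi> $ j\<bar>"] unfolding S_def by fastforce
    then show ?thesis by (simp add: vec_eq_iff)
  qed
  have motion: "hamiltonian_motion f (\<lambda>t. p + vr (\<theta> + t *\<^sub>R \<omega>)) (\<lambda>t. \<theta> + t *\<^sub>R \<omega> + ur (\<theta> + t *\<^sub>R \<omega>))" for \<theta>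
    unfolding hamiltonian_motion_def
  proof (intro allI conjI)
    fix t
    define \<phi> where "\<phi> = \<theta> + t *\<^sub>R \<omega>"
    have s: "e1 v u l i p (cvec \<phi>) = 0" "e2 v u i p (cvec \<phi>) = 0" for i using sol[OF p cvec_in_strip[OF r]] by auto
    have dv: "ddir (v i p) (cvec \<phi>) (cvec \<omega>) = - pd (Inr i) H (jn (cvec (p + vr \<phi>)) (cvec (\<phi> + ur \<phi>)))" for i
      using s(2)[of i] unfolding e2_def K by (simp add: eq_neg_iff_add_eq_0)
    have du: "complex_of_real (\<omega> $ i) + ddir (u i p) (cvec \<phi>) (cvec \<omega>) = pd (Inl i) H (jn (cvec (p + vr \<phi>)) (cvec (\<phi> + ur \<phi>)))" for i
      using s(1)[of i] unfolding e1_def K l by simp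
    have "((\<lambda>t. p + vr (\<theta> + t *\<^sub>R \<omega>)) has_vector_derivative 0 + (\<chi> i. Re (ddir (v i p) (cvec \<phi>) (cvec \<omega>)))) (at t)"
      unfolding vr_def \<phi>_def by (intro has_vector_derivative_add has_vector_derivative_const has_vector_derivative_real_trace[OF tfam_holo[OF v p] r])
    moreover have "- gradient (\<lambda>q. f (p + vr \<phi>) q) (\<phi> + ur \<phi>) = 0 + (\<chi> i. Re (ddir (v i p) (cvec \<phi>) (cvec \<omega>)))"
      using gradient_angle[OF holo_H(1) dom[of \<phi>] fH] by (simp add: dv vec_eq_iff)
    ultimately show "((\<lambda>t. p + vr (\<theta> + t *\<^sub>R \<omega>)) has_vector_derivative - gradient (\<lambda>q. f (p + vr (\<theta> + t *\<^sub>R \<omega>)) q) (\<theta> + t *\<^sub>R \<omega> + ur (\<theta> + t *\<^sub>R \<omega>))) (at t)"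
      by (simp add: \<phi>_def)
    have "((\<lambda>t. \<theta> + t *\<^sub>R \<omega>) has_vector_derivative \<omega>) (at t)"
      by (auto intro!: derivative_eq_intros)
    then have "((\<lambda>t. \<theta> + t *\<^sub>R \<omega> + ur (\<theta> + t *\<^sub>R \<omega>)) has_vector_derivative \<omega> + (\<chi> i. Re (ddir (u i p) (cvec \<phi>) (cvec \<omega>)))) (at t)"
      unfolding ur_def \<phi>_def by (intro has_vector_derivative_add has_vector_derivative_real_trace[OF tfam_holo[OF u p] r])
    moreover have "gradient (\<lambda>y. f y (\<phi> + ur \<phi>)) (p + vr \<phi>) = \<omega> + (\<chi> i. Re (ddir (u i p) (cvec \<phi>) (cvec \<omega>)))"
      using gradient_action[OF holo_H(1) dom[of \<phi>] fH] by (simp add: vec_eq_iff flip: du)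
    ultimately show "((\<lambda>t. \<theta> + t *\<^sub>R \<omega> + ur (\<theta> + t *\<^sub>R \<omega>)) has_vector_derivative gradient (\<lambda>y. f y (\<theta> + t *\<^sub>R \<omega> + ur (\<theta> + t *\<^sub>R \<omega>))) (p + vr (\<theta> + t *\<^sub>R \<omega>))) (at t)"
      by (simp add: \<phi>_def)
  qed
  have "invariant_torus f G \<omega> p vr ur"
    unfolding invariant_torus_def torus_periodic_def
  proof (intro conjI allI impI)
    fix \<theta> \<phi> assume a: "vr \<theta> = vr \<phi> \<and> torus_eq (\<theta> + ur \<theta>) (\<phi> + ur \<phi>)"
    then obtain k where k: "\<theta> + ur \<theta> - (\<phi> + ur \<phi>) = (2 * pi) *\<^sub>R ivec k" by (auto simp: torus_eq_def)
    \<comment> \<open>Moving one lift by a period reduces equality on the torus to equality of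
      lifts.\<close>
    define \<psi> where "\<psi> = \<phi> + (2 * pi) *\<^sub>R ivec k"
    have "torus_eq \<psi> \<phi>" by (auto simp: torus_eq_def \<psi>_def)
    then have "ur \<psi> = ur \<phi>" using per by blast
    then have "\<theta> + ur \<theta> = \<psi> + ur \<psi>" using k by (simp add: \<psi>_def algebra_simps)
    then have "\<theta> = \<psi>" by (rule inj)
    then show "torus_eq \<theta> \<phi>" using \<open>torus_eq \<psi> \<phi>\<close> by simp
  qed (use cont per inG motion in auto)
  then show ?thesis by (simp add: vr_def[abs_def] ur_def[abs_def])
qed


section \<open>Removing the counterterm\<close>

abbreviation act :: "complex ^ ('n::finite + 'n) \<Rightarrow> complex ^ 'n" where "act z \<equiv> \<chi> i. z $ Inl i"
abbreviation ang :: "complex ^ ('n::finite + 'n) \<Rightarrow> complex ^ 'n" where "ang z \<equiv> \<chi> i. z $ Inr i"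

lemma act_jn: "act (jn y x) = y" and ang_jn: "ang (jn y x) = x"
  by (simp_all add: vec_eq_iff)

lemma norm_vec_le_sum: "norm (x :: 'a::real_normed_vector ^ 'n::finite) \<le> (\<Sum>i\<in>UNIV. norm (x $ i))"
  unfolding norm_vec_def by (rule L2_set_le_sum) simp

lemma norm_vec_le_card:
  assumes "\<And>i. norm (x $ i) \<le> C" shows "norm (x :: 'a::real_normed_vector ^ 'n::finite) \<le> real CARD('n) * C"
  using norm_vec_le_sum[of x] sum_bounded_above[of UNIV "\<lambda>i. norm (x $ i)" C] assms by simp

lemma norm_vec_less_card:
  assumes "\<And>i. norm (x $ i) < C" shows "norm (x :: 'a::real_normed_vector ^ 'n::finite) < real CARD('n) * C"
  using norm_vec_le_sum[of x] sum_strict_mono[of UNIV "\<lambda>i. norm (x $ i)" "\<lambda>i. C"] assms by simp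

text \<open>\<open>pdom\<close> bounds single coordinates and \<open>complex_nbhd\<close> Euclidean
  norms; the passage costs the factor n.\<close>

lemma pdom_complex_nbhd:
  fixes z :: "complex ^ ('n::finite + 'n)"
  assumes "z \<in> pdom c \<rho>" "c \<in> G" "real CARD('n) * \<rho> \<le> s" "real CARD('n) * \<rho> \<le> r"
  shows "(act z, ang z) \<in> complex_nbhd G s r"
proof -
  have "norm (act z - cvec c) < real CARD('n) * \<rho>" "norm (\<chi> i. Im (ang z $ i)) < real CARD('n) * \<rho>"
    by (rule norm_vec_less_card; use assms(1) in \<open>simp add: pdom_def\<close>)+
  moreover have "infdist (act z) (cvec ` G) \<le> dist (act z) (cvec c)" using assms(2) by (intro infdist_le) simp
  ultimately show ?thesis using assms(3,4) by (simp add: complex_nbhd_def dist_norm)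
qed

lemma bounded_linear_act: "bounded_linear (act :: complex ^ ('n::finite + 'n) \<Rightarrow> complex ^ 'n)"
  and bounded_linear_ang: "bounded_linear (ang :: complex ^ ('n::finite + 'n) \<Rightarrow> complex ^ 'n)"
proof -
  have "linear (act :: complex ^ ('n + 'n) \<Rightarrow> complex ^ 'n)" "linear (ang :: complex ^ ('n + 'n) \<Rightarrow> complex ^ 'n)"
    by (auto intro!: linearI simp: vec_eq_iff)
  then show "bounded_linear (act :: complex ^ ('n + 'n) \<Rightarrow> complex ^ 'n)" "bounded_linear (ang :: complex ^ ('n + 'n) \<Rightarrow> complex ^ 'n)"
    by (simp_all add: linear_conv_bounded_linear)
qed

lemma pdom_real_action:
  fixes y :: "real ^ 'n::finite"
  assumes "jn (cvec y) (cvec x) \<in> pdom c \<rho>"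
  shows "\<bar>y $ i - c $ i\<bar> < \<rho>" and "norm (y - c) < real CARD('n) * \<rho>"
proof -
  have "cmod (jn (cvec y) (cvec x) $ Inl i - complex_of_real (c $ i)) < \<rho>" for i
    using assms by (simp add: pdom_def del: jn_nth)
  then show *: "\<bar>y $ i - c $ i\<bar> < \<rho>" for i by (simp add: norm_of_real flip: of_real_diff)
  show "norm (y - c) < real CARD('n) * \<rho>" by (rule norm_vec_less_card) (use * in simp)
qed

lemma pdom_real_point:
  assumes "z \<in> pdom c \<rho>" "\<And>a. z $ a \<in> \<real>"
  obtains y x where "z = jn (cvec y) (cvec x)"
proof
  show "z = jn (cvec (\<chi> i. Re (z $ Inl i))) (cvec (\<chi> i. Re (z $ Inr i)))"
    using assms(2) by (auto simp: vec_eq_iff jn_def of_real_Re split: sum.split)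
qed

text \<open>Periodicity of f is known at real points only. The difference between the extension and
  its translate by a period vanishes there, hence everywhere by
  \<open>pdom_identity\<close>.\<close>

lemma hclass_extension:
  fixes c :: "real ^ 'n::finite"
  assumes F: "analytic_extension f F G s r" and per: "\<And>y. infdist y G < s \<Longrightarrow> torus_periodic (f y)"
    and c: "c \<in> G" and \<rho>: "real CARD('n) * \<rho> \<le> s" "real CARD('n) * \<rho> \<le> r"
  shows "hclass c \<rho> (\<lambda>z. F (act z, ang z))"
    and "jn (cvec y) (cvec x) \<in> pdom c \<rho> \<Longrightarrow> F (act (jn (cvec y) (cvec x)), ang (jn (cvec y) (cvec x))) = complex_of_real (f y x)"
proof -
  let ?F = "\<lambda>z. F (act z, ang z)"
  have near: "infdist y G < s" if "jn (cvec y) (cvec x) \<in> pdom c \<rho>" for y x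
    using infdist_le[OF c, of y] pdom_real_action(2)[OF that] \<rho>(1) by (simp add: dist_norm)
  show real: "?F (jn (cvec y) (cvec x)) = complex_of_real (f y x)" if "jn (cvec y) (cvec x) \<in> pdom c \<rho>" for y x
    using F near[OF that] unfolding act_jn ang_jn by (simp add: analytic_extension_def)
  have holo: "holo ?F (pdom c \<rho>)"
    unfolding holo_def
  proof
    fix z :: "complex ^ ('n + 'n)" assume "z \<in> pdom c \<rho>"
    then obtain D where D: "(F has_derivative D) (at (act z, ang z))" and Dc: "\<And>c v w. D (c *s v, c *s w) = c * D (v, w)"
      using F pdom_complex_nbhd[OF _ c \<rho>] unfolding analytic_extension_def cholomorphic_on_def by blast
    have "((\<lambda>z. (act z, ang z)) has_derivative (\<lambda>z. (act z, ang z))) (at z)"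
      by (intro has_derivative_Pair bounded_linear_imp_has_derivative bounded_linear_act bounded_linear_ang)
    from has_derivative_compose[OF this D]
    have "(?F has_derivative (\<lambda>v. D (act v, ang v))) (at z)" .
    moreover have "D (act (c *s v), ang (c *s v)) = c * D (act v, ang v)" for c v
    proof -
      have "act (c *s v) = c *s act v" "ang (c *s v) = c *s ang v" by (simp_all add: vec_eq_iff)
      then show ?thesis by (simp only: Dc)
    qed
    ultimately show "\<exists>D. (?F has_derivative D) (at z) \<and> (\<forall>c v. D (c *s v) = c * D v)" by blast
  qed
  have per': "?F (z + xshift k) = ?F z" if z: "z \<in> pdom c \<rho>" for z k
  proof -
    have "holo (\<lambda>z. ?F (z + xshift k)) (pdom c \<rho>)"
    proof (rule holo_compose[OF holo])
      show "holo (\<lambda>z. (z + xshift k) $ a) (pdom c \<rho>)" for a by (simp add: holo_add holo_nth holo_const)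
    qed simp
    then have "holo (\<lambda>z. ?F (z + xshift k) - ?F z) (pdom c \<rho>)" by (rule holo_diff[OF _ holo])
    then have "?F (z + xshift k) - ?F z = 0"
    proof (rule pdom_identity[OF _ _ z])
      fix y x assume a: "jn (cvec y) (cvec x) \<in> pdom c \<rho>"
      have e: "jn (cvec y) (cvec x) + xshift k = jn (cvec y) (cvec (x + (2 * pi) *\<^sub>R ivec k))"
        by (auto simp: vec_eq_iff jn_def xshift_def pvec_def split: sum.split)
      have "torus_eq (x + (2 * pi) *\<^sub>R ivec k) x" by (auto simp: torus_eq_def)
      then have p: "f y (x + (2 * pi) *\<^sub>R ivec k) = f y x" using per[OF near[OF a]] by (simp add: torus_periodic_def)
      have s: "jn (cvec y) (cvec x) + xshift k \<in> pdom c \<rho>" using a by simp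
      then show "?F (jn (cvec y) (cvec x) + xshift k) - ?F (jn (cvec y) (cvec x)) = 0"
        unfolding e real[OF a] real[OF s[unfolded e]] by (simp add: p)
    qed
    then show ?thesis by simp
  qed
  show "hclass c \<rho> ?F"
    unfolding hclass_def
  proof (intro conjI holo ballI allI impI per')
    fix z assume z: "z \<in> pdom c \<rho>" and "\<forall>a. z $ a \<in> \<real>"
    then obtain y x where "z = jn (cvec y) (cvec x)" using pdom_real_point by blast
    then show "?F z \<in> \<real>" using real z by simp
  qed
qed

text \<open>Setting the angle to 0 in the extension of h makes it independent of the angle by
  construction, also at complex points, so that its angle derivatives are 0.\<close>

lemma hclass_action:
  fixes F :: "complex ^ ('n::finite + 'n) \<Rightarrow> complex"
  assumes F: "hclass c \<rho> F"
  shows "hclass c \<rho> (\<lambda>z. F (jn (act z) 0))"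
proof -
  have dom: "jn (act z) 0 \<in> pdom c \<rho>" if "z \<in> pdom c \<rho>" for z
    using that by (force simp: pdom_def intro: le_less_trans[OF norm_ge_zero])
  have "holo (\<lambda>z. F (jn (act z) 0)) (pdom c \<rho>)"
  proof (rule holo_compose)
    show "holo F (pdom c \<rho>)" using F by (simp add: hclass_def)
    show "holo (\<lambda>z. jn (act z) 0 $ a) (pdom c \<rho>)" for a by (cases a) (simp_all add: holo_nth holo_const)
  qed (rule dom)
  moreover have "act (z + xshift k) = act z" for z :: "complex ^ ('n + 'n)" and k
    by (simp add: vec_eq_iff xshift_def)
  moreover have "F (jn (act z) 0) \<in> \<real>" if "z \<in> pdom c \<rho>" "\<forall>a. z $ a \<in> \<real>" for z
  proof -
    have "jn (act z) 0 $ a \<in> \<real>" for a using that(2) by (cases a) auto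
    then show ?thesis using F dom[OF that(1)] by (simp add: hclass_def)
  qed
  ultimately show ?thesis by (simp add: hclass_def)
qed

text \<open>The extension of h comes without a bound. With the angle frozen only a closed polydisc
  of actions matters, which is compact and lies in the larger domain.\<close>

lemma action_bounded:
  fixes F :: "complex ^ ('n::finite + 'n) \<Rightarrow> complex"
  assumes F: "holo F (pdom c \<rho>')" and \<rho>: "\<rho> < \<rho>'" "0 < \<rho>'"
  obtains B where "\<And>z. z \<in> pdom c \<rho> \<Longrightarrow> cmod (F (jn (act z) 0)) \<le> B"
proof -
  define S where "S = {w :: complex ^ 'n. \<forall>i. cmod (w $ i - complex_of_real (c $ i)) \<le> \<rho>}"
  have "closed S" unfolding S_def by (intro closed_Collect_all closed_Collect_le continuous_intros)
  moreover have "bounded S"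
  proof (rule boundedI)
    fix w assume "w \<in> S"
    then have "norm (w - cvec c) \<le> real CARD('n) * \<rho>" by (intro norm_vec_le_card) (simp add: S_def)
    then show "norm w \<le> norm (cvec c) + real CARD('n) * \<rho>" using norm_triangle_sub[of w "cvec c"] by linarith
  qed
  ultimately have "compact S" by (simp add: compact_eq_bounded_closed)
  moreover have "continuous_on S (\<lambda>w. F (jn w 0))"
  proof (rule continuous_on_compose2[OF holo_continuous_on[OF F]])
    show "continuous_on S (\<lambda>w. jn w 0)"
      unfolding jn_def by (intro continuous_on_vec_lambda; rename_tac a; case_tac a; auto intro!: continuous_intros)
    show "(\<lambda>w. jn w 0) ` S \<subseteq> pdom c \<rho>'" using \<rho>(2) le_less_trans[OF _ \<rho>(1)] by (auto simp: S_def pdom_def)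
  qed
  ultimately have "bounded ((\<lambda>w. F (jn w 0)) ` S)" by (intro compact_imp_bounded compact_continuous_image)
  then obtain B where B: "\<And>w. w \<in> S \<Longrightarrow> cmod (F (jn w 0)) \<le> B" by (auto simp: bounded_iff)
  show thesis
    by (rule that[of B], rule B) (auto simp: S_def pdom_def intro: less_imp_le)
qed

lemma pd_action_only:
  assumes "\<And>z. F z = F (jn (act z) 0)"
  shows "pd (Inl i) F z = pd (Inl i) F (jn (act z) 0)" and "pd (Inr i) F z = 0"
proof -
  have F: "F z = F w" if "act z = act w" for z w by (subst (1 2) assms) (simp only: that)
  have "F (z + t *s axis (Inl i) 1) = F (jn (act z) 0 + t *s axis (Inl i) 1)" for t
    by (rule F) (simp add: vec_eq_iff)
  then show "pd (Inl i) F z = pd (Inl i) F (jn (act z) 0)" by (simp add: pd_def ddir_def)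
  have "F (z + t *s axis (Inr i) 1) = F z" for t
    by (rule F) (simp add: vec_eq_iff axis_def)
  then show "pd (Inr i) F z = 0" by (simp add: pd_def ddir_def)
qed

section \<open>Zeros of maps close to an injection\<close>

lemma continuous_inj_covers_ball:
  fixes g :: "'a::euclidean_space \<Rightarrow> 'a"
  assumes "continuous_on (cball a d) g" "inj_on g (cball a d)" "0 < d"
  obtains \<mu> where "0 < \<mu>" "cball (g a) \<mu> \<subseteq> g ` cball a d"
proof -
  have "open (g ` ball a d)"
    by (rule invariance_of_domain[OF continuous_on_subset[OF assms(1) ball_subset_cball] open_ball
        inj_on_subset[OF assms(2) ball_subset_cball]])
  then obtain \<mu> where "0 < \<mu>" "cball (g a) \<mu> \<subseteq> g ` ball a d"
    using assms(3) open_contains_cball[of "g ` ball a d"] by (metis centre_in_ball imageI)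
  then show thesis using that ball_subset_cball by blast
qed

text \<open>In the coordinate w = g p the zeros of \<phi> are the fixed points of w \<mapsto> w -
  \<phi> (g^-1 w), where the inverse is continuous by compactness. As \<phi> is \<mu>-close to g -
  \<omega>, this map sends the ball of radius \<mu> about \<omega> into itself.\<close>

lemma zero_of_near_injection:
  fixes g \<phi> :: "'a::euclidean_space \<Rightarrow> 'a"
  assumes \<Xi>: "compact \<Xi>" and g: "continuous_on \<Xi> g" "inj_on g \<Xi>" "cball \<omega> \<mu> \<subseteq> g ` \<Xi>"
    and \<mu>: "0 < \<mu>" and \<phi>: "continuous_on \<Xi> \<phi>" "\<And>p. p \<in> \<Xi> \<Longrightarrow> norm (\<phi> p - (g p - \<omega>)) \<le> \<mu>"
  obtains p where "p \<in> \<Xi>" "\<phi> p = 0"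
proof -
  define gi where "gi = inv_into \<Xi> g"
  have gi: "continuous_on (g ` \<Xi>) gi"
    by (rule continuous_on_inv[OF g(1) \<Xi>]) (simp add: gi_def g(2))
  have giX: "gi w \<in> \<Xi>" "g (gi w) = w" if "w \<in> cball \<omega> \<mu>" for w
    using g(3) that by (auto simp: gi_def inv_into_into f_inv_into_f)
  obtain w where w: "w \<in> cball \<omega> \<mu>" "w - \<phi> (gi w) = w"
  proof (rule brouwer[of "cball \<omega> \<mu>" "\<lambda>w. w - \<phi> (gi w)"])
    show "continuous_on (cball \<omega> \<mu>) (\<lambda>w. w - \<phi> (gi w))"
      by (intro continuous_intros continuous_on_compose2[OF \<phi>(1)] continuous_on_subset[OF gi g(3)]) (use giX in auto)
    show "(\<lambda>w. w - \<phi> (gi w)) \<in> cball \<omega> \<mu> \<rightarrow> cball \<omega> \<mu>"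
    proof
      fix w assume "w \<in> cball \<omega> \<mu>"
      from \<phi>(2)[OF giX(1)[OF this]] giX(2)[OF this]
      show "w - \<phi> (gi w) \<in> cball \<omega> \<mu>" by (simp add: dist_norm algebra_simps)
    qed
  qed (use \<mu> in auto)
  show thesis by (rule that[OF giX(1)[OF w(1)]]) (use w(2) in simp)
qed

lemma tfam_param_continuous:
  fixes c :: "'p::metric_space \<Rightarrow> complex"
  assumes "tfam \<Xi> r (\<lambda>p (\<theta> :: complex ^ 'n::finite). c p)" "r > 0"
  shows "continuous_on \<Xi> c"
proof -
  have "(0 :: complex ^ 'n) \<in> strip r" using assms(2) by (simp add: strip_def)
  then have "continuous_on \<Xi> (\<lambda>p. (\<lambda>(p, \<theta>). c p) (p, 0 :: complex ^ 'n))"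
    by (intro continuous_on_compose2[OF tfam_continuous[OF assms(1)]]) (auto intro!: continuous_intros)
  then show ?thesis by simp
qed

section \<open>The frequency map and the perturbed system\<close>

lemma pd_eq_gradient:
  fixes F :: "complex ^ ('n::finite + 'n) \<Rightarrow> complex"
  assumes F: "holo F (pdom c \<rho>)" "\<And>z. F z = F (jn (act z) 0)" and \<rho>: "0 < \<rho>"
    and f: "\<And>y x. jn (cvec y) (cvec x) \<in> pdom c \<rho> \<Longrightarrow> F (jn (cvec y) (cvec x)) = complex_of_real (f y)"
    and p: "\<And>i. \<bar>p $ i - c $ i\<bar> < \<rho>"
  shows "pd (Inl i) F (jn (cvec p) 0) = complex_of_real (gradient f p $ i)"
proof -
  have 0: "cvec 0 = (0 :: complex ^ 'n)" by (simp add: vec_eq_iff)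
  have d: "jn (cvec p) (cvec 0) \<in> pdom c \<rho>"
    using p \<rho> by (simp add: pdom_def norm_of_real flip: of_real_diff)
  show ?thesis
    using gradient_action[OF F(1) d f] pd_action_real[OF F(1) d f, of i] by (simp add: 0 of_real_Re)
qed

lemma continuous_on_gradient:
  fixes F :: "complex ^ ('n::finite + 'n) \<Rightarrow> complex"
  assumes F: "holo F (pdom c \<rho>)" "\<And>z. F z = F (jn (act z) 0)" and \<rho>: "0 < \<rho>"
    and f: "\<And>y x. jn (cvec y) (cvec x) \<in> pdom c \<rho> \<Longrightarrow> F (jn (cvec y) (cvec x)) = complex_of_real (f y)"
    and S: "\<And>p i. p \<in> S \<Longrightarrow> \<bar>p $ i - c $ i\<bar> < \<rho>"
  shows "continuous_on S (gradient f)"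
proof -
  have "continuous_on S (\<lambda>p. pd (Inl i) F (jn (cvec p) 0))" for i
  proof (rule continuous_on_compose2[OF holo_continuous_on[OF holo_pd[OF open_pdom F(1)]]])
    show "continuous_on S (\<lambda>p. jn (cvec p) 0)"
      unfolding jn_def by (intro continuous_on_vec_lambda; rename_tac a; case_tac a; auto intro!: continuous_intros)
    show "(\<lambda>p. jn (cvec p) 0) ` S \<subseteq> pdom c \<rho>"
      using S \<rho> by (auto simp: pdom_def norm_of_real simp flip: of_real_diff)
  qed
  then have "continuous_on S (\<lambda>p. Re (pd (Inl i) F (jn (cvec p) 0)))" for i by (rule continuous_on_Re)
  then have "continuous_on S (\<lambda>p. \<chi> i. Re (pd (Inl i) F (jn (cvec p) 0)))" by (intro continuous_on_vec_lambda)
  then show ?thesis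
    by (rule continuous_on_eq) (simp add: vec_eq_iff pd_eq_gradient[OF F \<rho> f S])
qed

text \<open>On the flat torus at p, with counterterm \<nabla>h(p) - \<omega>, both defects are, up
  to sign, first derivatives of \<epsilon> P. A Cauchy estimate with loss \<rho>/2 bounds them by
  \<eta> = \<epsilon> (2M/\<rho>), the starting error of the iteration.\<close>

lemma torus_of_small_perturbation:
  fixes \<xi>\<^sub>0 :: "real ^ 'n::finite" and h :: "real ^ 'n \<Rightarrow> real" and P :: "real ^ 'n \<Rightarrow> real ^ 'n \<Rightarrow> real"
    and \<rho> M B B' \<gamma> \<tau> \<epsilon> :: real
  defines "\<Xi> \<equiv> cball \<xi>\<^sub>0 (\<rho> / 8)" and "\<omega> \<equiv> gradient h \<xi>\<^sub>0"
    and "C \<equiv> kam_C TYPE('n) \<rho> B \<gamma> \<tau>" and "\<eta> \<equiv> \<epsilon> * (2 * M / \<rho>)"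
  assumes \<rho>: "0 < \<rho>" and hc: "hclass \<xi>\<^sub>0 \<rho> hc" "\<And>z. hc z = hc (jn (act z) 0)" "\<And>z. z \<in> pdom \<xi>\<^sub>0 \<rho> \<Longrightarrow> cmod (hc z) \<le> B'"
    and hr: "\<And>y x. jn (cvec y) (cvec x) \<in> pdom \<xi>\<^sub>0 \<rho> \<Longrightarrow> hc (jn (cvec y) (cvec x)) = complex_of_real (h y)"
    and FP: "hclass \<xi>\<^sub>0 \<rho> FP" "\<And>z. z \<in> pdom \<xi>\<^sub>0 \<rho> \<Longrightarrow> cmod (FP z) \<le> M"
    and Pr: "\<And>y x. jn (cvec y) (cvec x) \<in> pdom \<xi>\<^sub>0 \<rho> \<Longrightarrow> FP (jn (cvec y) (cvec x)) = complex_of_real (P y x)"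
    and G: "\<And>y. (\<And>i. \<bar>y $ i - \<xi>\<^sub>0 $ i\<bar> < \<rho>) \<Longrightarrow> y \<in> G"
    and d: "dioph \<omega> \<gamma> \<tau>" and inj: "inj_on (gradient h) \<Xi>" and \<mu>: "0 < \<mu>" "cball \<omega> \<mu> \<subseteq> gradient h ` \<Xi>"
    and \<epsilon>: "0 \<le> \<epsilon>" "B' + \<epsilon> * M \<le> B" and M: "0 \<le> M"
    and small: "C * \<eta> \<le> 1" "C * \<eta> \<le> kam_c1 TYPE('n) \<rho> B \<gamma> \<tau>" "real CARD('n) * (C * \<eta>) \<le> \<mu>"
  shows "\<exists>p\<in>G. \<exists>v u. invariant_torus (\<lambda>y x. h y + \<epsilon> * P y x) G \<omega> p v u \<and>
    (\<forall>\<theta>. norm (v \<theta>) \<le> real CARD('n) * (C * \<eta>) \<and> norm (u \<theta>) \<le> real CARD('n) * (C * \<eta>))"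
proof -
  define H where "H z = hc z + complex_of_real \<epsilon> * FP z" for z
  have hol: "holo hc (pdom \<xi>\<^sub>0 \<rho>)" "holo FP (pdom \<xi>\<^sub>0 \<rho>)" using hc(1) FP(1) by (auto simp: hclass_def)
  have holH: "holo H (pdom \<xi>\<^sub>0 \<rho>)" unfolding H_def by (intro holo_add holo_mult holo_const hol)
  have pdH: "pd a H z = pd a hc z + complex_of_real \<epsilon> * pd a FP z" if z: "z \<in> pdom \<xi>\<^sub>0 \<rho>" for a z
  proof -
    have "pd a H z = ddir hc z (axis a 1) + ddir (\<lambda>z. complex_of_real \<epsilon> * FP z) z (axis a 1)"
      unfolding pd_def H_def by (rule ddir_add[OF hol(1) holo_mult[OF holo_const hol(2)] z])
    also have "ddir (\<lambda>z. complex_of_real \<epsilon> * FP z) z (axis a 1) = complex_of_real \<epsilon> * pd a FP z"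
      using ddir_mult[OF holo_const hol(2) z] by (simp add: ddir_const pd_def)
    finally show ?thesis by (simp add: pd_def)
  qed
  have hcH: "hclass \<xi>\<^sub>0 \<rho> H"
    using hc(1) FP(1) holH by (auto simp: hclass_def H_def)
  have Xi: "\<bar>p $ i - \<xi>\<^sub>0 $ i\<bar> \<le> \<rho> / 8" if "p \<in> \<Xi>" for p i
    using that component_le_norm_cart[of "\<xi>\<^sub>0 - p" i] by (simp add: \<Xi>_def dist_norm abs_minus_commute)
  interpret kam \<Xi> \<xi>\<^sub>0 \<rho> B \<gamma> \<tau> \<omega> H
  proof
    show "compact \<Xi>" by (simp add: \<Xi>_def)
    show "cmod (H z) \<le> B" if z: "z \<in> pdom \<xi>\<^sub>0 \<rho>" for z
    proof -
      have "cmod (H z) \<le> cmod (hc z) + \<epsilon> * cmod (FP z)"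
        unfolding H_def using \<epsilon>(1) by (metis norm_triangle_ineq norm_mult norm_of_real abs_of_nonneg)
      also have "\<dots> \<le> B' + \<epsilon> * M" using hc(3)[OF z] FP(2)[OF z] \<epsilon>(1) by (intro add_mono mult_left_mono)
      finally show ?thesis using \<epsilon>(2) by simp
    qed
  qed (use Xi \<rho> hcH d in auto)
  have \<eta>0: "0 \<le> \<eta>" using \<epsilon> M \<rho> by (simp add: \<eta>_def)
  have w: "0 < width \<rho>" "width \<rho> \<le> \<rho> / 4" using \<rho> by (auto simp: width_def)
  let ?Z = "\<lambda>(i::'n) (p::real ^ 'n) (\<theta>::complex ^ 'n). 0 :: complex"
  have kd: "kpt ?Z ?Z p \<theta> \<in> pdom \<xi>\<^sub>0 (\<rho> / 2)" if "p \<in> \<Xi>" "\<theta> \<in> strip (width \<rho>)" for p \<theta>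
  proof -
    have "\<bar>p $ i - \<xi>\<^sub>0 $ i\<bar> < \<rho> / 2" "\<bar>Im (\<theta> $ i)\<bar> < \<rho> / 2" for i
      using Xi[OF that(1), of i] \<rho> w that(2) by (auto simp: strip_def dest!: spec[of _ i])
    then show ?thesis by (simp add: kpt_def pdom_def norm_of_real flip: of_real_diff)
  qed
  have kd': "kpt ?Z ?Z p \<theta> \<in> pdom \<xi>\<^sub>0 \<rho>" if "p \<in> \<Xi>" "\<theta> \<in> strip (width \<rho>)" for p \<theta>
    using kd[OF that] pdom_mono[of "\<rho> / 2" \<rho> \<xi>\<^sub>0] \<rho> by auto
  have ka: "act (kpt ?Z ?Z p \<theta>) = cvec p" for p \<theta> by (simp add: kpt_def vec_eq_iff)
  define l0 where "l0 i p = pd (Inl i) hc (jn (cvec p) 0) - complex_of_real (\<omega> $ i)" for i p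
  have hk: "pd (Inl i) hc (kpt ?Z ?Z p \<theta>) = pd (Inl i) hc (jn (cvec p) 0)" for i p \<theta>
    using pd_action_only(1)[of hc i "kpt ?Z ?Z p \<theta>", OF hc(2)] by (simp only: ka)
  have tl0: "tfam \<Xi> (width \<rho>) (\<lambda>p (\<theta>::complex ^ 'n). l0 i p)" for i
  proof -
    have "tfam \<Xi> (width \<rho>) (\<lambda>p \<theta>. pd (Inl i) hc (kpt ?Z ?Z p \<theta>))"
      by (rule tfam_kpt[OF hclass_pd[OF hc(1)] _ _ kd' w(1)]) (auto intro: tfam_const)
    then show ?thesis unfolding l0_def hk by (rule tfam_diff[OF _ tfam_const]) simp
  qed
  have pdFP: "cmod (complex_of_real \<epsilon> * pd a FP (kpt ?Z ?Z p \<theta>)) \<le> \<eta>" if "p \<in> \<Xi>" "\<theta> \<in> strip (width \<rho>)" for a p \<theta>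
  proof -
    have "kpt ?Z ?Z p \<theta> \<in> pdom \<xi>\<^sub>0 (\<rho> - \<rho> / 2)" using kd[OF that] by simp
    from pd_bound_pdom[OF hol(2) FP(2) _ this, of a] \<rho>
    have "cmod (pd a FP (kpt ?Z ?Z p \<theta>)) \<le> 2 * M / \<rho>" by (simp add: mult.commute)
    then show ?thesis unfolding norm_mult \<eta>_def norm_of_real using \<epsilon>(1) by (simp only: abs_of_nonneg mult_left_mono)
  qed
  have b1: "bnd \<Xi> (width \<rho>) (e1 ?Z ?Z l0 i) \<eta>" for i
    unfolding bnd_def
  proof (intro ballI)
    fix p and \<theta> :: "complex ^ 'n" assume a: "p \<in> \<Xi>" "\<theta> \<in> strip (width \<rho>)"
    have "e1 ?Z ?Z l0 i p \<theta> = - (complex_of_real \<epsilon> * pd (Inl i) FP (kpt ?Z ?Z p \<theta>))"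
      unfolding e1_def pdH[OF kd'[OF a]] hk by (simp add: l0_def ddir_const)
    then show "cmod (e1 ?Z ?Z l0 i p \<theta>) \<le> \<eta>" using pdFP[OF a] by simp
  qed
  have b2: "bnd \<Xi> (width \<rho>) (e2 ?Z ?Z i) \<eta>" for i
    unfolding bnd_def
  proof (intro ballI)
    fix p and \<theta> :: "complex ^ 'n" assume a: "p \<in> \<Xi>" "\<theta> \<in> strip (width \<rho>)"
    have "e2 ?Z ?Z i p \<theta> = complex_of_real \<epsilon> * pd (Inr i) FP (kpt ?Z ?Z p \<theta>)"
      unfolding e2_def pdH[OF kd'[OF a]] pd_action_only(2)[of hc, OF hc(2)] by (simp add: ddir_const)
    then show "cmod (e2 ?Z ?Z i p \<theta>) \<le> \<eta>" using pdFP[OF a] by simp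
  qed
  obtain v u l r where r: "r > 0" and v: "\<And>i. tfam \<Xi> r (v i)" and u: "\<And>i. tfam \<Xi> r (u i)"
    and l: "\<And>i. tfam \<Xi> r (\<lambda>p (\<theta>::complex ^ 'n). l i p)"
    and bv: "\<And>i. bnd \<Xi> r (v i) (C * \<eta>)" and bu: "\<And>i. bnd \<Xi> r (u i) (C * \<eta>)"
    and bl: "\<And>i. bnd \<Xi> r (\<lambda>p (\<theta>::complex ^ 'n). l i p - l0 i p) (C * \<eta>)"
    and bpd: "\<And>i j. bnd \<Xi> r (\<lambda>p. pd j (u i p)) (1 / (2 * real CARD('n)))"
    and sol: "\<And>i p \<theta>. p \<in> \<Xi> \<Longrightarrow> \<theta> \<in> strip r \<Longrightarrow> kpt v u p \<theta> \<in> pdom \<xi>\<^sub>0 (\<rho> / 2) \<and> e1 v u l i p \<theta> = 0 \<and> e2 v u i p \<theta> = 0"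
    by (rule kam_torus[OF \<eta>0 small(1,2)[unfolded C_def] tl0 b1 b2]) (rule that; (unfold C_def)?; assumption)
  have l0: "l0 i p = complex_of_real ((gradient h p - \<omega>) $ i)" if p: "p \<in> \<Xi>" for i p
  proof -
    have "\<bar>p $ i - \<xi>\<^sub>0 $ i\<bar> < \<rho>" for i using Xi[OF p, of i] \<rho> by linarith
    from pd_eq_gradient[OF hol(1) hc(2) \<rho> hr this] show ?thesis by (simp add: l0_def)
  qed
  have 0: "(0 :: complex ^ 'n) \<in> strip r" using r by (simp add: strip_def)
  have lreal: "l i p \<in> \<real>" if "p \<in> \<Xi>" for i p using tfam_real[OF l that] .
  \<comment> \<open>l stays within n C \<eta> \<le> \<mu> of \<nabla>h - \<omega>, so it vanishes at
    some p of the ball. There the torus belongs to the Hamiltonian without counterterm.\<close>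
  obtain p where p: "p \<in> \<Xi>" "(\<chi> i. Re (l i p)) = 0"
  proof (rule zero_of_near_injection[of \<Xi> "gradient h" \<omega> \<mu> "\<lambda>p. \<chi> i. Re (l i p)"])
    show "continuous_on \<Xi> (gradient h)"
    proof (rule continuous_on_gradient[OF hol(1) hc(2) \<rho> hr])
      show "\<bar>p $ i - \<xi>\<^sub>0 $ i\<bar> < \<rho>" if "p \<in> \<Xi>" for p i using Xi[OF that, of i] \<rho> by linarith
    qed
    show "continuous_on \<Xi> (\<lambda>p. \<chi> i. Re (l i p))"
      by (intro continuous_on_vec_lambda continuous_on_Re tfam_param_continuous[OF l r])
    show "norm ((\<chi> i. Re (l i p)) - (gradient h p - \<omega>)) \<le> \<mu>" if p: "p \<in> \<Xi>" for p
    proof -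
      have "norm ((\<chi> i. Re (l i p)) - (gradient h p - \<omega>)) \<le> real CARD('n) * (C * \<eta>)"
      proof (rule norm_vec_le_card)
        fix i
        have "norm (((\<chi> i. Re (l i p)) - (gradient h p - \<omega>)) $ i) = \<bar>Re (l i p - l0 i p)\<bar>" by (simp add: l0[OF p])
        also have "\<dots> \<le> C * \<eta>" using abs_Re_le_cmod[of "l i p - l0 i p"] bl[of i] p 0 by (force simp: bnd_def)
        finally show "norm (((\<chi> i. Re (l i p)) - (gradient h p - \<omega>)) $ i) \<le> C * \<eta>" .
      qed
      then show ?thesis using small(3) by simp
    qed
  qed (use compact_Xi inj \<mu> in auto)
  have lz: "l i p = 0" for i
    using p(2) of_real_Re[OF lreal[OF p(1), of i]] by (simp add: vec_eq_iff)
  have "invariant_torus (\<lambda>y x. h y + \<epsilon> * P y x) G \<omega> p (\<lambda>\<theta>. \<chi> i. Re (v i p (cvec \<theta>))) (\<lambda>\<theta>. \<chi> i. Re (u i p (cvec \<theta>)))"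
  proof (rule invariant_torus_of_solution[OF _ _ r v u bpd sol p(1) lz])
    show "H (jn (cvec y) (cvec x)) = complex_of_real (h y + \<epsilon> * P y x)" if "jn (cvec y) (cvec x) \<in> pdom \<xi>\<^sub>0 \<rho>" for y x
      using hr[OF that] Pr[OF that] by (simp add: H_def)
    show "y \<in> G" if y: "\<And>i. \<bar>y $ i - \<xi>\<^sub>0 $ i\<bar> < \<rho> / 2" for y
    proof (rule G)
      show "\<bar>y $ i - \<xi>\<^sub>0 $ i\<bar> < \<rho>" for i using y[of i] \<rho> by linarith
    qed
  qed
  moreover have "norm (\<chi> i. Re (w i p (cvec \<theta>))) \<le> real CARD('n) * (C * \<eta>)" if w: "\<And>i. bnd \<Xi> r (w i) (C * \<eta>)" for w :: "'n \<Rightarrow> real ^ 'n \<Rightarrow> complex ^ 'n \<Rightarrow> complex" and \<theta>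
  proof (rule norm_vec_le_card)
    fix i
    have "cmod (w i p (cvec \<theta>)) \<le> C * \<eta>" using w[of i] p(1) r by (simp add: bnd_def)
    then show "norm ((\<chi> i. Re (w i p (cvec \<theta>))) $ i) \<le> C * \<eta>"
      using abs_Re_le_cmod[of "w i p (cvec \<theta>)"] by simp
  qed
  moreover have "p \<in> G"
  proof (rule G)
    show "\<bar>p $ i - \<xi>\<^sub>0 $ i\<bar> < \<rho>" for i using Xi[OF p(1), of i] \<rho> by linarith
  qed
  ultimately show ?thesis using bv bu by blast
qed

text \<open>The two uniform limits in the conclusion express that the torus is a deformation of the
  unperturbed one, which in coordinates centred at \<open>y \<epsilon>\<close> is given by u = v =
  0.\<close>

theorem theorem2:
  fixes G :: "(real ^ 'n::finite) set"
    and h :: "real ^ 'n \<Rightarrow> real"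
    and P :: "real ^ 'n \<Rightarrow> real ^ 'n \<Rightarrow> real \<Rightarrow> real"
    and \<xi>\<^sub>0 :: "real ^ 'n"
    and s r M \<epsilon>\<^sub>0 \<sigma> L \<gamma> \<tau> :: real
  assumes G: "bounded G" "closed_region G"
    and sr: "0 < s" "s < 1" "0 < r" "r < 1"
    and eps0: "0 < \<epsilon>\<^sub>0"
    and h_analytic: "\<exists>F. analytic_extension (\<lambda>y x. h y) F G s r"
    and P_periodic: "\<And>\<epsilon> y. 0 < \<epsilon> \<Longrightarrow> \<epsilon> < \<epsilon>\<^sub>0 \<Longrightarrow> infdist y G < s \<Longrightarrow>
          torus_periodic (\<lambda>x. P y x \<epsilon>)"
    and P_analytic: "\<And>\<epsilon>. 0 < \<epsilon> \<Longrightarrow> \<epsilon> < \<epsilon>\<^sub>0 \<Longrightarrow>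
          \<exists>F. analytic_extension (\<lambda>y x. P y x \<epsilon>) F G s r \<and>
              (\<forall>z\<in>complex_nbhd G s r. cmod (F z) \<le> M)"
    and xi0: "\<xi>\<^sub>0 \<in> interior G"
    and A0: "brouwer_degree (gradient h) (interior G) (gradient h \<xi>\<^sub>0) \<noteq> 0"
    and A1: "0 < \<sigma>" "0 < L"
          "\<And>\<xi> \<xi>'. \<xi> \<in> G \<Longrightarrow> \<xi>' \<in> G \<Longrightarrow>
             norm (gradient h \<xi> - gradient h \<xi>') \<ge> \<sigma> * norm (\<xi> - \<xi>') powr L"
    and A2: "0 < \<gamma>" "\<tau> > real CARD('n) - 1"
          "\<And>k :: int ^ 'n. k \<noteq> 0 \<Longrightarrow>
             \<bar>ivec k \<bullet> gradient h \<xi>\<^sub>0\<bar> > \<gamma> / l1norm k powr \<tau>"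
  shows "\<exists>\<epsilon>'>0. \<exists>y v u.
           (\<forall>\<epsilon>. 0 < \<epsilon> \<and> \<epsilon> < \<epsilon>' \<longrightarrow>
              y \<epsilon> \<in> G \<and>
              invariant_torus (\<lambda>p q. h p + \<epsilon> * P p q \<epsilon>) G (gradient h \<xi>\<^sub>0) (y \<epsilon>) (v \<epsilon>) (u \<epsilon>)) \<and>
           uniform_limit UNIV v (\<lambda>\<theta>. 0) (at_right 0) \<and>
           uniform_limit UNIV u (\<lambda>\<theta>. 0) (at_right 0)"
proof -
  define n where "n = real CARD('n)"
  have n: "1 \<le> n" by (simp add: n_def Suc_leI)
  have "\<xi>\<^sub>0 \<in> G" using xi0 interior_subset by blast
  obtain e where e: "0 < e" "cball \<xi>\<^sub>0 e \<subseteq> G" using xi0 by (auto simp: mem_interior_cball)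
  \<comment> \<open>Division by n passes from Euclidean norms to coordinates. The factor 2 leaves
    room to bound the extension of h on the domain of radius \<rho> by compactness inside the one of
    radius 2 \<rho>, and e keeps the actions in G.\<close>
  define \<rho> where "\<rho> = min s (min r e) / (2 * n)"
  have \<rho>: "0 < \<rho>" "n * (2 * \<rho>) \<le> s" "n * (2 * \<rho>) \<le> r" "n * \<rho> \<le> e"
    using sr e n by (auto simp: \<rho>_def)
  have "n * \<rho> \<le> n * (2 * \<rho>)" using \<rho>(1) n by simp
  then have \<rho>': "n * \<rho> \<le> s" "n * \<rho> \<le> r" using \<rho>(2,3) by linarith+
  have G': "y \<in> G" if "\<And>i. \<bar>y $ i - \<xi>\<^sub>0 $ i\<bar> < \<rho>" for y
  proof -
    have "norm (y - \<xi>\<^sub>0) < n * \<rho>" unfolding n_def by (rule norm_vec_less_card) (use that in simp)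
    then show ?thesis using \<rho>(4) e(2) by (auto simp: dist_norm norm_minus_commute)
  qed
  obtain F0 where F0: "analytic_extension (\<lambda>y x. h y) F0 G s r" using h_analytic by blast
  define hc where "hc z = F0 (act (jn (act z) 0), ang (jn (act z) 0))" for z :: "complex ^ ('n + 'n)"
  have hc2: "hclass \<xi>\<^sub>0 (2 * \<rho>) (\<lambda>z. F0 (act z, ang z))"
    by (rule hclass_extension(1)[OF F0 _ \<open>\<xi>\<^sub>0 \<in> G\<close>]) (use \<rho> in \<open>auto simp: n_def torus_periodic_def\<close>)
  have hc: "hclass \<xi>\<^sub>0 \<rho> hc"
    unfolding hc_def
    by (rule hclass_action, rule hclass_extension(1)[OF F0 _ \<open>\<xi>\<^sub>0 \<in> G\<close>]) (use \<rho>' in \<open>auto simp: n_def torus_periodic_def\<close>)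
  have hca: "hc z = hc (jn (act z) 0)" for z by (simp only: hc_def act_jn)
  have hr: "hc (jn (cvec y) (cvec x)) = complex_of_real (h y)" if "jn (cvec y) (cvec x) \<in> pdom \<xi>\<^sub>0 \<rho>" for y x
  proof -
    have 0: "(0 :: complex ^ 'n) = cvec 0" by (simp add: vec_eq_iff)
    have "jn (cvec y) (cvec 0) \<in> pdom \<xi>\<^sub>0 \<rho>" using that \<rho>(1) by (simp add: pdom_def)
    from hclass_extension(2)[OF F0 _ \<open>\<xi>\<^sub>0 \<in> G\<close> _ _ this] \<rho>' show ?thesis
      unfolding hc_def act_jn 0 by (simp add: n_def torus_periodic_def)
  qed
  have "holo (\<lambda>z. F0 (act z, ang z)) (pdom \<xi>\<^sub>0 (2 * \<rho>))" using hc2 by (simp add: hclass_def)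
  then obtain Bh where Bh: "\<And>z. z \<in> pdom \<xi>\<^sub>0 \<rho> \<Longrightarrow> cmod (hc z) \<le> Bh"
    unfolding hc_def by (rule action_bounded[of _ _ _ \<rho>]) (use \<rho> in auto)
  define \<Xi> where "\<Xi> = cball \<xi>\<^sub>0 (\<rho> / 8)"
  define \<omega> where "\<omega> = gradient h \<xi>\<^sub>0"
  have Xi: "\<bar>p $ i - \<xi>\<^sub>0 $ i\<bar> < \<rho>" if "p \<in> \<Xi>" for p i
    using that component_le_norm_cart[of "\<xi>\<^sub>0 - p" i] \<rho>(1) by (simp add: \<Xi>_def dist_norm abs_minus_commute)
  have inj: "inj_on (gradient h) \<Xi>"
  proof (rule inj_onI)
    fix p q assume "p \<in> \<Xi>" "q \<in> \<Xi>" and eq: "gradient h p = gradient h q"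
    then have "p \<in> G" "q \<in> G" using G' Xi by blast+
    then have "\<sigma> * norm (p - q) powr L \<le> 0" using A1(3)[of p q] eq by simp
    then show "p = q" using A1(1) by (simp add: mult_le_0_iff not_le powr_gt_zero)
  qed
  have "holo hc (pdom \<xi>\<^sub>0 \<rho>)" using hc by (simp add: hclass_def)
  then have "continuous_on \<Xi> (gradient h)"
    by (rule continuous_on_gradient[OF _ hca \<rho>(1) hr Xi])
  then obtain \<mu> where \<mu>: "0 < \<mu>" "cball \<omega> \<mu> \<subseteq> gradient h ` \<Xi>"
    using continuous_inj_covers_ball[of \<xi>\<^sub>0 "\<rho> / 8" "gradient h"] inj \<rho>(1) unfolding \<Xi>_def \<omega>_def by auto
  have "0 \<le> \<tau>" using A2(2) n unfolding n_def by linarith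
  then have d: "dioph \<omega> \<gamma> \<tau>"
    using A2 by (simp add: dioph_def \<omega>_def)
  \<comment> \<open>A nonnegative bound, available before any \<epsilon> is fixed.\<close>
  define M' where "M' = max M 0"
  \<comment> \<open>One bound of h + \<epsilon> P for all \<epsilon> below
    \<open>\<epsilon>\<^sub>0\<close>. The Hamiltonian enters \<open>kam_C\<close> and
    \<open>kam_c1\<close> only through \<rho> and B, so the threshold for \<epsilon> is
    uniform.\<close>
  define B where "B = Bh + \<epsilon>\<^sub>0 * M'"
  define C where "C = kam_C TYPE('n) \<rho> B \<gamma> \<tau>"
  define c1 where "c1 = kam_c1 TYPE('n) \<rho> B \<gamma> \<tau>"
  \<comment> \<open>The integrable Hamiltonian with this enlarged B is an instance of
    \<open>kam\<close>. It serves to read off the signs of the constants, which are the same for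
    every \<epsilon>.\<close>
  have "kam \<Xi> \<xi>\<^sub>0 \<rho> B \<gamma> \<tau> \<omega> hc"
  proof
    show "\<bar>p $ i - \<xi>\<^sub>0 $ i\<bar> \<le> \<rho> / 8" if "p \<in> \<Xi>" for p i
      using that component_le_norm_cart[of "\<xi>\<^sub>0 - p" i] by (simp add: \<Xi>_def dist_norm abs_minus_commute)
    have "0 \<le> \<epsilon>\<^sub>0 * M'" using eps0 by (simp add: M'_def)
    then show "cmod (hc z) \<le> B" if "z \<in> pdom \<xi>\<^sub>0 \<rho>" for z using Bh[OF that] by (simp add: B_def)
  qed (use \<rho>(1) hc d in \<open>auto simp: \<Xi>_def\<close>)
  then interpret K0: kam \<Xi> \<xi>\<^sub>0 \<rho> B \<gamma> \<tau> \<omega> hc .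
  have c1: "0 < c1" using K0.c0(1) by (simp add: c1_def K0.c0_def)
  have C0: "0 \<le> C" using K0.K_ge_1 by (simp add: C_def kam_C_def K0.K_def)
  define D where "D = C * (2 * M' / \<rho>)"
  have D: "0 \<le> D" unfolding D_def using C0 \<rho>(1) by (intro mult_nonneg_nonneg) (auto simp: M'_def)
  \<comment> \<open>D \<epsilon> bounds the components of the corrections and of l - l0. It has to
    stay below 1, c1 and \<mu>/n; the 1 added to D avoids a division by zero.\<close>
  define \<epsilon>' where "\<epsilon>' = min \<epsilon>\<^sub>0 (min 1 (min c1 (\<mu> / n)) / (D + 1))"
  have eps': "0 < \<epsilon>'" using eps0 c1 \<mu>(1) n D by (simp add: \<epsilon>'_def)
  define good where "good \<epsilon> w \<longleftrightarrow> fst w \<in> G \<and>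
      invariant_torus (\<lambda>p q. h p + \<epsilon> * P p q \<epsilon>) G \<omega> (fst w) (fst (snd w)) (snd (snd w)) \<and>
      (\<forall>\<theta>. norm (fst (snd w) \<theta>) \<le> n * D * \<epsilon> \<and> norm (snd (snd w) \<theta>) \<le> n * D * \<epsilon>)"
    for \<epsilon> and w :: "(real ^ 'n) \<times> (real ^ 'n \<Rightarrow> real ^ 'n) \<times> (real ^ 'n \<Rightarrow> real ^ 'n)"
  have "\<exists>w. good \<epsilon> w" if \<epsilon>: "0 < \<epsilon>" "\<epsilon> < \<epsilon>'" for \<epsilon>
  proof -
    have \<epsilon>0: "\<epsilon> < \<epsilon>\<^sub>0" and "\<epsilon> * (D + 1) \<le> min 1 (min c1 (\<mu> / n))"
      using \<epsilon> D by (auto simp: \<epsilon>'_def pos_less_divide_eq)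
    then have small: "D * \<epsilon> \<le> 1" "D * \<epsilon> \<le> c1" "D * \<epsilon> \<le> \<mu> / n" using \<epsilon>(1) by (auto simp: algebra_simps)
    obtain F where F: "analytic_extension (\<lambda>y x. P y x \<epsilon>) F G s r" "\<And>z. z \<in> complex_nbhd G s r \<Longrightarrow> cmod (F z) \<le> M"
      using P_analytic[OF \<epsilon>(1) \<epsilon>0] by blast
    note ext = hclass_extension[OF F(1) P_periodic[OF \<epsilon>(1) \<epsilon>0] \<open>\<xi>\<^sub>0 \<in> G\<close> \<rho>'[unfolded n_def]]
    have bF: "cmod (F (act z, ang z)) \<le> M'" if "z \<in> pdom \<xi>\<^sub>0 \<rho>" for z
      using F(2)[OF pdom_complex_nbhd[OF that \<open>\<xi>\<^sub>0 \<in> G\<close> \<rho>'[unfolded n_def]]] by (simp add: M'_def)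
    have M'0: "0 \<le> M'" by (simp add: M'_def)
    have eB: "Bh + \<epsilon> * M' \<le> B" using M'0 \<epsilon>0 by (simp add: B_def mult_right_mono)
    have De: "C * (\<epsilon> * (2 * M' / \<rho>)) = D * \<epsilon>" by (simp add: D_def)
    have small': "C * (\<epsilon> * (2 * M' / \<rho>)) \<le> 1" "C * (\<epsilon> * (2 * M' / \<rho>)) \<le> c1" "n * (C * (\<epsilon> * (2 * M' / \<rho>))) \<le> \<mu>"
      unfolding De using small n by (auto simp: field_simps)
    have "\<exists>p\<in>G. \<exists>v u. invariant_torus (\<lambda>p q. h p + \<epsilon> * P p q \<epsilon>) G \<omega> p v u \<and>
      (\<forall>\<theta>. norm (v \<theta>) \<le> n * (D * \<epsilon>) \<and> norm (u \<theta>) \<le> n * (D * \<epsilon>))"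
      unfolding \<omega>_def n_def De[symmetric] C_def
      by (rule torus_of_small_perturbation[OF \<rho>(1) hc hca Bh hr ext(1) bF ext(2) G' d[unfolded \<omega>_def] inj[unfolded \<Xi>_def]
            \<mu>(1) \<mu>(2)[unfolded \<omega>_def \<Xi>_def] less_imp_le[OF \<epsilon>(1)] eB M'0])
        (use small'[unfolded C_def c1_def n_def] in blast)+
    then obtain p v u where "p \<in> G" "invariant_torus (\<lambda>p q. h p + \<epsilon> * P p q \<epsilon>) G \<omega> p v u"
      "\<And>\<theta>. norm (v \<theta>) \<le> n * (D * \<epsilon>)" "\<And>\<theta>. norm (u \<theta>) \<le> n * (D * \<epsilon>)" by blast
    then have "good \<epsilon> (p, v, u)" by (simp add: good_def mult.assoc)
    then show ?thesis by blast
  qed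
  then have "\<forall>\<epsilon>. \<exists>w. 0 < \<epsilon> \<and> \<epsilon> < \<epsilon>' \<longrightarrow> good \<epsilon> w" by blast
  from choice[OF this] obtain W where W: "\<And>\<epsilon>. 0 < \<epsilon> \<Longrightarrow> \<epsilon> < \<epsilon>' \<Longrightarrow> good \<epsilon> (W \<epsilon>)" by blast
  \<comment> \<open>The tori for different \<epsilon> are chosen independently of each other; the
    linear bound n D \<epsilon> alone forces the limit.\<close>
  have lim: "uniform_limit UNIV f (\<lambda>\<theta>. 0) (at_right 0)"
    if f: "\<And>\<epsilon> \<theta>. 0 < \<epsilon> \<Longrightarrow> \<epsilon> < \<epsilon>' \<Longrightarrow> norm (f \<epsilon> \<theta>) \<le> n * D * \<epsilon>" for f :: "real \<Rightarrow> real ^ 'n \<Rightarrow> real ^ 'n"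
  proof (rule uniform_limitI)
    fix \<delta> :: real assume \<delta>: "0 < \<delta>"
    have nD: "0 \<le> n * D" using n D by simp
    have "\<forall>\<theta>. dist (f \<epsilon> \<theta>) 0 < \<delta>" if "0 < \<epsilon>" "\<epsilon> < min \<epsilon>' (\<delta> / (n * D + 1))" for \<epsilon>
    proof
      fix \<theta>
      have "\<epsilon> * (n * D + 1) < \<delta>" using that nD by (simp add: pos_less_divide_eq)
      then show "dist (f \<epsilon> \<theta>) 0 < \<delta>" using f[of \<epsilon> \<theta>] that by (simp add: algebra_simps)
    qed
    then show "\<forall>\<^sub>F \<epsilon> in at_right 0. \<forall>\<theta>\<in>UNIV. dist (f \<epsilon> \<theta>) 0 < \<delta>"
      unfolding eventually_at_right_field using eps' \<delta> nD by (intro exI[of _ "min \<epsilon>' (\<delta> / (n * D + 1))"]) auto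
  qed
  show ?thesis
    by (rule exI[of _ \<epsilon>'], rule conjI[OF eps'], rule exI[of _ "\<lambda>\<epsilon>. fst (W \<epsilon>)"], rule exI[of _ "\<lambda>\<epsilon>. fst (snd (W \<epsilon>))"],
        rule exI[of _ "\<lambda>\<epsilon>. snd (snd (W \<epsilon>))"], intro conjI lim) (use W in \<open>auto simp: good_def \<omega>_def\<close>)
qed

end
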